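(* Let $k$ be a field, $f:\Lambda\to\Pi$ an order preserving map of finite posets, and $I^\bullet\in D^b(\Lambda)$. Let $\kappa^!\subset\Pi$ (resp. $\kappa^*\subset\Pi$) denote the set of $(I^\bullet,f,!)$-critical (resp. $(I^\bullet,f,* )$-critical) elements of $\Pi$. For each $\ell\in\mathbb{Z}$, $$(-1)^\ell\sum_{j\le\ell}(-1)^j\dim\mathbb{H}^j(I^\bullet)\le(-1)^\ell\sum_{\pi\in\kappa^!}\sum_{j\le\ell}(-1)^j\dim\mathbb{H}^j\left(\mathcal{I}i^!_{f^{-1}(\pi)}I^\bullet\right),$$ $$(-1)^\ell\sum_{j\le\ell}(-1)^j\dim\mathbb{H}^j(I^\bullet)\le(-1)^\ell\sum_{\pi\in\kappa^*}\sum_{j\le\ell}(-1)^j\dim\mathbb{H}^j\left(\mathcal{I}(i_{f^{-1}(\pi)})_!\,\mathcal{I}i^*_{f^{-1}(\pi)}I^\bullet\right).$$ Moreover, the inequalities become equalities when we sum over all $j\in\mathbb{Z}$: $$\chi I^\bullet=\sum_{\pi\in\kappa^!}\chi\,\mathcal{I}i^!_{f^{-1}(\pi)}I^\bullet=\sum_{\pi\in\kappa^*}\chi\,\mathcal{I}(i_{f^{-1}(\pi)})_!\,\mathcal{I}i^*_{f^{-1}(\pi)}I^\bullet.$$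
   Context: A sheaf on a finite poset is a functor to finite-dimensional $k$-vector spaces; complexes are bounded. $\mathrm{St}\,\pi=\{\tau:\pi\le\tau\}$. Injective sheaves are the injective objects in this category (equivalently, finite direct sums of sheaves $[\pi]$, where $[\pi](\sigma)=k$ for $\sigma\le\pi$ and $0$ otherwise, with identity maps between copies of $k$). A complex of injective sheaves is minimal if in each degree its number of indecomposable summands is least among all bounded complexes of injective sheaves quasi-isomorphic to it. Every bounded complex of sheaves has a minimal injective resolution (a quasi-isomorphism to a minimal complex of injectives), unique up to isomorphism. The objects of $D^b(\Lambda)$ are the minimal complexes of injective sheaves on $\Lambda$ (this is a skeleton of the bounded derived category). A subset $Z\subseteq\Lambda$ is locally closed if $a,c\in Z$, $a\le b\le c$ imply $b\in Z$; $i_Z:Z\hookrightarrow\Lambda$ is the inclusion. For a sheaf $F$ on $\Lambda$: $i_Z^*F$ is the restriction of $F$ to $Z$, and $i_Z^!F(\zeta)=\{v\in F(\zeta):F(\zeta\le\tau)(v)=0\ \forall\tau\in\mathrm{St}_\Lambda\zeta\setminus Z\}$. For a sheaf $G$ on $Z$, $(i_Z)_!G$ equals $G$ on $Z$ and $0$ outside. For $p:P\to\{\star\}$ the map from a finite poset to a point, $p_*F=\varprojlim_{\pi\in P}F(\pi)$. For each of these functors $\varphi$ and an injective complex $I^\bullet$, $\mathcal{I}\varphi I^\bullet$ denotes the minimal injective resolution of the complex $\varphi(I^\bullet)$. Hypercohomology of an injective complex on $P$: $\mathbb{H}^d(I^\bullet)=H^d(\mathcal{I}p_*I^\bullet)$,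 and $\chi I^\bullet=\sum_{j\in\mathbb{Z}}(-1)^j\dim\mathbb{H}^j(I^\bullet)$. Discrete microsupports of $I^\bullet\in D^b(\Lambda)$: $\mu\mathrm{supp}^*I^\bullet$ is the set of locally closed $Z\subseteq\Lambda$ with $\mathbb{H}^d(\mathcal{I}(i_Z)_!\,\mathcal{I}i_Z^*I^\bullet)\ne0$ for some $d$; $\mu\mathrm{supp}^!I^\bullet$ is the set of locally closed $Z\subseteq\Lambda$ with $\mathbb{H}^d(\mathcal{I}i_Z^!I^\bullet)\neq0$ for some $d$. An element $\pi\in\Pi$ is $(I^\bullet,f,* )$-critical if $f^{-1}(\pi)\in\mu\mathrm{supp}^*I^\bullet$, and $(I^\bullet,f,!)$-critical if $f^{-1}(\pi)\in\mu\mathrm{supp}^!I^\bullet$. *)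

theory Defs
  imports Complex_Main "HOL-Library.Function_Algebras" "HOL-Library.FuncSet"
begin

section \<open>Vector spaces\<close>

text \<open>
  The field is the type \<open>'k\<close>. Vector spaces are subspaces of spaces of functions
  \<open>'i \<Rightarrow> 'k\<close> with the pointwise operations (addition comes from Function_Algebras).
  Every finite-dimensional space is isomorphic to a subspace of \<open>nat \<Rightarrow> 'k\<close>, so for
  \<open>'i = nat\<close> nothing is lost up to isomorphism.
\<close>

definition vscale :: "'k::field \<Rightarrow> ('i \<Rightarrow> 'k) \<Rightarrow> 'i \<Rightarrow> 'k" where
  "vscale c v = (\<lambda>i. c * v i)"

global_interpretation kfun: vector_space "vscale :: 'k::field \<Rightarrow> ('i \<Rightarrow> 'k) \<Rightarrow> 'i \<Rightarrow> 'k"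
  by standard (auto simp: vscale_def fun_eq_iff algebra_simps)

definition findim_space :: "('i \<Rightarrow> 'k::field) set \<Rightarrow> bool" where
  "findim_space V \<longleftrightarrow> (\<exists>B. finite B \<and> V = kfun.span B)"

definition linear_map ::
    "('i \<Rightarrow> 'k::field) set \<Rightarrow> ('j \<Rightarrow> 'k) set \<Rightarrow> (('i \<Rightarrow> 'k) \<Rightarrow> 'j \<Rightarrow> 'k) \<Rightarrow> bool" where
  "linear_map V W g \<longleftrightarrow>
     (\<forall>x\<in>V. g x \<in> W) \<and>
     (\<forall>x\<in>V. \<forall>y\<in>V. g (x + y) = g x + g y) \<and>
     (\<forall>c. \<forall>x\<in>V. g (vscale c x) = vscale c (g x))"


section \<open>Sheaves on a finite poset\<close>

text \<open>
  A poset is a subset \<open>P\<close> of a type of class order, with the induced order. The value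
  \<open>res F \<sigma> \<tau>\<close> is the map \<open>F(\<sigma> \<le> \<tau>)\<close>; it and \<open>stalk\<close> are meaningful only on \<open>P\<close>.
\<close>

record ('a, 'i, 'k) sheaf =
  stalk :: "'a \<Rightarrow> ('i \<Rightarrow> 'k) set"
  res :: "'a \<Rightarrow> 'a \<Rightarrow> ('i \<Rightarrow> 'k) \<Rightarrow> 'i \<Rightarrow> 'k"

definition is_sheaf :: "'a::order set \<Rightarrow> ('a, 'i, 'k::field) sheaf \<Rightarrow> bool" where
  "is_sheaf P F \<longleftrightarrow>
     (\<forall>\<sigma>\<in>P. findim_space (stalk F \<sigma>)) \<and>
     (\<forall>\<sigma>\<in>P. \<forall>\<tau>\<in>P. \<sigma> \<le> \<tau> \<longrightarrow> linear_map (stalk F \<sigma>) (stalk F \<tau>) (res F \<sigma> \<tau>)) \<and>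
     (\<forall>\<sigma>\<in>P. \<forall>v\<in>stalk F \<sigma>. res F \<sigma> \<sigma> v = v) \<and>
     (\<forall>\<rho>\<in>P. \<forall>\<sigma>\<in>P. \<forall>\<tau>\<in>P. \<rho> \<le> \<sigma> \<longrightarrow> \<sigma> \<le> \<tau> \<longrightarrow>
        (\<forall>v\<in>stalk F \<rho>. res F \<sigma> \<tau> (res F \<rho> \<sigma> v) = res F \<rho> \<tau> v))"

definition sheaf_hom ::
    "'a::order set \<Rightarrow> ('a, 'i, 'k::field) sheaf \<Rightarrow> ('a, 'j, 'k) sheaf \<Rightarrow>
     ('a \<Rightarrow> ('i \<Rightarrow> 'k) \<Rightarrow> 'j \<Rightarrow> 'k) \<Rightarrow> bool" where
  "sheaf_hom P F G \<phi> \<longleftrightarrow>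
     (\<forall>\<sigma>\<in>P. linear_map (stalk F \<sigma>) (stalk G \<sigma>) (\<phi> \<sigma>)) \<and>
     (\<forall>\<sigma>\<in>P. \<forall>\<tau>\<in>P. \<sigma> \<le> \<tau> \<longrightarrow>
        (\<forall>v\<in>stalk F \<sigma>. \<phi> \<tau> (res F \<sigma> \<tau> v) = res G \<sigma> \<tau> (\<phi> \<sigma> v)))"

definition zero_sheaf :: "'a set \<Rightarrow> ('a, 'i, 'k::field) sheaf \<Rightarrow> bool" where
  "zero_sheaf P F \<longleftrightarrow> (\<forall>\<sigma>\<in>P. stalk F \<sigma> = {0})"

definition injective_sheaf :: "'a::order set \<Rightarrow> ('a, nat, 'k::field) sheaf \<Rightarrow> bool" where
  "injective_sheaf P J \<longleftrightarrow> is_sheaf P J \<and>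
     (\<forall>(A :: ('a, nat, 'k) sheaf) (B :: ('a, nat, 'k) sheaf) \<iota> \<phi>.
        is_sheaf P A \<and> is_sheaf P B \<and>
        sheaf_hom P A B \<iota> \<and> (\<forall>\<sigma>\<in>P. inj_on (\<iota> \<sigma>) (stalk A \<sigma>)) \<and>
        sheaf_hom P A J \<phi> \<longrightarrow>
        (\<exists>\<psi>. sheaf_hom P B J \<psi> \<and> (\<forall>\<sigma>\<in>P. \<forall>v\<in>stalk A \<sigma>. \<psi> \<sigma> (\<iota> \<sigma> v) = \<phi> \<sigma> v)))"

definition subsheaf ::
    "'a::order set \<Rightarrow> ('a, 'i, 'k::field) sheaf \<Rightarrow> ('a, 'i, 'k) sheaf \<Rightarrow> bool" where
  "subsheaf P S F \<longleftrightarrow> is_sheaf P S \<and>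
     (\<forall>\<sigma>\<in>P. stalk S \<sigma> \<subseteq> stalk F \<sigma>) \<and>
     (\<forall>\<sigma>\<in>P. \<forall>\<tau>\<in>P. \<sigma> \<le> \<tau> \<longrightarrow> (\<forall>v\<in>stalk S \<sigma>. res S \<sigma> \<tau> v = res F \<sigma> \<tau> v))"

text \<open>\<open>F\<close> is the internal direct sum of the subsheaves \<open>S 0, \<dots>, S (n - 1)\<close>.\<close>

definition direct_sum_decomposition ::
    "'a::order set \<Rightarrow> ('a, 'i, 'k::field) sheaf \<Rightarrow> nat \<Rightarrow> (nat \<Rightarrow> ('a, 'i, 'k) sheaf) \<Rightarrow> bool" where
  "direct_sum_decomposition P F n S \<longleftrightarrow>
     (\<forall>i<n. subsheaf P (S i) F) \<and>
     (\<forall>\<sigma>\<in>P. \<forall>v\<in>stalk F \<sigma>. \<exists>!w. (\<forall>i<n. w i \<in> stalk (S i) \<sigma>) \<and> (\<forall>i\<ge>n. w i = 0) \<and>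
        v = (\<Sum>i<n. w i))"

definition indecomposable :: "'a::order set \<Rightarrow> ('a, 'i, 'k::field) sheaf \<Rightarrow> bool" where
  "indecomposable P F \<longleftrightarrow> is_sheaf P F \<and> \<not> zero_sheaf P F \<and>
     (\<forall>S. direct_sum_decomposition P F 2 S \<longrightarrow> zero_sheaf P (S 0) \<or> zero_sheaf P (S 1))"

text \<open>Existence and uniqueness of this number is the Krull--Schmidt theorem.\<close>

definition num_summands :: "'a::order set \<Rightarrow> ('a, 'i, 'k::field) sheaf \<Rightarrow> nat" where
  "num_summands P F =
     (THE n. \<exists>S. direct_sum_decomposition P F n S \<and> (\<forall>i<n. indecomposable P (S i)))"


section \<open>Complexes, minimal injective resolutions\<close>

record ('a, 'i, 'k) cpx =
  obj :: "int \<Rightarrow> ('a, 'i, 'k) sheaf"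
  diff :: "int \<Rightarrow> 'a \<Rightarrow> ('i \<Rightarrow> 'k) \<Rightarrow> 'i \<Rightarrow> 'k"

definition bounded_complex :: "'a::order set \<Rightarrow> ('a, 'i, 'k::field) cpx \<Rightarrow> bool" where
  "bounded_complex P C \<longleftrightarrow>
     (\<forall>n. is_sheaf P (obj C n)) \<and>
     (\<forall>n. sheaf_hom P (obj C n) (obj C (n + 1)) (diff C n)) \<and>
     (\<forall>n. \<forall>\<sigma>\<in>P. \<forall>v\<in>stalk (obj C n) \<sigma>. diff C (n + 1) \<sigma> (diff C n \<sigma> v) = 0) \<and>
     (\<exists>N. \<forall>n. \<bar>n\<bar> > N \<longrightarrow> zero_sheaf P (obj C n))"

definition cocycles :: "('a, 'i, 'k::field) cpx \<Rightarrow> int \<Rightarrow> 'a \<Rightarrow> ('i \<Rightarrow> 'k) set" where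
  "cocycles C n \<sigma> = {v \<in> stalk (obj C n) \<sigma>. diff C n \<sigma> v = 0}"

definition coboundaries :: "('a, 'i, 'k::field) cpx \<Rightarrow> int \<Rightarrow> 'a \<Rightarrow> ('i \<Rightarrow> 'k) set" where
  "coboundaries C n \<sigma> = diff C (n - 1) \<sigma> ` stalk (obj C (n - 1)) \<sigma>"

text \<open>
  Dimension of the quotient cocycles/coboundaries at \<open>\<sigma>\<close>; for a complex the natural-number
  subtraction does not truncate.
\<close>

definition cohomology_dim :: "('a, 'i, 'k::field) cpx \<Rightarrow> int \<Rightarrow> 'a \<Rightarrow> nat" where
  "cohomology_dim C n \<sigma> = kfun.dim (cocycles C n \<sigma>) - kfun.dim (coboundaries C n \<sigma>)"

definition chain_map ::
    "'a::order set \<Rightarrow> ('a, 'i, 'k::field) cpx \<Rightarrow> ('a, 'j, 'k) cpx \<Rightarrow>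
     (int \<Rightarrow> 'a \<Rightarrow> ('i \<Rightarrow> 'k) \<Rightarrow> 'j \<Rightarrow> 'k) \<Rightarrow> bool" where
  "chain_map P C D \<phi> \<longleftrightarrow>
     (\<forall>n. sheaf_hom P (obj C n) (obj D n) (\<phi> n)) \<and>
     (\<forall>n. \<forall>\<sigma>\<in>P. \<forall>v\<in>stalk (obj C n) \<sigma>. \<phi> (n + 1) \<sigma> (diff C n \<sigma> v) = diff D n \<sigma> (\<phi> n \<sigma> v))"

text \<open>The last two conditions: the induced maps on cohomology are injective, resp. surjective.\<close>

definition quasi_iso ::
    "'a::order set \<Rightarrow> ('a, 'i, 'k::field) cpx \<Rightarrow> ('a, 'j, 'k) cpx \<Rightarrow>
     (int \<Rightarrow> 'a \<Rightarrow> ('i \<Rightarrow> 'k) \<Rightarrow> 'j \<Rightarrow> 'k) \<Rightarrow> bool" where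
  "quasi_iso P C D \<phi> \<longleftrightarrow> chain_map P C D \<phi> \<and>
     (\<forall>n. \<forall>\<sigma>\<in>P. \<forall>z\<in>cocycles C n \<sigma>. \<phi> n \<sigma> z \<in> coboundaries D n \<sigma> \<longrightarrow> z \<in> coboundaries C n \<sigma>) \<and>
     (\<forall>n. \<forall>\<sigma>\<in>P. \<forall>w\<in>cocycles D n \<sigma>. \<exists>z\<in>cocycles C n \<sigma>. w - \<phi> n \<sigma> z \<in> coboundaries D n \<sigma>)"

text \<open>Connected by a zigzag of quasi-isomorphisms, i.e. isomorphic in the bounded derived category.\<close>

definition quasi_isomorphic ::
    "'a::order set \<Rightarrow> ('a, 'i, 'k::field) cpx \<Rightarrow> ('a, 'i, 'k) cpx \<Rightarrow> bool" where
  "quasi_isomorphic P =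
     equivclp (\<lambda>C D. bounded_complex P C \<and> bounded_complex P D \<and> (\<exists>\<phi>. quasi_iso P C D \<phi>))"

definition injective_complex :: "'a::order set \<Rightarrow> ('a, nat, 'k::field) cpx \<Rightarrow> bool" where
  "injective_complex P J \<longleftrightarrow> bounded_complex P J \<and> (\<forall>n. injective_sheaf P (obj J n))"

text \<open>The objects of \<open>D\<^sup>b(P)\<close>.\<close>

definition minimal_injective_complex :: "'a::order set \<Rightarrow> ('a, nat, 'k::field) cpx \<Rightarrow> bool" where
  "minimal_injective_complex P J \<longleftrightarrow> injective_complex P J \<and>
     (\<forall>K. injective_complex P K \<and> quasi_isomorphic P J K \<longrightarrow>
        (\<forall>n. num_summands P (obj J n) \<le> num_summands P (obj K n)))"

text \<open>
  The functor \<open>\<I>\<close>. A minimal injective resolution is unique only up to isomorphism, and one of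
  them is chosen. The input may live in any ambient space \<open>'i \<Rightarrow> 'k\<close>; the output is always in
  \<open>nat \<Rightarrow> 'k\<close>.
\<close>

definition min_inj_res ::
    "'a::order set \<Rightarrow> ('a, 'i, 'k::field) cpx \<Rightarrow> ('a, nat, 'k) cpx" where
  "min_inj_res P C = (SOME J. minimal_injective_complex P J \<and> (\<exists>\<phi>. quasi_iso P C J \<phi>))"


section \<open>Functors\<close>

definition locally_closed :: "'a::order set \<Rightarrow> 'a set \<Rightarrow> bool" where
  "locally_closed P Z \<longleftrightarrow> Z \<subseteq> P \<and> (\<forall>a\<in>Z. \<forall>c\<in>Z. \<forall>b\<in>P. a \<le> b \<and> b \<le> c \<longrightarrow> b \<in> Z)"

definition star :: "'a::order set \<Rightarrow> 'a \<Rightarrow> 'a set" where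
  "star P \<pi> = {\<tau>\<in>P. \<pi> \<le> \<tau>}"

definition pullback_star :: "'a set \<Rightarrow> ('a, 'i, 'k::field) cpx \<Rightarrow> ('a, 'i, 'k) cpx" where
  "pullback_star Z C = \<lparr>
     obj = (\<lambda>n. \<lparr> stalk = (\<lambda>\<zeta>\<in>Z. stalk (obj C n) \<zeta>),
                   res = (\<lambda>\<zeta>\<in>Z. \<lambda>\<xi>\<in>Z. res (obj C n) \<zeta> \<xi>) \<rparr>),
     diff = (\<lambda>n. \<lambda>\<zeta>\<in>Z. diff C n \<zeta>) \<rparr>"

definition pullback_shriek ::
    "'a::order set \<Rightarrow> 'a set \<Rightarrow> ('a, 'i, 'k::field) cpx \<Rightarrow> ('a, 'i, 'k) cpx" where
  "pullback_shriek P Z C = \<lparr>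
     obj = (\<lambda>n. \<lparr> stalk = (\<lambda>\<zeta>\<in>Z. {v \<in> stalk (obj C n) \<zeta>.
                                  \<forall>\<tau>\<in>star P \<zeta> - Z. res (obj C n) \<zeta> \<tau> v = 0}),
                   res = (\<lambda>\<zeta>\<in>Z. \<lambda>\<xi>\<in>Z. res (obj C n) \<zeta> \<xi>) \<rparr>),
     diff = (\<lambda>n. \<lambda>\<zeta>\<in>Z. diff C n \<zeta>) \<rparr>"

definition pushforward_shriek :: "'a set \<Rightarrow> ('a, 'i, 'k::field) cpx \<Rightarrow> ('a, 'i, 'k) cpx" where
  "pushforward_shriek Z C = \<lparr>
     obj = (\<lambda>n. \<lparr> stalk = (\<lambda>\<sigma>. if \<sigma> \<in> Z then stalk (obj C n) \<sigma> else {0}),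
                   res = (\<lambda>\<sigma> \<tau>. if \<sigma> \<in> Z \<and> \<tau> \<in> Z then res (obj C n) \<sigma> \<tau> else (\<lambda>_. 0)) \<rparr>),
     diff = (\<lambda>n \<sigma>. if \<sigma> \<in> Z then diff C n \<sigma> else (\<lambda>_. 0)) \<rparr>"

text \<open>
  A family \<open>(v\<^sub>\<pi>)\<close> in the product of the stalks is encoded as one function of \<open>(\<pi>, i)\<close> that
  vanishes for \<open>\<pi> \<notin> P\<close>. The one-point poset is the type \<open>unit\<close>.
\<close>

definition limit_space :: "'a::order set \<Rightarrow> ('a, 'i, 'k::field) sheaf \<Rightarrow> ('a \<times> 'i \<Rightarrow> 'k) set" where
  "limit_space P F = {v.
     (\<forall>\<pi>\<in>P. curry v \<pi> \<in> stalk F \<pi>) \<and>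
     (\<forall>\<pi>. \<pi> \<notin> P \<longrightarrow> curry v \<pi> = 0) \<and>
     (\<forall>\<pi>\<in>P. \<forall>\<rho>\<in>P. \<pi> \<le> \<rho> \<longrightarrow> res F \<pi> \<rho> (curry v \<pi>) = curry v \<rho>)}"

definition pushforward_point ::
    "'a::order set \<Rightarrow> ('a, 'i, 'k::field) cpx \<Rightarrow> (unit, 'a \<times> 'i, 'k) cpx" where
  "pushforward_point P C = \<lparr>
     obj = (\<lambda>n. \<lparr> stalk = (\<lambda>_. limit_space P (obj C n)), res = (\<lambda>_ _ v. v) \<rparr>),
     diff = (\<lambda>n _ v. \<lambda>(\<pi>, i). if \<pi> \<in> P then diff C n \<pi> (curry v \<pi>) i else 0) \<rparr>"


section \<open>Hypercohomology and discrete microsupports\<close>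

definition hypercoh_dim :: "'a::order set \<Rightarrow> ('a, nat, 'k::field) cpx \<Rightarrow> int \<Rightarrow> nat" where
  "hypercoh_dim P I d = cohomology_dim (min_inj_res {()} (pushforward_point P I)) d ()"

definition neg_one_pow :: "int \<Rightarrow> int" where
  "neg_one_pow j = (- 1) ^ nat \<bar>j\<bar>"

text \<open>
  The sums over \<open>j \<le> \<ell>\<close> and over all integers \<open>j\<close> are restricted to the nonzero terms, of which
  there are finitely many.
\<close>

definition alt_sum_upto :: "'a::order set \<Rightarrow> ('a, nat, 'k::field) cpx \<Rightarrow> int \<Rightarrow> int" where
  "alt_sum_upto P I l =
     (\<Sum>j | j \<le> l \<and> hypercoh_dim P I j \<noteq> 0. neg_one_pow j * int (hypercoh_dim P I j))"

definition euler_char :: "'a::order set \<Rightarrow> ('a, nat, 'k::field) cpx \<Rightarrow> int" where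
  "euler_char P I =
     (\<Sum>j | hypercoh_dim P I j \<noteq> 0. neg_one_pow j * int (hypercoh_dim P I j))"

definition local_star ::
    "'a::order set \<Rightarrow> 'a set \<Rightarrow> ('a, nat, 'k::field) cpx \<Rightarrow> ('a, nat, 'k) cpx" where
  "local_star P Z I =
     min_inj_res P (pushforward_shriek Z (min_inj_res Z (pullback_star Z I)))"

definition local_shriek ::
    "'a::order set \<Rightarrow> 'a set \<Rightarrow> ('a, nat, 'k::field) cpx \<Rightarrow> ('a, nat, 'k) cpx" where
  "local_shriek P Z I = min_inj_res Z (pullback_shriek P Z I)"

definition musupp_star :: "'a::order set \<Rightarrow> ('a, nat, 'k::field) cpx \<Rightarrow> 'a set set" where
  "musupp_star P I = {Z. locally_closed P Z \<and> (\<exists>d. hypercoh_dim P (local_star P Z I) d \<noteq> 0)}"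

definition musupp_shriek :: "'a::order set \<Rightarrow> ('a, nat, 'k::field) cpx \<Rightarrow> 'a set set" where
  "musupp_shriek P I = {Z. locally_closed P Z \<and> (\<exists>d. hypercoh_dim Z (local_shriek P Z I) d \<noteq> 0)}"

definition fibre :: "'a set \<Rightarrow> ('a \<Rightarrow> 'b) \<Rightarrow> 'b \<Rightarrow> 'a set" where
  "fibre P f \<pi> = {\<sigma>\<in>P. f \<sigma> = \<pi>}"

definition critical_star ::
    "'a::order set \<Rightarrow> 'b set \<Rightarrow> ('a \<Rightarrow> 'b) \<Rightarrow> ('a, nat, 'k::field) cpx \<Rightarrow> 'b set" where
  "critical_star P Q f I = {\<pi>\<in>Q. fibre P f \<pi> \<in> musupp_star P I}"

definition critical_shriek ::
    "'a::order set \<Rightarrow> 'b set \<Rightarrow> ('a \<Rightarrow> 'b) \<Rightarrow> ('a, nat, 'k::field) cpx \<Rightarrow> 'b set" where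
  "critical_shriek P Q f I = {\<pi>\<in>Q. fibre P f \<pi> \<in> musupp_shriek P I}"

end

theory Submission
  imports Defs
begin

text \<open>
  A sheaf is injective iff it is a retract of its Godement sheaf, the product of its stalks over
  stars; such a retraction gives extension of homomorphisms and of sections by formulas. Iterating
  the Godement embedding yields injective resolutions, and splitting off contractible summands
  \<open>[p] \<rightarrow> [p]\<close> as long as a differential does not kill a socle vector makes them minimal, because
  the number of indecomposable summands of an injective sheaf is the total dimension of its socles.
  Hence hypercohomology is the cohomology of global sections of any injective resolution.

  Both inequalities come from filtering along \<open>f\<close>. For \<open>!\<close>, the sections with support in preimages of
  down-sets form short exact sequences whose quotients are the sections of \<open>i\<^sup>!\<close> over the fibres. For
  \<open>*\<close>, the extensions by zero from preimages of up-sets form short exact sequences of complexes, and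
  resolutions of the last two terms give, via the mapping cocone, a resolution of the first.
\<close>


section \<open>Linear algebra\<close>

text \<open>Minimality matters only for existence: \<open>min_inj_res\<close> is a choice, and
  minimality compares numbers given by definite descriptions, so both need proven witnesses
  (Krull-Schmidt for injective sheaves, a reduced resolution). Afterwards only the homotopy type
  counts: a quasi-isomorphism of injective complexes is a homotopy equivalence, and homotopies
  survive global sections, which quasi-isomorphisms in general do not. The two filtrations run in
  opposite directions: sections supported in down-sets extend by zero, while extensions by zero from
  up-sets include into each other; so one induction removes maximal elements of the target and the
  other minimal ones. In the second case the pieces are not injective and their sections need not
  form exact sequences, which is why the cocone takes over there. No long exact sequence is formed.
  The signed partial sum of cohomology dimensions up to degree l equals that of the chain dimensions
  minus the rank of the differential in degree l, so both Morse inequalities are inequalities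
  between ranks.\<close>

abbreviation subsp :: "('i \<Rightarrow> 'k::field) set \<Rightarrow> bool" where
  "subsp \<equiv> kfun.subspace"

abbreviation dm :: "('i \<Rightarrow> 'k::field) set \<Rightarrow> nat" where
  "dm \<equiv> kfun.dim"

lemma kpair: "vector_space_pair (vscale :: 'k::field \<Rightarrow> ('i \<Rightarrow> 'k) \<Rightarrow> _) (vscale :: 'k \<Rightarrow> ('j \<Rightarrow> 'k) \<Rightarrow> _)"
  by unfold_locales

lemma vscale_zero [simp]: "vscale c (0 :: 'i \<Rightarrow> 'k::field) = 0"
  by (rule kfun.scale_zero_right)

lemma subspI:
  assumes "0 \<in> V" "\<And>x y. x \<in> V \<Longrightarrow> y \<in> V \<Longrightarrow> x + y \<in> V" "\<And>c x. x \<in> V \<Longrightarrow> vscale c x \<in> V"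
  shows "subsp V"
  using assms by (auto intro: kfun.subspaceI)

lemmas subsp_0 = kfun.subspace_0 and subsp_add = kfun.subspace_add
  and subsp_scale = kfun.subspace_scale and subsp_diff = kfun.subspace_diff
  and subsp_neg = kfun.subspace_neg and subsp_sum = kfun.subspace_sum

lemma findim_subsp: "findim_space V \<Longrightarrow> subsp V"
  by (auto simp: findim_space_def)

lemma findimI:
  assumes "subsp V" "finite B" "V \<subseteq> kfun.span B"
  shows "findim_space V"
proof -
  obtain C where C: "C \<subseteq> V" "kfun.independent C" "V \<subseteq> kfun.span C"
    by (rule kfun.maximal_independent_subset)
  have "finite C" using kfun.independent_span_bound[OF assms(2) C(2)] C(1) assms(3) by auto
  moreover have "V = kfun.span C" using C assms(1) kfun.span_subspace by blast
  ultimately show ?thesis unfolding findim_space_def by blast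
qed

lemma findim_subset: "findim_space V \<Longrightarrow> subsp W \<Longrightarrow> W \<subseteq> V \<Longrightarrow> findim_space W"
  by (metis findim_space_def findimI)

lemma findim_zero [simp]: "findim_space {0}"
  by (rule findimI[of _ "{}"]) auto

lemma findim_basis:
  assumes "findim_space V"
  obtains B where "finite B" "B \<subseteq> V" "kfun.independent B" "V = kfun.span B" "card B = dm V"
proof -
  obtain B where B: "B \<subseteq> V" "kfun.independent B" "V \<subseteq> kfun.span B" "card B = dm V"
    by (rule kfun.basis_exists)
  have "V = kfun.span B" using B findim_subsp[OF assms] kfun.span_subspace by blast
  moreover have "finite B" using assms B kfun.independent_span_bound
    by (metis findim_space_def)
  ultimately show thesis using B that by blast
qed

lemma linear_mapI:
  assumes "\<And>x. x \<in> V \<Longrightarrow> g x \<in> W"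
    and "\<And>x y. x \<in> V \<Longrightarrow> y \<in> V \<Longrightarrow> g (x + y) = g x + g y"
    and "\<And>c x. x \<in> V \<Longrightarrow> g (vscale c x) = vscale c (g x)"
  shows "linear_map V W g"
  using assms by (auto simp: linear_map_def)

lemma lm_in: "linear_map V W g \<Longrightarrow> x \<in> V \<Longrightarrow> g x \<in> W"
  and lm_add: "linear_map V W g \<Longrightarrow> x \<in> V \<Longrightarrow> y \<in> V \<Longrightarrow> g (x + y) = g x + g y"
  and lm_scale: "linear_map V W g \<Longrightarrow> x \<in> V \<Longrightarrow> g (vscale c x) = vscale c (g x)"
  by (auto simp: linear_map_def)

lemma lm_0: "linear_map V W g \<Longrightarrow> subsp V \<Longrightarrow> g 0 = 0"
  using lm_add[of V W g 0 0] by (simp add: subsp_0)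

lemma lm_neg: "linear_map V W g \<Longrightarrow> x \<in> V \<Longrightarrow> g (- x) = - g x"
  using lm_scale[of V W g x "-1"] by simp

lemma lm_diff:
  assumes "linear_map V W g" "subsp V" "x \<in> V" "y \<in> V"
  shows "g (x - y) = g x - g y"
  using lm_add[OF assms(1), of x "- y"] lm_neg[OF assms(1), of y] assms by (simp add: subsp_neg)

lemma lm_compose: "linear_map V W g \<Longrightarrow> linear_map W X h \<Longrightarrow> linear_map V X (\<lambda>x. h (g x))"
  by (auto simp: linear_map_def)

lemma lm_restrict: "linear_map V W g \<Longrightarrow> V' \<subseteq> V \<Longrightarrow> (\<And>x. x \<in> V' \<Longrightarrow> g x \<in> W') \<Longrightarrow> linear_map V' W' g"
  by (auto simp: linear_map_def subset_iff)

lemma lm_id: "linear_map V V (\<lambda>x. x)"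
  by (auto simp: linear_map_def)

lemma lm_zero: "subsp W \<Longrightarrow> linear_map V W (\<lambda>_. 0)"
  by (auto simp: linear_map_def subsp_0)

lemma lm_plus: "linear_map V W g \<Longrightarrow> linear_map V W h \<Longrightarrow> subsp W \<Longrightarrow> linear_map V W (\<lambda>x. g x + h x)"
  by (rule linear_mapI) (auto simp: lm_in lm_add lm_scale subsp_add kfun.scale_right_distrib)

lemma lm_minus: "linear_map V W g \<Longrightarrow> linear_map V W h \<Longrightarrow> subsp W \<Longrightarrow> linear_map V W (\<lambda>x. g x - h x)"
  by (rule linear_mapI) (auto simp: lm_in lm_add lm_scale subsp_diff kfun.scale_right_diff_distrib)

lemma lm_global: "Vector_Spaces.linear vscale vscale g \<Longrightarrow> (\<And>x. x \<in> V \<Longrightarrow> g x \<in> W) \<Longrightarrow> linear_map V W g"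
  by (auto simp: linear_map_def Vector_Spaces.linear_iff)

lemma subsp_image: "linear_map V W g \<Longrightarrow> subsp V \<Longrightarrow> subsp (g ` V)"
  by (rule subspI)
    (auto simp: image_iff intro: lm_0[symmetric] subsp_0 lm_add[symmetric] lm_scale[symmetric]
      subsp_add subsp_scale, (metis lm_0 subsp_0 lm_add lm_scale subsp_add subsp_scale)+)

lemma subsp_kernel: "linear_map V W g \<Longrightarrow> subsp V \<Longrightarrow> subsp {x \<in> V. g x = 0}"
  by (rule subspI) (auto simp: lm_0 lm_add lm_scale subsp_0 subsp_add subsp_scale)

lemma linear_map_on_basis:
  assumes "kfun.independent B"
  shows "\<exists>g. Vector_Spaces.linear vscale vscale g \<and> (\<forall>x\<in>B. g x = h x) \<and> range g = kfun.span (h ` B)"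
  by (rule vector_space_pair.linear_independent_extend_subspace[OF kpair assms])

lemma linear_maps_eq_on_span:
  assumes "linear_map (kfun.span B) W g" "linear_map (kfun.span B) W' h" "\<And>b. b \<in> B \<Longrightarrow> g b = h b"
    and "x \<in> kfun.span B"
  shows "g x = h x"
proof -
  let ?E = "{x \<in> kfun.span B. g x = h x}"
  have "subsp ?E"
    by (rule subspI) (auto simp: lm_0[OF assms(1)] lm_0[OF assms(2)] lm_add[OF assms(1)] lm_add[OF assms(2)]
      lm_scale[OF assms(1)] lm_scale[OF assms(2)] kfun.span_zero kfun.span_add kfun.span_scale)
  then have "kfun.span B \<subseteq> ?E" using assms(3) by (intro kfun.span_minimal) (auto intro: kfun.span_base)
  then show ?thesis using assms(4) by auto
qed

text \<open>\<open>u\<close> may have a kernel, on which \<open>\<phi>\<close> must vanish, because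
  later \<open>u\<close> is a differential. \<open>\<phi>\<close> descends to the image of
  \<open>u\<close> through chosen preimages, and a basis of the image extends the result to the
  whole space.\<close>

lemma linear_map_factor:
  assumes A: "subsp A" and B: "subsp B" and J: "subsp J"
    and u: "linear_map A B u" and p: "linear_map A J \<phi>"
    and ker: "\<And>x. x \<in> A \<Longrightarrow> u x = 0 \<Longrightarrow> \<phi> x = 0"
  obtains \<psi> where "linear_map B J \<psi>" "\<And>x. x \<in> A \<Longrightarrow> \<psi> (u x) = \<phi> x"
proof -
  define pre where "pre y = (SOME x. x \<in> A \<and> u x = y)" for y
  have pre: "pre y \<in> A" "u (pre y) = y" if "y \<in> u ` A" for y
    using that someI_ex[of "\<lambda>x. x \<in> A \<and> u x = y"] by (auto simp: pre_def)
  have eq: "\<phi> x = \<phi> y" if "x \<in> A" "y \<in> A" "u x = u y" for x y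
    using ker[of "x - y"] lm_diff[OF u A that(1,2)] lm_diff[OF p A that(1,2)] that A
    by (simp add: subsp_diff)
  define h where "h y = \<phi> (pre y)" for y
  have hu: "h (u x) = \<phi> x" if "x \<in> A" for x
    using that pre[of "u x"] by (auto simp: h_def intro!: eq)
  have h: "linear_map (u ` A) J h"
    by (rule linear_mapI)
      (use hu in \<open>auto simp: hu lm_in[OF p] lm_add[OF p] lm_scale[OF p] A subsp_add subsp_scale
        simp flip: lm_add[OF u] lm_scale[OF u]\<close>)
  have uA: "subsp (u ` A)" using u A by (rule subsp_image)
  obtain C where C: "C \<subseteq> u ` A" "kfun.independent C" "u ` A \<subseteq> kfun.span C"
    by (rule kfun.maximal_independent_subset)
  have sC: "u ` A = kfun.span C" using C uA kfun.span_subspace by blast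
  obtain g where g: "Vector_Spaces.linear vscale vscale g" "\<forall>x\<in>C. g x = h x"
    "range g = kfun.span (h ` C)"
    using linear_map_on_basis[OF C(2), of h] by (elim exE conjE)
  \<comment> \<open>The extension sends everything, not only the image of \<open>u\<close>, into the
    span of the values of \<open>h\<close> on \<open>C\<close>; this keeps it inside
    \<open>J\<close>.\<close>
  have "kfun.span (h ` C) \<subseteq> J"
    by (rule kfun.span_minimal) (use C(1) lm_in[OF h] J in auto)
  then have gJ: "g x \<in> J" for x using g(3) by blast
  have "g (u x) = \<phi> x" if "x \<in> A" for x
  proof -
    have "g (u x) = h (u x)"
      by (rule linear_maps_eq_on_span[of C J _ J])
        (use that sC h g(2) in \<open>auto intro: lm_global[OF g(1)] gJ\<close>)
    then show ?thesis using hu that by simp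
  qed
  then show thesis using that lm_global[OF g(1)] gJ by blast
qed

lemma findim_image:
  assumes "linear_map V W g" "findim_space V"
  shows "findim_space (g ` V)"
proof -
  obtain B where B: "finite B" "B \<subseteq> V" "V = kfun.span B" using findim_basis[OF assms(2)] by metis
  have sV: "subsp V" using assms(2) findim_subsp by blast
  let ?E = "{x \<in> V. g x \<in> kfun.span (g ` B)}"
  have "subsp ?E"
    by (rule subspI) (auto simp: lm_0[OF assms(1) sV] lm_add[OF assms(1)]
      lm_scale[OF assms(1)] kfun.span_zero kfun.span_add kfun.span_scale subsp_0 subsp_add subsp_scale sV)
  then have "kfun.span B \<subseteq> ?E" using B(2) by (intro kfun.span_minimal) (auto intro: kfun.span_base)
  then show ?thesis using B(3) B(1) subsp_image[OF assms(1) sV] by (intro findimI[of _ "g ` B"]) auto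
qed

lemma dim_mono:
  assumes "findim_space W" "V \<subseteq> W"
  shows "dm V \<le> dm W"
proof -
  obtain B where "finite B" "W = kfun.span B" "card B = dm W" using findim_basis[OF assms(1)] by metis
  then show ?thesis using assms(2) kfun.dim_le_card[of V B] by simp
qed

text \<open>A basis of the kernel is extended to a basis \<open>C\<close> of \<open>V\<close>; the
  added vectors map injectively onto a basis of the image.\<close>

lemma rank_nullity:
  assumes g: "linear_map V W g" and V: "findim_space V"
  shows "dm V = dm {x \<in> V. g x = 0} + dm (g ` V)"
proof -
  let ?K = "{x \<in> V. g x = 0}"
  have sV: "subsp V" using V findim_subsp by blast
  have sK: "subsp ?K" using subsp_kernel[OF g sV] .
  obtain B where B: "finite B" "B \<subseteq> ?K" "kfun.independent B" "?K = kfun.span B" "card B = dm ?K"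
    using findim_basis[OF findim_subset[OF V sK]] by blast
  obtain C where C: "B \<subseteq> C" "C \<subseteq> V" "kfun.independent C" "V \<subseteq> kfun.span C"
    using kfun.maximal_independent_subset_extend[of B V] B by blast
  have VC: "V = kfun.span C" using C sV kfun.span_subspace by blast
  have fC: "finite C" using V C kfun.independent_span_bound by (metis findim_space_def)
  have dV: "dm V = card C" using VC C(3) by (simp add: kfun.dim_eq_card)
  obtain g' where g': "Vector_Spaces.linear vscale vscale g'" "\<forall>x\<in>C. g' x = g x"
    using linear_map_on_basis[OF C(3), of g] by (elim exE conjE)
  have gg': "g x = g' x" if "x \<in> V" for x
    by (rule linear_maps_eq_on_span[OF g[unfolded VC] lm_global[OF g'(1) UNIV_I] bspec[OF g'(2), symmetric] that[unfolded VC]])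
  let ?D = "C - B"
  have DV: "kfun.span ?D \<subseteq> V" unfolding VC by (rule kfun.span_mono) blast
  have ker: "x = 0" if x: "x \<in> kfun.span ?D" "g' x = 0" for x
  proof -
    \<comment> \<open>\<open>h\<close> is the projection to the kernel along the span of the added
      vectors, so it both fixes \<open>x\<close> and kills it.\<close>
    obtain h where h: "Vector_Spaces.linear vscale vscale h" "\<forall>x\<in>C. h x = (if x \<in> B then x else 0)"
      using linear_map_on_basis[OF C(3), of "\<lambda>x. if x \<in> B then x else 0"] by (elim exE conjE)
    have "x \<in> V" using subsetD[OF DV x(1)] .
    then have "x \<in> ?K" using gg'[of x] x(2) by simp
    then have xB: "x \<in> kfun.span B" by (rule subst[OF B(4)])
    have hl: "linear_map S UNIV h" for S by (rule lm_global[OF h(1)]) simp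
    have hB: "h b = b" if "b \<in> B" for b using bspec[OF h(2), of b] subsetD[OF C(1)] that by auto
    have hD: "h b = 0" if "b \<in> ?D" for b using bspec[OF h(2), of b] that by simp
    have "h x = x"
      by (rule linear_maps_eq_on_span[OF hl lm_id hB xB])
    moreover have "h x = 0"
      by (rule linear_maps_eq_on_span[OF hl lm_zero[OF kfun.subspace_UNIV] hD x(1)])
    ultimately show ?thesis by simp
  qed
  have inj: "inj_on g' (kfun.span ?D)"
  proof (rule inj_onI)
    fix x y assume xy: "x \<in> kfun.span ?D" "y \<in> kfun.span ?D" "g' x = g' y"
    have "g' (x - y) = 0" using xy lm_diff[OF lm_global[OF g'(1), of UNIV UNIV], of x y] by simp
    then show "x = y" using ker[OF kfun.span_diff[OF xy(1,2)]] by simp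
  qed
  have ind: "kfun.independent (g' ` ?D)"
    by (rule vector_space_pair.linear_independent_injective_image[OF kpair g'(1) _ inj])
      (rule kfun.independent_mono[OF C(3)], blast)
  have "g ` V = g' ` kfun.span C" using gg' VC by auto
  also have "\<dots> = kfun.span (g' ` C)"
    by (rule vector_space_pair.linear_span_image[OF kpair g'(1), symmetric])
  also have "\<dots> = kfun.span (g' ` ?D)"
  proof
    have "g' x = 0" if "x \<in> B" for x
    proof -
      have "x \<in> ?K" using that B(2) by (rule rev_subsetD)
      then show ?thesis using gg'[of x] by simp
    qed
    then have "g' ` C \<subseteq> insert 0 (g' ` ?D)" by auto
    then show "kfun.span (g' ` C) \<subseteq> kfun.span (g' ` ?D)" by (metis kfun.span_insert_0 kfun.span_mono)
    show "kfun.span (g' ` ?D) \<subseteq> kfun.span (g' ` C)" by (rule kfun.span_mono) auto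
  qed
  finally have "g ` V = kfun.span (g' ` ?D)" .
  then have "dm (g ` V) = card (g' ` ?D)" using ind by (simp add: kfun.dim_eq_card)
  also have "\<dots> = card ?D" by (rule card_image) (rule inj_on_subset[OF inj kfun.span_superset])
  also have "\<dots> = card C - card B" using fC C(1) by (simp add: card_Diff_subset B(1))
  finally show ?thesis using dV B(5) fC C(1) card_mono[OF fC C(1)] by simp
qed


lemma dim_zero [simp]: "dm {0} = 0"
  using kfun.dim_eq_card[of "{}" "{0}"] by (simp add: kfun.independent_empty)

lemma dim_inj_image:
  assumes "linear_map V W g" "findim_space V" "inj_on g V"
  shows "dm (g ` V) = dm V"
proof -
  have "{x \<in> V. g x = 0} = {0}"
    using lm_0[OF assms(1)] findim_subsp[OF assms(2)] inj_onD[OF assms(3), of _ 0] by (auto simp: subsp_0)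
  then show ?thesis using rank_nullity[OF assms(1,2)] by simp
qed

lemma dim_le_via_inj:
  assumes "linear_map V W g" "findim_space V" "findim_space W" "inj_on g V"
  shows "dm V \<le> dm W"
  using dim_inj_image[OF assms(1,2,4)] dim_mono[OF assms(3), of "g ` V"] lm_in[OF assms(1)] by (simp add: image_subset_iff)

lemma dim_psubset:
  assumes "findim_space W" "subsp V" "V \<subset> W"
  shows "dm V < dm W"
proof -
  have fV: "findim_space V" using assms findim_subset by blast
  obtain B where B: "finite B" "B \<subseteq> V" "kfun.independent B" "V = kfun.span B" "card B = dm V"
    using findim_basis[OF fV] by blast
  obtain x where x: "x \<in> W" "x \<notin> V" using assms(3) by blast
  then have i: "kfun.independent (insert x B)" using B kfun.independent_insertI by blast
  have "x \<notin> B" using x B by auto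
  then have "dm V < card (insert x B)" using B by simp
  also have "\<dots> = dm (insert x B)" using i by (simp add: kfun.dim_eq_card_independent)
  also have "\<dots> \<le> dm W" using dim_mono[OF assms(1)] x B(2) assms(3) by (metis insert_subset order.trans psubset_imp_subset)
  finally show ?thesis .
qed

section \<open>Direct sums of spaces and models over the index type \<open>nat\<close>\<close>

definition dsum :: "('i \<Rightarrow> 'k::field) set \<Rightarrow> ('j \<Rightarrow> 'k) set \<Rightarrow> ('i + 'j \<Rightarrow> 'k) set" where
  "dsum V W = {v. v \<circ> Inl \<in> V \<and> v \<circ> Inr \<in> W}"

lemma
  fixes v w :: "'i \<Rightarrow> 'k::field"
  shows comp_add [simp]: "(v + w) \<circ> h = (v \<circ> h) + (w \<circ> h)"
  and comp_diff [simp]: "(v - w) \<circ> h = (v \<circ> h) - (w \<circ> h)"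
  and comp_vscale [simp]: "(vscale c v) \<circ> h = vscale c (v \<circ> h)"
  and comp_zero [simp]: "(0 :: 'i \<Rightarrow> 'k::field) \<circ> h = 0"
  by (auto simp: fun_eq_iff vscale_def)

lemma dsum_eqI: "v \<circ> Inl = w \<circ> Inl \<Longrightarrow> v \<circ> Inr = w \<circ> Inr \<Longrightarrow> v = w"
  by (rule ext, case_tac x) (simp_all add: fun_eq_iff)

lemma case_sum_comp [simp]: "case_sum a b \<circ> Inl = a" "case_sum a b \<circ> Inr = b"
  by (auto simp: fun_eq_iff)

lemma case_sum_in_dsum [simp]: "case_sum a b \<in> dsum V W \<longleftrightarrow> a \<in> V \<and> b \<in> W"
  by (simp add: dsum_def)

lemma case_sum_linear:
  fixes a :: "'i \<Rightarrow> 'k::field" and b :: "'j \<Rightarrow> 'k"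
  shows "case_sum a b + case_sum a' b' = case_sum (a + a') (b + b')"
    "case_sum a b - case_sum a' b' = case_sum (a - a') (b - b')"
    "vscale c (case_sum a b) = case_sum (vscale c a) (vscale c b)"
    "case_sum 0 0 = (0 :: 'i + 'j \<Rightarrow> 'k)"
  by (auto intro: dsum_eqI)

lemma case_sum_eq_0 [simp]: "case_sum a b = (0 :: 'i + 'j \<Rightarrow> 'k::field) \<longleftrightarrow> a = 0 \<and> b = 0"
  using case_sum_comp[of a b] case_sum_linear(4) by (metis comp_zero)

lemma dsumE:
  assumes "v \<in> dsum V W" obtains a b where "v = case_sum a b" "a \<in> V" "b \<in> W"
  using that[of "v \<circ> Inl" "v \<circ> Inr"] assms dsum_eqI[of v "case_sum (v \<circ> Inl) (v \<circ> Inr)"] by (simp add: dsum_def)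

lemma subsp_dsum: "subsp V \<Longrightarrow> subsp W \<Longrightarrow> subsp (dsum V W)"
  by (rule subspI) (auto simp: dsum_def subsp_0 subsp_add subsp_scale)

lemma linear_Inl: "subsp W \<Longrightarrow> linear_map V (dsum V W) (\<lambda>v. case_sum v 0)"
  and linear_Inr: "subsp V \<Longrightarrow> linear_map W (dsum V W) (\<lambda>v. case_sum 0 v)"
  by (auto intro!: linear_mapI simp: case_sum_linear subsp_0)

lemma findim_dsum:
  fixes V :: "('i \<Rightarrow> 'k::field) set" and W :: "('j \<Rightarrow> 'k) set"
  assumes "findim_space V" "findim_space W" shows "findim_space (dsum V W)"
proof -
  have s: "subsp V" "subsp W" using assms findim_subsp by auto
  obtain B where B: "finite B" "(\<lambda>v. case_sum v (0 :: 'j \<Rightarrow> 'k)) ` V = kfun.span B"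
    using findim_image[OF linear_Inl[OF s(2)] assms(1)] unfolding findim_space_def by blast
  obtain C where C: "finite C" "(\<lambda>v. case_sum (0 :: 'i \<Rightarrow> 'k) v) ` W = kfun.span C"
    using findim_image[OF linear_Inr[OF s(1)] assms(2)] unfolding findim_space_def by blast
  have "dsum V W \<subseteq> kfun.span (B \<union> C)"
  proof
    fix v assume "v \<in> dsum V W"
    then obtain a b where ab: "v = case_sum a b" "a \<in> V" "b \<in> W" by (rule dsumE)
    then have "v = case_sum a (0 :: 'j \<Rightarrow> 'k) + case_sum (0 :: 'i \<Rightarrow> 'k) b" by (simp add: case_sum_linear)
    moreover have "case_sum a (0 :: 'j \<Rightarrow> 'k) \<in> kfun.span (B \<union> C)" "case_sum (0 :: 'i \<Rightarrow> 'k) b \<in> kfun.span (B \<union> C)"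
      using imageI[OF ab(2), of "\<lambda>v. case_sum v (0 :: 'j \<Rightarrow> 'k)"] imageI[OF ab(3), of "\<lambda>v. case_sum (0 :: 'i \<Rightarrow> 'k) v"]
        kfun.span_mono[of B "B \<union> C"] kfun.span_mono[of C "B \<union> C"]
      unfolding B(2) C(2) by blast+
    ultimately show "v \<in> kfun.span (B \<union> C)" by (simp add: kfun.span_add)
  qed
  then show ?thesis using findimI[OF subsp_dsum[OF s], of "B \<union> C"] B(1) C(1) by simp
qed

lemma dim_dsum:
  fixes V :: "('i \<Rightarrow> 'k::field) set" and W :: "('j \<Rightarrow> 'k) set"
  assumes "findim_space V" "findim_space W" shows "dm (dsum V W) = dm V + dm W"
proof -
  have s: "subsp V" "subsp W" using assms findim_subsp by auto
  have l: "linear_map (dsum V W) V (\<lambda>v. v \<circ> Inl)" by (auto intro!: linear_mapI simp: dsum_def)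
  have im: "(\<lambda>v. v \<circ> Inl) ` dsum V W = V"
  proof
    show "V \<subseteq> (\<lambda>v. v \<circ> Inl) ` dsum V W"
      using s subsp_0 by (auto intro!: image_eqI[of _ _ "case_sum _ 0"])
  qed (auto simp: dsum_def)
  have "{x \<in> dsum V W. x \<circ> Inl = 0} = case_sum (0 :: 'i \<Rightarrow> 'k) ` W"
    using s(1) by (auto simp: subsp_0 elim!: dsumE)
  moreover have "dm (case_sum (0 :: 'i \<Rightarrow> 'k) ` W) = dm W"
    by (rule dim_inj_image[OF linear_Inr[OF s(1)] assms(2)]) (metis case_sum_comp(2) inj_onI)
  ultimately show ?thesis using rank_nullity[OF l findim_dsum[OF assms]] im by simp
qed

text \<open>Coordinates in a basis, padded by zeros. The constructions below enlarge the index type,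
  whereas resolutions have to live over \<open>nat\<close>; this is the way back.\<close>

lemma nat_model:
  fixes V :: "('i \<Rightarrow> 'k::field) set"
  assumes "findim_space V"
  obtains t s and W :: "(nat \<Rightarrow> 'k) set" where "findim_space W" "linear_map V W t" "linear_map W V s"
    "\<And>x. x \<in> V \<Longrightarrow> s (t x) = x" "t ` V = W"
proof -
  obtain B where B: "finite B" "B \<subseteq> V" "kfun.independent B" "V = kfun.span B" using findim_basis[OF assms] by metis
  obtain c where c: "bij_betw c {..<card B} B" using B(1) ex_bij_betw_nat_finite atLeast0LessThan by metis
  define t :: "('i \<Rightarrow> 'k) \<Rightarrow> nat \<Rightarrow> 'k" where
    "t = (\<lambda>x n. if n < card B then kfun.representation B x (c n) else 0)"
  have t: "linear_map V (UNIV :: (nat \<Rightarrow> 'k) set) t"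
  proof (rule linear_mapI)
    fix x y assume "x \<in> V" "y \<in> V"
    then have "x \<in> kfun.span B" "y \<in> kfun.span B" using equalityD1[OF B(4)] by blast+
    then show "t (x + y) = t x + t y"
      by (intro ext) (simp add: t_def kfun.representation_add[OF B(3)])
  next
    fix c x assume "x \<in> V"
    then have "x \<in> kfun.span B" by (rule subst[OF B(4)])
    then show "t (vscale c x) = vscale c (t x)"
      by (intro ext) (simp only: t_def kfun.representation_scale[OF B(3)] vscale_def[where 'i = nat], simp)
  qed (rule UNIV_I)
  have inj: "x = y" if "x \<in> V" "y \<in> V" "t x = t y" for x y
  proof -
    have "kfun.representation B x b = kfun.representation B y b" if "b \<in> B" for b
    proof -
      have "b \<in> c ` {..<card B}" using that bij_betw_imp_surj_on[OF c] by (rule subst[OF sym, rotated])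
      then obtain n where "n < card B" "b = c n" by blast
      then show ?thesis using fun_cong[OF \<open>t x = t y\<close>, of n] by (simp add: t_def)
    qed
    moreover have rp: "(\<Sum>b\<in>B. vscale (kfun.representation B v b) b) = v" if "v \<in> V" for v
      using kfun.sum_representation_eq[OF B(3) _ B(1) subset_refl] that[unfolded B(4)] .
    ultimately have "(\<Sum>b\<in>B. vscale (kfun.representation B x b) b) = (\<Sum>b\<in>B. vscale (kfun.representation B y b) b)"
      by (intro sum.cong) auto
    then have "x = (\<Sum>b\<in>B. vscale (kfun.representation B y b) b)" by (simp only: rp[OF that(1)])
    also have "\<dots> = y" by (rule rp[OF that(2)])
    finally show ?thesis .
  qed
  have sV: "subsp V" using assms findim_subsp by blast
  have tV: "linear_map V (t ` V) t" using t by (auto simp: linear_map_def)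
  have sW: "subsp (t ` V)" using tV sV subsp_image by blast
  have "t x = 0 \<Longrightarrow> x = 0" if "x \<in> V" for x using inj[OF that subsp_0[OF sV]] lm_0[OF t sV] by simp
  then have "\<exists>s. linear_map (t ` V) V s \<and> (\<forall>x\<in>V. s (t x) = x)"
    using linear_map_factor[OF sV sW sV tV lm_id] by (metis (no_types, lifting))
  then obtain s where "linear_map (t ` V) V s" "\<forall>x\<in>V. s (t x) = x" by blast
  then show thesis using that[of "t ` V" t s] findim_image[OF t assms] tV by simp
qed


section \<open>Sheaves and injectivity\<close>

lemma sheaf_findim: "is_sheaf P F \<Longrightarrow> \<sigma> \<in> P \<Longrightarrow> findim_space (stalk F \<sigma>)"
  and sheaf_res: "is_sheaf P F \<Longrightarrow> \<sigma> \<in> P \<Longrightarrow> \<tau> \<in> P \<Longrightarrow> \<sigma> \<le> \<tau> \<Longrightarrow> linear_map (stalk F \<sigma>) (stalk F \<tau>) (res F \<sigma> \<tau>)"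
  and sheaf_res_id: "is_sheaf P F \<Longrightarrow> \<sigma> \<in> P \<Longrightarrow> v \<in> stalk F \<sigma> \<Longrightarrow> res F \<sigma> \<sigma> v = v"
  and sheaf_res_res: "is_sheaf P F \<Longrightarrow> \<rho> \<in> P \<Longrightarrow> \<sigma> \<in> P \<Longrightarrow> \<tau> \<in> P \<Longrightarrow> \<rho> \<le> \<sigma> \<Longrightarrow> \<sigma> \<le> \<tau> \<Longrightarrow>
        v \<in> stalk F \<rho> \<Longrightarrow> res F \<sigma> \<tau> (res F \<rho> \<sigma> v) = res F \<rho> \<tau> v"
  by (simp_all add: is_sheaf_def)

lemma sheaf_subsp: "is_sheaf P F \<Longrightarrow> \<sigma> \<in> P \<Longrightarrow> subsp (stalk F \<sigma>)"
  using sheaf_findim findim_subsp by blast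

lemma sheaf_res_in: "is_sheaf P F \<Longrightarrow> \<sigma> \<in> P \<Longrightarrow> \<tau> \<in> P \<Longrightarrow> \<sigma> \<le> \<tau> \<Longrightarrow> v \<in> stalk F \<sigma> \<Longrightarrow> res F \<sigma> \<tau> v \<in> stalk F \<tau>"
  using lm_in sheaf_res by blast

lemma is_sheafI:
  assumes "\<And>\<sigma>. \<sigma> \<in> P \<Longrightarrow> findim_space (stalk F \<sigma>)"
    and "\<And>\<sigma> \<tau>. \<sigma> \<in> P \<Longrightarrow> \<tau> \<in> P \<Longrightarrow> \<sigma> \<le> \<tau> \<Longrightarrow> linear_map (stalk F \<sigma>) (stalk F \<tau>) (res F \<sigma> \<tau>)"
    and "\<And>\<sigma> v. \<sigma> \<in> P \<Longrightarrow> v \<in> stalk F \<sigma> \<Longrightarrow> res F \<sigma> \<sigma> v = v"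
    and "\<And>\<rho> \<sigma> \<tau> v. \<rho> \<in> P \<Longrightarrow> \<sigma> \<in> P \<Longrightarrow> \<tau> \<in> P \<Longrightarrow> \<rho> \<le> \<sigma> \<Longrightarrow> \<sigma> \<le> \<tau> \<Longrightarrow>
        v \<in> stalk F \<rho> \<Longrightarrow> res F \<sigma> \<tau> (res F \<rho> \<sigma> v) = res F \<rho> \<tau> v"
  shows "is_sheaf P F"
  using assms by (simp add: is_sheaf_def)

lemma hom_lm: "sheaf_hom P F G \<phi> \<Longrightarrow> \<sigma> \<in> P \<Longrightarrow> linear_map (stalk F \<sigma>) (stalk G \<sigma>) (\<phi> \<sigma>)"
  and hom_nat: "sheaf_hom P F G \<phi> \<Longrightarrow> \<sigma> \<in> P \<Longrightarrow> \<tau> \<in> P \<Longrightarrow> \<sigma> \<le> \<tau> \<Longrightarrow> v \<in> stalk F \<sigma> \<Longrightarrow>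
        \<phi> \<tau> (res F \<sigma> \<tau> v) = res G \<sigma> \<tau> (\<phi> \<sigma> v)"
  by (simp_all add: sheaf_hom_def)

lemma hom_in: "sheaf_hom P F G \<phi> \<Longrightarrow> \<sigma> \<in> P \<Longrightarrow> v \<in> stalk F \<sigma> \<Longrightarrow> \<phi> \<sigma> v \<in> stalk G \<sigma>"
  using hom_lm lm_in by blast

lemma sheaf_homI:
  assumes "\<And>\<sigma>. \<sigma> \<in> P \<Longrightarrow> linear_map (stalk F \<sigma>) (stalk G \<sigma>) (\<phi> \<sigma>)"
    and "\<And>\<sigma> \<tau> v. \<sigma> \<in> P \<Longrightarrow> \<tau> \<in> P \<Longrightarrow> \<sigma> \<le> \<tau> \<Longrightarrow> v \<in> stalk F \<sigma> \<Longrightarrow>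
        \<phi> \<tau> (res F \<sigma> \<tau> v) = res G \<sigma> \<tau> (\<phi> \<sigma> v)"
  shows "sheaf_hom P F G \<phi>"
  using assms by (simp add: sheaf_hom_def)

lemma hom_id: "sheaf_hom P F F (\<lambda>_ v. v)"
  by (rule sheaf_homI) (auto intro: lm_id)

lemma hom_comp:
  assumes "sheaf_hom P F G \<phi>" "sheaf_hom P G H \<psi>"
  shows "sheaf_hom P F H (\<lambda>\<sigma> v. \<psi> \<sigma> (\<phi> \<sigma> v))"
proof (rule sheaf_homI)
  fix \<sigma> assume "\<sigma> \<in> P"
  then show "linear_map (stalk F \<sigma>) (stalk H \<sigma>) (\<lambda>v. \<psi> \<sigma> (\<phi> \<sigma> v))"
    using lm_compose[OF hom_lm[OF assms(1)] hom_lm[OF assms(2)]] by blast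
qed (simp add: hom_nat[OF assms(1)] hom_nat[OF assms(2)] hom_in[OF assms(1)])

lemma hom_zero: "is_sheaf P F \<Longrightarrow> is_sheaf P G \<Longrightarrow> sheaf_hom P F G (\<lambda>_ _. 0)"
  by (rule sheaf_homI) (auto simp: lm_zero sheaf_subsp lm_0[OF sheaf_res])

lemma hom_minus:
  assumes "is_sheaf P G" "sheaf_hom P F G \<phi>" "sheaf_hom P F G \<psi>"
  shows "sheaf_hom P F G (\<lambda>\<sigma> v. \<phi> \<sigma> v - \<psi> \<sigma> v)"
  by (rule sheaf_homI)
    (auto simp: lm_minus hom_lm[OF assms(2)] hom_lm[OF assms(3)] sheaf_subsp[OF assms(1)]
       hom_nat[OF assms(2)] hom_nat[OF assms(3)] lm_diff[OF sheaf_res[OF assms(1)]] hom_in[OF assms(2)] hom_in[OF assms(3)])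

section \<open>Products of stalks and the Godement sheaf\<close>

lemma
  fixes x y :: "'a \<times> 'i \<Rightarrow> 'k::field"
  shows curry_add [simp]: "curry (x + y) p = curry x p + curry y p"
    and curry_diff [simp]: "curry (x - y) p = curry x p - curry y p"
    and curry_vscale [simp]: "curry (vscale c x) p = vscale c (curry x p)"
    and curry_zero [simp]: "curry (0 :: 'a \<times> 'i \<Rightarrow> 'k::field) p = 0"
  by (auto simp: fun_eq_iff vscale_def)

lemma curry_eqI: "(\<And>p. curry x p = curry y p) \<Longrightarrow> x = y"
  by (auto simp: fun_eq_iff curry_def)

definition prod_space :: "'a set \<Rightarrow> ('a \<Rightarrow> ('i \<Rightarrow> 'k::field) set) \<Rightarrow> ('a \<times> 'i \<Rightarrow> 'k) set" where
  "prod_space P V = {x. \<forall>p. if p \<in> P then curry x p \<in> V p else curry x p = 0}"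

lemma subsp_prod: "(\<And>p. p \<in> P \<Longrightarrow> subsp (V p)) \<Longrightarrow> subsp (prod_space P V)"
  by (rule subspI) (auto simp: prod_space_def subsp_0 subsp_add subsp_scale)

lemma findim_prod:
  assumes "finite P" "\<And>p. p \<in> P \<Longrightarrow> findim_space (V p)"
  shows "findim_space (prod_space P V)"
  using assms
proof (induct P rule: finite_induct)
  case empty
  have "prod_space {} V = {0}"
    by (auto simp: prod_space_def intro!: curry_eqI)
  then show ?case by simp
next
  case (insert p P)
  let ?g = "\<lambda>w. case_prod (\<lambda>q. if q = p then w \<circ> Inl else curry (w \<circ> Inr) q)"
  have l: "linear_map (dsum (V p) (prod_space P V)) (prod_space (insert p P) V) ?g"
    by (rule linear_mapI) (auto simp: prod_space_def dsum_def intro!: curry_eqI)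
  have f: "findim_space (dsum (V p) (prod_space P V))"
    using insert by (intro findim_dsum) auto
  have "prod_space (insert p P) V \<subseteq> ?g ` dsum (V p) (prod_space P V)"
  proof
    fix x assume x: "x \<in> prod_space (insert p P) V"
    let ?w = "case_sum (curry x p) (case_prod (\<lambda>q. if q \<in> P then curry x q else 0))"
    have "x = ?g ?w"
      by (rule curry_eqI) (use x in \<open>auto simp: prod_space_def\<close>)
    moreover have "?w \<in> dsum (V p) (prod_space P V)"
      using x by (auto simp: prod_space_def)
    ultimately show "x \<in> ?g ` dsum (V p) (prod_space P V)" by (rule image_eqI)
  qed
  then have "prod_space (insert p P) V = ?g ` dsum (V p) (prod_space P V)"
    using lm_in[OF l] by blast
  then show ?case using findim_image[OF l f] by simp
qed

text \<open>The product over \<open>p\<close> of [p] tensored with the stalk at \<open>p\<close>: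
  coordinate \<open>p\<close> lives on all \<sigma> below \<open>p\<close>, and restriction to
  \<tau> drops the coordinates that are not above \<tau>.\<close>

definition godement :: "'a::order set \<Rightarrow> ('a, 'i, 'k::field) sheaf \<Rightarrow> ('a, 'a \<times> 'i, 'k) sheaf" where
  "godement P F = \<lparr> stalk = (\<lambda>\<sigma>. prod_space {p \<in> P. \<sigma> \<le> p} (stalk F)),
                    res = (\<lambda>\<sigma> \<tau> x. case_prod (\<lambda>p. if \<tau> \<le> p then curry x p else 0)) \<rparr>"

lemma godement_stalk: "x \<in> stalk (godement P F) \<sigma> \<longleftrightarrow>
    (\<forall>p. if p \<in> P \<and> \<sigma> \<le> p then curry x p \<in> stalk F p else curry x p = 0)"
  by (simp add: godement_def prod_space_def)

lemma godement_stalkI: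
  assumes "\<And>p. p \<in> P \<Longrightarrow> \<sigma> \<le> p \<Longrightarrow> curry x p \<in> stalk F p"
    and "\<And>p. \<not> (p \<in> P \<and> \<sigma> \<le> p) \<Longrightarrow> curry x p = 0"
  shows "x \<in> stalk (godement P F) \<sigma>"
  unfolding godement_stalk using assms by presburger

lemma godement_inside: "x \<in> stalk (godement P F) \<sigma> \<Longrightarrow> p \<in> P \<Longrightarrow> \<sigma> \<le> p \<Longrightarrow> curry x p \<in> stalk F p"
  and godement_outside: "x \<in> stalk (godement P F) \<sigma> \<Longrightarrow> \<not> (p \<in> P \<and> \<sigma> \<le> p) \<Longrightarrow> curry x p = 0"
  unfolding godement_stalk by presburger+

lemma godement_res:
  fixes F :: "('a::order, 'i, 'k::field) sheaf"
  shows "curry (res (godement P F) \<sigma> \<tau> x) p = (if \<tau> \<le> p then curry x p else 0)"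
  by (simp add: godement_def)

lemma godement_sheaf:
  assumes "finite P" "is_sheaf P F"
  shows "is_sheaf P (godement P F)"
proof (rule is_sheafI)
  fix \<sigma> assume "\<sigma> \<in> P"
  then show "findim_space (stalk (godement P F) \<sigma>)"
    using assms by (auto simp: godement_def intro!: findim_prod sheaf_findim)
next
  fix \<sigma> \<tau> assume st: "\<sigma> \<in> P" "\<tau> \<in> P" "\<sigma> \<le> \<tau>"
  show "linear_map (stalk (godement P F) \<sigma>) (stalk (godement P F) \<tau>) (res (godement P F) \<sigma> \<tau>)"
  proof (rule linear_mapI)
    fix x assume "x \<in> stalk (godement P F) \<sigma>"
    then show "res (godement P F) \<sigma> \<tau> x \<in> stalk (godement P F) \<tau>"
      using order.trans[OF st(3)] godement_inside[of x P F \<sigma>] godement_outside[of x P F \<sigma>]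
      by (intro godement_stalkI) (auto simp: godement_res)
  qed (rule curry_eqI, simp add: godement_res)+
next
  fix \<sigma> v assume "\<sigma> \<in> P" "v \<in> stalk (godement P F) \<sigma>"
  then show "res (godement P F) \<sigma> \<sigma> v = v"
    by (intro curry_eqI) (simp add: godement_res godement_outside[of v P F \<sigma>])
next
  fix \<rho> \<sigma> \<tau> v assume "\<rho> \<in> P" "\<sigma> \<in> P" "\<tau> \<in> P" "\<rho> \<le> \<sigma>" "\<sigma> \<le> \<tau>"
  then show "res (godement P F) \<sigma> \<tau> (res (godement P F) \<rho> \<sigma> v) = res (godement P F) \<rho> \<tau> v"
    by (intro curry_eqI) (auto simp: godement_res)
qed

text \<open>The adjunction behind injectivity: any family of linear maps \<open>h p\<close> on
  stalks, with no naturality between them, gives a homomorphism into a Godement sheaf.\<close>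

definition god_map :: "'a::order set \<Rightarrow> ('a, 'i, 'k::field) sheaf \<Rightarrow> ('a \<Rightarrow> ('i \<Rightarrow> 'k) \<Rightarrow> 'j \<Rightarrow> 'k) \<Rightarrow>
    'a \<Rightarrow> ('i \<Rightarrow> 'k) \<Rightarrow> 'a \<times> 'j \<Rightarrow> 'k" where
  "god_map P B h \<sigma> b = case_prod (\<lambda>p. if p \<in> P \<and> \<sigma> \<le> p then h p (res B \<sigma> p b) else 0)"

lemma curry_god_map: "curry (god_map P B h \<sigma> b) p = (if p \<in> P \<and> \<sigma> \<le> p then h p (res B \<sigma> p b) else 0)"
  by (simp add: god_map_def)

lemma god_map_hom:
  assumes B: "is_sheaf P B" and h: "\<And>p. p \<in> P \<Longrightarrow> linear_map (stalk B p) (stalk J p) (h p)"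
  shows "sheaf_hom P B (godement P J) (god_map P B h)"
proof (rule sheaf_homI)
  fix \<sigma> assume s: "\<sigma> \<in> P"
  show "linear_map (stalk B \<sigma>) (stalk (godement P J) \<sigma>) (god_map P B h \<sigma>)"
    by (rule linear_mapI)
      (auto intro!: godement_stalkI simp: curry_god_map s lm_in[OF h] sheaf_res_in[OF B] lm_add[OF h] lm_scale[OF h]
        lm_add[OF sheaf_res[OF B]] lm_scale[OF sheaf_res[OF B]] intro!: curry_eqI)
next
  fix \<sigma> \<tau> v assume "\<sigma> \<in> P" "\<tau> \<in> P" "\<sigma> \<le> \<tau>" "v \<in> stalk B \<sigma>"
  then show "god_map P B h \<tau> (res B \<sigma> \<tau> v) = res (godement P J) \<sigma> \<tau> (god_map P B h \<sigma> v)"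
    by (intro curry_eqI) (auto simp: curry_god_map godement_res sheaf_res_res[OF B])
qed

abbreviation god_unit :: "'a::order set \<Rightarrow> ('a, 'i, 'k::field) sheaf \<Rightarrow> 'a \<Rightarrow> ('i \<Rightarrow> 'k) \<Rightarrow> 'a \<times> 'i \<Rightarrow> 'k" where
  "god_unit P F \<equiv> god_map P F (\<lambda>_ v. v)"

lemma god_unit_hom: "is_sheaf P F \<Longrightarrow> sheaf_hom P F (godement P F) (god_unit P F)"
  by (rule god_map_hom) (auto intro: lm_id)

lemma god_unit_eq_0: "is_sheaf P F \<Longrightarrow> \<sigma> \<in> P \<Longrightarrow> v \<in> stalk F \<sigma> \<Longrightarrow> god_unit P F \<sigma> v = 0 \<Longrightarrow> v = 0"
  using curry_god_map[of P F "\<lambda>_ v. v" \<sigma> v \<sigma>] by (simp add: sheaf_res_id)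

text \<open>
  Being a retract of the Godement sheaf is a form of injectivity that makes sense, and
  gives extensions, for every ambient index type.
\<close>

definition god_retraction :: "'a::order set \<Rightarrow> ('a, 'i, 'k::field) sheaf \<Rightarrow> ('a \<Rightarrow> ('a \<times> 'i \<Rightarrow> 'k) \<Rightarrow> 'i \<Rightarrow> 'k) \<Rightarrow> bool" where
  "god_retraction P J r \<longleftrightarrow> is_sheaf P J \<and> sheaf_hom P (godement P J) J r \<and>
     (\<forall>\<sigma>\<in>P. \<forall>v\<in>stalk J \<sigma>. r \<sigma> (god_unit P J \<sigma> v) = v)"

definition ginj :: "'a::order set \<Rightarrow> ('a, 'i, 'k::field) sheaf \<Rightarrow> bool" where
  "ginj P J \<longleftrightarrow> (\<exists>r. god_retraction P J r)"

lemma ginj_sheaf: "ginj P J \<Longrightarrow> is_sheaf P J"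
  by (auto simp: ginj_def god_retraction_def)

text \<open>The extension problem is solved in each stalk separately. The solutions need not commute
  with restrictions, but \<open>god_map\<close> assembles them into a homomorphism to the Godement
  sheaf, and the retraction leads back to \<open>J\<close>.\<close>

lemma ginj_extend:
  assumes A: "is_sheaf P A" and B: "is_sheaf P B" and J: "ginj P J"
    and u: "sheaf_hom P A B u" and p: "sheaf_hom P A J \<phi>"
    and ker: "\<And>\<sigma> v. \<sigma> \<in> P \<Longrightarrow> v \<in> stalk A \<sigma> \<Longrightarrow> u \<sigma> v = 0 \<Longrightarrow> \<phi> \<sigma> v = 0"
  shows "\<exists>\<psi>. sheaf_hom P B J \<psi> \<and> (\<forall>\<sigma>\<in>P. \<forall>v\<in>stalk A \<sigma>. \<psi> \<sigma> (u \<sigma> v) = \<phi> \<sigma> v)"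
proof -
  obtain r where r: "is_sheaf P J" "sheaf_hom P (godement P J) J r"
      "\<forall>\<sigma>\<in>P. \<forall>v\<in>stalk J \<sigma>. r \<sigma> (god_unit P J \<sigma> v) = v"
    using J unfolding ginj_def god_retraction_def by blast
  have "\<exists>h. linear_map (stalk B \<sigma>) (stalk J \<sigma>) h \<and> (\<forall>v\<in>stalk A \<sigma>. h (u \<sigma> v) = \<phi> \<sigma> v)" if "\<sigma> \<in> P" for \<sigma>
    by (rule linear_map_factor[OF sheaf_subsp[OF A that] sheaf_subsp[OF B that] sheaf_subsp[OF r(1) that]
        hom_lm[OF u that] hom_lm[OF p that] ker[OF that]]) auto
  then obtain h where h: "\<And>\<sigma>. \<sigma> \<in> P \<Longrightarrow> linear_map (stalk B \<sigma>) (stalk J \<sigma>) (h \<sigma>)"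
      "\<And>\<sigma> v. \<sigma> \<in> P \<Longrightarrow> v \<in> stalk A \<sigma> \<Longrightarrow> h \<sigma> (u \<sigma> v) = \<phi> \<sigma> v"
    by metis
  have "god_map P B h \<sigma> (u \<sigma> v) = god_unit P J \<sigma> (\<phi> \<sigma> v)" if "\<sigma> \<in> P" "v \<in> stalk A \<sigma>" for \<sigma> v
    using that by (intro curry_eqI)
      (auto simp: curry_god_map hom_nat[OF u, symmetric] hom_nat[OF p, symmetric] h(2) sheaf_res_in[OF A])
  then show ?thesis
    using hom_comp[OF god_map_hom[OF B h(1)] r(2)] r(3) hom_in[OF p] by (intro exI conjI) auto
qed

text \<open>Extending \<open>s\<close> along the unit of \<open>K\<close> and then applying
  \<open>e\<close> retracts the Godement sheaf of \<open>K\<close> onto \<open>K\<close>.\<close>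

lemma ginj_retract:
  assumes J: "ginj P J" and K: "is_sheaf P K" and s: "sheaf_hom P K J s" and e: "sheaf_hom P J K e"
    and es: "\<And>\<sigma> v. \<sigma> \<in> P \<Longrightarrow> v \<in> stalk K \<sigma> \<Longrightarrow> e \<sigma> (s \<sigma> v) = v" and P: "finite P"
  shows "ginj P K"
proof -
  obtain \<psi> where "sheaf_hom P (godement P K) J \<psi>" "\<forall>\<sigma>\<in>P. \<forall>v\<in>stalk K \<sigma>. \<psi> \<sigma> (god_unit P K \<sigma> v) = s \<sigma> v"
    using ginj_extend[OF K godement_sheaf[OF P K] J god_unit_hom[OF K] s]
      god_unit_eq_0[OF K] lm_0[OF hom_lm[OF s] sheaf_subsp[OF K]] by blast
  then have "god_retraction P K (\<lambda>\<sigma> x. e \<sigma> (\<psi> \<sigma> x))"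
    using K hom_comp[OF _ e] es by (simp add: god_retraction_def)
  then show ?thesis unfolding ginj_def by blast
qed

lemma ginj_godement:
  assumes "finite P" "is_sheaf P F"
  shows "ginj P (godement P F)"
proof -
  let ?G = "godement P F"
  \<comment> \<open>The retraction takes the diagonal of a double family; the unit puts a copy of
    coordinate \<open>q\<close> into row \<open>p\<close> for every \<open>p\<close> below
    \<open>q\<close>.\<close>
  let ?r = "\<lambda>\<sigma> x. case_prod (\<lambda>q. if q \<in> P \<and> \<sigma> \<le> q then curry (curry x q) q else 0)"
  have G: "is_sheaf P ?G" using assms by (rule godement_sheaf)
  have "sheaf_hom P (godement P ?G) ?G ?r"
  proof (rule sheaf_homI)
    fix \<sigma> assume "\<sigma> \<in> P"
    show "linear_map (stalk (godement P ?G) \<sigma>) (stalk ?G \<sigma>) (?r \<sigma>)"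
    proof (rule linear_mapI)
      fix x assume x: "x \<in> stalk (godement P ?G) \<sigma>"
      show "?r \<sigma> x \<in> stalk ?G \<sigma>"
        using godement_inside[OF godement_inside[OF x]] by (intro godement_stalkI) auto
    qed (rule curry_eqI, simp)+
  next
    fix \<sigma> \<tau> v assume "\<sigma> \<in> P" "\<tau> \<in> P" "\<sigma> \<le> \<tau>" "v \<in> stalk (godement P ?G) \<sigma>"
    then show "?r \<tau> (res (godement P ?G) \<sigma> \<tau> v) = res ?G \<sigma> \<tau> (?r \<sigma> v)"
      by (intro curry_eqI) (auto simp: godement_res)
  qed
  moreover have "?r \<sigma> (god_unit P ?G \<sigma> v) = v" if "\<sigma> \<in> P" "v \<in> stalk ?G \<sigma>" for \<sigma> v
    using that by (intro curry_eqI) (simp add: godement_res curry_god_map godement_outside[OF that(2)])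
  ultimately have "god_retraction P ?G ?r" using G by (simp add: god_retraction_def)
  then show ?thesis unfolding ginj_def by blast
qed

section \<open>Models over \<open>nat\<close>, and agreement of the two notions of
  injectivity\<close>

lemma sheaf_nat_model:
  fixes F :: "('a::order, 'i, 'k::field) sheaf"
  assumes F: "is_sheaf P F"
  shows "\<exists>(N :: ('a, nat, 'k) sheaf) t s. is_sheaf P N \<and> sheaf_hom P F N t \<and> sheaf_hom P N F s \<and>
    (\<forall>\<sigma>\<in>P. \<forall>v\<in>stalk F \<sigma>. s \<sigma> (t \<sigma> v) = v) \<and> (\<forall>\<sigma>\<in>P. \<forall>v\<in>stalk N \<sigma>. t \<sigma> (s \<sigma> v) = v)"
proof -
  define Q where "Q = (\<lambda>\<sigma> (W :: (nat \<Rightarrow> 'k) set, t, s). findim_space W \<and> linear_map (stalk F \<sigma>) W t \<and>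
      linear_map W (stalk F \<sigma>) s \<and> (\<forall>v\<in>stalk F \<sigma>. s (t v) = v) \<and> t ` stalk F \<sigma> = W)"
  have "\<forall>\<sigma>\<in>P. \<exists>x. Q \<sigma> x"
  proof
    fix \<sigma> assume "\<sigma> \<in> P"
    show "\<exists>x. Q \<sigma> x"
    proof (rule nat_model[OF sheaf_findim[OF F \<open>\<sigma> \<in> P\<close>]])
      fix t s and W :: "(nat \<Rightarrow> 'k) set"
      assume "findim_space W" "linear_map (stalk F \<sigma>) W t" "linear_map W (stalk F \<sigma>) s"
        "\<And>x. x \<in> stalk F \<sigma> \<Longrightarrow> s (t x) = x" "t ` stalk F \<sigma> = W"
      then have "Q \<sigma> (W, t, s)" by (simp add: Q_def)
      then show ?thesis ..
    qed
  qed
  then obtain X where X: "\<forall>\<sigma>\<in>P. Q \<sigma> (X \<sigma>)" using bchoice[of P Q] by blast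
  define W where "W \<sigma> = fst (X \<sigma>)" for \<sigma>
  define t where "t \<sigma> = fst (snd (X \<sigma>))" for \<sigma>
  define s where "s \<sigma> = snd (snd (X \<sigma>))" for \<sigma>
  have Q: "Q \<sigma> (W \<sigma>, t \<sigma>, s \<sigma>)" if "\<sigma> \<in> P" for \<sigma>
    using X that by (simp add: W_def t_def s_def)
  have *: "\<And>\<sigma>. \<sigma> \<in> P \<Longrightarrow> findim_space (W \<sigma>)"
      and t: "\<And>\<sigma>. \<sigma> \<in> P \<Longrightarrow> linear_map (stalk F \<sigma>) (W \<sigma>) (t \<sigma>)"
      and s: "\<And>\<sigma>. \<sigma> \<in> P \<Longrightarrow> linear_map (W \<sigma>) (stalk F \<sigma>) (s \<sigma>)"
      and st: "\<And>\<sigma> v. \<sigma> \<in> P \<Longrightarrow> v \<in> stalk F \<sigma> \<Longrightarrow> s \<sigma> (t \<sigma> v) = v"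
      and W: "\<And>\<sigma>. \<sigma> \<in> P \<Longrightarrow> t \<sigma> ` stalk F \<sigma> = W \<sigma>"
    using Q by (simp_all add: Q_def)
  have ts: "t \<sigma> (s \<sigma> w) = w" if "\<sigma> \<in> P" "w \<in> W \<sigma>" for \<sigma> w
    using that st[OF that(1)] W[OF that(1)] by force
  define N where "N = \<lparr> stalk = W, res = (\<lambda>\<sigma> \<tau> w. t \<tau> (res F \<sigma> \<tau> (s \<sigma> w))) \<rparr>"
  have "is_sheaf P N"
    by (rule is_sheafI)
      (auto simp: N_def * ts sheaf_res_id[OF F] lm_in[OF s] st sheaf_res_in[OF F] sheaf_res_res[OF F]
        intro!: lm_compose[OF lm_compose[OF s sheaf_res[OF F]] t])
  moreover have "sheaf_hom P F N t"
    by (rule sheaf_homI) (auto simp: N_def t st)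
  moreover have "sheaf_hom P N F s"
    by (rule sheaf_homI) (auto simp: N_def s st sheaf_res_in[OF F] lm_in[OF s])
  ultimately show ?thesis using st ts by (intro exI[of _ N] exI[of _ t] exI[of _ s]) (simp add: N_def)
qed

text \<open>\<open>injective_sheaf\<close> tests only sheaves over \<open>nat\<close>, so the
  Godement sheaf is replaced by a model over \<open>nat\<close> before the identity of
  \<open>J\<close> is extended along the unit.\<close>

lemma injective_sheaf_iff_ginj:
  fixes J :: "('a::order, nat, 'k::field) sheaf"
  assumes P: "finite P"
  shows "injective_sheaf P J \<longleftrightarrow> ginj P J"
proof
  assume "ginj P J"
  have "\<exists>\<psi>. sheaf_hom P B J \<psi> \<and> (\<forall>\<sigma>\<in>P. \<forall>v\<in>stalk A \<sigma>. \<psi> \<sigma> (\<iota> \<sigma> v) = \<phi> \<sigma> v)"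
    if h: "is_sheaf P A" "is_sheaf P B" "sheaf_hom P A B \<iota>" "\<forall>\<sigma>\<in>P. inj_on (\<iota> \<sigma>) (stalk A \<sigma>)" "sheaf_hom P A J \<phi>"
    for A B :: "('a, nat, 'k) sheaf" and \<iota> \<phi>
  proof (rule ginj_extend[OF h(1,2) \<open>ginj P J\<close> h(3,5)])
    fix \<sigma> v assume "\<sigma> \<in> P" "v \<in> stalk A \<sigma>" "\<iota> \<sigma> v = 0"
    moreover from this have "v = 0"
      using h(4) lm_0[OF hom_lm[OF h(3)] sheaf_subsp[OF h(1)], of \<sigma>] subsp_0[OF sheaf_subsp[OF h(1)], of \<sigma>]
      by (metis inj_onD)
    ultimately show "\<phi> \<sigma> v = 0"
      using lm_0[OF hom_lm[OF h(5)] sheaf_subsp[OF h(1)], of \<sigma>] by simp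
  qed
  then show "injective_sheaf P J" using ginj_sheaf[OF \<open>ginj P J\<close>] unfolding injective_sheaf_def by blast
next
  assume inj: "injective_sheaf P J"
  then have J: "is_sheaf P J" by (simp add: injective_sheaf_def)
  obtain N :: "('a, nat, 'k) sheaf" and t s where N: "is_sheaf P N" and t: "sheaf_hom P (godement P J) N t"
    and s: "sheaf_hom P N (godement P J) s"
    and st: "\<forall>\<sigma>\<in>P. \<forall>v\<in>stalk (godement P J) \<sigma>. s \<sigma> (t \<sigma> v) = v"
    using sheaf_nat_model[OF godement_sheaf[OF P J]] by blast
  let ?u = "\<lambda>\<sigma> v. t \<sigma> (god_unit P J \<sigma> v)"
  have u: "sheaf_hom P J N ?u" using hom_comp[OF god_unit_hom[OF J] t] .
  have "inj_on (?u \<sigma>) (stalk J \<sigma>)" if "\<sigma> \<in> P" for \<sigma>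
  proof (rule inj_onI)
    fix v w assume vw: "v \<in> stalk J \<sigma>" "w \<in> stalk J \<sigma>" "?u \<sigma> v = ?u \<sigma> w"
    have "god_unit P J \<sigma> v = god_unit P J \<sigma> w"
      using st that vw hom_in[OF god_unit_hom[OF J] that] by metis
    then show "v = w" using vw that sheaf_res_id[OF J that] curry_god_map[of P J "\<lambda>_ v. v" \<sigma> _ \<sigma>]
      by (metis order_refl)
  qed
  then obtain \<psi> where "sheaf_hom P N J \<psi>" "\<forall>\<sigma>\<in>P. \<forall>v\<in>stalk J \<sigma>. \<psi> \<sigma> (?u \<sigma> v) = v"
    using inj J N u hom_id[of P J] unfolding injective_sheaf_def by blast
  then have "god_retraction P J (\<lambda>\<sigma> x. \<psi> \<sigma> (t \<sigma> x))"
    using J hom_comp[OF t] by (simp add: god_retraction_def)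
  then show "ginj P J" unfolding ginj_def by blast
qed

definition dsum_sheaf :: "('a, 'i, 'k::field) sheaf \<Rightarrow> ('a, 'j, 'k) sheaf \<Rightarrow> ('a, 'i + 'j, 'k) sheaf" where
  "dsum_sheaf F G = \<lparr> stalk = (\<lambda>\<sigma>. dsum (stalk F \<sigma>) (stalk G \<sigma>)),
     res = (\<lambda>\<sigma> \<tau> v. case_sum (res F \<sigma> \<tau> (v \<circ> Inl)) (res G \<sigma> \<tau> (v \<circ> Inr))) \<rparr>"

lemma lm_pair:
  assumes "linear_map V W f" "linear_map V W' g"
  shows "linear_map V (dsum W W') (\<lambda>v. case_sum (f v) (g v))"
  by (rule linear_mapI)
    (auto simp: lm_in[OF assms(1)] lm_in[OF assms(2)] lm_add[OF assms(1)] lm_add[OF assms(2)]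
      lm_scale[OF assms(1)] lm_scale[OF assms(2)] case_sum_linear)

lemma lm_Inl: "linear_map (dsum V W) V (\<lambda>v. v \<circ> Inl)"
  and lm_Inr: "linear_map (dsum V W) W (\<lambda>v. v \<circ> Inr)"
  by (auto intro!: linear_mapI simp: dsum_def)

lemma dsum_sheaf:
  assumes "is_sheaf P F" "is_sheaf P G"
  shows "is_sheaf P (dsum_sheaf F G)"
proof (rule is_sheafI)
  fix \<sigma> \<tau> assume "\<sigma> \<in> P" "\<tau> \<in> P" "\<sigma> \<le> \<tau>"
  then show "linear_map (stalk (dsum_sheaf F G) \<sigma>) (stalk (dsum_sheaf F G) \<tau>) (res (dsum_sheaf F G) \<sigma> \<tau>)"
    unfolding dsum_sheaf_def sheaf.simps
    using assms by (intro lm_pair lm_compose[OF lm_Inl] lm_compose[OF lm_Inr] sheaf_res)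
qed (auto simp: dsum_sheaf_def findim_dsum sheaf_findim[OF assms(1)] sheaf_findim[OF assms(2)] sheaf_res_id[OF assms(1)] sheaf_res_id[OF assms(2)]
      sheaf_res_res[OF assms(1)] sheaf_res_res[OF assms(2)] elim!: dsumE)

lemma dsum_hom:
  assumes "sheaf_hom P H F \<phi>" "sheaf_hom P H G \<psi>"
  shows "sheaf_hom P H (dsum_sheaf F G) (\<lambda>\<sigma> v. case_sum (\<phi> \<sigma> v) (\<psi> \<sigma> v))"
  by (rule sheaf_homI)
    (auto simp: dsum_sheaf_def hom_nat[OF assms(1)] hom_nat[OF assms(2)] intro!: lm_pair
      hom_lm[OF assms(1)] hom_lm[OF assms(2)])

lemma hom_Inl: "sheaf_hom P (dsum_sheaf F G) F (\<lambda>_ v. v \<circ> Inl)"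
  and hom_Inr: "sheaf_hom P (dsum_sheaf F G) G (\<lambda>_ v. v \<circ> Inr)"
  by (auto intro!: sheaf_homI simp: dsum_sheaf_def lm_Inl lm_Inr)

text \<open>Each projection extends along the unit of the sum, and the pair of the two extensions is
  a retraction.\<close>

lemma ginj_dsum:
  assumes "ginj P F" "ginj P G" "finite P"
  shows "ginj P (dsum_sheaf F G)"
proof -
  let ?D = "dsum_sheaf F G"
  have D: "is_sheaf P ?D" using assms by (intro dsum_sheaf ginj_sheaf)
  note GD = godement_sheaf[OF assms(3) D] and uD = god_unit_hom[OF D]
  obtain a where a: "sheaf_hom P (godement P ?D) F a" "\<forall>\<sigma>\<in>P. \<forall>v\<in>stalk ?D \<sigma>. a \<sigma> (god_unit P ?D \<sigma> v) = v \<circ> Inl"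
    using ginj_extend[OF D GD assms(1) uD hom_Inl] god_unit_eq_0[OF D] by (metis comp_zero)
  obtain b where b: "sheaf_hom P (godement P ?D) G b" "\<forall>\<sigma>\<in>P. \<forall>v\<in>stalk ?D \<sigma>. b \<sigma> (god_unit P ?D \<sigma> v) = v \<circ> Inr"
    using ginj_extend[OF D GD assms(2) uD hom_Inr] god_unit_eq_0[OF D] by (metis comp_zero)
  have "god_retraction P ?D (\<lambda>\<sigma> v. case_sum (a \<sigma> v) (b \<sigma> v))"
    unfolding god_retraction_def
    using D dsum_hom[OF a(1) b(1)] a(2) b(2) by (auto intro!: dsum_eqI)
  then show ?thesis unfolding ginj_def by blast
qed


section \<open>Complexes\<close>

abbreviation stk :: "('a, 'i, 'k) cpx \<Rightarrow> int \<Rightarrow> 'a \<Rightarrow> ('i \<Rightarrow> 'k) set" where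
  "stk C n \<sigma> \<equiv> stalk (obj C n) \<sigma>"

lemma cpx_sheaf: "bounded_complex P C \<Longrightarrow> is_sheaf P (obj C n)"
  and cpx_diff: "bounded_complex P C \<Longrightarrow> sheaf_hom P (obj C n) (obj C (n + 1)) (diff C n)"
  and cpx_dd: "bounded_complex P C \<Longrightarrow> \<sigma> \<in> P \<Longrightarrow> v \<in> stk C n \<sigma> \<Longrightarrow> diff C (n + 1) \<sigma> (diff C n \<sigma> v) = 0"
  and cpx_bounded: "bounded_complex P C \<Longrightarrow> \<exists>N. \<forall>n. \<bar>n\<bar> > N \<longrightarrow> zero_sheaf P (obj C n)"
  by (simp_all add: bounded_complex_def)

lemma map_hom: "chain_map P C D \<phi> \<Longrightarrow> sheaf_hom P (obj C n) (obj D n) (\<phi> n)"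
  and map_comm: "chain_map P C D \<phi> \<Longrightarrow> \<sigma> \<in> P \<Longrightarrow> v \<in> stk C n \<sigma> \<Longrightarrow> \<phi> (n + 1) \<sigma> (diff C n \<sigma> v) = diff D n \<sigma> (\<phi> n \<sigma> v)"
  by (simp_all add: chain_map_def)

lemma qi_map: "quasi_iso P C D \<phi> \<Longrightarrow> chain_map P C D \<phi>"
  by (simp add: quasi_iso_def)

definition hty :: "'a::order set \<Rightarrow> ('a, 'i, 'k::field) cpx \<Rightarrow> ('a, 'j, 'k) cpx \<Rightarrow>
    (int \<Rightarrow> 'a \<Rightarrow> ('i \<Rightarrow> 'k) \<Rightarrow> 'j \<Rightarrow> 'k) \<Rightarrow> (int \<Rightarrow> 'a \<Rightarrow> ('i \<Rightarrow> 'k) \<Rightarrow> 'j \<Rightarrow> 'k) \<Rightarrow>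
    (int \<Rightarrow> 'a \<Rightarrow> ('i \<Rightarrow> 'k) \<Rightarrow> 'j \<Rightarrow> 'k) \<Rightarrow> bool" where
  "hty P C D f g h \<longleftrightarrow> (\<forall>n. sheaf_hom P (obj C n) (obj D (n - 1)) (h n)) \<and>
     (\<forall>n. \<forall>\<sigma>\<in>P. \<forall>v\<in>stk C n \<sigma>. f n \<sigma> v = g n \<sigma> v + diff D (n - 1) \<sigma> (h n \<sigma> v) + h (n + 1) \<sigma> (diff C n \<sigma> v))"

lemma hty_hom: "hty P C D f g h \<Longrightarrow> sheaf_hom P (obj C n) (obj D (n - 1)) (h n)"
  and hty_eq: "hty P C D f g h \<Longrightarrow> \<sigma> \<in> P \<Longrightarrow> v \<in> stk C n \<sigma> \<Longrightarrow>
     f n \<sigma> v = g n \<sigma> v + diff D (n - 1) \<sigma> (h n \<sigma> v) + h (n + 1) \<sigma> (diff C n \<sigma> v)"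
  by (simp_all add: hty_def)

lemma comp_uminus [simp]: "(- v) \<circ> h = - (v \<circ> h)" for v :: "'i \<Rightarrow> 'k::field"
  by (auto simp: fun_eq_iff)

text \<open>
  The following facts restate linearity at a fixed point of the poset. The versions
  marked with \<open>m\<close> (for minus one) arrive at degree \<open>n\<close>, which avoids \<open>n - 1 + 1\<close>.
\<close>

context
  fixes P :: "'a::order set" and \<sigma> :: 'a and C :: "('a, 'i, 'k::field) cpx"
  assumes C: "bounded_complex P C" and s: "\<sigma> \<in> P"
begin

lemma c_subsp: "subsp (stk C n \<sigma>)"
  using sheaf_subsp[OF cpx_sheaf[OF C] s] .

lemma d_lm: "linear_map (stk C n \<sigma>) (stk C (n + 1) \<sigma>) (diff C n \<sigma>)"
  using hom_lm[OF cpx_diff[OF C] s] .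

lemma c_0: "0 \<in> stk C n \<sigma>"
  and c_add: "x \<in> stk C n \<sigma> \<Longrightarrow> y \<in> stk C n \<sigma> \<Longrightarrow> x + y \<in> stk C n \<sigma>"
  and c_diff: "x \<in> stk C n \<sigma> \<Longrightarrow> y \<in> stk C n \<sigma> \<Longrightarrow> x - y \<in> stk C n \<sigma>"
  using subsp_0 subsp_add subsp_diff c_subsp by blast+

lemma d_in: "x \<in> stk C n \<sigma> \<Longrightarrow> diff C n \<sigma> x \<in> stk C (n + 1) \<sigma>"
  and d_inm: "x \<in> stk C (n - 1) \<sigma> \<Longrightarrow> diff C (n - 1) \<sigma> x \<in> stk C n \<sigma>"
  and d_0: "diff C n \<sigma> 0 = 0"
  and d_add: "x \<in> stk C n \<sigma> \<Longrightarrow> y \<in> stk C n \<sigma> \<Longrightarrow> diff C n \<sigma> (x + y) = diff C n \<sigma> x + diff C n \<sigma> y"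
  and d_diff: "x \<in> stk C n \<sigma> \<Longrightarrow> y \<in> stk C n \<sigma> \<Longrightarrow> diff C n \<sigma> (x - y) = diff C n \<sigma> x - diff C n \<sigma> y"
  and d_d: "x \<in> stk C n \<sigma> \<Longrightarrow> diff C (n + 1) \<sigma> (diff C n \<sigma> x) = 0"
  and d_dm: "x \<in> stk C (n - 1) \<sigma> \<Longrightarrow> diff C n \<sigma> (diff C (n - 1) \<sigma> x) = 0"
  using lm_in[OF d_lm] lm_in[OF d_lm, of x "n - 1"] lm_0[OF d_lm c_subsp] lm_add[OF d_lm] lm_diff[OF d_lm c_subsp]
    cpx_dd[OF C s] cpx_dd[OF C s, of x "n - 1"] by simp_all

end

lemma hom0: "sheaf_hom P F G \<phi> \<Longrightarrow> is_sheaf P F \<Longrightarrow> \<sigma> \<in> P \<Longrightarrow> \<phi> \<sigma> 0 = 0"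
  and hom_add: "sheaf_hom P F G \<phi> \<Longrightarrow> \<sigma> \<in> P \<Longrightarrow> x \<in> stalk F \<sigma> \<Longrightarrow> y \<in> stalk F \<sigma> \<Longrightarrow> \<phi> \<sigma> (x + y) = \<phi> \<sigma> x + \<phi> \<sigma> y"
  and hom_diff: "sheaf_hom P F G \<phi> \<Longrightarrow> is_sheaf P F \<Longrightarrow> \<sigma> \<in> P \<Longrightarrow> x \<in> stalk F \<sigma> \<Longrightarrow> y \<in> stalk F \<sigma> \<Longrightarrow>
    \<phi> \<sigma> (x - y) = \<phi> \<sigma> x - \<phi> \<sigma> y"
  by (blast intro: lm_0[OF hom_lm sheaf_subsp] lm_add[OF hom_lm] lm_diff[OF hom_lm sheaf_subsp])+

context
  fixes P :: "'a::order set" and \<sigma> :: 'a and C :: "('a, 'i, 'k::field) cpx" and D :: "('a, 'j, 'k) cpx" and \<phi>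
  assumes C: "bounded_complex P C" and f: "chain_map P C D \<phi>" and s: "\<sigma> \<in> P"
begin

lemma f_in: "x \<in> stk C n \<sigma> \<Longrightarrow> \<phi> n \<sigma> x \<in> stk D n \<sigma>"
  and f_0: "\<phi> n \<sigma> 0 = 0"
  and f_add: "x \<in> stk C n \<sigma> \<Longrightarrow> y \<in> stk C n \<sigma> \<Longrightarrow> \<phi> n \<sigma> (x + y) = \<phi> n \<sigma> x + \<phi> n \<sigma> y"
  and f_diff: "x \<in> stk C n \<sigma> \<Longrightarrow> y \<in> stk C n \<sigma> \<Longrightarrow> \<phi> n \<sigma> (x - y) = \<phi> n \<sigma> x - \<phi> n \<sigma> y"
  and f_comm: "x \<in> stk C n \<sigma> \<Longrightarrow> \<phi> (n + 1) \<sigma> (diff C n \<sigma> x) = diff D n \<sigma> (\<phi> n \<sigma> x)"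
  and f_commm: "x \<in> stk C (n - 1) \<sigma> \<Longrightarrow> \<phi> n \<sigma> (diff C (n - 1) \<sigma> x) = diff D (n - 1) \<sigma> (\<phi> (n - 1) \<sigma> x)"
  using hom_in[OF map_hom[OF f] s] hom0[OF map_hom[OF f] cpx_sheaf[OF C] s]
    hom_add[OF map_hom[OF f] s] hom_diff[OF map_hom[OF f] cpx_sheaf[OF C] s]
    map_comm[OF f s] map_comm[OF f s, of x "n - 1"] by simp_all

lemma f_cocycle: "x \<in> stk C n \<sigma> \<Longrightarrow> diff C n \<sigma> x = 0 \<Longrightarrow> diff D n \<sigma> (\<phi> n \<sigma> x) = 0"
  by (simp only: f_comm[symmetric] f_0)

end

lemma quasi_isoI:
  assumes "chain_map P C D \<phi>"
    and "\<And>n \<sigma> z u. \<sigma> \<in> P \<Longrightarrow> z \<in> stk C n \<sigma> \<Longrightarrow> diff C n \<sigma> z = 0 \<Longrightarrow> u \<in> stk D (n - 1) \<sigma> \<Longrightarrow>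
      \<phi> n \<sigma> z = diff D (n - 1) \<sigma> u \<Longrightarrow> \<exists>y\<in>stk C (n - 1) \<sigma>. z = diff C (n - 1) \<sigma> y"
    and "\<And>n \<sigma> w. \<sigma> \<in> P \<Longrightarrow> w \<in> stk D n \<sigma> \<Longrightarrow> diff D n \<sigma> w = 0 \<Longrightarrow>
      \<exists>z\<in>stk C n \<sigma>. diff C n \<sigma> z = 0 \<and> (\<exists>u\<in>stk D (n - 1) \<sigma>. w = \<phi> n \<sigma> z + diff D (n - 1) \<sigma> u)"
  shows "quasi_iso P C D \<phi>"
proof -
  have "\<exists>z\<in>cocycles C n \<sigma>. w - \<phi> n \<sigma> z \<in> coboundaries D n \<sigma>" if "\<sigma> \<in> P" "w \<in> cocycles D n \<sigma>" for n \<sigma> w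
    using assms(3)[of \<sigma> w n] that by (force simp: cocycles_def coboundaries_def)
  moreover have "z \<in> coboundaries C n \<sigma>"
    if "\<sigma> \<in> P" "z \<in> cocycles C n \<sigma>" "\<phi> n \<sigma> z \<in> coboundaries D n \<sigma>" for n \<sigma> z
    using assms(2)[of \<sigma> z n] that by (force simp: cocycles_def coboundaries_def)
  ultimately show ?thesis using assms(1) by (simp add: quasi_iso_def)
qed

lemma qi_inj:
  assumes "quasi_iso P C D \<phi>" "\<sigma> \<in> P" "z \<in> stk C n \<sigma>" "diff C n \<sigma> z = 0" "u \<in> stk D (n - 1) \<sigma>"
    "\<phi> n \<sigma> z = diff D (n - 1) \<sigma> u"
  shows "\<exists>y. y \<in> stk C (n - 1) \<sigma> \<and> z = diff C (n - 1) \<sigma> y"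
proof -
  have "z \<in> cocycles C n \<sigma>" "\<phi> n \<sigma> z \<in> coboundaries D n \<sigma>"
    using assms by (auto simp: cocycles_def coboundaries_def)
  then have "z \<in> coboundaries C n \<sigma>" using assms(1,2) by (simp add: quasi_iso_def)
  then show ?thesis by (auto simp: coboundaries_def)
qed

lemma qi_surj:
  assumes "quasi_iso P C D \<phi>" "\<sigma> \<in> P" "w \<in> stk D n \<sigma>" "diff D n \<sigma> w = 0"
  shows "\<exists>z u. z \<in> stk C n \<sigma> \<and> diff C n \<sigma> z = 0 \<and> u \<in> stk D (n - 1) \<sigma> \<and> w = \<phi> n \<sigma> z + diff D (n - 1) \<sigma> u"
proof -
  have "w \<in> cocycles D n \<sigma>" using assms by (auto simp: cocycles_def)
  then obtain z where z: "z \<in> cocycles C n \<sigma>" "w - \<phi> n \<sigma> z \<in> coboundaries D n \<sigma>"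
    using assms(1,2) unfolding quasi_iso_def by blast
  then obtain u where u: "u \<in> stk D (n - 1) \<sigma>" "w - \<phi> n \<sigma> z = diff D (n - 1) \<sigma> u"
    by (auto simp: coboundaries_def)
  from u(2) have "w = \<phi> n \<sigma> z + diff D (n - 1) \<sigma> u" by (simp add: algebra_simps)
  moreover have "z \<in> stk C n \<sigma>" "diff C n \<sigma> z = 0" using z(1) by (auto simp: cocycles_def)
  ultimately show ?thesis using u(1) by blast
qed

lemma chain_map_id: "chain_map P C C (\<lambda>_ _ v. v)"
  by (simp add: chain_map_def hom_id)

lemma chain_map_comp:
  assumes "chain_map P C D \<phi>" "chain_map P D E \<psi>"
  shows "chain_map P C E (\<lambda>n \<sigma> v. \<psi> n \<sigma> (\<phi> n \<sigma> v))"
  unfolding chain_map_def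
  by (auto simp: map_comm[OF assms(1)] map_comm[OF assms(2)] hom_in[OF map_hom[OF assms(1)]]
      intro: hom_comp[OF map_hom[OF assms(1)] map_hom[OF assms(2)]])

lemma quasi_iso_id: "bounded_complex P C \<Longrightarrow> quasi_iso P C C (\<lambda>_ _ v. v)"
proof (rule quasi_isoI[OF chain_map_id])
  fix n \<sigma> w assume C: "bounded_complex P C" and w: "\<sigma> \<in> P" "w \<in> stk C n \<sigma>" "diff C n \<sigma> w = 0"
  then have "w = w + diff C (n - 1) \<sigma> 0" "0 \<in> stk C (n - 1) \<sigma>" using c_0[OF C w(1)] d_0[OF C w(1)] by simp_all
  then show "\<exists>z\<in>stk C n \<sigma>. diff C n \<sigma> z = 0 \<and> (\<exists>u\<in>stk C (n - 1) \<sigma>. w = z + diff C (n - 1) \<sigma> u)"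
    using w by blast
qed blast

lemma quasi_iso_comp:
  assumes "bounded_complex P C" "bounded_complex P D" "bounded_complex P E"
    and f: "quasi_iso P C D \<phi>" and g: "quasi_iso P D E \<psi>"
  shows "quasi_iso P C E (\<lambda>n \<sigma> v. \<psi> n \<sigma> (\<phi> n \<sigma> v))"
proof (rule quasi_isoI[OF chain_map_comp[OF qi_map[OF f] qi_map[OF g]]])
  note mf = qi_map[OF f] and mg = qi_map[OF g]
  fix n \<sigma> z u assume h: "\<sigma> \<in> P" "z \<in> stk C n \<sigma>" "diff C n \<sigma> z = 0" "u \<in> stk E (n - 1) \<sigma>"
    "\<psi> n \<sigma> (\<phi> n \<sigma> z) = diff E (n - 1) \<sigma> u"
  have 0: "diff D n \<sigma> (\<phi> n \<sigma> z) = 0"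
    by (rule f_cocycle[OF assms(1) mf h(1,2,3)])
  obtain y where y: "y \<in> stk D (n - 1) \<sigma>" "\<phi> n \<sigma> z = diff D (n - 1) \<sigma> y"
    using qi_inj[OF g h(1), OF f_in[OF assms(1) mf h(1,2)] 0 h(4,5)] by blast
  obtain x where "x \<in> stk C (n - 1) \<sigma>" "z = diff C (n - 1) \<sigma> x"
    using qi_inj[OF f h(1), OF h(2,3) y] by blast
  then show "\<exists>y\<in>stk C (n - 1) \<sigma>. z = diff C (n - 1) \<sigma> y" by blast
next
  note mf = qi_map[OF f] and mg = qi_map[OF g]
  fix n \<sigma> w assume h: "\<sigma> \<in> P" "w \<in> stk E n \<sigma>" "diff E n \<sigma> w = 0"
  obtain y u where y: "y \<in> stk D n \<sigma>" "diff D n \<sigma> y = 0" "u \<in> stk E (n - 1) \<sigma>" "w = \<psi> n \<sigma> y + diff E (n - 1) \<sigma> u"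
    using qi_surj[OF g h] by blast
  obtain z v where z: "z \<in> stk C n \<sigma>" "diff C n \<sigma> z = 0" "v \<in> stk D (n - 1) \<sigma>" "y = \<phi> n \<sigma> z + diff D (n - 1) \<sigma> v"
    using qi_surj[OF f h(1) y(1,2)] by blast
  have "\<psi> n \<sigma> y = \<psi> n \<sigma> (\<phi> n \<sigma> z) + diff E (n - 1) \<sigma> (\<psi> (n - 1) \<sigma> v)"
    unfolding z(4) f_add[OF assms(2) mg h(1) f_in[OF assms(1) mf h(1) z(1)] d_inm[OF assms(2) h(1) z(3)]]
      f_commm[OF assms(2) mg h(1) z(3)] ..
  then have "w = \<psi> n \<sigma> (\<phi> n \<sigma> z) + diff E (n - 1) \<sigma> (\<psi> (n - 1) \<sigma> v + u)"
    unfolding d_add[OF assms(3) h(1) f_in[OF assms(2) mg h(1) z(3)] y(3)] y(4) by simp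
  then show "\<exists>z\<in>stk C n \<sigma>. diff C n \<sigma> z = 0 \<and> (\<exists>u\<in>stk E (n - 1) \<sigma>. w = \<psi> n \<sigma> (\<phi> n \<sigma> z) + diff E (n - 1) \<sigma> u)"
    using z c_add[OF assms(3) h(1) f_in[OF assms(2) mg h(1) z(3)] y(3)] by blast
qed

text \<open>Two out of three: on cohomology \<open>\<alpha>\<close> after \<open>\<phi>\<close>
  equals \<open>a\<close>, and \<open>\<phi>\<close> and \<open>a\<close> are isomorphisms
  there.\<close>

lemma quasi_iso_of_homotopy:
  assumes C: "bounded_complex P C" and D: "bounded_complex P D" and J: "bounded_complex P J"
    and f: "quasi_iso P C D \<phi>" and a: "quasi_iso P C J a" and m: "chain_map P D J \<alpha>"
    and h: "hty P C J (\<lambda>n \<sigma> v. \<alpha> n \<sigma> (\<phi> n \<sigma> v)) a h"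
  shows "quasi_iso P D J \<alpha>"
proof (rule quasi_isoI[OF m])
  note mf = qi_map[OF f] and ma = qi_map[OF a]
  fix n \<sigma> z u assume z: "\<sigma> \<in> P" "z \<in> stk D n \<sigma>" "diff D n \<sigma> z = 0" "u \<in> stk J (n - 1) \<sigma>"
    "\<alpha> n \<sigma> z = diff J (n - 1) \<sigma> u"
  note s = z(1)
  obtain y w where y: "y \<in> stk C n \<sigma>" "diff C n \<sigma> y = 0" "w \<in> stk D (n - 1) \<sigma>" "z = \<phi> n \<sigma> y + diff D (n - 1) \<sigma> w"
    using qi_surj[OF f z(1-3)] by blast
  note hin = hom_in[OF hty_hom[OF h] s y(1)]
  have 1: "\<alpha> n \<sigma> (\<phi> n \<sigma> y) = a n \<sigma> y + diff J (n - 1) \<sigma> (h n \<sigma> y)"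
    using hty_eq[OF h s y(1)] y(2) hom0[OF hty_hom[OF h] cpx_sheaf[OF C] s] by simp
  have 2: "\<alpha> n \<sigma> z = \<alpha> n \<sigma> (\<phi> n \<sigma> y) + diff J (n - 1) \<sigma> (\<alpha> (n - 1) \<sigma> w)"
    unfolding y(4) f_add[OF D m s f_in[OF C mf s y(1)] d_inm[OF D s y(3)]] f_commm[OF D m s y(3)] ..
  have "diff J (n - 1) \<sigma> (u - \<alpha> (n - 1) \<sigma> w - h n \<sigma> y)
      = diff J (n - 1) \<sigma> u - diff J (n - 1) \<sigma> (\<alpha> (n - 1) \<sigma> w) - diff J (n - 1) \<sigma> (h n \<sigma> y)"
    using z(4) f_in[OF D m s y(3)] hin by (simp add: d_diff[OF J s] c_diff[OF J s])
  then have 3: "a n \<sigma> y = diff J (n - 1) \<sigma> (u - \<alpha> (n - 1) \<sigma> w - h n \<sigma> y)"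
    using 1 2 z(5) by simp
  obtain y' where y': "y' \<in> stk C (n - 1) \<sigma>" "y = diff C (n - 1) \<sigma> y'"
    using qi_inj[OF a s, OF y(1,2) c_diff[OF J s c_diff[OF J s z(4) f_in[OF D m s y(3)]] hin] 3] by blast
  have "z = diff D (n - 1) \<sigma> (\<phi> (n - 1) \<sigma> y' + w)"
    unfolding y(4) y'(2) d_add[OF D s f_in[OF C mf s y'(1)] y(3)] f_commm[OF C mf s y'(1)] ..
  then show "\<exists>y\<in>stk D (n - 1) \<sigma>. z = diff D (n - 1) \<sigma> y"
    using c_add[OF D s f_in[OF C mf s y'(1)] y(3)] by blast
next
  note mf = qi_map[OF f] and ma = qi_map[OF a]
  fix n \<sigma> w assume w: "\<sigma> \<in> P" "w \<in> stk J n \<sigma>" "diff J n \<sigma> w = 0"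
  note s = w(1)
  obtain y u where y: "y \<in> stk C n \<sigma>" "diff C n \<sigma> y = 0" "u \<in> stk J (n - 1) \<sigma>" "w = a n \<sigma> y + diff J (n - 1) \<sigma> u"
    using qi_surj[OF a w] by blast
  note hin = hom_in[OF hty_hom[OF h] s y(1)]
  have 1: "\<alpha> n \<sigma> (\<phi> n \<sigma> y) = a n \<sigma> y + diff J (n - 1) \<sigma> (h n \<sigma> y)"
    using hty_eq[OF h s y(1)] y(2) hom0[OF hty_hom[OF h] cpx_sheaf[OF C] s] by simp
  have "w = \<alpha> n \<sigma> (\<phi> n \<sigma> y) + diff J (n - 1) \<sigma> (u - h n \<sigma> y)"
    using 1 y hin by (simp add: d_diff[OF J s])
  moreover have "diff D n \<sigma> (\<phi> n \<sigma> y) = 0" by (rule f_cocycle[OF C mf s y(1,2)])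
  ultimately show "\<exists>z\<in>stk D n \<sigma>. diff D n \<sigma> z = 0 \<and> (\<exists>u\<in>stk J (n - 1) \<sigma>. w = \<alpha> n \<sigma> z + diff J (n - 1) \<sigma> u)"
    using c_diff[OF J s y(3) hin] f_in[OF C mf s y(1)] by blast
qed

section \<open>Mapping cocones and extension along quasi-isomorphisms\<close>

definition cocone :: "('a, 'i, 'k::field) cpx \<Rightarrow> ('a, 'j, 'k) cpx \<Rightarrow> (int \<Rightarrow> 'a \<Rightarrow> ('i \<Rightarrow> 'k) \<Rightarrow> 'j \<Rightarrow> 'k) \<Rightarrow> ('a, 'i + 'j, 'k) cpx" where
  "cocone C D \<phi> = \<lparr> obj = (\<lambda>n. dsum_sheaf (obj C n) (obj D (n - 1))),
     diff = (\<lambda>n \<sigma> v. case_sum (diff C n \<sigma> (v \<circ> Inl)) (\<phi> n \<sigma> (v \<circ> Inl) - diff D (n - 1) \<sigma> (v \<circ> Inr))) \<rparr>"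

lemma cocone_obj: "obj (cocone C D \<phi>) n = dsum_sheaf (obj C n) (obj D (n - 1))"
  and cocone_stk: "stk (cocone C D \<phi>) n \<sigma> = dsum (stk C n \<sigma>) (stk D (n - 1) \<sigma>)"
  and cocone_diff: "diff (cocone C D \<phi>) n \<sigma> (case_sum a b) = case_sum (diff C n \<sigma> a) (\<phi> n \<sigma> a - diff D (n - 1) \<sigma> b)"
  by (simp_all add: cocone_def dsum_sheaf_def)

text \<open>The cocone is the mapping cone shifted by one, with \<open>D\<close> placed one degree
  late. The minus sign before its differential cancels the two occurrences of \<phi> d a in the
  square of the differential.\<close>

lemma cocone_complex:
  assumes C: "bounded_complex P C" and D: "bounded_complex P D" and f: "chain_map P C D \<phi>"
  shows "bounded_complex P (cocone C D \<phi>)"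
proof -
  have "sheaf_hom P (obj (cocone C D \<phi>) n) (obj (cocone C D \<phi>) (n + 1)) (diff (cocone C D \<phi>) n)" for n
  proof -
    have "sheaf_hom P (dsum_sheaf (obj C n) (obj D (n - 1))) (obj D n) (\<lambda>\<sigma> v. diff D (n - 1) \<sigma> (v \<circ> Inr))"
      using hom_comp[OF hom_Inr cpx_diff[OF D, of "n - 1"]] by simp
    then show ?thesis
      using dsum_hom[OF hom_comp[OF hom_Inl cpx_diff[OF C]] hom_minus[OF cpx_sheaf[OF D] hom_comp[OF hom_Inl map_hom[OF f]]]]
      by (simp add: cocone_def)
  qed
  moreover have "\<exists>N. \<forall>n. \<bar>n\<bar> > N \<longrightarrow> zero_sheaf P (obj (cocone C D \<phi>) n)"
  proof -
    obtain N M where N: "\<And>n. \<bar>n\<bar> > N \<Longrightarrow> zero_sheaf P (obj C n)" and M: "\<And>n. \<bar>n\<bar> > M \<Longrightarrow> zero_sheaf P (obj D n)"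
      using cpx_bounded[OF C] cpx_bounded[OF D] by blast
    have "zero_sheaf P (obj (cocone C D \<phi>) n)" if "\<bar>n\<bar> > \<bar>N\<bar> + \<bar>M\<bar> + 1" for n
    proof -
      have "zero_sheaf P (obj C n)" "zero_sheaf P (obj D (n - 1))" using that by (auto intro!: N M)
      then have "stk (cocone C D \<phi>) n \<sigma> = {0}" if "\<sigma> \<in> P" for \<sigma>
        using that by (auto simp: zero_sheaf_def cocone_stk dsum_def intro: dsum_eqI)
      then show ?thesis by (simp add: zero_sheaf_def)
    qed
    then show ?thesis by blast
  qed
  moreover have "diff (cocone C D \<phi>) (n + 1) \<sigma> (diff (cocone C D \<phi>) n \<sigma> v) = 0"
    if s: "\<sigma> \<in> P" and v: "v \<in> stk (cocone C D \<phi>) n \<sigma>" for n \<sigma> v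
  proof -
    obtain a b where "v = case_sum a b" "a \<in> stk C n \<sigma>" "b \<in> stk D (n - 1) \<sigma>"
      using v unfolding cocone_stk by (rule dsumE)
    then show ?thesis
      by (simp add: cocone_diff d_d[OF C s] f_comm[OF C f s] d_diff[OF D s] f_in[OF C f s] d_inm[OF D s] d_dm[OF D s])
  qed
  moreover have "is_sheaf P (obj (cocone C D \<phi>) n)" for n
    unfolding cocone_obj using cpx_sheaf[OF C] cpx_sheaf[OF D] by (rule dsum_sheaf)
  ultimately show ?thesis unfolding bounded_complex_def by blast
qed

definition acyclic_cpx :: "'a set \<Rightarrow> ('a, 'i, 'k::field) cpx \<Rightarrow> bool" where
  "acyclic_cpx P C \<longleftrightarrow> (\<forall>n. \<forall>\<sigma>\<in>P. \<forall>v\<in>stk C n \<sigma>. diff C n \<sigma> v = 0 \<longrightarrow> (\<exists>u\<in>stk C (n - 1) \<sigma>. v = diff C (n - 1) \<sigma> u))"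

text \<open>A cocycle (c, e) satisfies d c = 0 and \<phi> c = d e, so injectivity on cohomology
  gives c = d c'. The difference \<phi> c' - e is again a cocycle, and surjectivity absorbs it by
  changing c' by a cocycle and adding a coboundary.\<close>

lemma cocone_acyclic:
  assumes C: "bounded_complex P C" and D: "bounded_complex P D" and q: "quasi_iso P C D \<phi>"
  shows "acyclic_cpx P (cocone C D \<phi>)"
  unfolding acyclic_cpx_def
proof (intro allI ballI impI)
  note f = qi_map[OF q]
  fix n \<sigma> v assume s: "\<sigma> \<in> P" and v: "v \<in> stk (cocone C D \<phi>) n \<sigma>" "diff (cocone C D \<phi>) n \<sigma> v = 0"
  obtain c e where ce: "v = case_sum c e" "c \<in> stk C n \<sigma>" "e \<in> stk D (n - 1) \<sigma>"
    using v(1) unfolding cocone_stk by (rule dsumE)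
  have 0: "diff C n \<sigma> c = 0" "\<phi> n \<sigma> c = diff D (n - 1) \<sigma> e" using v(2) by (auto simp: ce(1) cocone_diff)
  obtain c' where c': "c' \<in> stk C (n - 1) \<sigma>" "c = diff C (n - 1) \<sigma> c'"
    using qi_inj[OF q s, OF ce(2) 0(1) ce(3) 0(2)] by blast
  have w: "\<phi> (n - 1) \<sigma> c' - e \<in> stk D (n - 1) \<sigma>" "diff D (n - 1) \<sigma> (\<phi> (n - 1) \<sigma> c' - e) = 0"
    using c' ce 0 by (auto simp: c_diff[OF D s] f_in[OF C f s] d_diff[OF D s] f_commm[OF C f s, symmetric])
  obtain z u where z: "z \<in> stk C (n - 1) \<sigma>" "diff C (n - 1) \<sigma> z = 0" "u \<in> stk D (n - 1 - 1) \<sigma>"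
      "\<phi> (n - 1) \<sigma> c' - e = \<phi> (n - 1) \<sigma> z + diff D (n - 1 - 1) \<sigma> u"
    using qi_surj[OF q s w] by blast
  have "e = \<phi> (n - 1) \<sigma> (c' - z) - diff D (n - 1 - 1) \<sigma> u"
    using z c' by (simp add: f_diff[OF C f s] algebra_simps)
  then have "v = diff (cocone C D \<phi>) (n - 1) \<sigma> (case_sum (c' - z) u)"
    using ce c' z by (simp add: cocone_diff d_diff[OF C s])
  moreover have "case_sum (c' - z) u \<in> stk (cocone C D \<phi>) (n - 1) \<sigma>"
    using c' z by (simp add: cocone_stk c_diff[OF C s])
  ultimately show "\<exists>u\<in>stk (cocone C D \<phi>) (n - 1) \<sigma>. v = diff (cocone C D \<phi>) (n - 1) \<sigma> u" by blast
qed

lemma acyclic_nullhomotopic: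
  assumes C: "bounded_complex P C" and ac: "acyclic_cpx P C" and J: "bounded_complex P J" and a: "chain_map P C J a"
    and inj: "\<And>n. ginj P (obj J n)"
  shows "\<exists>h. hty P C J a (\<lambda>_ _ _. 0) h"
proof -
  obtain N where N: "\<And>n. \<bar>n\<bar> > N \<Longrightarrow> zero_sheaf P (obj C n)" using cpx_bounded[OF C] by blast
  \<comment> \<open>All stalks of \<open>C\<close> vanish in degrees up to \<open>n0\<close>, so the
    homotopy may start there with zero.\<close>
  define n0 where "n0 = - \<bar>N\<bar> - 1"
  \<comment> \<open>The invariant: \<open>g\<close> is the homotopy in degree n0 + k and is already
    correct on cocycles, where the next component does not contribute. Then a - d g vanishes on the
    kernel of the differential, hence factors through it, and the factor is the next component
    related by \<open>S\<close>.\<close>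
  define R where "R k g \<longleftrightarrow> sheaf_hom P (obj C (n0 + int k)) (obj J (n0 + int k - 1)) g \<and>
      (\<forall>\<sigma>\<in>P. \<forall>v\<in>stk C (n0 + int k) \<sigma>. diff C (n0 + int k) \<sigma> v = 0 \<longrightarrow>
        a (n0 + int k) \<sigma> v = diff J (n0 + int k - 1) \<sigma> (g \<sigma> v))" for k g
  define S where "S k g g' \<longleftrightarrow> (\<forall>\<sigma>\<in>P. \<forall>v\<in>stk C (n0 + int k) \<sigma>.
        a (n0 + int k) \<sigma> v = diff J (n0 + int k - 1) \<sigma> (g \<sigma> v) + g' \<sigma> (diff C (n0 + int k) \<sigma> v))" for k g g'
  have zC: "stk C n \<sigma> = {0}" if "n \<le> n0" "\<sigma> \<in> P" for n \<sigma>
    using N[of n] that by (auto simp: n0_def zero_sheaf_def)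
  have "R 0 (\<lambda>_ _. 0)"
    using zC f_0[OF C a] d_0[OF J] by (simp add: R_def hom_zero cpx_sheaf[OF C] cpx_sheaf[OF J])
  moreover have "\<exists>g'. R (Suc k) g' \<and> S k g g'" if R: "R k g" for k g
  proof -
    define n where "n = n0 + int k"
    have n1: "n0 + int (Suc k) = n + 1" by (simp add: n_def)
    have g: "sheaf_hom P (obj C n) (obj J (n - 1)) g"
      and gk: "\<And>\<sigma> v. \<sigma> \<in> P \<Longrightarrow> v \<in> stk C n \<sigma> \<Longrightarrow> diff C n \<sigma> v = 0 \<Longrightarrow> a n \<sigma> v = diff J (n - 1) \<sigma> (g \<sigma> v)"
      using R by (auto simp: R_def n_def)
    let ?f = "\<lambda>\<sigma> v. a n \<sigma> v - diff J (n - 1) \<sigma> (g \<sigma> v)"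
    have "sheaf_hom P (obj C n) (obj J n) (\<lambda>\<sigma> v. diff J (n - 1) \<sigma> (g \<sigma> v))"
      using hom_comp[OF g cpx_diff[OF J, of "n - 1"]] by simp
    then have f: "sheaf_hom P (obj C n) (obj J n) ?f"
      by (rule hom_minus[OF cpx_sheaf[OF J] map_hom[OF a]])
    have k: "?f \<sigma> v = 0" if "\<sigma> \<in> P" "v \<in> stk C n \<sigma>" "diff C n \<sigma> v = 0" for \<sigma> v
      using gk[OF that] by simp
    obtain g' where g': "sheaf_hom P (obj C (n + 1)) (obj J n) g'"
      "\<And>\<sigma> v. \<sigma> \<in> P \<Longrightarrow> v \<in> stk C n \<sigma> \<Longrightarrow> g' \<sigma> (diff C n \<sigma> v) = ?f \<sigma> v"
      using ginj_extend[OF cpx_sheaf[OF C] cpx_sheaf[OF C] inj cpx_diff[OF C] f k] by blast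
    have eq: "a n \<sigma> v = diff J (n - 1) \<sigma> (g \<sigma> v) + g' \<sigma> (diff C n \<sigma> v)" if "\<sigma> \<in> P" "v \<in> stk C n \<sigma>" for \<sigma> v
      using g'(2)[OF that] by simp
    have "a (n + 1) \<sigma> v = diff J n \<sigma> (g' \<sigma> v)"
      if s: "\<sigma> \<in> P" and v: "v \<in> stk C (n + 1) \<sigma>" "diff C (n + 1) \<sigma> v = 0" for \<sigma> v
    proof -
      obtain u where u: "u \<in> stk C n \<sigma>" "v = diff C n \<sigma> u"
        using ac s v unfolding acyclic_cpx_def by (metis add_diff_cancel_right')
      have "a (n + 1) \<sigma> v = diff J n \<sigma> (a n \<sigma> u)" using u f_comm[OF C a s] by simp
      also have "\<dots> = diff J n \<sigma> (g' \<sigma> v)"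
        using eq[OF s u(1)] u hom_in[OF g s u(1)] hom_in[OF g'(1) s v(1)]
        by (simp add: d_add[OF J s] d_inm[OF J s] d_dm[OF J s])
      finally show ?thesis .
    qed
    then have "R (Suc k) g'" using g'(1) unfolding R_def n1 add_diff_cancel_right' by blast
    moreover have "S k g g'" using eq by (simp add: S_def n_def)
    ultimately show ?thesis by blast
  qed
  ultimately obtain H where H: "\<forall>k. R k (H k)" "\<forall>k. S k (H k) (H (Suc k))"
    using dependent_nat_choice[of R S] by blast
  define h where "h n = (if n < n0 then (\<lambda>_ _. 0) else H (nat (n - n0)))" for n
  have "sheaf_hom P (obj C n) (obj J (n - 1)) (h n)" for n
  proof (cases "n < n0")
    case True
    then show ?thesis by (simp add: h_def hom_zero cpx_sheaf[OF C] cpx_sheaf[OF J])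
  next
    case False
    then have "n0 + int (nat (n - n0)) = n" by simp
    then show ?thesis using H(1)[rule_format, of "nat (n - n0)"] False by (simp add: R_def h_def)
  qed
  moreover have "a n \<sigma> v = 0 + diff J (n - 1) \<sigma> (h n \<sigma> v) + h (n + 1) \<sigma> (diff C n \<sigma> v)"
    if s: "\<sigma> \<in> P" and v: "v \<in> stk C n \<sigma>" for n \<sigma> v
  proof (cases "n < n0")
    case True
    then have "v = 0" using zC[of n \<sigma>] s v by auto
    then have "a n \<sigma> v = 0" "diff C n \<sigma> v = 0" "h n \<sigma> v = 0"
      using f_0[OF C a s] d_0[OF C s] hom0[OF calculation cpx_sheaf[OF C] s] by auto
    then show ?thesis using d_0[OF J s] hom0[OF calculation cpx_sheaf[OF C] s] by simp
  next
    case False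
    then have "n0 + int (nat (n - n0)) = n" "nat (n + 1 - n0) = Suc (nat (n - n0))" by auto
    then show ?thesis using H(2)[rule_format, of "nat (n - n0)"] False s v by (simp add: S_def h_def)
  qed
  ultimately show ?thesis unfolding hty_def by blast
qed

text \<open>A null homotopy of \<open>cocone \<phi> \<rightarrow> C \<rightarrow> J\<close> consists of an extension of \<open>a\<close> along \<open>\<phi>\<close> and a homotopy.\<close>

lemma extend_along_quasi_iso:
  assumes C: "bounded_complex P C" and D: "bounded_complex P D" and q: "quasi_iso P C D \<phi>"
    and J: "bounded_complex P J" and inj: "\<And>n. ginj P (obj J n)" and a: "chain_map P C J a"
  shows "\<exists>\<alpha> h. chain_map P D J \<alpha> \<and> hty P C J (\<lambda>n \<sigma> v. \<alpha> n \<sigma> (\<phi> n \<sigma> v)) a h"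
proof -
  note f = qi_map[OF q]
  let ?K = "cocone C D \<phi>"
  have K: "bounded_complex P ?K" using cocone_complex[OF C D f] .
  have "chain_map P ?K C (\<lambda>_ _ v. v \<circ> Inl)"
    by (simp add: chain_map_def cocone_obj hom_Inl) (simp add: cocone_def)
  then have "chain_map P ?K J (\<lambda>n \<sigma> v. a n \<sigma> (v \<circ> Inl))" using chain_map_comp a by blast
  then obtain H where H: "hty P ?K J (\<lambda>n \<sigma> v. a n \<sigma> (v \<circ> Inl)) (\<lambda>_ _ _. 0) H"
    using acyclic_nullhomotopic[OF K cocone_acyclic[OF C D q] J _ inj] by blast
  \<comment> \<open>Degree n of \<open>D\<close> is the second summand of the cocone in degree n +
    1, hence the shift. The sign of \<open>h\<close> comes from solving the null homotopy equation
    at (c, 0) for \<alpha> \<phi> c.\<close>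
  define \<alpha> where "\<alpha> n \<sigma> e = H (n + 1) \<sigma> (case_sum 0 e)" for n \<sigma> e
  define h where "h n \<sigma> c = - H n \<sigma> (case_sum c 0)" for n \<sigma> c
  have HH: "sheaf_hom P (dsum_sheaf (obj C n) (obj D (n - 1))) (obj J (n - 1)) (H n)" for n
    using hty_hom[OF H, of n] by (simp add: cocone_obj)
  have H_eq: "a n \<sigma> c = diff J (n - 1) \<sigma> (H n \<sigma> (case_sum c e)) + H (n + 1) \<sigma> (case_sum (diff C n \<sigma> c) (\<phi> n \<sigma> c - diff D (n - 1) \<sigma> e))"
    if "\<sigma> \<in> P" "c \<in> stk C n \<sigma>" "e \<in> stk D (n - 1) \<sigma>" for n \<sigma> c e
    using hty_eq[OF H that(1), of "case_sum c e" n] that by (simp add: cocone_stk cocone_diff)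
  have "sheaf_hom P (obj D n) (obj J n) (\<alpha> n)" for n
    unfolding \<alpha>_def using hom_comp[OF dsum_hom[OF hom_zero hom_id], of P "obj D n" "obj C (n + 1)"] HH[of "n + 1"]
    by (simp add: cpx_sheaf[OF C] cpx_sheaf[OF D])
  moreover have "\<alpha> (n + 1) \<sigma> (diff D n \<sigma> e) = diff J n \<sigma> (\<alpha> n \<sigma> e)" if s: "\<sigma> \<in> P" and e: "e \<in> stk D n \<sigma>" for n \<sigma> e
  proof -
    have 1: "case_sum 0 (- diff D n \<sigma> e) = 0 - case_sum 0 (diff D n \<sigma> e)"
      by (rule dsum_eqI) simp_all
    have 2: "H (n + 1 + 1) \<sigma> (0 - case_sum 0 (diff D n \<sigma> e)) = 0 - \<alpha> (n + 1) \<sigma> (diff D n \<sigma> e)"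
      unfolding \<alpha>_def using e
      by (subst hom_diff[OF HH _ s]) (simp_all add: dsum_sheaf cpx_sheaf[OF C] cpx_sheaf[OF D] hom0[OF HH _ s]
        subsp_0[OF sheaf_subsp[OF dsum_sheaf s]] , simp add: dsum_sheaf_def c_0[OF C s] d_in[OF D s, unfolded add.commute[of _ 1]])
    have "0 = diff J n \<sigma> (\<alpha> n \<sigma> e) + H (n + 1 + 1) \<sigma> (case_sum 0 (- diff D n \<sigma> e))"
      using H_eq[OF s c_0[OF C s], of e "n + 1"] e by (simp add: f_0[OF C a s] f_0[OF C f s] d_0[OF C s] \<alpha>_def)
    then show ?thesis unfolding 1 2 by simp
  qed
  ultimately have m: "chain_map P D J \<alpha>" by (simp add: chain_map_def)
  have "sheaf_hom P (obj C n) (obj J (n - 1)) (\<lambda>\<sigma> v. 0 - H n \<sigma> (case_sum v 0))" for n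
    using hom_minus[OF cpx_sheaf[OF J] hom_zero hom_comp[OF dsum_hom[OF hom_id hom_zero] HH]]
    by (simp add: cpx_sheaf[OF C] cpx_sheaf[OF D] cpx_sheaf[OF J])
  then have h: "sheaf_hom P (obj C n) (obj J (n - 1)) (h n)" for n
    unfolding h_def[abs_def] by simp
  moreover have "\<alpha> n \<sigma> (\<phi> n \<sigma> c) = a n \<sigma> c + diff J (n - 1) \<sigma> (h n \<sigma> c) + h (n + 1) \<sigma> (diff C n \<sigma> c)"
    if s: "\<sigma> \<in> P" and c: "c \<in> stk C n \<sigma>" for n \<sigma> c
  proof -
    have e: "case_sum (diff C n \<sigma> c) (\<phi> n \<sigma> c) = case_sum (diff C n \<sigma> c) 0 + case_sum 0 (\<phi> n \<sigma> c)"
      by (simp add: case_sum_linear)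
    have "H (n + 1) \<sigma> (case_sum (diff C n \<sigma> c) (\<phi> n \<sigma> c)) = H (n + 1) \<sigma> (case_sum (diff C n \<sigma> c) 0) + \<alpha> n \<sigma> (\<phi> n \<sigma> c)"
      unfolding e \<alpha>_def
      by (rule hom_add[OF HH s]) (simp_all add: dsum_sheaf_def c d_in[OF C s] f_in[OF C f s] c_0[OF C s] c_0[OF D s])
    moreover have "diff J (n - 1) \<sigma> (h n \<sigma> c) = - diff J (n - 1) \<sigma> (H n \<sigma> (case_sum c 0))"
      unfolding h_def using lm_neg[OF d_lm[OF J s], of "H n \<sigma> (case_sum c 0)" "n - 1"] hom_in[OF HH s, of "case_sum c 0" n]
      by (simp add: dsum_sheaf_def c c_0[OF D s])
    ultimately show ?thesis
      using H_eq[OF s c c_0[OF D s]] by (simp add: d_0[OF D s] h_def)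
  qed
  ultimately have "hty P C J (\<lambda>n \<sigma> v. \<alpha> n \<sigma> (\<phi> n \<sigma> v)) a h" by (simp add: hty_def)
  then show ?thesis using m by blast
qed


lemma h_facts:
  assumes C: "bounded_complex P C" and h: "hty P C D f g h" and s: "\<sigma> \<in> P"
  shows "x \<in> stk C n \<sigma> \<Longrightarrow> h n \<sigma> x \<in> stk D (n - 1) \<sigma>"
    and "h n \<sigma> 0 = 0"
    and "x \<in> stk C n \<sigma> \<Longrightarrow> y \<in> stk C n \<sigma> \<Longrightarrow> h n \<sigma> (x + y) = h n \<sigma> x + h n \<sigma> y"
    and "x \<in> stk C n \<sigma> \<Longrightarrow> y \<in> stk C n \<sigma> \<Longrightarrow> h n \<sigma> (x - y) = h n \<sigma> x - h n \<sigma> y"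
    and "x \<in> stk C (n - 1) \<sigma> \<Longrightarrow>
      f (n - 1) \<sigma> x = g (n - 1) \<sigma> x + diff D (n - 1 - 1) \<sigma> (h (n - 1) \<sigma> x) + h n \<sigma> (diff C (n - 1) \<sigma> x)"
    and "x \<in> stk C n \<sigma> \<Longrightarrow> diff C n \<sigma> x = 0 \<Longrightarrow> f n \<sigma> x = g n \<sigma> x + diff D (n - 1) \<sigma> (h n \<sigma> x)"
  using hom_in[OF hty_hom[OF h] s] hom0[OF hty_hom[OF h] cpx_sheaf[OF C] s] hom_add[OF hty_hom[OF h] s]
    hom_diff[OF hty_hom[OF h] cpx_sheaf[OF C] s] hty_eq[OF h s, of x "n - 1"] hty_eq[OF h s, of x n]
  by (simp_all add: eq_diff_eq)

text \<open>The map pairs the inclusion into \<open>B'\<close> with the homotopy; it is a chain map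
  because q i = 0 turns the homotopy equation on \<open>A\<close> into \<beta> j i = d h i + h d i.
  Conceptually this is the five lemma on two long exact sequences; the chase is done on elements,
  with \<open>h\<close> recording the failure of the square to commute strictly.\<close>

lemma cocone_resolves:
  assumes A: "bounded_complex P A" and B: "bounded_complex P B" and C: "bounded_complex P C"
    and B': "bounded_complex P B'" and C': "bounded_complex P C'"
    and i: "chain_map P A B i" and q: "chain_map P B C q"
    and i_inj: "\<And>n \<sigma> x. \<sigma> \<in> P \<Longrightarrow> x \<in> stk A n \<sigma> \<Longrightarrow> i n \<sigma> x = 0 \<Longrightarrow> x = 0"
    and qi0: "\<And>n \<sigma> x. \<sigma> \<in> P \<Longrightarrow> x \<in> stk A n \<sigma> \<Longrightarrow> q n \<sigma> (i n \<sigma> x) = 0"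
    and exact: "\<And>n \<sigma> b. \<sigma> \<in> P \<Longrightarrow> b \<in> stk B n \<sigma> \<Longrightarrow> q n \<sigma> b = 0 \<Longrightarrow> \<exists>a\<in>stk A n \<sigma>. b = i n \<sigma> a"
    and q_surj: "\<And>n \<sigma> c. \<sigma> \<in> P \<Longrightarrow> c \<in> stk C n \<sigma> \<Longrightarrow> \<exists>b\<in>stk B n \<sigma>. c = q n \<sigma> b"
    and j: "quasi_iso P B B' j" and c: "quasi_iso P C C' c" and b: "chain_map P B' C' \<beta>"
    and h: "hty P B C' (\<lambda>n \<sigma> v. \<beta> n \<sigma> (j n \<sigma> v)) (\<lambda>n \<sigma> v. c n \<sigma> (q n \<sigma> v)) h"
  shows "quasi_iso P A (cocone B' C' \<beta>) (\<lambda>n \<sigma> x. case_sum (j n \<sigma> (i n \<sigma> x)) (h n \<sigma> (i n \<sigma> x)))"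
proof -
  note jm = qi_map[OF j] and cm = qi_map[OF c]
  have hom: "sheaf_hom P (obj A n) (obj (cocone B' C' \<beta>) n) (\<lambda>\<sigma> x. case_sum (j n \<sigma> (i n \<sigma> x)) (h n \<sigma> (i n \<sigma> x)))" for n
    unfolding cocone_obj
    by (intro dsum_hom hom_comp[OF map_hom[OF i] map_hom[OF jm]] hom_comp[OF map_hom[OF i] hty_hom[OF h]])
  have hA: "\<beta> n \<sigma> (j n \<sigma> (i n \<sigma> x)) = diff C' (n - 1) \<sigma> (h n \<sigma> (i n \<sigma> x)) + h (n + 1) \<sigma> (diff B n \<sigma> (i n \<sigma> x))"
    if s: "\<sigma> \<in> P" and x: "x \<in> stk A n \<sigma>" for n \<sigma> x
    using hty_eq[OF h s f_in[OF A i s x]] qi0[OF s x] by (simp add: f_0[OF C cm s])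
  have mp: "chain_map P A (cocone B' C' \<beta>) (\<lambda>n \<sigma> x. case_sum (j n \<sigma> (i n \<sigma> x)) (h n \<sigma> (i n \<sigma> x)))"
    unfolding chain_map_def
  proof (intro conjI allI ballI hom)
    fix n \<sigma> v assume s: "\<sigma> \<in> P" and v: "v \<in> stk A n \<sigma>"
    show "case_sum (j (n + 1) \<sigma> (i (n + 1) \<sigma> (diff A n \<sigma> v))) (h (n + 1) \<sigma> (i (n + 1) \<sigma> (diff A n \<sigma> v)))
        = diff (cocone B' C' \<beta>) n \<sigma> (case_sum (j n \<sigma> (i n \<sigma> v)) (h n \<sigma> (i n \<sigma> v)))"
      unfolding cocone_diff f_comm[OF A i s v] f_comm[OF B jm s f_in[OF A i s v]] hA[OF s v] by simp
  qed
  show ?thesis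
  proof (rule quasi_isoI[OF mp])
    fix n \<sigma> x u assume s: "\<sigma> \<in> P" and x: "x \<in> stk A n \<sigma>" "diff A n \<sigma> x = 0"
      and u: "u \<in> stk (cocone B' C' \<beta>) (n - 1) \<sigma>"
      and eq: "case_sum (j n \<sigma> (i n \<sigma> x)) (h n \<sigma> (i n \<sigma> x)) = diff (cocone B' C' \<beta>) (n - 1) \<sigma> u"
    obtain b c' where bc: "u = case_sum b c'" "b \<in> stk B' (n - 1) \<sigma>" "c' \<in> stk C' (n - 1 - 1) \<sigma>"
      using u unfolding cocone_stk by (rule dsumE)
    have e1: "j n \<sigma> (i n \<sigma> x) = diff B' (n - 1) \<sigma> b"
      and e2: "h n \<sigma> (i n \<sigma> x) = \<beta> (n - 1) \<sigma> b - diff C' (n - 1 - 1) \<sigma> c'"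
      using eq unfolding bc(1) cocone_diff by (metis case_sum_comp)+
    have ix: "i n \<sigma> x \<in> stk B n \<sigma>" "diff B n \<sigma> (i n \<sigma> x) = 0"
      using f_in[OF A i s x(1)] f_cocycle[OF A i s x] by auto
    \<comment> \<open>i x is the differential of \<open>y\<close>, but \<open>y\<close> need not
      come from \<open>A\<close>: it is first moved by a cocycle \<open>z\<close> to fit
      \<open>b\<close>, then by a coboundary into the image of \<open>i\<close>.\<close>
    obtain y where y: "y \<in> stk B (n - 1) \<sigma>" "i n \<sigma> x = diff B (n - 1) \<sigma> y"
      using qi_inj[OF j s, OF ix bc(2) e1] by blast
    have jy: "j (n - 1) \<sigma> y \<in> stk B' (n - 1) \<sigma>" using f_in[OF B jm s y(1)] .
    have "diff B' (n - 1) \<sigma> (j (n - 1) \<sigma> y - b) = 0"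
      unfolding d_diff[OF B' s jy bc(2)] f_commm[OF B jm s y(1), symmetric] y(2)[symmetric] e1 by simp
    then obtain z b2 where z: "z \<in> stk B (n - 1) \<sigma>" "diff B (n - 1) \<sigma> z = 0" "b2 \<in> stk B' (n - 1 - 1) \<sigma>"
        "j (n - 1) \<sigma> y - b = j (n - 1) \<sigma> z + diff B' (n - 1 - 1) \<sigma> b2"
      using qi_surj[OF j s c_diff[OF B' s jy bc(2)]] by blast
    let ?w = "y - z"
    have w: "?w \<in> stk B (n - 1) \<sigma>" "diff B (n - 1) \<sigma> ?w = i n \<sigma> x"
      using c_diff[OF B s y(1) z(1)] d_diff[OF B s y(1) z(1)] z(2) y(2) by auto
    have qw: "q (n - 1) \<sigma> ?w \<in> stk C (n - 1) \<sigma>" using f_in[OF B q s w(1)] .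
    have dqw: "diff C (n - 1) \<sigma> (q (n - 1) \<sigma> ?w) = 0"
      unfolding f_commm[OF B q s w(1), symmetric] w(2) by (rule qi0[OF s x(1)])
    have hw: "h (n - 1) \<sigma> ?w \<in> stk C' (n - 1 - 1) \<sigma>" using h_facts(1)[OF B h s w(1)] .
    have bb: "\<beta> (n - 1 - 1) \<sigma> b2 \<in> stk C' (n - 1 - 1) \<sigma>" using f_in[OF B' b s z(3)] .
    have "j (n - 1) \<sigma> ?w = b + diff B' (n - 1 - 1) \<sigma> b2"
      unfolding f_diff[OF B jm s y(1) z(1)] using z(4) by (simp add: algebra_simps)
    then have 1: "\<beta> (n - 1) \<sigma> (j (n - 1) \<sigma> ?w) = \<beta> (n - 1) \<sigma> b + diff C' (n - 1 - 1) \<sigma> (\<beta> (n - 1 - 1) \<sigma> b2)"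
      using f_add[OF B' b s bc(2) d_inm[OF B' s z(3)]] f_commm[OF B' b s z(3)] by simp
    have 2: "\<beta> (n - 1) \<sigma> (j (n - 1) \<sigma> ?w) = c (n - 1) \<sigma> (q (n - 1) \<sigma> ?w)
        + diff C' (n - 1 - 1) \<sigma> (h (n - 1) \<sigma> ?w) + h n \<sigma> (i n \<sigma> x)"
      using h_facts(5)[OF B h s w(1)] unfolding w(2) .
    have 3: "diff C' (n - 1 - 1) \<sigma> (\<beta> (n - 1 - 1) \<sigma> b2 - h (n - 1) \<sigma> ?w + c') =
       diff C' (n - 1 - 1) \<sigma> (\<beta> (n - 1 - 1) \<sigma> b2) - diff C' (n - 1 - 1) \<sigma> (h (n - 1) \<sigma> ?w) + diff C' (n - 1 - 1) \<sigma> c'"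
      using d_add[OF C' s c_diff[OF C' s bb hw] bc(3)] d_diff[OF C' s bb hw] by simp
    have "c (n - 1) \<sigma> (q (n - 1) \<sigma> ?w) = \<beta> (n - 1) \<sigma> (j (n - 1) \<sigma> ?w)
        - diff C' (n - 1 - 1) \<sigma> (h (n - 1) \<sigma> ?w) - h n \<sigma> (i n \<sigma> x)"
      unfolding 2 by simp
    then have "c (n - 1) \<sigma> (q (n - 1) \<sigma> ?w) = diff C' (n - 1 - 1) \<sigma> (\<beta> (n - 1 - 1) \<sigma> b2 - h (n - 1) \<sigma> ?w + c')"
      unfolding 1 e2 3 by simp
    \<comment> \<open>The image of the cocycle q w in \<open>C'\<close> is a coboundary, so q w is
      already one in \<open>C\<close>; a lift of its primitive through \<open>q\<close> corrects
      \<open>w\<close>.\<close>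
    then obtain c3 where c3: "c3 \<in> stk C (n - 1 - 1) \<sigma>" "q (n - 1) \<sigma> ?w = diff C (n - 1 - 1) \<sigma> c3"
      using qi_inj[OF c s, OF qw dqw c_add[OF C' s c_diff[OF C' s bb hw] bc(3)]] by blast
    obtain b3 where b3: "b3 \<in> stk B (n - 1 - 1) \<sigma>" "c3 = q (n - 1 - 1) \<sigma> b3" using q_surj[OF s c3(1)] by blast
    have db3: "diff B (n - 1 - 1) \<sigma> b3 \<in> stk B (n - 1) \<sigma>" using d_inm[OF B s b3(1)] .
    have "q (n - 1) \<sigma> (?w - diff B (n - 1 - 1) \<sigma> b3) = 0"
      unfolding f_diff[OF B q s w(1) db3] f_commm[OF B q s b3(1)] c3(2) b3(2) by simp
    then obtain a where a: "a \<in> stk A (n - 1) \<sigma>" "?w - diff B (n - 1 - 1) \<sigma> b3 = i (n - 1) \<sigma> a"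
      using exact[OF s c_diff[OF B s w(1) db3]] by blast
    have "i n \<sigma> x = diff B (n - 1) \<sigma> (i (n - 1) \<sigma> a)"
      unfolding a(2)[symmetric] d_diff[OF B s w(1) db3] w(2) d_dm[OF B s b3(1)] by simp
    then have "i n \<sigma> (x - diff A (n - 1) \<sigma> a) = 0"
      unfolding f_diff[OF A i s x(1) d_inm[OF A s a(1)]] f_commm[OF A i s a(1)] by simp
    then have "x - diff A (n - 1) \<sigma> a = 0" by (rule i_inj[OF s c_diff[OF A s x(1) d_inm[OF A s a(1)]]])
    then show "\<exists>y\<in>stk A (n - 1) \<sigma>. x = diff A (n - 1) \<sigma> y" using a(1) by (intro bexI[of _ a]) simp_all
  next
    fix n \<sigma> w assume s: "\<sigma> \<in> P" and w: "w \<in> stk (cocone B' C' \<beta>) n \<sigma>" and dw: "diff (cocone B' C' \<beta>) n \<sigma> w = 0"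
    obtain b e where be: "w = case_sum b e" "b \<in> stk B' n \<sigma>" "e \<in> stk C' (n - 1) \<sigma>"
      using w unfolding cocone_stk by (rule dsumE)
    have db: "diff B' n \<sigma> b = 0" and de: "\<beta> n \<sigma> b = diff C' (n - 1) \<sigma> e"
      using dw unfolding be(1) cocone_diff by auto
    \<comment> \<open>Fit the first component: \<open>b\<close> is cohomologous to the image of a
      cocycle \<open>z\<close> of \<open>B\<close>. Since \<beta> b is a coboundary, so is q z, and
      \<open>z\<close> can be moved into the image of \<open>A\<close>.\<close>
    obtain z b' where z: "z \<in> stk B n \<sigma>" "diff B n \<sigma> z = 0" "b' \<in> stk B' (n - 1) \<sigma>"
        "b = j n \<sigma> z + diff B' (n - 1) \<sigma> b'"
      using qi_surj[OF j s be(2) db] by blast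
    have hz: "h n \<sigma> z \<in> stk C' (n - 1) \<sigma>" using h_facts(1)[OF B h s z(1)] .
    have bb': "\<beta> (n - 1) \<sigma> b' \<in> stk C' (n - 1) \<sigma>" using f_in[OF B' b s z(3)] .
    have bz: "\<beta> n \<sigma> b = \<beta> n \<sigma> (j n \<sigma> z) + diff C' (n - 1) \<sigma> (\<beta> (n - 1) \<sigma> b')"
      unfolding z(4) f_add[OF B' b s f_in[OF B jm s z(1)] d_inm[OF B' s z(3)]] f_commm[OF B' b s z(3)] ..
    have "c n \<sigma> (q n \<sigma> z) = diff C' (n - 1) \<sigma> (e - \<beta> (n - 1) \<sigma> b' - h n \<sigma> z)"
      unfolding d_diff[OF C' s c_diff[OF C' s be(3) bb'] hz] d_diff[OF C' s be(3) bb'] de[symmetric] bz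
        h_facts(6)[OF B h s z(1,2)] by simp
    then obtain c2 where c2: "c2 \<in> stk C (n - 1) \<sigma>" "q n \<sigma> z = diff C (n - 1) \<sigma> c2"
      using qi_inj[OF c s, OF f_in[OF B q s z(1)] f_cocycle[OF B q s z(1,2)] c_diff[OF C' s c_diff[OF C' s be(3) bb'] hz]] by blast
    obtain b2 where b2: "b2 \<in> stk B (n - 1) \<sigma>" "c2 = q (n - 1) \<sigma> b2" using q_surj[OF s c2(1)] by blast
    have db2: "diff B (n - 1) \<sigma> b2 \<in> stk B n \<sigma>" using d_inm[OF B s b2(1)] .
    have "q n \<sigma> (z - diff B (n - 1) \<sigma> b2) = 0"
      unfolding f_diff[OF B q s z(1) db2] f_commm[OF B q s b2(1)] c2(2) b2(2) by simp
    then obtain x where x: "x \<in> stk A n \<sigma>" "z - diff B (n - 1) \<sigma> b2 = i n \<sigma> x"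
      using exact[OF s c_diff[OF B s z(1) db2]] by blast
    have ix: "i n \<sigma> x \<in> stk B n \<sigma>" using f_in[OF A i s x(1)] .
    have dix: "diff B n \<sigma> (i n \<sigma> x) = 0"
      unfolding x(2)[symmetric] d_diff[OF B s z(1) db2] z(2) d_dm[OF B s b2(1)] by simp
    then have "i (n + 1) \<sigma> (diff A n \<sigma> x) = 0" unfolding f_comm[OF A i s x(1)] .
    then have dx: "diff A n \<sigma> x = 0" by (rule i_inj[OF s d_in[OF A s x(1)]])
    let ?b = "j (n - 1) \<sigma> b2 + b'"
    have jb2: "j (n - 1) \<sigma> b2 \<in> stk B' (n - 1) \<sigma>" using f_in[OF B jm s b2(1)] .
    have bin: "?b \<in> stk B' (n - 1) \<sigma>" using c_add[OF B' s jb2 z(3)] .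
    have hix: "h n \<sigma> (i n \<sigma> x) \<in> stk C' (n - 1) \<sigma>" using h_facts(1)[OF B h s ix] .
    have bbin: "\<beta> (n - 1) \<sigma> ?b \<in> stk C' (n - 1) \<sigma>" using f_in[OF B' b s bin] .
    have zi: "z = i n \<sigma> x + diff B (n - 1) \<sigma> b2" using x(2) by (simp add: algebra_simps)
    have beq: "b = j n \<sigma> (i n \<sigma> x) + diff B' (n - 1) \<sigma> ?b"
      unfolding z(4) d_add[OF B' s jb2 z(3)] f_commm[OF B jm s b2(1), symmetric]
      using f_add[OF B jm s ix db2] unfolding zi[symmetric] by (simp add: add.assoc)
    \<comment> \<open>What is left of the second component is a cocycle of \<open>C'\<close>. It
      comes from a cocycle \<open>w'\<close> of \<open>C\<close> up to a coboundary, and the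
      connecting map sends \<open>w'\<close> to \<open>x4\<close>; subtracting \<open>x4\<close>
      from \<open>x\<close> absorbs it.\<close>
    let ?e = "e - h n \<sigma> (i n \<sigma> x) - \<beta> (n - 1) \<sigma> ?b"
    have ein: "?e \<in> stk C' (n - 1) \<sigma>" using c_diff[OF C' s c_diff[OF C' s be(3) hix] bbin] .
    have "\<beta> n \<sigma> b = \<beta> n \<sigma> (j n \<sigma> (i n \<sigma> x)) + diff C' (n - 1) \<sigma> (\<beta> (n - 1) \<sigma> ?b)"
      unfolding f_commm[OF B' b s bin, symmetric]
      using f_add[OF B' b s f_in[OF B jm s ix] d_inm[OF B' s bin]] unfolding beq[symmetric] .
    moreover have "\<beta> n \<sigma> (j n \<sigma> (i n \<sigma> x)) = diff C' (n - 1) \<sigma> (h n \<sigma> (i n \<sigma> x))"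
      using hA[OF s x(1)] dix h_facts(2)[OF B h s, of "n + 1"] by simp
    ultimately have "diff C' (n - 1) \<sigma> ?e = 0"
      unfolding d_diff[OF C' s c_diff[OF C' s be(3) hix] bbin] d_diff[OF C' s be(3) hix] de[symmetric] by simp
    then obtain w' e2 where w': "w' \<in> stk C (n - 1) \<sigma>" "diff C (n - 1) \<sigma> w' = 0" "e2 \<in> stk C' (n - 1 - 1) \<sigma>"
        "?e = c (n - 1) \<sigma> w' + diff C' (n - 1 - 1) \<sigma> e2"
      using qi_surj[OF c s ein] by blast
    obtain b4 where b4: "b4 \<in> stk B (n - 1) \<sigma>" "w' = q (n - 1) \<sigma> b4" using q_surj[OF s w'(1)] by blast
    have db4: "diff B (n - 1) \<sigma> b4 \<in> stk B n \<sigma>" using d_inm[OF B s b4(1)] .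
    have "q n \<sigma> (diff B (n - 1) \<sigma> b4) = 0" unfolding f_commm[OF B q s b4(1)] b4(2)[symmetric] w'(2) ..
    then obtain x4 where x4: "x4 \<in> stk A n \<sigma>" "diff B (n - 1) \<sigma> b4 = i n \<sigma> x4" using exact[OF s db4] by blast
    have "i (n + 1) \<sigma> (diff A n \<sigma> x4) = 0" unfolding f_comm[OF A i s x4(1)] x4(2)[symmetric] d_dm[OF B s b4(1)] ..
    then have dx4: "diff A n \<sigma> x4 = 0" by (rule i_inj[OF s d_in[OF A s x4(1)]])
    have ix4: "i n \<sigma> x4 \<in> stk B n \<sigma>" using f_in[OF A i s x4(1)] .
    have jb4: "j (n - 1) \<sigma> b4 \<in> stk B' (n - 1) \<sigma>" using f_in[OF B jm s b4(1)] .
    have hb4: "h (n - 1) \<sigma> b4 \<in> stk C' (n - 1 - 1) \<sigma>" using h_facts(1)[OF B h s b4(1)] .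
    define X where "X = x - x4"
    define b5 where "b5 = ?b + j (n - 1) \<sigma> b4"
    define e5 where "e5 = h (n - 1) \<sigma> b4 - e2"
    have X: "X \<in> stk A n \<sigma>" "diff A n \<sigma> X = 0"
      unfolding X_def using c_diff[OF A s x(1) x4(1)] d_diff[OF A s x(1) x4(1)] dx dx4 by auto
    have iX: "i n \<sigma> X = i n \<sigma> x - i n \<sigma> x4" unfolding X_def by (rule f_diff[OF A i s x(1) x4(1)])
    have b5: "b5 \<in> stk B' (n - 1) \<sigma>" unfolding b5_def by (rule c_add[OF B' s bin jb4])
    have e5: "e5 \<in> stk C' (n - 1 - 1) \<sigma>" unfolding e5_def by (rule c_diff[OF C' s hb4 w'(3)])
    have r1: "b = j n \<sigma> (i n \<sigma> X) + diff B' (n - 1) \<sigma> b5"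
      unfolding iX f_diff[OF B jm s ix ix4] b5_def d_add[OF B' s bin jb4] f_commm[OF B jm s b4(1), symmetric] x4(2)
      using beq by (simp add: algebra_simps)
    have "\<beta> (n - 1) \<sigma> b5 = \<beta> (n - 1) \<sigma> ?b + \<beta> (n - 1) \<sigma> (j (n - 1) \<sigma> b4)"
      unfolding b5_def by (rule f_add[OF B' b s bin jb4])
    moreover have "\<beta> (n - 1) \<sigma> (j (n - 1) \<sigma> b4) = c (n - 1) \<sigma> w'
        + diff C' (n - 1 - 1) \<sigma> (h (n - 1) \<sigma> b4) + h n \<sigma> (i n \<sigma> x4)"
      using h_facts(5)[OF B h s b4(1)] unfolding b4(2)[symmetric] x4(2) .
    moreover have "diff C' (n - 1 - 1) \<sigma> e5 = diff C' (n - 1 - 1) \<sigma> (h (n - 1) \<sigma> b4) - diff C' (n - 1 - 1) \<sigma> e2"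
      unfolding e5_def by (rule d_diff[OF C' s hb4 w'(3)])
    moreover have "h n \<sigma> (i n \<sigma> X) = h n \<sigma> (i n \<sigma> x) - h n \<sigma> (i n \<sigma> x4)"
      unfolding iX by (rule h_facts(4)[OF B h s ix ix4])
    moreover have "e = c (n - 1) \<sigma> w' + diff C' (n - 1 - 1) \<sigma> e2 + h n \<sigma> (i n \<sigma> x) + \<beta> (n - 1) \<sigma> ?b"
      using w'(4) by (simp add: algebra_simps)
    ultimately have r2: "e = h n \<sigma> (i n \<sigma> X) + (\<beta> (n - 1) \<sigma> b5 - diff C' (n - 1 - 1) \<sigma> e5)"
      by (simp add: algebra_simps)
    have "w = case_sum (j n \<sigma> (i n \<sigma> X)) (h n \<sigma> (i n \<sigma> X)) + diff (cocone B' C' \<beta>) (n - 1) \<sigma> (case_sum b5 e5)"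
      unfolding be(1) cocone_diff case_sum_linear r1[symmetric] r2[symmetric] ..
    moreover have "case_sum b5 e5 \<in> stk (cocone B' C' \<beta>) (n - 1) \<sigma>" using b5 e5 by (simp add: cocone_stk)
    ultimately show "\<exists>z\<in>stk A n \<sigma>. diff A n \<sigma> z = 0 \<and> (\<exists>u\<in>stk (cocone B' C' \<beta>) (n - 1) \<sigma>.
        w = case_sum (j n \<sigma> (i n \<sigma> z)) (h n \<sigma> (i n \<sigma> z)) + diff (cocone B' C' \<beta>) (n - 1) \<sigma> u)"
      using X by blast
  qed
qed


section \<open>Isomorphic complexes and models over \<open>nat\<close>\<close>

lemma iso_quasi_iso:
  assumes C: "bounded_complex P C" and D: "bounded_complex P D" and t: "chain_map P C D t" and s: "chain_map P D C s"
    and st: "\<And>n \<sigma> v. \<sigma> \<in> P \<Longrightarrow> v \<in> stk C n \<sigma> \<Longrightarrow> s n \<sigma> (t n \<sigma> v) = v"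
    and ts: "\<And>n \<sigma> v. \<sigma> \<in> P \<Longrightarrow> v \<in> stk D n \<sigma> \<Longrightarrow> t n \<sigma> (s n \<sigma> v) = v"
  shows "quasi_iso P C D t"
proof (rule quasi_isoI[OF t])
  fix n \<sigma> z u assume p: "\<sigma> \<in> P" and z: "z \<in> stk C n \<sigma>" "t n \<sigma> z = diff D (n - 1) \<sigma> u" and u: "u \<in> stk D (n - 1) \<sigma>"
  have "z = diff C (n - 1) \<sigma> (s (n - 1) \<sigma> u)"
    using st[OF p z(1)] unfolding z(2) f_commm[OF D s p u] by simp
  then show "\<exists>y\<in>stk C (n - 1) \<sigma>. z = diff C (n - 1) \<sigma> y" using f_in[OF D s p u] by blast
next
  fix n \<sigma> w assume p: "\<sigma> \<in> P" and w: "w \<in> stk D n \<sigma>" "diff D n \<sigma> w = 0"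
  have "w = t n \<sigma> (s n \<sigma> w) + diff D (n - 1) \<sigma> 0" unfolding ts[OF p w(1)] d_0[OF D p] by simp
  then show "\<exists>z\<in>stk C n \<sigma>. diff C n \<sigma> z = 0 \<and> (\<exists>u\<in>stk D (n - 1) \<sigma>. w = t n \<sigma> z + diff D (n - 1) \<sigma> u)"
    using f_in[OF D s p w(1)] f_cocycle[OF D s p w] c_0[OF D p] by blast
qed

lemma cpx_nat_model:
  fixes C :: "('a::order, 'i, 'k::field) cpx"
  assumes C: "bounded_complex P C"
  shows "\<exists>(N :: ('a, nat, 'k) cpx) t s. bounded_complex P N \<and> quasi_iso P C N t \<and> chain_map P N C s \<and> chain_map P C N t \<and>
    (\<forall>n. \<forall>\<sigma>\<in>P. \<forall>v\<in>stk C n \<sigma>. s n \<sigma> (t n \<sigma> v) = v) \<and> (\<forall>n. \<forall>\<sigma>\<in>P. \<forall>v\<in>stk N n \<sigma>. t n \<sigma> (s n \<sigma> v) = v)"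
proof -
  define Q where "Q = (\<lambda>n (N :: ('a, nat, 'k) sheaf, t, s). is_sheaf P N \<and> sheaf_hom P (obj C n) N t \<and> sheaf_hom P N (obj C n) s \<and>
    (\<forall>\<sigma>\<in>P. \<forall>v\<in>stk C n \<sigma>. s \<sigma> (t \<sigma> v) = v) \<and> (\<forall>\<sigma>\<in>P. \<forall>v\<in>stalk N \<sigma>. t \<sigma> (s \<sigma> v) = v))"
  have "\<exists>x. Q n x" for n
    using sheaf_nat_model[OF cpx_sheaf[OF C, of n]] unfolding Q_def by fast
  then obtain X where X: "\<And>n. Q n (X n)" by metis
  define N where "N n = fst (X n)" for n
  define t where "t n = fst (snd (X n))" for n
  define s where "s n = snd (snd (X n))" for n
  have Q: "Q n (N n, t n, s n)" for n using X by (simp add: N_def t_def s_def)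
  have N: "\<And>n. is_sheaf P (N n)" and t: "\<And>n. sheaf_hom P (obj C n) (N n) (t n)" and s: "\<And>n. sheaf_hom P (N n) (obj C n) (s n)"
    and st: "\<And>n \<sigma> v. \<sigma> \<in> P \<Longrightarrow> v \<in> stk C n \<sigma> \<Longrightarrow> s n \<sigma> (t n \<sigma> v) = v"
    and ts: "\<And>n \<sigma> v. \<sigma> \<in> P \<Longrightarrow> v \<in> stalk (N n) \<sigma> \<Longrightarrow> t n \<sigma> (s n \<sigma> v) = v"
    using Q by (simp_all add: Q_def)
  define K where "K = \<lparr> obj = N, diff = (\<lambda>n \<sigma> w. t (n + 1) \<sigma> (diff C n \<sigma> (s n \<sigma> w))) \<rparr>"
  have tst: "s (n + 1) \<sigma> (t (n + 1) \<sigma> (diff C n \<sigma> v)) = diff C n \<sigma> v" if "\<sigma> \<in> P" "v \<in> stk C n \<sigma>" for n \<sigma> v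
    by (rule st[OF that(1) d_in[OF C that]])
  have K: "bounded_complex P K"
    unfolding bounded_complex_def
  proof (intro conjI allI ballI)
    show "sheaf_hom P (obj K n) (obj K (n + 1)) (diff K n)" for n
      unfolding K_def cpx.simps by (rule hom_comp[OF hom_comp[OF s cpx_diff[OF C]] t])
    show "diff K (n + 1) \<sigma> (diff K n \<sigma> v) = 0" if p: "\<sigma> \<in> P" and v: "v \<in> stk K n \<sigma>" for n \<sigma> v
    proof -
      have "s n \<sigma> v \<in> stk C n \<sigma>" using v hom_in[OF s p] by (simp add: K_def)
      then show ?thesis
        by (simp add: K_def tst[OF p] d_d[OF C p] hom0[OF t cpx_sheaf[OF C] p])
    qed
    obtain M where "\<And>n. \<bar>n\<bar> > M \<Longrightarrow> zero_sheaf P (obj C n)" using cpx_bounded[OF C] by blast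
    moreover have "zero_sheaf P (obj K n)" if z: "zero_sheaf P (obj C n)" for n
    proof -
      have "v = 0" if p: "\<sigma> \<in> P" and v: "v \<in> stalk (N n) \<sigma>" for \<sigma> v
      proof -
        have "s n \<sigma> v = 0" using hom_in[OF s p v] z p by (auto simp: zero_sheaf_def)
        then show ?thesis using ts[OF p v] hom0[OF t cpx_sheaf[OF C] p] by simp
      qed
      then show ?thesis using subsp_0[OF sheaf_subsp[OF N]] by (auto simp: zero_sheaf_def K_def)
    qed
    ultimately show "\<exists>N. \<forall>n. N < \<bar>n\<bar> \<longrightarrow> zero_sheaf P (obj K n)" by blast
  qed (simp add: K_def N)
  moreover have tm: "chain_map P C K t"
    by (simp add: chain_map_def K_def t st)
  moreover have sm: "chain_map P K C s"
    unfolding chain_map_def K_def cpx.simps using s tst hom_in[OF s] by blast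
  moreover have "quasi_iso P C K t"
    by (rule iso_quasi_iso[OF C K tm sm]) (auto simp: K_def st ts)
  ultimately show ?thesis using st ts by (intro exI[of _ K] exI[of _ t] exI[of _ s]) (simp add: K_def)
qed

section \<open>The Godement embedding and its cokernel\<close>

text \<open>The cokernel of the unit \<open>F \<rightarrow> godement P F\<close>.\<close>

definition god_quot :: "'a::order set \<Rightarrow> ('a, 'i, 'k::field) sheaf \<Rightarrow> ('a, 'a \<times> 'i, 'k) sheaf" where
  "god_quot P F = \<lparr> stalk = (\<lambda>\<sigma>. prod_space {p \<in> P. \<sigma> < p} (stalk F)),
     res = (\<lambda>\<sigma> \<tau> y. case_prod (\<lambda>p. if p \<in> P \<and> \<tau> < p then curry y p - (if \<sigma> = \<tau> then 0 else res F \<tau> p (curry y \<tau>)) else 0)) \<rparr>"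

text \<open>Modulo the unit, every family at \<sigma> has exactly one representative with coordinate
  0 at \<sigma>: subtract the unit of that coordinate. So the cokernel consists of families over p >
  \<sigma>, and restricting to \<tau> requires normalizing again, which explains the correction term
  in \<open>god_quot\<close>.\<close>

definition god_proj :: "'a::order set \<Rightarrow> ('a, 'i, 'k::field) sheaf \<Rightarrow> 'a \<Rightarrow> ('a \<times> 'i \<Rightarrow> 'k) \<Rightarrow> 'a \<times> 'i \<Rightarrow> 'k" where
  "god_proj P F \<sigma> x = case_prod (\<lambda>p. if p \<in> P \<and> \<sigma> < p then curry x p - res F \<sigma> p (curry x \<sigma>) else 0)"

lemma curry_god_quot_res: "curry (res (god_quot P F) \<sigma> \<tau> y) p =
    (if p \<in> P \<and> \<tau> < p then curry y p - (if \<sigma> = \<tau> then 0 else res F \<tau> p (curry y \<tau>)) else 0)"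
  and curry_god_proj: "curry (god_proj P F \<sigma> x) p = (if p \<in> P \<and> \<sigma> < p then curry x p - res F \<sigma> p (curry x \<sigma>) else 0)"
  for P :: "'a::order set" and F :: "('a, 'i, 'k::field) sheaf"
  by (simp_all add: god_quot_def god_proj_def)

lemma god_quot_stalk: "y \<in> stalk (god_quot P F) \<sigma> \<longleftrightarrow>
    (\<forall>p. (p \<in> P \<and> \<sigma> < p \<longrightarrow> curry y p \<in> stalk F p) \<and> (\<not> (p \<in> P \<and> \<sigma> < p) \<longrightarrow> curry y p = 0))"
  by (simp add: god_quot_def prod_space_def)

lemma god_proj_surj:
  assumes F: "is_sheaf P F" and s: "\<sigma> \<in> P" and y: "y \<in> stalk (god_quot P F) \<sigma>"
  shows "y \<in> stalk (godement P F) \<sigma>" "god_proj P F \<sigma> y = y"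
proof -
  have o: "curry y p = 0" if "\<not> (p \<in> P \<and> \<sigma> < p)" for p using y that unfolding god_quot_stalk by blast
  have i: "curry y p \<in> stalk F p" if "p \<in> P" "\<sigma> < p" for p using y that unfolding god_quot_stalk by blast
  have "curry y p \<in> stalk F p" if "p \<in> P" "\<sigma> \<le> p" for p
    using that i[of p] o[of p] subsp_0[OF sheaf_subsp[OF F]] by (cases "\<sigma> = p") (auto simp: less_le)
  moreover have "curry y p = 0" if "\<not> (p \<in> P \<and> \<sigma> \<le> p)" for p using o[of p] that by (auto simp: less_le)
  ultimately show "y \<in> stalk (godement P F) \<sigma>" by (rule godement_stalkI)
  show "god_proj P F \<sigma> y = y"
    by (rule curry_eqI) (use o s in \<open>auto simp: curry_god_proj lm_0[OF sheaf_res[OF F] sheaf_subsp[OF F]]\<close>)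
qed

lemma god_proj_lm:
  assumes F: "is_sheaf P F" and s: "\<sigma> \<in> P"
  shows "linear_map (stalk (godement P F) \<sigma>) (stalk (god_quot P F) \<sigma>) (god_proj P F \<sigma>)"
proof (rule linear_mapI)
  fix x assume x: "x \<in> stalk (godement P F) \<sigma>"
  note i = godement_inside[OF x]
  show "god_proj P F \<sigma> x \<in> stalk (god_quot P F) \<sigma>"
    unfolding god_quot_stalk using i s sheaf_res_in[OF F s] subsp_diff[OF sheaf_subsp[OF F]]
    by (auto simp: curry_god_proj)
next
  fix x y assume "x \<in> stalk (godement P F) \<sigma>" "y \<in> stalk (godement P F) \<sigma>"
  note i = this[THEN godement_inside[OF _ s order_refl]]
  show "god_proj P F \<sigma> (x + y) = god_proj P F \<sigma> x + god_proj P F \<sigma> y"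
    by (rule curry_eqI) (use i s in \<open>auto simp: curry_god_proj lm_add[OF sheaf_res[OF F]]\<close>)
next
  fix c x assume "x \<in> stalk (godement P F) \<sigma>"
  note i = this[THEN godement_inside[OF _ s order_refl]]
  show "god_proj P F \<sigma> (vscale c x) = vscale c (god_proj P F \<sigma> x)"
    by (rule curry_eqI) (use i s in \<open>auto simp: curry_god_proj lm_scale[OF sheaf_res[OF F]] kfun.scale_right_diff_distrib\<close>)
qed

lemma god_proj_nat:
  assumes F: "is_sheaf P F" and s: "\<sigma> \<in> P" "\<tau> \<in> P" "\<sigma> \<le> \<tau>" and x: "x \<in> stalk (godement P F) \<sigma>"
  shows "god_proj P F \<tau> (res (godement P F) \<sigma> \<tau> x) = res (god_quot P F) \<sigma> \<tau> (god_proj P F \<sigma> x)"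
proof (rule curry_eqI)
  fix p
  note i = godement_inside[OF x]
  show "curry (god_proj P F \<tau> (res (godement P F) \<sigma> \<tau> x)) p = curry (res (god_quot P F) \<sigma> \<tau> (god_proj P F \<sigma> x)) p"
  proof (cases "p \<in> P \<and> \<tau> < p \<and> \<sigma> \<noteq> \<tau>")
    case True
    then have p: "p \<in> P" "\<tau> \<le> p" "\<sigma> \<le> p" "\<sigma> < p" "\<sigma> < \<tau>" using s(3) by auto
    have "res F \<tau> p (curry x \<tau> - res F \<sigma> \<tau> (curry x \<sigma>)) = res F \<tau> p (curry x \<tau>) - res F \<sigma> p (curry x \<sigma>)"
      using lm_diff[OF sheaf_res[OF F s(2) p(1,2)] sheaf_subsp[OF F s(2)] i[OF s(2,3)] sheaf_res_in[OF F s i[OF s(1) order_refl]]]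
        sheaf_res_res[OF F s(1,2) p(1) s(3) p(2) i[OF s(1) order_refl]] by simp
    then show ?thesis using p s True by (simp add: curry_god_proj curry_god_quot_res godement_res)
  next
    case False
    then show ?thesis using s by (auto simp: curry_god_proj curry_god_quot_res godement_res)
  qed
qed

text \<open>Every law is inherited from the Godement sheaf: \<open>god_proj\<close> is surjective on
  stalks and, by \<open>god_proj_nat\<close>, intertwines the restrictions.\<close>

lemma god_quot_sheaf:
  assumes P: "finite P" and F: "is_sheaf P F"
  shows "is_sheaf P (god_quot P F)"
proof (rule is_sheafI)
  let ?G = "godement P F" and ?Q = "god_quot P F"
  have G: "is_sheaf P ?G" by (rule godement_sheaf[OF P F])
  have sur: "\<exists>x\<in>stalk ?G \<sigma>. y = god_proj P F \<sigma> x" if "\<sigma> \<in> P" "y \<in> stalk ?Q \<sigma>" for \<sigma> y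
    using god_proj_surj[OF F that] by metis
  {
    fix \<sigma> assume "\<sigma> \<in> P"
    then show "findim_space (stalk ?Q \<sigma>)"
      using P F by (auto simp: god_quot_def intro!: findim_prod sheaf_findim)
  next
    fix \<sigma> \<tau> assume s: "\<sigma> \<in> P" "\<tau> \<in> P" "\<sigma> \<le> \<tau>"
    show "linear_map (stalk ?Q \<sigma>) (stalk ?Q \<tau>) (res ?Q \<sigma> \<tau>)"
    proof (rule linear_mapI)
      fix x assume "x \<in> stalk ?Q \<sigma>"
      then obtain y where y: "y \<in> stalk ?G \<sigma>" "x = god_proj P F \<sigma> y" using sur s by blast
      show "res ?Q \<sigma> \<tau> x \<in> stalk ?Q \<tau>"
        unfolding y(2) god_proj_nat[OF F s y(1), symmetric]
        using lm_in[OF god_proj_lm[OF F s(2)] sheaf_res_in[OF G s y(1)]] .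
    next
      fix x y assume "x \<in> stalk ?Q \<sigma>" "y \<in> stalk ?Q \<sigma>"
      then obtain x' y' where *: "x' \<in> stalk ?G \<sigma>" "x = god_proj P F \<sigma> x'" "y' \<in> stalk ?G \<sigma>" "y = god_proj P F \<sigma> y'"
        using sur s by meson
      have a: "x' + y' \<in> stalk ?G \<sigma>" using subsp_add[OF sheaf_subsp[OF G s(1)] *(1,3)] .
      show "res ?Q \<sigma> \<tau> (x + y) = res ?Q \<sigma> \<tau> x + res ?Q \<sigma> \<tau> y"
        unfolding *(2,4) lm_add[OF god_proj_lm[OF F s(1)] *(1,3), symmetric]
          god_proj_nat[OF F s *(1), symmetric] god_proj_nat[OF F s *(3), symmetric] god_proj_nat[OF F s a, symmetric]
          lm_add[OF sheaf_res[OF G s] *(1,3)]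
        by (rule lm_add[OF god_proj_lm[OF F s(2)] sheaf_res_in[OF G s *(1)] sheaf_res_in[OF G s *(3)]])
    next
      fix c x assume "x \<in> stalk ?Q \<sigma>"
      then obtain x' where *: "x' \<in> stalk ?G \<sigma>" "x = god_proj P F \<sigma> x'" using sur s by meson
      have a: "vscale c x' \<in> stalk ?G \<sigma>" using subsp_scale[OF sheaf_subsp[OF G s(1)] *(1)] .
      show "res ?Q \<sigma> \<tau> (vscale c x) = vscale c (res ?Q \<sigma> \<tau> x)"
        unfolding *(2) lm_scale[OF god_proj_lm[OF F s(1)] *(1), symmetric]
          god_proj_nat[OF F s *(1), symmetric] god_proj_nat[OF F s a, symmetric] lm_scale[OF sheaf_res[OF G s] *(1)]
        by (rule lm_scale[OF god_proj_lm[OF F s(2)] sheaf_res_in[OF G s *(1)]])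
    qed
  next
    fix \<sigma> v assume s: "\<sigma> \<in> P" and "v \<in> stalk ?Q \<sigma>"
    then obtain x where x: "x \<in> stalk ?G \<sigma>" "v = god_proj P F \<sigma> x" using sur by blast
    show "res ?Q \<sigma> \<sigma> v = v"
      unfolding x(2) god_proj_nat[OF F s s order_refl x(1), symmetric] sheaf_res_id[OF G s x(1)] ..
  next
    fix \<rho> \<sigma> \<tau> v assume s: "\<rho> \<in> P" "\<sigma> \<in> P" "\<tau> \<in> P" "\<rho> \<le> \<sigma>" "\<sigma> \<le> \<tau>" and "v \<in> stalk ?Q \<rho>"
    then obtain x where x: "x \<in> stalk ?G \<rho>" "v = god_proj P F \<rho> x" using sur by blast
    have xs: "res ?G \<rho> \<sigma> x \<in> stalk ?G \<sigma>" using sheaf_res_in[OF G s(1,2,4) x(1)] .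
    show "res ?Q \<sigma> \<tau> (res ?Q \<rho> \<sigma> v) = res ?Q \<rho> \<tau> v"
      unfolding x(2) god_proj_nat[OF F s(1,2,4) x(1), symmetric] god_proj_nat[OF F s(2,3,5) xs, symmetric]
        god_proj_nat[OF F s(1,3) order.trans[OF s(4,5)] x(1), symmetric] sheaf_res_res[OF G s x(1)] ..
  }
qed

lemma god_proj_hom: "is_sheaf P F \<Longrightarrow> sheaf_hom P (godement P F) (god_quot P F) (god_proj P F)"
  by (rule sheaf_homI) (simp_all add: god_proj_lm god_proj_nat)

lemma god_proj_unit:
  assumes "is_sheaf P F" "\<sigma> \<in> P" "v \<in> stalk F \<sigma>"
  shows "god_proj P F \<sigma> (god_unit P F \<sigma> v) = 0"
  by (rule curry_eqI) (use assms in \<open>auto simp: curry_god_proj curry_god_map sheaf_res_id\<close>)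

lemma god_exact:
  assumes F: "is_sheaf P F" and s: "\<sigma> \<in> P" and x: "x \<in> stalk (godement P F) \<sigma>" "god_proj P F \<sigma> x = 0"
  shows "x = god_unit P F \<sigma> (curry x \<sigma>)"
proof (rule curry_eqI)
  fix p
  have "curry (god_proj P F \<sigma> x) p = 0" using x(2) by simp
  then have "p \<in> P \<Longrightarrow> \<sigma> < p \<Longrightarrow> curry x p = res F \<sigma> p (curry x \<sigma>)" by (simp add: curry_god_proj)
  then show "curry x p = curry (god_unit P F \<sigma> (curry x \<sigma>)) p"
    using godement_outside[OF x(1), of p] sheaf_res_id[OF F s godement_inside[OF x(1) s order_refl]]
    by (cases "p = \<sigma>") (auto simp: curry_god_map s less_le)
qed


definition god_fun :: "'a::order set \<Rightarrow> ('a \<Rightarrow> ('i \<Rightarrow> 'k::field) \<Rightarrow> 'j \<Rightarrow> 'k) \<Rightarrow> 'a \<Rightarrow> ('a \<times> 'i \<Rightarrow> 'k) \<Rightarrow> 'a \<times> 'j \<Rightarrow> 'k" where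
  "god_fun P \<phi> \<sigma> x = case_prod (\<lambda>p. if p \<in> P \<and> \<sigma> \<le> p then \<phi> p (curry x p) else 0)"

definition quot_fun :: "'a::order set \<Rightarrow> ('a \<Rightarrow> ('i \<Rightarrow> 'k::field) \<Rightarrow> 'j \<Rightarrow> 'k) \<Rightarrow> 'a \<Rightarrow> ('a \<times> 'i \<Rightarrow> 'k) \<Rightarrow> 'a \<times> 'j \<Rightarrow> 'k" where
  "quot_fun P \<phi> \<sigma> x = case_prod (\<lambda>p. if p \<in> P \<and> \<sigma> < p then \<phi> p (curry x p) else 0)"

lemma curry_god_fun: "curry (god_fun P \<phi> \<sigma> x) p = (if p \<in> P \<and> \<sigma> \<le> p then \<phi> p (curry x p) else 0)"
  and curry_quot_fun: "curry (quot_fun P \<phi> \<sigma> x) p = (if p \<in> P \<and> \<sigma> < p then \<phi> p (curry x p) else 0)"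
  by (simp_all add: god_fun_def quot_fun_def)

lemma god_fun_hom:
  assumes f: "sheaf_hom P F G \<phi>"
  shows "sheaf_hom P (godement P F) (godement P G) (god_fun P \<phi>)"
proof (rule sheaf_homI)
  fix \<sigma> assume s: "\<sigma> \<in> P"
  show "linear_map (stalk (godement P F) \<sigma>) (stalk (godement P G) \<sigma>) (god_fun P \<phi> \<sigma>)"
  proof (rule linear_mapI)
    fix x assume x: "x \<in> stalk (godement P F) \<sigma>"
    show "god_fun P \<phi> \<sigma> x \<in> stalk (godement P G) \<sigma>"
      by (rule godement_stalkI) (auto simp: curry_god_fun intro: hom_in[OF f] godement_inside[OF x])
  next
    fix x y assume "x \<in> stalk (godement P F) \<sigma>" "y \<in> stalk (godement P F) \<sigma>"
    note i = this[THEN godement_inside]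
    show "god_fun P \<phi> \<sigma> (x + y) = god_fun P \<phi> \<sigma> x + god_fun P \<phi> \<sigma> y"
      by (rule curry_eqI) (simp add: curry_god_fun hom_add[OF f] i)
  next
    fix c x assume "x \<in> stalk (godement P F) \<sigma>"
    note i = this[THEN godement_inside]
    show "god_fun P \<phi> \<sigma> (vscale c x) = vscale c (god_fun P \<phi> \<sigma> x)"
      by (rule curry_eqI) (simp add: curry_god_fun lm_scale[OF hom_lm[OF f]] i)
  qed
next
  fix \<sigma> \<tau> v assume s: "\<sigma> \<in> P" "\<tau> \<in> P" "\<sigma> \<le> \<tau>" and v: "v \<in> stalk (godement P F) \<sigma>"
  show "god_fun P \<phi> \<tau> (res (godement P F) \<sigma> \<tau> v) = res (godement P G) \<sigma> \<tau> (god_fun P \<phi> \<sigma> v)"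
    by (rule curry_eqI) (use order.trans[OF s(3)] godement_outside[OF v] in \<open>auto simp: curry_god_fun godement_res\<close>)
qed

lemma god_fun_unit:
  assumes F: "is_sheaf P F" and f: "sheaf_hom P F G \<phi>" and s: "\<sigma> \<in> P" "v \<in> stalk F \<sigma>"
  shows "god_fun P \<phi> \<sigma> (god_unit P F \<sigma> v) = god_unit P G \<sigma> (\<phi> \<sigma> v)"
  by (rule curry_eqI) (simp add: curry_god_fun curry_god_map hom_nat[OF f s(1) _ _ s(2)])

lemma god_fun_proj:
  assumes F: "is_sheaf P F" and f: "sheaf_hom P F G \<phi>" and s: "\<sigma> \<in> P" and x: "x \<in> stalk (godement P F) \<sigma>"
  shows "god_proj P G \<sigma> (god_fun P \<phi> \<sigma> x) = quot_fun P \<phi> \<sigma> (god_proj P F \<sigma> x)"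
proof (rule curry_eqI)
  fix p
  note i = godement_inside[OF x]
  show "curry (god_proj P G \<sigma> (god_fun P \<phi> \<sigma> x)) p = curry (quot_fun P \<phi> \<sigma> (god_proj P F \<sigma> x)) p"
  proof (cases "p \<in> P \<and> \<sigma> < p")
    case True
    then have p: "p \<in> P" "\<sigma> \<le> p" by auto
    note xs = i[OF s order_refl]
    show ?thesis
      using True s p hom_diff[OF f F p(1) i[OF p] sheaf_res_in[OF F s p xs]] hom_nat[OF f s p xs]
      by (simp add: curry_god_proj curry_god_fun curry_quot_fun)
  qed (auto simp: curry_god_proj curry_quot_fun)
qed

lemma quot_fun_hom:
  assumes F: "is_sheaf P F" and G: "is_sheaf P G" and f: "sheaf_hom P F G \<phi>"
  shows "sheaf_hom P (god_quot P F) (god_quot P G) (quot_fun P \<phi>)"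
proof (rule sheaf_homI)
  fix \<sigma> assume s: "\<sigma> \<in> P"
  have i: "p \<in> P \<Longrightarrow> \<sigma> < p \<Longrightarrow> curry x p \<in> stalk F p" if "x \<in> stalk (god_quot P F) \<sigma>" for x p
    using that unfolding god_quot_stalk by blast
  show "linear_map (stalk (god_quot P F) \<sigma>) (stalk (god_quot P G) \<sigma>) (quot_fun P \<phi> \<sigma>)"
  proof (rule linear_mapI)
    fix x assume x: "x \<in> stalk (god_quot P F) \<sigma>"
    show "quot_fun P \<phi> \<sigma> x \<in> stalk (god_quot P G) \<sigma>"
      unfolding god_quot_stalk by (auto simp: curry_quot_fun intro: hom_in[OF f] i[OF x])
  next
    fix x y assume "x \<in> stalk (god_quot P F) \<sigma>" "y \<in> stalk (god_quot P F) \<sigma>"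
    note i = this[THEN i]
    show "quot_fun P \<phi> \<sigma> (x + y) = quot_fun P \<phi> \<sigma> x + quot_fun P \<phi> \<sigma> y"
      by (rule curry_eqI) (simp add: curry_quot_fun hom_add[OF f] i)
  next
    fix c x assume "x \<in> stalk (god_quot P F) \<sigma>"
    note i = this[THEN i]
    show "quot_fun P \<phi> \<sigma> (vscale c x) = vscale c (quot_fun P \<phi> \<sigma> x)"
      by (rule curry_eqI) (simp add: curry_quot_fun lm_scale[OF hom_lm[OF f]] i)
  qed
next
  fix \<sigma> \<tau> v assume s: "\<sigma> \<in> P" "\<tau> \<in> P" "\<sigma> \<le> \<tau>" and v: "v \<in> stalk (god_quot P F) \<sigma>"
  note gf = god_fun_hom[OF f]
  define x where "x = v"
  have x: "x \<in> stalk (godement P F) \<sigma>" "v = god_proj P F \<sigma> x"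
    unfolding x_def using god_proj_surj[OF F s(1) v] by auto
  have rx: "res (godement P F) \<sigma> \<tau> x \<in> stalk (godement P F) \<tau>"
    using order.trans[OF s(3)] by (intro godement_stalkI) (auto simp: godement_res intro: godement_inside[OF x(1)] godement_outside[OF x(1)])
  show "quot_fun P \<phi> \<tau> (res (god_quot P F) \<sigma> \<tau> v) = res (god_quot P G) \<sigma> \<tau> (quot_fun P \<phi> \<sigma> v)"
    unfolding x(2) god_proj_nat[OF F s x(1), symmetric] god_fun_proj[OF F f s(2) rx, symmetric] hom_nat[OF gf s x(1)]
      god_proj_nat[OF G s hom_in[OF gf s(1) x(1)]] god_fun_proj[OF F f s(1) x(1)] ..
qed

section \<open>Godement complexes and injective resolutions\<close>

definition god_cpx :: "'a::order set \<Rightarrow> ('a, 'i, 'k::field) cpx \<Rightarrow> ('a, 'a \<times> 'i, 'k) cpx" where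
  "god_cpx P C = \<lparr> obj = (\<lambda>n. godement P (obj C n)), diff = (\<lambda>n. god_fun P (diff C n)) \<rparr>"

definition quot_cpx :: "'a::order set \<Rightarrow> ('a, 'i, 'k::field) cpx \<Rightarrow> ('a, 'a \<times> 'i, 'k) cpx" where
  "quot_cpx P C = \<lparr> obj = (\<lambda>n. god_quot P (obj C n)), diff = (\<lambda>n. quot_fun P (diff C n)) \<rparr>"

lemma god_cpx_complex:
  assumes P: "finite P" and C: "bounded_complex P C"
  shows "bounded_complex P (god_cpx P C)"
  unfolding bounded_complex_def
proof (intro conjI allI ballI)
  show "is_sheaf P (obj (god_cpx P C) n)" for n
    by (simp add: god_cpx_def godement_sheaf[OF P] cpx_sheaf[OF C])
  show "sheaf_hom P (obj (god_cpx P C) n) (obj (god_cpx P C) (n + 1)) (diff (god_cpx P C) n)" for n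
    by (simp add: god_cpx_def god_fun_hom cpx_diff[OF C])
  show "diff (god_cpx P C) (n + 1) \<sigma> (diff (god_cpx P C) n \<sigma> v) = 0"
    if "\<sigma> \<in> P" and v: "v \<in> stk (god_cpx P C) n \<sigma>" for n \<sigma> v
    by (rule curry_eqI) (use godement_inside v in \<open>force simp: god_cpx_def curry_god_fun d_d[OF C]\<close>)
  obtain M where M: "\<And>n. \<bar>n\<bar> > M \<Longrightarrow> zero_sheaf P (obj C n)" using cpx_bounded[OF C] by blast
  have "zero_sheaf P (obj (god_cpx P C) n)" if "\<bar>n\<bar> > M" for n
  proof -
    have "x = 0" if "x \<in> stalk (godement P (obj C n)) \<sigma>" for \<sigma> x
      by (rule curry_eqI) (use godement_inside[OF that] godement_outside[OF that] M[OF \<open>\<bar>n\<bar> > M\<close>] in \<open>force simp: zero_sheaf_def\<close>)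
    then show ?thesis
      using subsp_0[OF sheaf_subsp[OF godement_sheaf[OF P cpx_sheaf[OF C]]]] by (auto simp: zero_sheaf_def god_cpx_def)
  qed
  then show "\<exists>N. \<forall>n. N < \<bar>n\<bar> \<longrightarrow> zero_sheaf P (obj (god_cpx P C) n)" by blast
qed

lemma quot_cpx_complex:
  assumes P: "finite P" and C: "bounded_complex P C"
  shows "bounded_complex P (quot_cpx P C)"
  unfolding bounded_complex_def
proof (intro conjI allI ballI)
  show "is_sheaf P (obj (quot_cpx P C) n)" for n
    by (simp add: quot_cpx_def god_quot_sheaf[OF P] cpx_sheaf[OF C])
  show "sheaf_hom P (obj (quot_cpx P C) n) (obj (quot_cpx P C) (n + 1)) (diff (quot_cpx P C) n)" for n
    by (simp add: quot_cpx_def quot_fun_hom cpx_sheaf[OF C] cpx_diff[OF C])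
  show "diff (quot_cpx P C) (n + 1) \<sigma> (diff (quot_cpx P C) n \<sigma> v) = 0"
    if "\<sigma> \<in> P" and v: "v \<in> stk (quot_cpx P C) n \<sigma>" for n \<sigma> v
    by (rule curry_eqI) (use v in \<open>force simp: quot_cpx_def god_quot_stalk curry_quot_fun d_d[OF C]\<close>)
  obtain M where M: "\<And>n. \<bar>n\<bar> > M \<Longrightarrow> zero_sheaf P (obj C n)" using cpx_bounded[OF C] by blast
  have "zero_sheaf P (obj (quot_cpx P C) n)" if "\<bar>n\<bar> > M" for n
  proof -
    have "x = 0" if x: "x \<in> stalk (god_quot P (obj C n)) \<sigma>" for \<sigma> x
      by (rule curry_eqI) (use x[unfolded god_quot_stalk] M[OF \<open>\<bar>n\<bar> > M\<close>] in \<open>force simp: zero_sheaf_def\<close>)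
    then show ?thesis
      using subsp_0[OF sheaf_subsp[OF god_quot_sheaf[OF P cpx_sheaf[OF C]]]] by (auto simp: zero_sheaf_def quot_cpx_def)
  qed
  then show "\<exists>N. \<forall>n. N < \<bar>n\<bar> \<longrightarrow> zero_sheaf P (obj (quot_cpx P C) n)" by blast
qed

lemma ginj_transfer:
  assumes P: "finite P" and K: "bounded_complex P K" and N: "bounded_complex P N"
    and t: "chain_map P K N t" and s: "chain_map P N K s"
    and ts: "\<And>n \<sigma> v. \<sigma> \<in> P \<Longrightarrow> v \<in> stk N n \<sigma> \<Longrightarrow> t n \<sigma> (s n \<sigma> v) = v" and inj: "\<And>n. ginj P (obj K n)"
  shows "ginj P (obj N n)"
  by (rule ginj_retract[OF inj cpx_sheaf[OF N] map_hom[OF s] map_hom[OF t] ts P])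

lemma zero_sheaf_ginj:
  assumes "is_sheaf P F" "\<And>\<sigma>. \<sigma> \<in> P \<Longrightarrow> stalk F \<sigma> = {0}" "finite P"
  shows "ginj P F"
  unfolding ginj_def god_retraction_def
  using assms hom_zero[OF godement_sheaf[OF assms(3,1)] assms(1)] by (intro exI[of _ "\<lambda>_ _. 0"]) simp

text \<open>The induction measure for resolutions. The down-closure is taken because the cokernel at
  \<sigma> sees all stalks strictly above \<sigma>, so the support itself may grow
  downwards.\<close>

definition support_down :: "'a::order set \<Rightarrow> ('a, 'i, 'k::field) cpx \<Rightarrow> 'a set" where
  "support_down P C = {\<sigma>\<in>P. \<exists>p\<in>P. \<sigma> \<le> p \<and> (\<exists>n. stk C n p \<noteq> {0})}"

text \<open>A nonzero stalk of the cokernel at \<open>p\<close> requires a nonzero stalk of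
  \<open>C\<close> strictly above \<open>p\<close>. Hence a maximal point of the support of
  \<open>C\<close> leaves the down-closure.\<close>

lemma support_quot:
  assumes P: "finite P" and C: "bounded_complex P C" and ne: "support_down P C \<noteq> {}"
    and N: "bounded_complex P N" and s: "chain_map P N (quot_cpx P C) s" and t: "chain_map P (quot_cpx P C) N t"
    and ts: "\<And>n \<sigma> v. \<sigma> \<in> P \<Longrightarrow> v \<in> stk N n \<sigma> \<Longrightarrow> t n \<sigma> (s n \<sigma> v) = v"
  shows "card (support_down P N) < card (support_down P C)"
proof (rule psubset_card_mono)
  show "finite (support_down P C)" using P by (simp add: support_down_def)
  have *: "\<exists>p'\<in>P. p < p' \<and> stk C n p' \<noteq> {0}" if p: "p \<in> P" and n: "stk N n p \<noteq> {0}" for p n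
  proof -
    obtain v where v: "v \<in> stk N n p" "v \<noteq> 0" using n c_0[OF N p, of n] by blast
    have Q: "bounded_complex P (quot_cpx P C)" by (rule quot_cpx_complex[OF P C])
    have sv: "s n p v \<in> stk (quot_cpx P C) n p" by (rule f_in[OF N s p v(1)])
    have "s n p v \<noteq> 0" using ts[OF p v(1)] v(2) f_0[OF Q t p] by metis
    then obtain q where q: "curry (s n p v) q \<noteq> 0" by (metis curry_eqI curry_zero)
    then have "q \<in> P" "p < q" "curry (s n p v) q \<in> stk C n q"
      using sv by (auto simp: quot_cpx_def god_quot_stalk)
    then show ?thesis using q by blast
  qed
  have "finite {p\<in>P. \<exists>n. stk C n p \<noteq> {0}}" "{p\<in>P. \<exists>n. stk C n p \<noteq> {0}} \<noteq> {}"
    using P ne by (auto simp: support_down_def)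
  then obtain m where m: "m \<in> P" "\<exists>n. stk C n m \<noteq> {0}" "\<And>p. p \<in> P \<Longrightarrow> \<exists>n. stk C n p \<noteq> {0} \<Longrightarrow> m \<le> p \<Longrightarrow> p = m"
    using finite_has_maximal[of "{p\<in>P. \<exists>n. stk C n p \<noteq> {0}}"] by blast
  have "m \<in> support_down P C" using m by (auto simp: support_down_def)
  moreover have "m \<notin> support_down P N"
  proof
    assume "m \<in> support_down P N"
    then obtain p n where p: "p \<in> P" "m \<le> p" "stk N n p \<noteq> {0}" unfolding support_down_def by blast
    then obtain p' where p': "p' \<in> P" "p < p'" "stk C n p' \<noteq> {0}" using * by blast
    have "m < p'" using p(2) p'(2) by (rule order.strict_trans1)
    have "\<exists>n. stk C n p' \<noteq> {0}" using p'(3) by (rule exI)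
    then have "p' = m" by (rule m(3)[OF p'(1) _ order.strict_implies_order[OF \<open>m < p'\<close>]])
    then show False using \<open>m < p'\<close> by simp
  qed
  moreover have "support_down P N \<subseteq> support_down P C"
  proof
    fix x assume "x \<in> support_down P N"
    then obtain p n where x: "x \<in> P" "p \<in> P" "x \<le> p" "stk N n p \<noteq> {0}" by (auto simp: support_down_def)
    obtain p' where "p' \<in> P" "p < p'" "stk C n p' \<noteq> {0}" using *[OF x(2,4)] by blast
    then show "x \<in> support_down P C" using x unfolding support_down_def by (auto intro!: bexI[of _ p'])
  qed
  ultimately show "support_down P N \<subset> support_down P C" by blast
qed

text \<open>In the exact sequence of the Godement embedding the middle term is injective, so a
  resolution of the cokernel yields one of \<open>C\<close> by the cocone. The index type is fixed
  to \<open>nat\<close> because an induction hypothesis cannot change type, whereas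
  \<open>quot_cpx\<close> does; a model over \<open>nat\<close> is inserted before the
  recursion.\<close>

lemma injective_resolution_nat:
  fixes C :: "('a::order, nat, 'k::field) cpx"
  assumes P: "finite P" and C: "bounded_complex P C"
  shows "\<exists>(J :: ('a, nat, 'k) cpx) \<phi>. bounded_complex P J \<and> (\<forall>n. ginj P (obj J n)) \<and> quasi_iso P C J \<phi>"
  using C
proof (induct "card (support_down P C)" arbitrary: C rule: less_induct)
  case less
  note C = less.prems
  show ?case
  proof (cases "support_down P C = {}")
    case True
    then have "stk C n \<sigma> = {0}" if "\<sigma> \<in> P" for n \<sigma>
      using that by (auto simp: support_down_def)
    then have "ginj P (obj C n)" for n by (intro zero_sheaf_ginj cpx_sheaf[OF C] P) auto
    then show ?thesis using C quasi_iso_id[OF C] by blast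
  next
    case False
    let ?Q = "quot_cpx P C" and ?G = "god_cpx P C"
    have Q: "bounded_complex P ?Q" by (rule quot_cpx_complex[OF P C])
    have G: "bounded_complex P ?G" by (rule god_cpx_complex[OF P C])
    obtain N :: "('a, nat, 'k) cpx" and t s where N: "bounded_complex P N" "quasi_iso P ?Q N t" "chain_map P N ?Q s" "chain_map P ?Q N t"
        "\<forall>n. \<forall>\<sigma>\<in>P. \<forall>v\<in>stk N n \<sigma>. t n \<sigma> (s n \<sigma> v) = v"
      using cpx_nat_model[OF Q] by blast
    have "card (support_down P N) < card (support_down P C)"
      using support_quot[OF P C False N(1,3,4)] N(5) by blast
    then obtain J :: "('a, nat, 'k) cpx" and \<psi> where J: "bounded_complex P J" "\<And>n. ginj P (obj J n)" "quasi_iso P N J \<psi>"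
      using less.hyps[OF _ N(1)] by blast
    define c where "c = (\<lambda>n \<sigma> v. \<psi> n \<sigma> (t n \<sigma> v))"
    have c: "quasi_iso P ?Q J c" unfolding c_def by (rule quasi_iso_comp[OF Q N(1) J(1) N(2) J(3)])
    define i where "i = (\<lambda>n. god_unit P (obj C n))"
    define q where "q = (\<lambda>n. god_proj P (obj C n))"
    have i: "chain_map P C ?G i"
      unfolding chain_map_def i_def god_cpx_def cpx.simps
      using god_unit_hom[OF cpx_sheaf[OF C]] god_fun_unit[OF cpx_sheaf[OF C] cpx_diff[OF C]] by auto
    have q: "chain_map P ?G ?Q q"
      unfolding chain_map_def q_def god_cpx_def quot_cpx_def cpx.simps
      using god_proj_hom[OF cpx_sheaf[OF C]] god_fun_proj[OF cpx_sheaf[OF C] cpx_diff[OF C]] by auto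
    \<comment> \<open>The Godement complex serves as its own resolution, so the composite c q is
      already defined on it and the homotopy in \<open>cocone_resolves\<close> is 0.\<close>
    have b: "chain_map P ?G J (\<lambda>n \<sigma> v. c n \<sigma> (q n \<sigma> v))" by (rule chain_map_comp[OF q qi_map[OF c]])
    have h: "hty P ?G J (\<lambda>n \<sigma> v. c n \<sigma> (q n \<sigma> v)) (\<lambda>n \<sigma> v. c n \<sigma> (q n \<sigma> v)) (\<lambda>_ _ _. 0)"
      unfolding hty_def using hom_zero[OF cpx_sheaf[OF G] cpx_sheaf[OF J(1)]] d_0[OF J(1)] by simp
    let ?K = "cocone ?G J (\<lambda>n \<sigma> v. c n \<sigma> (q n \<sigma> v))"
    have K: "bounded_complex P ?K" by (rule cocone_complex[OF G J(1) b])
    have qiK: "quasi_iso P C ?K (\<lambda>n \<sigma> x. case_sum (i n \<sigma> x) 0)"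
    proof (rule cocone_resolves[OF C G Q G J(1) i q _ _ _ _ quasi_iso_id[OF G] c b h])
      fix n \<sigma> x assume s: "\<sigma> \<in> P" and x: "x \<in> stk C n \<sigma>"
      show "i n \<sigma> x = 0 \<Longrightarrow> x = 0" unfolding i_def by (rule god_unit_eq_0[OF cpx_sheaf[OF C] s x])
      show "q n \<sigma> (i n \<sigma> x) = 0" unfolding i_def q_def by (rule god_proj_unit[OF cpx_sheaf[OF C] s x])
    next
      fix n \<sigma> b assume s: "\<sigma> \<in> P" and b: "b \<in> stk ?G n \<sigma>" "q n \<sigma> b = 0"
      have b': "b \<in> stalk (godement P (obj C n)) \<sigma>" using b(1) by (simp add: god_cpx_def)
      show "\<exists>a\<in>stk C n \<sigma>. b = i n \<sigma> a"
        unfolding i_def using god_exact[OF cpx_sheaf[OF C] s b' b(2)[unfolded q_def]] godement_inside[OF b' s order_refl] by blast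
    next
      fix n \<sigma> c assume s: "\<sigma> \<in> P" and c: "c \<in> stk ?Q n \<sigma>"
      have c': "c \<in> stalk (god_quot P (obj C n)) \<sigma>" using c by (simp add: quot_cpx_def)
      show "\<exists>b\<in>stk ?G n \<sigma>. c = q n \<sigma> b"
        using god_proj_surj[OF cpx_sheaf[OF C] s c'] by (intro bexI[of _ c]) (simp_all add: q_def god_cpx_def)
    qed
    have injK: "ginj P (obj ?K n)" for n
      unfolding cocone_obj god_cpx_def cpx.simps by (rule ginj_dsum[OF ginj_godement[OF P cpx_sheaf[OF C]] J(2) P])
    obtain M :: "('a, nat, 'k) cpx" and t' s' where M: "bounded_complex P M" "quasi_iso P ?K M t'" "chain_map P M ?K s'" "chain_map P ?K M t'"
        "\<forall>n. \<forall>\<sigma>\<in>P. \<forall>v\<in>stk M n \<sigma>. t' n \<sigma> (s' n \<sigma> v) = v"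
      using cpx_nat_model[OF K] by blast
    have "ginj P (obj M n)" for n
      by (rule ginj_transfer[OF P K M(1,4,3) _ injK]) (use M(5) in blast)
    then show ?thesis using M(1) quasi_iso_comp[OF C K M(1) qiK M(2)] by blast
  qed
qed

lemma injective_resolution:
  fixes C :: "('a::order, 'i, 'k::field) cpx"
  assumes P: "finite P" and C: "bounded_complex P C"
  shows "\<exists>(J :: ('a, nat, 'k) cpx) \<phi>. bounded_complex P J \<and> (\<forall>n. ginj P (obj J n)) \<and> quasi_iso P C J \<phi>"
proof -
  obtain N :: "('a, nat, 'k) cpx" and t where N: "bounded_complex P N" "quasi_iso P C N t"
    using cpx_nat_model[OF C] by blast
  obtain J :: "('a, nat, 'k) cpx" and \<phi> where "bounded_complex P J" "\<forall>n. ginj P (obj J n)" "quasi_iso P N J \<phi>"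
    using injective_resolution_nat[OF P N(1)] by blast
  then show ?thesis using quasi_iso_comp[OF C N(1) _ N(2)] by blast
qed


section \<open>Socles and minimal resolutions\<close>

text \<open>Homomorphisms from the simple sheaf at \<open>p\<close>. For the sheaf [q] this space is
  a line if p = q and 0 otherwise, so it counts the summands [p].\<close>

definition soc :: "'a::order set \<Rightarrow> ('a, 'i, 'k::field) sheaf \<Rightarrow> 'a \<Rightarrow> ('i \<Rightarrow> 'k) set" where
  "soc P F p = {v \<in> stalk F p. \<forall>\<tau>\<in>P. p < \<tau> \<longrightarrow> res F p \<tau> v = 0}"

lemma soc_in: "v \<in> soc P F p \<Longrightarrow> v \<in> stalk F p"
  and soc_res: "v \<in> soc P F p \<Longrightarrow> \<tau> \<in> P \<Longrightarrow> p < \<tau> \<Longrightarrow> res F p \<tau> v = 0"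
  by (simp_all add: soc_def)

lemma subsp_soc:
  assumes F: "is_sheaf P F" and p: "p \<in> P"
  shows "subsp (soc P F p)"
  by (rule subspI) (auto simp: soc_def subsp_0 subsp_add subsp_scale sheaf_subsp[OF F p] lm_0[OF sheaf_res[OF F p]]
      lm_add[OF sheaf_res[OF F p]] lm_scale[OF sheaf_res[OF F p]])

lemma findim_soc: "is_sheaf P F \<Longrightarrow> p \<in> P \<Longrightarrow> findim_space (soc P F p)"
  using findim_subset[OF sheaf_findim subsp_soc] soc_in by blast

lemma hom_soc:
  assumes f: "sheaf_hom P F G \<phi>" and F: "is_sheaf P F" and p: "p \<in> P" and v: "v \<in> soc P F p"
  shows "\<phi> p v \<in> soc P G p"
  unfolding soc_def
proof (intro CollectI conjI ballI impI)
  show "\<phi> p v \<in> stalk G p" by (rule hom_in[OF f p soc_in[OF v]])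
  fix \<tau> assume t: "\<tau> \<in> P" "p < \<tau>"
  show "res G p \<tau> (\<phi> p v) = 0"
    unfolding hom_nat[OF f p t(1) less_imp_le[OF t(2)] soc_in[OF v], symmetric] soc_res[OF v t] hom0[OF f F t(1)] ..
qed

text \<open>A retraction of the unit turns a socle vector at \<open>p\<close> into a map from \<open>[p]\<close> to the sheaf.\<close>

definition point_sec :: "('a \<Rightarrow> ('a \<times> 'i \<Rightarrow> 'k::field) \<Rightarrow> 'i \<Rightarrow> 'k) \<Rightarrow> 'a \<Rightarrow> ('i \<Rightarrow> 'k) \<Rightarrow> 'a \<Rightarrow> 'i \<Rightarrow> 'k" where
  "point_sec r p v \<sigma> = r \<sigma> (case_prod (\<lambda>q. if q = p then v else 0))"

text \<open>The images of 1 under a homomorphism from [p]; values at points that are not below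
  \<open>p\<close> are left free.\<close>

definition point_family :: "'a::order set \<Rightarrow> ('a, 'i, 'k::field) sheaf \<Rightarrow> 'a \<Rightarrow> ('a \<Rightarrow> 'i \<Rightarrow> 'k) \<Rightarrow> bool" where
  "point_family P F p w \<longleftrightarrow> (\<forall>\<sigma>\<in>P. \<sigma> \<le> p \<longrightarrow> w \<sigma> \<in> stalk F \<sigma>) \<and>
     (\<forall>\<sigma>\<in>P. \<forall>\<tau>\<in>P. \<sigma> \<le> p \<longrightarrow> \<sigma> \<le> \<tau> \<longrightarrow> res F \<sigma> \<tau> (w \<sigma>) = (if \<tau> \<le> p then w \<tau> else 0))"

lemma point_sec:
  assumes r: "god_retraction P F r" and p: "p \<in> P" and v: "v \<in> soc P F p"
  shows "point_family P F p (point_sec r p v)" "point_sec r p v p = v"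
proof -
  have F: "is_sheaf P F" and rh: "sheaf_hom P (godement P F) F r"
    and ru: "\<And>\<sigma> v. \<sigma> \<in> P \<Longrightarrow> v \<in> stalk F \<sigma> \<Longrightarrow> r \<sigma> (god_unit P F \<sigma> v) = v"
    using r by (auto simp: god_retraction_def)
  let ?d = "case_prod (\<lambda>q. if q = p then v else 0) :: 'a \<times> 'b \<Rightarrow> 'c"
  have d: "?d \<in> stalk (godement P F) \<sigma>" if "\<sigma> \<le> p" for \<sigma>
    using that p soc_in[OF v] subsp_0[OF sheaf_subsp[OF F]] by (intro godement_stalkI) auto
  show "point_family P F p (point_sec r p v)"
    unfolding point_family_def
  proof (intro conjI ballI impI)
    fix \<sigma> assume "\<sigma> \<in> P" "\<sigma> \<le> p"
    then show "point_sec r p v \<sigma> \<in> stalk F \<sigma>" unfolding point_sec_def by (rule hom_in[OF rh _ d])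
  next
    fix \<sigma> \<tau> assume s: "\<sigma> \<in> P" "\<tau> \<in> P" "\<sigma> \<le> p" "\<sigma> \<le> \<tau>"
    have "res (godement P F) \<sigma> \<tau> ?d = (if \<tau> \<le> p then ?d else 0)"
      by (rule curry_eqI) (auto simp: godement_res)
    moreover have "linear_map (stalk (godement P F) \<tau>) (stalk F \<tau>) (r \<tau>)" by (rule hom_lm[OF rh s(2)])
    moreover have "subsp (stalk (godement P F) \<tau>)"
      unfolding godement_def sheaf.simps by (rule subsp_prod) (simp add: sheaf_subsp[OF F])
    ultimately show "res F \<sigma> \<tau> (point_sec r p v \<sigma>) = (if \<tau> \<le> p then point_sec r p v \<tau> else 0)"
      unfolding point_sec_def hom_nat[OF rh s(1,2,4) d[OF s(3)], symmetric] using lm_0 by auto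
  qed
  \<comment> \<open>A socle vector restricts to 0 strictly above \<open>p\<close>, so its unit has
    only the coordinate \<open>p\<close>.\<close>
  have "?d = god_unit P F p v"
  proof (rule curry_eqI)
    fix q show "curry ?d q = curry (god_unit P F p v) q"
      using sheaf_res_id[OF F p soc_in[OF v]] soc_res[OF v, of q] p
      by (cases "q = p") (auto simp: curry_god_map less_le)
  qed
  then show "point_sec r p v p = v" unfolding point_sec_def using ru[OF p soc_in[OF v]] by simp
qed

text \<open>
  Homomorphisms into \<open>[p]\<close> are linear functionals on the stalk at \<open>p\<close>; a scaled coordinate
  suffices as functional.
\<close>

definition point_map :: "('a::order, 'j, 'k::field) sheaf \<Rightarrow> 'a \<Rightarrow> ('a \<Rightarrow> 'i \<Rightarrow> 'k) \<Rightarrow> 'j \<Rightarrow> 'k \<Rightarrow> 'a \<Rightarrow> ('j \<Rightarrow> 'k) \<Rightarrow> 'i \<Rightarrow> 'k" where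
  "point_map G p w i c \<sigma> x = (if \<sigma> \<le> p then vscale (res G \<sigma> p x i / c) (w \<sigma>) else 0)"

lemma point_map_hom:
  assumes G: "is_sheaf P G" and F: "is_sheaf P F" and p: "p \<in> P" and w: "point_family P F p w"
  shows "sheaf_hom P G F (point_map G p w i c)"
proof (rule sheaf_homI)
  have win: "\<And>\<sigma>. \<sigma> \<in> P \<Longrightarrow> \<sigma> \<le> p \<Longrightarrow> w \<sigma> \<in> stalk F \<sigma>"
    and wres: "\<And>\<sigma> \<tau>. \<sigma> \<in> P \<Longrightarrow> \<tau> \<in> P \<Longrightarrow> \<sigma> \<le> p \<Longrightarrow> \<sigma> \<le> \<tau> \<Longrightarrow> res F \<sigma> \<tau> (w \<sigma>) = (if \<tau> \<le> p then w \<tau> else 0)"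
    using w unfolding point_family_def by blast+
  {
    fix \<sigma> assume s: "\<sigma> \<in> P"
    have sF: "subsp (stalk F \<sigma>)" by (rule sheaf_subsp[OF F s])
    show "linear_map (stalk G \<sigma>) (stalk F \<sigma>) (point_map G p w i c \<sigma>)"
    proof (rule linear_mapI)
      fix x assume "x \<in> stalk G \<sigma>"
      show "point_map G p w i c \<sigma> x \<in> stalk F \<sigma>"
        using subsp_0[OF sF] subsp_scale[OF sF win[OF s]] by (auto simp: point_map_def)
    next
      fix x y assume "x \<in> stalk G \<sigma>" "y \<in> stalk G \<sigma>"
      then show "point_map G p w i c \<sigma> (x + y) = point_map G p w i c \<sigma> x + point_map G p w i c \<sigma> y"
        using lm_add[OF sheaf_res[OF G s p]] by (simp add: point_map_def add_divide_distrib kfun.scale_left_distrib)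
    next
      fix a x assume "x \<in> stalk G \<sigma>"
      then show "point_map G p w i c \<sigma> (vscale a x) = vscale a (point_map G p w i c \<sigma> x)"
        using lm_scale[OF sheaf_res[OF G s p]] by (simp add: point_map_def) (simp add: vscale_def)
    qed
  next
    fix \<sigma> \<tau> v assume s: "\<sigma> \<in> P" "\<tau> \<in> P" "\<sigma> \<le> \<tau>" and v: "v \<in> stalk G \<sigma>"
    show "point_map G p w i c \<tau> (res G \<sigma> \<tau> v) = res F \<sigma> \<tau> (point_map G p w i c \<sigma> v)"
    proof (cases "\<sigma> \<le> p")
      case True
      then show ?thesis
        using lm_scale[OF sheaf_res[OF F s] win[OF s(1) True]] wres[OF s(1,2) True s(3)] sheaf_res_res[OF G s(1,2) p s(3) _ v]
        by (simp add: point_map_def)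
    next
      case False
      then have "\<not> \<tau> \<le> p" using s(3) by (meson order.trans)
      then show ?thesis using False lm_0[OF sheaf_res[OF F s] sheaf_subsp[OF F s(1)]] by (simp add: point_map_def)
    qed
  }
qed

section \<open>Reduced complexes and the splitting of contractible summands\<close>

definition reduced :: "'a::order set \<Rightarrow> ('a, 'i, 'k::field) cpx \<Rightarrow> bool" where
  "reduced P K \<longleftrightarrow> (\<forall>n. \<forall>p\<in>P. \<forall>v\<in>soc P (obj K n) p. diff K n p v = 0)"

definition sub_sheaf :: "('a, 'i, 'k::field) sheaf \<Rightarrow> ('a \<Rightarrow> ('i \<Rightarrow> 'k) set) \<Rightarrow> ('a, 'i, 'k) sheaf" where
  "sub_sheaf F V = \<lparr> stalk = V, res = res F \<rparr>"

lemma sub_sheaf_simps [simp]: "stalk (sub_sheaf F V) = V" "res (sub_sheaf F V) = res F"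
  by (simp_all add: sub_sheaf_def)

lemma sub_sheaf:
  assumes F: "is_sheaf P F" and sub: "\<And>\<sigma>. \<sigma> \<in> P \<Longrightarrow> V \<sigma> \<subseteq> stalk F \<sigma>" and V: "\<And>\<sigma>. \<sigma> \<in> P \<Longrightarrow> subsp (V \<sigma>)"
    and cl: "\<And>\<sigma> \<tau> x. \<sigma> \<in> P \<Longrightarrow> \<tau> \<in> P \<Longrightarrow> \<sigma> \<le> \<tau> \<Longrightarrow> x \<in> V \<sigma> \<Longrightarrow> res F \<sigma> \<tau> x \<in> V \<tau>"
  shows "is_sheaf P (sub_sheaf F V)" "sheaf_hom P (sub_sheaf F V) F (\<lambda>_ v. v)"
proof -
  have in': "x \<in> stalk F \<sigma>" if "\<sigma> \<in> P" "x \<in> V \<sigma>" for \<sigma> x using sub that by blast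
  show "is_sheaf P (sub_sheaf F V)"
  proof (rule is_sheafI, unfold sub_sheaf_simps)
    fix \<sigma> \<tau> assume s: "\<sigma> \<in> P" "\<tau> \<in> P" "\<sigma> \<le> \<tau>"
    show "linear_map (V \<sigma>) (V \<tau>) (res F \<sigma> \<tau>)"
      by (rule lm_restrict[OF sheaf_res[OF F s] sub[OF s(1)] cl[OF s]])
  qed (auto simp: in' sheaf_res_id[OF F] sheaf_res_res[OF F] intro: findim_subset[OF sheaf_findim[OF F] V sub])
  show "sheaf_hom P (sub_sheaf F V) F (\<lambda>_ v. v)"
    by (rule sheaf_homI) (auto intro: lm_restrict[OF lm_id] in')
qed

lemma kernel_sheaf:
  assumes F: "is_sheaf P F" and G: "is_sheaf P G" and f: "sheaf_hom P F G \<phi>"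
  shows "is_sheaf P (sub_sheaf F (\<lambda>\<sigma>. {x \<in> stalk F \<sigma>. \<phi> \<sigma> x = 0}))"
    "sheaf_hom P (sub_sheaf F (\<lambda>\<sigma>. {x \<in> stalk F \<sigma>. \<phi> \<sigma> x = 0})) F (\<lambda>_ v. v)"
proof -
  have *: "res F \<sigma> \<tau> x \<in> {x \<in> stalk F \<tau>. \<phi> \<tau> x = 0}"
    if "\<sigma> \<in> P" "\<tau> \<in> P" "\<sigma> \<le> \<tau>" "x \<in> {x \<in> stalk F \<sigma>. \<phi> \<sigma> x = 0}" for \<sigma> \<tau> x
    using that sheaf_res_in[OF F] hom_nat[OF f] lm_0[OF sheaf_res[OF G] sheaf_subsp[OF G]] by simp
  show "is_sheaf P (sub_sheaf F (\<lambda>\<sigma>. {x \<in> stalk F \<sigma>. \<phi> \<sigma> x = 0}))"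
    "sheaf_hom P (sub_sheaf F (\<lambda>\<sigma>. {x \<in> stalk F \<sigma>. \<phi> \<sigma> x = 0})) F (\<lambda>_ v. v)"
    by (rule sub_sheaf[OF F _ subsp_kernel[OF hom_lm[OF f] sheaf_subsp[OF F]] *]; blast)+
qed

text \<open>
  If \<open>d\<close> does not kill a socle vector \<open>v\<close>, the contractible summand \<open>[p] \<rightarrow> [p]\<close> that it generates
  splits off. With \<open>s\<close> the map back, \<open>s d s = s\<close>, and the complement consists of kernels.
\<close>

lemma split_off:
  fixes K :: "('a::order, 'i, 'k::field) cpx"
  assumes P: "finite P" and K: "bounded_complex P K" and inj: "\<And>n. ginj P (obj K n)"
    and p: "p \<in> P" and v: "v \<in> soc P (obj K m) p" and dv: "diff K m p v \<noteq> 0"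
  shows "\<exists>(L :: ('a, 'i, 'k) cpx) e. bounded_complex P L \<and> (\<forall>n. ginj P (obj L n)) \<and> quasi_iso P K L e \<and>
    (\<forall>n. \<forall>\<sigma>\<in>P. stk L n \<sigma> \<subseteq> stk K n \<sigma>) \<and> v \<notin> stk L m p"
proof -
  obtain r where r: "god_retraction P (obj K m) r" using inj unfolding ginj_def by blast
  define w where "w = point_sec r p v"
  have w: "point_family P (obj K m) p w" "w p = v" unfolding w_def using point_sec[OF r p v] by auto
  \<comment> \<open>A coordinate that is nonzero on d v, divided by its value there, is a functional
    with value 1 on d v.\<close>
  obtain i where i: "diff K m p v i \<noteq> 0" using dv by (auto simp: fun_eq_iff)
  define s where "s = point_map (obj K (m + 1)) p w i (diff K m p v i)"
  have sh: "sheaf_hom P (obj K (m + 1)) (obj K m) s"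
    unfolding s_def by (rule point_map_hom[OF cpx_sheaf[OF K] cpx_sheaf[OF K] p w(1)])
  have win: "\<And>\<sigma>. \<sigma> \<in> P \<Longrightarrow> \<sigma> \<le> p \<Longrightarrow> w \<sigma> \<in> stk K m \<sigma>"
    and wres: "\<And>\<sigma>. \<sigma> \<in> P \<Longrightarrow> \<sigma> \<le> p \<Longrightarrow> res (obj K m) \<sigma> p (w \<sigma>) = v"
    using w p unfolding point_family_def by auto
  have dw: "s \<sigma> (diff K m \<sigma> (w \<sigma>)) = w \<sigma>" if "\<sigma> \<in> P" "\<sigma> \<le> p" for \<sigma>
    using i that hom_nat[OF cpx_diff[OF K] that(1) p that(2) win[OF that]]
    by (simp add: s_def point_map_def wres)
  have sds: "s \<sigma> (diff K m \<sigma> (s \<sigma> x)) = s \<sigma> x" if g: "\<sigma> \<in> P" for \<sigma> x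
  proof (cases "\<sigma> \<le> p")
    case True
    define a where "a = res (obj K (m + 1)) \<sigma> p x i / diff K m p v i"
    have a: "s \<sigma> x = vscale a (w \<sigma>)" using True by (simp add: s_def point_map_def a_def)
    show ?thesis
      unfolding a lm_scale[OF d_lm[OF K g] win[OF g True]] lm_scale[OF hom_lm[OF sh g] d_in[OF K g win[OF g True]]] dw[OF g True] ..
  next
    case False
    then have "s \<sigma> y = 0" for y by (simp add: s_def point_map_def)
    then show ?thesis by simp
  qed
  have s0: "s \<sigma> 0 = 0" if "\<sigma> \<in> P" for \<sigma> by (rule hom0[OF sh cpx_sheaf[OF K] that])
  have s_in: "s \<sigma> x \<in> stk K m \<sigma>" if "\<sigma> \<in> P" "x \<in> stk K (m + 1) \<sigma>" for \<sigma> x by (rule hom_in[OF sh that])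
  \<comment> \<open>The complement is ker s in degree m + 1, ker (s d) in degree m, and everything
    in the other degrees, where \<psi> is 0.\<close>
  define \<psi> where "\<psi> n = (if n = m + 1 then s else if n = m then (\<lambda>\<sigma> x. s \<sigma> (diff K m \<sigma> x)) else (\<lambda>_ _. 0))" for n
  have psi: "sheaf_hom P (obj K n) (obj K m) (\<psi> n)" for n
    using sh hom_comp[OF cpx_diff[OF K] sh] hom_zero[OF cpx_sheaf[OF K] cpx_sheaf[OF K]] by (simp add: \<psi>_def)
  define V where "V n \<sigma> = {x \<in> stk K n \<sigma>. \<psi> n \<sigma> x = 0}" for n \<sigma>
  define L where "L = \<lparr> obj = (\<lambda>n. sub_sheaf (obj K n) (V n)), diff = diff K \<rparr>"
  have L_simps: "obj L n = sub_sheaf (obj K n) (V n)" "diff L = diff K" "stk L n \<sigma> = V n \<sigma>" for n \<sigma>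
    by (simp_all add: L_def)
  have Ls: "is_sheaf P (obj L n)" "sheaf_hom P (obj L n) (obj K n) (\<lambda>_ v. v)" for n
    unfolding L_simps V_def using kernel_sheaf[OF cpx_sheaf[OF K] cpx_sheaf[OF K] psi] by auto
  have VK: "x \<in> V n \<sigma> \<Longrightarrow> x \<in> stk K n \<sigma>" for x n \<sigma> by (simp add: V_def)
  have dV: "diff K n \<sigma> x \<in> V (n + 1) \<sigma>" if g: "\<sigma> \<in> P" and x: "x \<in> V n \<sigma>" for n \<sigma> x
    using x d_in[OF K g VK[OF x]] d_d[OF K g VK[OF x]] s0[OF g] by (auto simp: V_def \<psi>_def)
  have Ld: "sheaf_hom P (obj L n) (obj L (n + 1)) (diff L n)" for n
    by (rule sheaf_homI; unfold L_simps sub_sheaf_simps)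
      (auto intro: lm_restrict[OF d_lm[OF K]] VK dV hom_nat[OF cpx_diff[OF K]])
  have L: "bounded_complex P L"
    unfolding bounded_complex_def
  proof (intro conjI allI ballI Ls Ld)
    fix n \<sigma> x assume "\<sigma> \<in> P" "x \<in> stk L n \<sigma>"
    then show "diff L (n + 1) \<sigma> (diff L n \<sigma> x) = 0"
      unfolding L_simps sub_sheaf_simps using d_d[OF K _ VK] by blast
  next
    obtain M where M: "\<And>n. \<bar>n\<bar> > M \<Longrightarrow> zero_sheaf P (obj K n)" using cpx_bounded[OF K] by blast
    have "zero_sheaf P (obj L n)" if "\<bar>n\<bar> > M" for n
    proof -
      have "V n \<sigma> = {0}" if "\<sigma> \<in> P" for \<sigma>
      proof
        have "stk K n \<sigma> = {0}" using M[OF \<open>\<bar>n\<bar> > M\<close>] that by (simp add: zero_sheaf_def)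
        then show "V n \<sigma> \<subseteq> {0}" using VK by blast
        show "{0} \<subseteq> V n \<sigma>" using subsp_0[OF sheaf_subsp[OF Ls(1)[of n] that]] by (simp add: L_simps)
      qed
      then show ?thesis by (simp add: zero_sheaf_def L_simps)
    qed
    then show "\<exists>N. \<forall>n. N < \<bar>n\<bar> \<longrightarrow> zero_sheaf P (obj L n)" by blast
  qed
  \<comment> \<open>The projections 1 - d s and 1 - s d onto these kernels. They differ from the
    identity by the homotopy terms of \<open>s\<close>, hence induce isomorphisms on
    cohomology.\<close>
  define e where "e n = (if n = m + 1 then (\<lambda>\<sigma> x. x - diff K m \<sigma> (s \<sigma> x)) else
      if n = m then (\<lambda>\<sigma> x. x - s \<sigma> (diff K m \<sigma> x)) else (\<lambda>_ x. x))" for n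
  have eK: "sheaf_hom P (obj K n) (obj K n) (e n)" for n
    using hom_minus[OF cpx_sheaf[OF K] hom_id hom_comp[OF sh cpx_diff[OF K]]]
      hom_minus[OF cpx_sheaf[OF K] hom_id hom_comp[OF cpx_diff[OF K] sh]] hom_id
    by (auto simp: e_def)
  have eV: "e n \<sigma> x \<in> V n \<sigma>" if g: "\<sigma> \<in> P" and x: "x \<in> stk K n \<sigma>" for n \<sigma> x
  proof -
    have "\<psi> n \<sigma> (e n \<sigma> x) = 0"
    proof (cases "n = m + 1")
      case True
      then have x': "x \<in> stk K (m + 1) \<sigma>" using x by simp
      have "s \<sigma> (x - diff K m \<sigma> (s \<sigma> x)) = 0"
        unfolding hom_diff[OF sh cpx_sheaf[OF K] g x' d_in[OF K g s_in[OF g x']]] sds[OF g] by simp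
      then show ?thesis using True by (simp add: \<psi>_def e_def)
    next
      case False
      have "s \<sigma> (diff K m \<sigma> (x - s \<sigma> (diff K m \<sigma> x))) = 0" if "n = m"
      proof -
        have x': "x \<in> stk K m \<sigma>" using x that by simp
        note dx = d_in[OF K g x']
        show ?thesis
          unfolding d_diff[OF K g x' s_in[OF g dx]] hom_diff[OF sh cpx_sheaf[OF K] g dx d_in[OF K g s_in[OF g dx]]] sds[OF g] by simp
      qed
      then show ?thesis using False by (simp add: \<psi>_def e_def)
    qed
    then show ?thesis using hom_in[OF eK g x] by (simp add: V_def)
  qed
  have e_id: "e n \<sigma> x = x" if g: "\<sigma> \<in> P" and x: "x \<in> V n \<sigma>" for n \<sigma> x
    using x d_0[OF K g] s0[OF g] by (auto simp: V_def e_def \<psi>_def)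
  have eh: "sheaf_hom P (obj K n) (obj L n) (e n)" for n
    by (rule sheaf_homI; unfold L_simps sub_sheaf_simps)
      (auto intro: lm_restrict[OF hom_lm[OF eK]] eV hom_nat[OF eK])
  have injL: "ginj P (obj L n)" for n
    by (rule ginj_retract[OF inj Ls(1) Ls(2) eh _ P]) (simp add: L_simps e_id)
  have em: "chain_map P K L e"
    unfolding chain_map_def
  proof (intro conjI allI ballI eh)
    fix n \<sigma> x assume g: "\<sigma> \<in> P" and x: "x \<in> stk K n \<sigma>"
    consider "n = m" | "n = m + 1" | "n + 1 = m" | "n \<noteq> m" "n \<noteq> m + 1" "n + 1 \<noteq> m" by blast
    then show "e (n + 1) \<sigma> (diff K n \<sigma> x) = diff L n \<sigma> (e n \<sigma> x)"
    proof cases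
      case 1
      then show ?thesis
        using x d_diff[OF K g _ s_in[OF g d_in[OF K g]]] by (simp add: e_def L_simps)
    next
      case 2
      then have x': "x \<in> stk K (m + 1) \<sigma>" using x by simp
      show ?thesis
        using 2 d_diff[OF K g x' d_in[OF K g s_in[OF g x']]] d_d[OF K g s_in[OF g x']] by (simp add: e_def L_simps)
    next
      case 3
      then have "diff K m \<sigma> (diff K n \<sigma> x) = 0" using d_d[OF K g x] by simp
      then show ?thesis using 3 s0[OF g] by (auto simp: e_def L_simps)
    next
      case 4
      then show ?thesis by (auto simp: e_def L_simps)
    qed
  qed
  have "quasi_iso P K L e"
  proof (rule quasi_isoI[OF em])
    fix n \<sigma> z u assume g: "\<sigma> \<in> P" and z: "z \<in> stk K n \<sigma>" "diff K n \<sigma> z = 0" and u: "u \<in> stk L (n - 1) \<sigma>"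
      and ez: "e n \<sigma> z = diff L (n - 1) \<sigma> u"
    have uK: "u \<in> stk K (n - 1) \<sigma>" using u VK by (simp add: L_simps)
    show "\<exists>y\<in>stk K (n - 1) \<sigma>. z = diff K (n - 1) \<sigma> y"
    proof (cases "n = m + 1")
      case True
      then have z': "z \<in> stk K (m + 1) \<sigma>" using z by simp
      have u': "u \<in> stk K m \<sigma>" using uK True by simp
      have "z - diff K m \<sigma> (s \<sigma> z) = diff K m \<sigma> u" using ez True by (simp add: e_def L_simps)
      then have "z = diff K m \<sigma> (s \<sigma> z + u)" unfolding d_add[OF K g s_in[OF g z'] u'] by (simp add: algebra_simps)
      then show ?thesis using c_add[OF K g s_in[OF g z'] u'] True by auto
    next
      case False
      then have "z = diff K (n - 1) \<sigma> u"
        using ez z(2) s0[OF g] by (cases "n = m") (auto simp: e_def L_simps)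
      then show ?thesis using uK by blast
    qed
  next
    fix n \<sigma> x assume g: "\<sigma> \<in> P" and x: "x \<in> stk L n \<sigma>" and dx: "diff L n \<sigma> x = 0"
    have "x = e n \<sigma> x + diff L (n - 1) \<sigma> 0" "x \<in> stk K n \<sigma>" "diff K n \<sigma> x = 0"
      using e_id[OF g, of x n] VK[of x n \<sigma>] x dx d_0[OF L g] by (auto simp: L_simps)
    then show "\<exists>z\<in>stk K n \<sigma>. diff K n \<sigma> z = 0 \<and> (\<exists>u\<in>stk L (n - 1) \<sigma>. x = e n \<sigma> z + diff L (n - 1) \<sigma> u)"
      using c_0[OF L g] by blast
  qed
  moreover have "v \<notin> V m p"
  proof
    assume "v \<in> V m p"
    then have "s p (diff K m p v) = 0" by (simp add: V_def \<psi>_def)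
    then have "v = 0" using dw[OF p order_refl] w(2) by simp
    then show False using dv d_0[OF K p] by simp
  qed
  ultimately show ?thesis
    using L injL VK by (intro exI[of _ L] exI[of _ e]) (auto simp: L_simps)
qed

text \<open>Each use of \<open>split_off\<close> loses the vector \<open>v\<close>, so the total
  dimension drops. Stalks only shrink, so the same window of degrees from -N to N serves throughout
  the induction.\<close>

lemma reduce_injective_complex:
  fixes K :: "('a::order, 'i, 'k::field) cpx"
  assumes P: "finite P" and "bounded_complex P K" and "\<And>n. ginj P (obj K n)"
  shows "\<exists>(L :: ('a, 'i, 'k) cpx) e. bounded_complex P L \<and> (\<forall>n. ginj P (obj L n)) \<and> quasi_iso P K L e \<and> reduced P L"
proof -
  obtain N where "\<And>n. \<bar>n\<bar> > N \<Longrightarrow> zero_sheaf P (obj K n)" using cpx_bounded[OF assms(2)] by blast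
  then show ?thesis
    using assms(2,3)
  proof (induct "\<Sum>n\<in>{-N..N}. \<Sum>\<sigma>\<in>P. dm (stk K n \<sigma>)" arbitrary: K rule: less_induct)
    case less
    note K = less.prems(2)
    show ?case
    proof (cases "reduced P K")
      case True
      then show ?thesis using K less.prems(3) quasi_iso_id[OF K] by blast
    next
      case False
      then obtain m p v where v: "p \<in> P" "v \<in> soc P (obj K m) p" "diff K m p v \<noteq> 0"
        unfolding reduced_def by blast
      obtain L :: "('a, 'i, 'k) cpx" and e where L: "bounded_complex P L" "\<forall>n. ginj P (obj L n)" "quasi_iso P K L e"
        "\<forall>n. \<forall>\<sigma>\<in>P. stk L n \<sigma> \<subseteq> stk K n \<sigma>" "v \<notin> stk L m p"
        using split_off[OF P K less.prems(3) v] by blast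
      have z: "zero_sheaf P (obj L n)" if "\<bar>n\<bar> > N" for n
        using less.prems(1)[OF that] L(4) c_0[OF L(1), of _ n] unfolding zero_sheaf_def by blast
      have le: "dm (stk L n \<sigma>) \<le> dm (stk K n \<sigma>)" if "\<sigma> \<in> P" for n \<sigma>
        by (rule dim_mono[OF sheaf_findim[OF cpx_sheaf[OF K] that]]) (use L(4) that in blast)
      have vK: "v \<in> stk K m p" by (rule soc_in[OF v(2)])
      have "v \<noteq> 0" using v(3) d_0[OF K v(1)] by metis
      then have m: "m \<in> {-N..N}" using less.prems(1)[of m] vK v(1) by (force simp: zero_sheaf_def)
      have "dm (stk L m p) < dm (stk K m p)"
        by (rule dim_psubset[OF sheaf_findim[OF cpx_sheaf[OF K] v(1)] c_subsp[OF L(1) v(1)]])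
          (use L(4,5) v(1) vK in blast)
      then have "(\<Sum>\<sigma>\<in>P. dm (stk L m \<sigma>)) < (\<Sum>\<sigma>\<in>P. dm (stk K m \<sigma>))"
        using le v(1) P by (intro sum_strict_mono_ex1) auto
      then have "(\<Sum>n\<in>{-N..N}. \<Sum>\<sigma>\<in>P. dm (stk L n \<sigma>)) < (\<Sum>n\<in>{-N..N}. \<Sum>\<sigma>\<in>P. dm (stk K n \<sigma>))"
        using le m by (intro sum_strict_mono_ex1) (auto intro: sum_mono)
      then obtain L' :: "('a, 'i, 'k) cpx" and e' where L': "bounded_complex P L'" "\<forall>n. ginj P (obj L' n)" "quasi_iso P L L' e'" "reduced P L'"
        using less.hyps[of L] z L(1,2) by blast
      then show ?thesis using quasi_iso_comp[OF K L(1) L'(1) L(3) L'(3)] by blast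
    qed
  qed
qed

text \<open>Along the zigzag a quasi-isomorphism to \<open>J\<close> is maintained: an arrow leaving
  the current complex is passed by extension into the injective complex, an arrow entering it by
  composition.\<close>

lemma zigzag_quasi_iso:
  fixes J :: "('a::order, nat, 'k::field) cpx"
  assumes J: "bounded_complex P J" and inj: "\<And>n. ginj P (obj J n)" and q: "quasi_isomorphic P J K"
  shows "bounded_complex P K \<and> (\<exists>b. quasi_iso P K J b)"
  using q unfolding quasi_isomorphic_def
proof (induct rule: equivclp_induct)
  case base
  then show ?case using J quasi_iso_id[OF J] by blast
next
  case (step y z)
  then obtain a where y: "bounded_complex P y" and a: "quasi_iso P y J a" by blast
  from step(2) consider \<phi> where "bounded_complex P z" "quasi_iso P y z \<phi>" | \<phi> where "bounded_complex P z" "quasi_iso P z y \<phi>"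
    by blast
  then show ?case
  proof cases
    case 1
    obtain \<alpha> h where "chain_map P z J \<alpha>" "hty P y J (\<lambda>n \<sigma> v. \<alpha> n \<sigma> (\<phi> n \<sigma> v)) a h"
      using extend_along_quasi_iso[OF y 1 J inj qi_map[OF a]] by blast
    then have "quasi_iso P z J \<alpha>" by (rule quasi_iso_of_homotopy[OF y 1(1) J 1(2) a])
    then show ?thesis using 1(1) by blast
  next
    case 2
    then show ?thesis using quasi_iso_comp[OF 2(1) y J 2(2) a] by blast
  qed
qed

text \<open>Extending the identity of \<open>K\<close> along \<open>b\<close> gives
  \<open>\<alpha>\<close> with \<alpha> b homotopic to the identity, hence a quasi-isomorphism; the
  same step applied to \<open>\<alpha>\<close> gives \<open>\<beta>\<close>.\<close>

lemma homotopy_inverses: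
  assumes J: "bounded_complex P J" and injJ: "\<And>n. ginj P (obj J n)" and K: "bounded_complex P K" and injK: "\<And>n. ginj P (obj K n)"
    and b: "quasi_iso P K J b"
  shows "\<exists>\<alpha> \<beta> h h'. quasi_iso P J K \<alpha> \<and> chain_map P K J \<beta> \<and>
    hty P J J (\<lambda>n \<sigma> v. \<beta> n \<sigma> (\<alpha> n \<sigma> v)) (\<lambda>_ _ v. v) h \<and> hty P K K (\<lambda>n \<sigma> v. \<alpha> n \<sigma> (b n \<sigma> v)) (\<lambda>_ _ v. v) h'"
proof -
  obtain \<alpha> h' where a: "chain_map P J K \<alpha>" "hty P K K (\<lambda>n \<sigma> v. \<alpha> n \<sigma> (b n \<sigma> v)) (\<lambda>_ _ v. v) h'"
    using extend_along_quasi_iso[OF K J b K injK chain_map_id] by blast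
  have qa: "quasi_iso P J K \<alpha>" by (rule quasi_iso_of_homotopy[OF K J K b quasi_iso_id[OF K] a])
  show ?thesis using extend_along_quasi_iso[OF J K qa J injJ chain_map_id] a(2) qa by blast
qed

text \<open>A homotopy maps socles to socles, and \<open>reduced\<close> makes the differentials of
  \<open>J\<close> vanish on them. So both homotopy terms disappear there, \<beta> \<alpha> is the
  identity on the socle, and \<alpha> is injective on it.\<close>

lemma reduced_soc_le:
  assumes J: "bounded_complex P J" and injJ: "\<And>n. ginj P (obj J n)" and K: "bounded_complex P K" and injK: "\<And>n. ginj P (obj K n)"
    and b: "quasi_iso P K J b" and red: "reduced P J" and p: "p \<in> P"
  shows "dm (soc P (obj J n) p) \<le> dm (soc P (obj K n) p)"
proof -
  obtain \<alpha> \<beta> h where a: "quasi_iso P J K \<alpha>" and be: "chain_map P K J \<beta>"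
    and h: "hty P J J (\<lambda>n \<sigma> v. \<beta> n \<sigma> (\<alpha> n \<sigma> v)) (\<lambda>_ _ v. v) h"
    using homotopy_inverses[OF J injJ K injK b] by blast
  note am = qi_map[OF a]
  have id: "\<beta> n p (\<alpha> n p v) = v" if v: "v \<in> soc P (obj J n) p" for v
  proof -
    have "diff J n p v = 0" using red v p unfolding reduced_def by blast
    moreover have "h n p v \<in> soc P (obj J (n - 1)) p" by (rule hom_soc[OF hty_hom[OF h] cpx_sheaf[OF J] p v])
    then have "diff J (n - 1) p (h n p v) = 0" using red p unfolding reduced_def by blast
    ultimately show ?thesis using h_facts(6)[OF J h p soc_in[OF v]] by simp
  qed
  show ?thesis
  proof (rule dim_le_via_inj)
    show "linear_map (soc P (obj J n) p) (soc P (obj K n) p) (\<alpha> n p)"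
      by (rule lm_restrict[OF hom_lm[OF map_hom[OF am] p]])
        (auto intro: soc_in hom_soc[OF map_hom[OF am] cpx_sheaf[OF J] p])
    show "inj_on (\<alpha> n p) (soc P (obj J n) p)" using id by (metis inj_onI)
  qed (auto intro: findim_soc[OF cpx_sheaf[OF J] p] findim_soc[OF cpx_sheaf[OF K] p])
qed


section \<open>The number of indecomposable summands\<close>

lemma lm_sum:
  assumes g: "linear_map V W g" and V: "subsp V" and x: "\<And>i. i \<in> I \<Longrightarrow> x i \<in> V"
  shows "g (\<Sum>i\<in>I. x i) = (\<Sum>i\<in>I. g (x i))"
  using x
proof (induct I rule: infinite_finite_induct)
  case (insert i I)
  then have "(\<Sum>i\<in>I. x i) \<in> V" "x i \<in> V" by (auto intro!: subsp_sum[OF V])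
  then have 1: "g (x i + (\<Sum>i\<in>I. x i)) = g (x i) + g (\<Sum>i\<in>I. x i)" by (intro lm_add[OF g])
  have 2: "g (\<Sum>i\<in>I. x i) = (\<Sum>i\<in>I. g (x i))" using insert by blast
  show ?case unfolding sum.insert[OF insert(1,2)] 1 2 by (rule refl)
qed (simp_all add: lm_0[OF g V])

lemma subsheafD:
  assumes "subsheaf P S F"
  shows "is_sheaf P S" "\<sigma> \<in> P \<Longrightarrow> x \<in> stalk S \<sigma> \<Longrightarrow> x \<in> stalk F \<sigma>"
    "\<sigma> \<in> P \<Longrightarrow> \<tau> \<in> P \<Longrightarrow> \<sigma> \<le> \<tau> \<Longrightarrow> x \<in> stalk S \<sigma> \<Longrightarrow> res S \<sigma> \<tau> x = res F \<sigma> \<tau> x"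
    "\<sigma> \<in> P \<Longrightarrow> \<tau> \<in> P \<Longrightarrow> \<sigma> \<le> \<tau> \<Longrightarrow> x \<in> stalk S \<sigma> \<Longrightarrow> res F \<sigma> \<tau> x \<in> stalk S \<tau>"
proof -
  show S: "is_sheaf P S" using assms by (simp add: subsheaf_def)
  show "\<sigma> \<in> P \<Longrightarrow> x \<in> stalk S \<sigma> \<Longrightarrow> x \<in> stalk F \<sigma>" using assms by (auto simp: subsheaf_def)
  show *: "res S \<sigma> \<tau> x = res F \<sigma> \<tau> x" if "\<sigma> \<in> P" "\<tau> \<in> P" "\<sigma> \<le> \<tau>" "x \<in> stalk S \<sigma>"
    using assms that by (simp add: subsheaf_def)
  show "res F \<sigma> \<tau> x \<in> stalk S \<tau>" if "\<sigma> \<in> P" "\<tau> \<in> P" "\<sigma> \<le> \<tau>" "x \<in> stalk S \<sigma>"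
    using *[OF that] sheaf_res_in[OF S that] by simp
qed

lemma dsd_sub: "direct_sum_decomposition P F n S \<Longrightarrow> i < n \<Longrightarrow> subsheaf P (S i) F"
  by (simp add: direct_sum_decomposition_def)

lemma dsd_span:
  assumes "direct_sum_decomposition P F n S" "\<sigma> \<in> P" "v \<in> stalk F \<sigma>"
  shows "\<exists>w. (\<forall>i<n. w i \<in> stalk (S i) \<sigma>) \<and> v = (\<Sum>i<n. w i)"
  using assms unfolding direct_sum_decomposition_def by blast

lemma dsd_eq:
  assumes d: "direct_sum_decomposition P F n S" and F: "is_sheaf P F" and s: "\<sigma> \<in> P"
    and w: "\<And>i. i < n \<Longrightarrow> w i \<in> stalk (S i) \<sigma>" and w': "\<And>i. i < n \<Longrightarrow> w' i \<in> stalk (S i) \<sigma>"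
    and eq: "(\<Sum>i<n. w i) = (\<Sum>i<n. w' i)" and i: "i < n"
  shows "w i = w' i"
proof -
  let ?t = "\<lambda>w i. if i < n then w i else 0"
  have "(\<Sum>i<n. w i) \<in> stalk F \<sigma>"
    using subsheafD(2)[OF dsd_sub[OF d] s w] by (intro subsp_sum[OF sheaf_subsp[OF F s]]) auto
  then have ex: "\<exists>!u. (\<forall>i<n. u i \<in> stalk (S i) \<sigma>) \<and> (\<forall>i\<ge>n. u i = 0) \<and> (\<Sum>i<n. w i) = (\<Sum>i<n. u i)"
    using d s unfolding direct_sum_decomposition_def by blast
  have a: "(\<forall>i<n. ?t w i \<in> stalk (S i) \<sigma>) \<and> (\<forall>i\<ge>n. ?t w i = 0) \<and> (\<Sum>i<n. w i) = (\<Sum>i<n. ?t w i)"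
    using w by simp
  have b: "(\<forall>i<n. ?t w' i \<in> stalk (S i) \<sigma>) \<and> (\<forall>i\<ge>n. ?t w' i = 0) \<and> (\<Sum>i<n. w i) = (\<Sum>i<n. ?t w' i)"
    using w' eq by simp
  have "?t w = ?t w'" by (rule trans[OF the1_equality[OF ex, OF a, symmetric] the1_equality[OF ex, OF b]])
  then have "?t w i = ?t w' i" by (rule fun_cong)
  then show ?thesis using i by simp
qed

lemma dsd_zero:
  assumes d: "direct_sum_decomposition P F n S" and F: "is_sheaf P F" and s: "\<sigma> \<in> P"
    and w: "\<And>i. i < n \<Longrightarrow> w i \<in> stalk (S i) \<sigma>" and eq: "(\<Sum>i<n. w i) = 0" and i: "i < n"
  shows "w i = 0"
  using dsd_eq[OF d F s w, of "\<lambda>_. 0", OF _ _ _ i] eq subsp_0[OF sheaf_subsp[OF subsheafD(1)[OF dsd_sub[OF d]] s]] by simp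

lemma dsdI:
  assumes sub: "\<And>i. i < n \<Longrightarrow> subsheaf P (S i) F"
    and span: "\<And>\<sigma> v. \<sigma> \<in> P \<Longrightarrow> v \<in> stalk F \<sigma> \<Longrightarrow> \<exists>w. (\<forall>i<n. w i \<in> stalk (S i) \<sigma>) \<and> v = (\<Sum>i<n. w i)"
    and ind: "\<And>\<sigma> w i. \<sigma> \<in> P \<Longrightarrow> (\<And>i. i < n \<Longrightarrow> w i \<in> stalk (S i) \<sigma>) \<Longrightarrow> (\<Sum>i<n. w i) = 0 \<Longrightarrow> i < n \<Longrightarrow> w i = 0"
  shows "direct_sum_decomposition P F n S"
  unfolding direct_sum_decomposition_def
proof (intro conjI allI impI ballI sub)
  fix \<sigma> v assume s: "\<sigma> \<in> P" and v: "v \<in> stalk F \<sigma>"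
  obtain w where w: "\<forall>i<n. w i \<in> stalk (S i) \<sigma>" "v = (\<Sum>i<n. w i)" using span[OF s v] by blast
  show "\<exists>!w. (\<forall>i<n. w i \<in> stalk (S i) \<sigma>) \<and> (\<forall>i\<ge>n. w i = 0) \<and> v = (\<Sum>i<n. w i)"
  proof (rule ex1I[of _ "\<lambda>i. if i < n then w i else 0"])
    show "(\<forall>i<n. (if i < n then w i else 0) \<in> stalk (S i) \<sigma>) \<and> (\<forall>i\<ge>n. (if i < n then w i else 0) = 0) \<and>
      v = (\<Sum>i<n. if i < n then w i else 0)" using w by simp
  next
    fix u assume u: "(\<forall>i<n. u i \<in> stalk (S i) \<sigma>) \<and> (\<forall>i\<ge>n. u i = 0) \<and> v = (\<Sum>i<n. u i)"
    have "u i - w i = 0" if i: "i < n" for i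
    proof (rule ind[OF s _ _ i])
      show "u j - w j \<in> stalk (S j) \<sigma>" if "j < n" for j
        using u w that by (intro subsp_diff[OF sheaf_subsp[OF subsheafD(1)[OF sub[OF that]] s]]) auto
      show "(\<Sum>i<n. u i - w i) = 0" using u w(2) by (simp add: sum_subtractf)
    qed
    then show "u = (\<lambda>i. if i < n then w i else 0)" using u by auto
  qed
qed

lemma dim_direct_sum:
  fixes U :: "nat \<Rightarrow> ('i \<Rightarrow> 'k::field) set"
  assumes "\<And>i. i < n \<Longrightarrow> findim_space (U i)"
    and "\<And>w i. (\<And>i. i < n \<Longrightarrow> w i \<in> U i) \<Longrightarrow> (\<Sum>i<n. w i) = 0 \<Longrightarrow> i < n \<Longrightarrow> w i = 0"
  shows "findim_space {\<Sum>i<n. w i |w. \<forall>i<n. w i \<in> U i} \<and> dm {\<Sum>i<n. w i |w. \<forall>i<n. w i \<in> U i} = (\<Sum>i<n. dm (U i))"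
  using assms
proof (induct n)
  case 0
  have *: "{\<Sum>i<0. w i |w. \<forall>i<0. w i \<in> U i} = {0}" by auto
  show ?case unfolding * by simp
next
  case (Suc n)
  let ?X = "{\<Sum>i<n. w i |w. \<forall>i<n. w i \<in> U i}"
  have U: "findim_space (U i)" if "i < Suc n" for i using Suc.prems(1) that .
  have ind: "w i = 0" if w: "\<And>i. i < n \<Longrightarrow> w i \<in> U i" "(\<Sum>i<n. w i) = 0" "i < n" for w i
  proof -
    have "(w(n := 0)) i = 0"
    proof (rule Suc.prems(2))
      show "(w(n := 0)) j \<in> U j" if "j < Suc n" for j
        using w(1) that subsp_0[OF findim_subsp[OF U[of n]]] by (cases "j = n") auto
      have "(\<Sum>i<n. (w(n := 0)) i) = (\<Sum>i<n. w i)" by (rule sum.cong) auto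
      then show "(\<Sum>i<Suc n. (w(n := 0)) i) = 0" using w(2) by simp
    qed (use w(3) in simp)
    then show ?thesis using w(3) by simp
  qed
  have "findim_space ?X \<and> dm ?X = (\<Sum>i<n. dm (U i))"
  proof (rule Suc.hyps)
    show "findim_space (U i)" if "i < n" for i using U that by simp
    show "w i = 0" if "\<And>i. i < n \<Longrightarrow> w i \<in> U i" "(\<Sum>i<n. w i) = 0" "i < n" for w i
      by (rule ind[OF that])
  qed
  then have IH: "findim_space ?X" "dm ?X = (\<Sum>i<n. dm (U i))" by simp_all
  \<comment> \<open>Addition maps the external sum of the first n terms together and the last one
    bijectively onto the full sum.\<close>
  let ?D = "dsum ?X (U n)" and ?g = "\<lambda>v. (v \<circ> Inl) + (v \<circ> Inr) :: 'i \<Rightarrow> 'k"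
  have D: "findim_space ?D" using IH(1) U[of n] by (intro findim_dsum) auto
  have g: "linear_map ?D UNIV ?g"
    by (rule linear_mapI) (simp_all add: kfun.scale_right_distrib)
  have ker: "v = 0" if v: "v \<in> ?D" "?g v = 0" for v
  proof -
    obtain a b where ab: "v = case_sum a b" "a \<in> ?X" "b \<in> U n" using v(1) by (rule dsumE)
    obtain w where w: "\<forall>i<n. w i \<in> U i" "a = (\<Sum>i<n. w i)" using ab(2) by blast
    have "(\<Sum>i<n. (w(n := b)) i) = (\<Sum>i<n. w i)" by (rule sum.cong) auto
    then have "(\<Sum>i<Suc n. (w(n := b)) i) = 0" using v(2) w(2) by (simp add: ab(1))
    moreover have "(w(n := b)) j \<in> U j" if "j < Suc n" for j using w(1) ab(3) that by (cases "j = n") auto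
    ultimately have "(w(n := b)) n = 0" using Suc.prems(2)[of "w(n := b)" n] by blast
    then have "b = 0" by simp
    then show ?thesis using v(2) by (simp add: ab(1))
  qed
  have inj: "inj_on ?g ?D"
  proof (rule inj_onI)
    fix x y assume "x \<in> ?D" "y \<in> ?D" "?g x = ?g y"
    then have "x - y = 0"
      using ker[OF subsp_diff[OF findim_subsp[OF D], of x y]] lm_diff[OF g findim_subsp[OF D], of x y] by simp
    then show "x = y" by simp
  qed
  have XS: "{\<Sum>i<Suc n. w i |w. \<forall>i<Suc n. w i \<in> U i} = ?g ` ?D"
  proof
    show "{\<Sum>i<Suc n. w i |w. \<forall>i<Suc n. w i \<in> U i} \<subseteq> ?g ` ?D"
    proof
      fix x assume "x \<in> {\<Sum>i<Suc n. w i |w. \<forall>i<Suc n. w i \<in> U i}"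
      then obtain w where w: "\<forall>i<Suc n. w i \<in> U i" "x = (\<Sum>i<Suc n. w i)" by blast
      have "x = ?g (case_sum (\<Sum>i<n. w i) (w n))" using w(2) by simp
      moreover have "case_sum (\<Sum>i<n. w i) (w n) \<in> ?D" using w(1) by auto
      ultimately show "x \<in> ?g ` ?D" by (rule image_eqI)
    qed
    show "?g ` ?D \<subseteq> {\<Sum>i<Suc n. w i |w. \<forall>i<Suc n. w i \<in> U i}"
    proof
      fix x assume "x \<in> ?g ` ?D"
      then obtain v where v: "v \<in> ?D" "x = ?g v" by blast
      obtain a b where ab: "v = case_sum a b" "a \<in> ?X" "b \<in> U n" using v(1) by (rule dsumE)
      obtain w where w: "\<forall>i<n. w i \<in> U i" "a = (\<Sum>i<n. w i)" using ab(2) by blast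
      have "(\<Sum>i<n. (w(n := b)) i) = (\<Sum>i<n. w i)" by (rule sum.cong) auto
      then have "x = (\<Sum>i<Suc n. (w(n := b)) i)" using v(2) ab(1) w(2) by simp
      moreover have "\<forall>i<Suc n. (w(n := b)) i \<in> U i" using w(1) ab(3) by (simp add: less_Suc_eq)
      ultimately show "x \<in> {\<Sum>i<Suc n. w i |w. \<forall>i<Suc n. w i \<in> U i}" by blast
    qed
  qed
  have "dm (?g ` ?D) = dm ?X + dm (U n)"
    unfolding dim_inj_image[OF g D inj] by (rule dim_dsum[OF IH(1) U]) simp
  then have "dm (?g ` ?D) = (\<Sum>i<Suc n. dm (U i))" unfolding IH(2) by simp
  then show ?case unfolding XS using findim_image[OF g D] by (rule conjI[rotated])
qed

section \<open>Additivity of socle dimensions and injectivity of summands\<close>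

abbreviation soc_dim :: "'a::order set \<Rightarrow> ('a, 'i, 'k::field) sheaf \<Rightarrow> nat" where
  "soc_dim P F \<equiv> \<Sum>p\<in>P. dm (soc P F p)"

text \<open>Components in a direct sum are unique and respected by restriction, so a restriction
  that kills the sum kills every component.\<close>

lemma soc_decomposition:
  assumes d: "direct_sum_decomposition P F n S" and F: "is_sheaf P F" and p: "p \<in> P"
  shows "soc P F p = {\<Sum>i<n. w i |w. \<forall>i<n. w i \<in> soc P (S i) p}"
proof
  note sub = dsd_sub[OF d]
  show "soc P F p \<subseteq> {\<Sum>i<n. w i |w. \<forall>i<n. w i \<in> soc P (S i) p}"
  proof
    fix v assume v: "v \<in> soc P F p"
    obtain w where w: "\<forall>i<n. w i \<in> stalk (S i) p" "v = (\<Sum>i<n. w i)" using dsd_span[OF d p soc_in[OF v]] by blast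
    have "w i \<in> soc P (S i) p" if i: "i < n" for i
      unfolding soc_def
    proof (intro CollectI conjI ballI impI)
      show "w i \<in> stalk (S i) p" using w(1) i by blast
      fix \<tau> assume t: "\<tau> \<in> P" "p < \<tau>"
      have "(\<Sum>i<n. res F p \<tau> (w i)) = res F p \<tau> v"
        unfolding w(2) using w(1) subsheafD(2)[OF sub p] t
        by (intro lm_sum[OF sheaf_res[OF F p] sheaf_subsp[OF F p], symmetric]) auto
      then have 0: "(\<Sum>i<n. res F p \<tau> (w i)) = 0" using soc_res[OF v t] by simp
      have "res F p \<tau> (w i) = 0"
      proof (rule dsd_zero[OF d F t(1), where w = "\<lambda>i. res F p \<tau> (w i)" and i = i])
        show "res F p \<tau> (w j) \<in> stalk (S j) \<tau>" if "j < n" for j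
          using w(1) that by (intro subsheafD(4)[OF sub[OF that] p t(1) less_imp_le[OF t(2)]]) blast
      qed (rule 0, rule i)
      then show "res (S i) p \<tau> (w i) = 0"
        using subsheafD(3)[OF sub[OF i] p t(1) less_imp_le[OF t(2)], of "w i"] w(1) i by simp
    qed
    then show "v \<in> {\<Sum>i<n. w i |w. \<forall>i<n. w i \<in> soc P (S i) p}" using w(2) by blast
  qed
  have "x \<in> soc P F p" if i: "i < n" and x: "x \<in> soc P (S i) p" for i x
    using subsheafD(2)[OF sub[OF i] p soc_in[OF x]] soc_res[OF x] subsheafD(3)[OF sub[OF i] p _ less_imp_le soc_in[OF x]]
    by (simp add: soc_def)
  then show "{\<Sum>i<n. w i |w. \<forall>i<n. w i \<in> soc P (S i) p} \<subseteq> soc P F p"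
    using subsp_sum[OF subsp_soc[OF F p]] by (smt (verit, best) lessThan_iff mem_Collect_eq subsetI)
qed

lemma soc_dim_decomposition:
  assumes d: "direct_sum_decomposition P F n S" and F: "is_sheaf P F"
  shows "soc_dim P F = (\<Sum>i<n. soc_dim P (S i))"
proof -
  have "dm (soc P F p) = (\<Sum>i<n. dm (soc P (S i) p))" if p: "p \<in> P" for p
  proof -
    have "dm {\<Sum>i<n. w i |w. \<forall>i<n. w i \<in> soc P (S i) p} = (\<Sum>i<n. dm (soc P (S i) p))"
      by (rule conjunct2[OF dim_direct_sum])
        (auto intro: findim_soc[OF subsheafD(1)[OF dsd_sub[OF d]] p] dsd_zero[OF d F p] soc_in)
    then show ?thesis unfolding soc_decomposition[OF d F p] .
  qed
  then have "soc_dim P F = (\<Sum>p\<in>P. \<Sum>i<n. dm (soc P (S i) p))" by simp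
  also have "\<dots> = (\<Sum>i<n. soc_dim P (S i))" by (rule sum.swap)
  finally show ?thesis .
qed

text \<open>Uniqueness of components makes their choice linear and natural, so taking the j-th
  component is a projection that exhibits \<open>S j\<close> as a retract of
  \<open>F\<close>.\<close>

lemma ginj_summand:
  assumes d: "direct_sum_decomposition P F n S" and F: "ginj P F" and j: "j < n" and P: "finite P"
  shows "ginj P (S j)"
proof -
  note sh = ginj_sheaf[OF F] and sub = dsd_sub[OF d]
  define W where "W \<sigma> v = (SOME w. (\<forall>i<n. w i \<in> stalk (S i) \<sigma>) \<and> v = (\<Sum>i<n. w i))" for \<sigma> v
  have W: "(\<forall>i<n. W \<sigma> v i \<in> stalk (S i) \<sigma>) \<and> v = (\<Sum>i<n. W \<sigma> v i)" if "\<sigma> \<in> P" "v \<in> stalk F \<sigma>" for \<sigma> v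
    unfolding W_def by (rule someI_ex[OF dsd_span[OF d that]])
  have W_eq: "W \<sigma> v j = w j" if "\<sigma> \<in> P" "v \<in> stalk F \<sigma>" "\<And>i. i < n \<Longrightarrow> w i \<in> stalk (S i) \<sigma>" "v = (\<Sum>i<n. w i)" for \<sigma> v w
    using dsd_eq[OF d sh that(1), of "W \<sigma> v" w] W[OF that(1,2)] that(3,4) j by auto
  have Ss: "subsp (stalk (S i) \<sigma>)" if "i < n" "\<sigma> \<in> P" for i \<sigma>
    by (rule sheaf_subsp[OF subsheafD(1)[OF sub[OF that(1)]] that(2)])
  have e: "sheaf_hom P F (S j) (\<lambda>\<sigma> v. W \<sigma> v j)"
  proof (rule sheaf_homI)
    fix \<sigma> assume s: "\<sigma> \<in> P"
    note sF = sheaf_subsp[OF sh s]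
    show "linear_map (stalk F \<sigma>) (stalk (S j) \<sigma>) (\<lambda>v. W \<sigma> v j)"
    proof (rule linear_mapI)
      show "W \<sigma> x j \<in> stalk (S j) \<sigma>" if "x \<in> stalk F \<sigma>" for x using W[OF s that] j by blast
      show "W \<sigma> (x + y) j = W \<sigma> x j + W \<sigma> y j" if x: "x \<in> stalk F \<sigma>" "y \<in> stalk F \<sigma>" for x y
      proof (rule W_eq[OF s subsp_add[OF sF x], of "\<lambda>i. W \<sigma> x i + W \<sigma> y i"])
        show "W \<sigma> x i + W \<sigma> y i \<in> stalk (S i) \<sigma>" if "i < n" for i
          using W[OF s x(1)] W[OF s x(2)] that by (intro subsp_add[OF Ss[OF that s]]) auto
        show "x + y = (\<Sum>i<n. W \<sigma> x i + W \<sigma> y i)"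
          using W[OF s x(1)] W[OF s x(2)] by (simp add: sum.distrib)
      qed
      show "W \<sigma> (vscale c x) j = vscale c (W \<sigma> x j)" if x: "x \<in> stalk F \<sigma>" for c x
      proof (rule W_eq[OF s subsp_scale[OF sF x], of "\<lambda>i. vscale c (W \<sigma> x i)"])
        show "vscale c (W \<sigma> x i) \<in> stalk (S i) \<sigma>" if "i < n" for i
          using W[OF s x] that by (intro subsp_scale[OF Ss[OF that s]]) auto
        show "vscale c x = (\<Sum>i<n. vscale c (W \<sigma> x i))"
          using W[OF s x] by (simp flip: kfun.scale_sum_right)
      qed
    qed
  next
    fix \<sigma> \<tau> v assume s: "\<sigma> \<in> P" "\<tau> \<in> P" "\<sigma> \<le> \<tau>" and v: "v \<in> stalk F \<sigma>"
    have "W \<tau> (res F \<sigma> \<tau> v) j = res F \<sigma> \<tau> (W \<sigma> v j)"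
    proof (rule W_eq[OF s(2) sheaf_res_in[OF sh s v], of "\<lambda>i. res F \<sigma> \<tau> (W \<sigma> v i)"])
      show "res F \<sigma> \<tau> (W \<sigma> v i) \<in> stalk (S i) \<tau>" if "i < n" for i
        using W[OF s(1) v] that by (intro subsheafD(4)[OF sub[OF that] s]) auto
      have "res F \<sigma> \<tau> (\<Sum>i<n. W \<sigma> v i) = (\<Sum>i<n. res F \<sigma> \<tau> (W \<sigma> v i))"
        using W[OF s(1) v] subsheafD(2)[OF sub s(1)] by (intro lm_sum[OF sheaf_res[OF sh s] sheaf_subsp[OF sh s(1)]]) auto
      then show "res F \<sigma> \<tau> v = (\<Sum>i<n. res F \<sigma> \<tau> (W \<sigma> v i))" using W[OF s(1) v] by simp
    qed
    then show "W \<tau> (res F \<sigma> \<tau> v) j = res (S j) \<sigma> \<tau> (W \<sigma> v j)"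
      using subsheafD(3)[OF sub[OF j] s] W[OF s(1) v] j by simp
  qed
  have i: "sheaf_hom P (S j) F (\<lambda>_ v. v)"
    by (rule sheaf_homI) (auto intro: lm_restrict[OF lm_id] subsheafD(2)[OF sub[OF j]] subsheafD(3)[OF sub[OF j]])
  show ?thesis
  proof (rule ginj_retract[OF F subsheafD(1)[OF sub[OF j]] i e _ P])
    fix \<sigma> v assume s: "\<sigma> \<in> P" and v: "v \<in> stalk (S j) \<sigma>"
    have "W \<sigma> v j = (if j = j then v else 0)"
      by (rule W_eq[OF s subsheafD(2)[OF sub[OF j] s v], of "\<lambda>i. if i = j then v else 0"])
        (use v j subsp_0[OF Ss[OF _ s]] in auto)
    then show "W \<sigma> v j = v" by simp
  qed
qed

section \<open>Indecomposable summands of injective sheaves\<close>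

lemma sum_lessThan_2: "(\<Sum>i<2. f i) = f 0 + f (1::nat)" for f :: "nat \<Rightarrow> 'b::comm_monoid_add"
  by (simp add: numeral_2_eq_2)

text \<open>At a maximal point \<open>p\<close> of the support every vector is in the socle. Such a
  vector gives a map from [p] to \<open>F\<close>, a normalized coordinate at \<open>p\<close> gives
  a map back, and the resulting idempotent \<open>e\<close> splits off a copy of [p].\<close>

lemma split_point:
  fixes F :: "('a::order, 'i, 'k::field) sheaf"
  assumes P: "finite P" and F: "ginj P F" and nz: "\<not> zero_sheaf P F"
  shows "\<exists>A B. direct_sum_decomposition P F 2 (\<lambda>i. if i = 0 then A else B) \<and> indecomposable P A \<and> soc_dim P A = 1 \<and>
    (\<exists>p\<in>P. stalk B p \<noteq> stalk F p)"
proof -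
  note sh = ginj_sheaf[OF F]
  let ?M = "{p\<in>P. stalk F p \<noteq> {0}}"
  have "finite ?M" "?M \<noteq> {}" using P nz by (auto simp: zero_sheaf_def)
  then obtain p where p: "p \<in> P" "stalk F p \<noteq> {0}" "\<And>q. q \<in> P \<Longrightarrow> stalk F q \<noteq> {0} \<Longrightarrow> p \<le> q \<Longrightarrow> q = p"
    using finite_has_maximal[of ?M] by blast
  obtain v where v0: "v \<in> stalk F p" "v \<noteq> 0" using p(2) subsp_0[OF sheaf_subsp[OF sh p(1)]] by blast
  have "res F p \<tau> v = 0" if "\<tau> \<in> P" "p < \<tau>" for \<tau>
    using p(3)[OF that(1)] that sheaf_res_in[OF sh p(1) that(1) less_imp_le[OF that(2)] v0(1)] by fastforce
  then have v: "v \<in> soc P F p" using v0(1) by (simp add: soc_def)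
  obtain i where i: "v i \<noteq> 0" using v0(2) by (auto simp: fun_eq_iff)
  obtain r where r: "god_retraction P F r" using F unfolding ginj_def by blast
  define w where "w = point_sec r p v"
  have w: "point_family P F p w" "w p = v" unfolding w_def using point_sec[OF r p(1) v] by auto
  have win: "\<And>\<sigma>. \<sigma> \<in> P \<Longrightarrow> \<sigma> \<le> p \<Longrightarrow> w \<sigma> \<in> stalk F \<sigma>"
    and wres: "\<And>\<sigma>. \<sigma> \<in> P \<Longrightarrow> \<sigma> \<le> p \<Longrightarrow> res F \<sigma> p (w \<sigma>) = v"
    using w p(1) unfolding point_family_def by auto
  define e where "e = point_map F p w i (v i)"
  have e: "sheaf_hom P F F e" unfolding e_def by (rule point_map_hom[OF sh sh p(1) w(1)])
  have e_out: "e \<sigma> x = 0" if "\<not> \<sigma> \<le> p" for \<sigma> x using that by (simp add: e_def point_map_def)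
  have e_on: "e \<sigma> x = vscale (res F \<sigma> p x i / v i) (w \<sigma>)" if "\<sigma> \<le> p" for \<sigma> x using that by (simp add: e_def point_map_def)
  have ew: "e \<sigma> (w \<sigma>) = w \<sigma>" if "\<sigma> \<in> P" "\<sigma> \<le> p" for \<sigma> using i by (simp add: e_on that wres)
  have ee: "e \<sigma> (e \<sigma> x) = e \<sigma> x" if s: "\<sigma> \<in> P" for \<sigma> x
  proof (cases "\<sigma> \<le> p")
    case True
    show ?thesis unfolding e_on[OF True, of x] lm_scale[OF hom_lm[OF e s] win[OF s True]] ew[OF s True] ..
  qed (simp add: e_out)
  define A where "A = sub_sheaf F (\<lambda>\<sigma>. {x \<in> stalk F \<sigma>. x - e \<sigma> x = 0})"
  define B where "B = sub_sheaf F (\<lambda>\<sigma>. {x \<in> stalk F \<sigma>. e \<sigma> x = 0})"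
  have As: "is_sheaf P A" unfolding A_def by (rule kernel_sheaf(1)[OF sh sh hom_minus[OF sh hom_id e]])
  have Bs: "is_sheaf P B" unfolding B_def by (rule kernel_sheaf(1)[OF sh sh e])
  have A_in: "x \<in> stalk A \<sigma> \<longleftrightarrow> x \<in> stalk F \<sigma> \<and> e \<sigma> x = x" for x \<sigma> by (auto simp: A_def)
  have B_in: "x \<in> stalk B \<sigma> \<longleftrightarrow> x \<in> stalk F \<sigma> \<and> e \<sigma> x = 0" for x \<sigma> by (auto simp: B_def)
  have resA: "res A = res F" and resB: "res B = res F" by (simp_all add: A_def B_def)
  have d: "direct_sum_decomposition P F 2 (\<lambda>i. if i = 0 then A else B)"
  proof (rule dsdI)
    fix j :: nat assume "j < 2"
    show "subsheaf P (if j = 0 then A else B) F"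
      using As Bs by (auto simp: subsheaf_def A_in B_in resA resB)
  next
    fix \<sigma> x assume s: "\<sigma> \<in> P" and x: "x \<in> stalk F \<sigma>"
    have "e \<sigma> (x - e \<sigma> x) = 0" using hom_diff[OF e sh s x hom_in[OF e s x]] ee[OF s] by simp
    then have "e \<sigma> x \<in> stalk A \<sigma>" "x - e \<sigma> x \<in> stalk B \<sigma>"
      using hom_in[OF e s x] ee[OF s] subsp_diff[OF sheaf_subsp[OF sh s] x] by (auto simp: A_in B_in)
    then show "\<exists>w. (\<forall>i<2::nat. w i \<in> stalk (if i = 0 then A else B) \<sigma>) \<and> x = (\<Sum>i<2. w i)"
      by (intro exI[of _ "\<lambda>i::nat. if i = 0 then e \<sigma> x else x - e \<sigma> x"]) (simp add: sum_lessThan_2)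
  next
    fix \<sigma> u and j :: nat assume s: "\<sigma> \<in> P" and u: "\<And>i::nat. i < 2 \<Longrightarrow> u i \<in> stalk (if i = 0 then A else B) \<sigma>"
      and 0: "(\<Sum>i<2. u i) = 0" and j: "j < 2"
    have u01: "u 0 \<in> stalk A \<sigma>" "u 1 \<in> stalk B \<sigma>" using u[of 0] u[of 1] by auto
    have sum0: "u 0 + u 1 = 0" using 0 by (simp add: sum_lessThan_2)
    have "e \<sigma> (u 0 + u 1) = u 0" using u01 hom_add[OF e s] by (simp add: A_in B_in)
    then have "u 0 = 0" using sum0 hom0[OF e sh s] by simp
    then show "u j = 0" using sum0 j by (cases "j = 0") (auto simp: less_2_cases_iff)
  qed
  have vA: "v \<in> stalk A p" using v0(1) ew[OF p(1) order_refl] w(2) by (simp add: A_in)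
  have Ap: "x = vscale (x i / v i) v" if "x \<in> stalk A p" for x
  proof -
    have x: "x \<in> stalk F p" "e p x = x" using that by (auto simp: A_in)
    have "x = e p x" using x(2) by simp
    also have "\<dots> = vscale (x i / v i) v" unfolding e_on[OF order_refl] sheaf_res_id[OF sh p(1) x(1)] w(2) ..
    finally show ?thesis .
  qed
  \<comment> \<open>An element of \<open>A\<close> is a multiple of \<open>w \<sigma>\<close> with
    the factor read off from its restriction to \<open>p\<close>. So nonzero subsheaves of
    \<open>A\<close> are nonzero at \<open>p\<close>, where \<open>A\<close> is a line.\<close>
  have A0: "x = 0" if "\<sigma> \<in> P" "x \<in> stalk A \<sigma>" "\<sigma> \<le> p \<Longrightarrow> res F \<sigma> p x = 0" for \<sigma> x
    using that e_out[of \<sigma> x] e_on[of \<sigma> x] by (cases "\<sigma> \<le> p") (auto simp: A_in)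
  have socA: "dm (soc P A q) = (if q = p then 1 else 0)" if q: "q \<in> P" for q
  proof (cases "q = p")
    case True
    have "soc P A p = kfun.span {v}"
    proof
      show "soc P A p \<subseteq> kfun.span {v}"
      proof
        fix x assume "x \<in> soc P A p"
        then have x: "x = vscale (x i / v i) v" by (rule Ap[OF soc_in])
        show "x \<in> kfun.span {v}" by (subst x) (intro kfun.span_scale kfun.span_base, simp)
      qed
      have "v \<in> soc P A p" using v vA by (simp add: soc_def resA)
      then show "kfun.span {v} \<subseteq> soc P A p" by (intro kfun.span_minimal subsp_soc[OF As p(1)]) simp
    qed
    then show ?thesis using True v0(2) by (simp add: kfun.dim_eq_card_independent)
  next
    case False
    have "soc P A q = {0}"
    proof
      show "soc P A q \<subseteq> {0}"
      proof
        fix x assume x: "x \<in> soc P A q"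
        have "x = 0" by (rule A0[OF q soc_in[OF x]]) (use soc_res[OF x p(1)] False in \<open>simp add: resA less_le\<close>)
        then show "x \<in> {0}" by simp
      qed
    qed (use subsp_0[OF subsp_soc[OF As q]] in simp)
    then show ?thesis using False by simp
  qed
  have "soc_dim P A = (\<Sum>q\<in>P. if q = p then 1 else 0)" using socA by simp
  then have 1: "soc_dim P A = 1" using P p(1) by simp
  have "indecomposable P A"
    unfolding indecomposable_def
  proof (intro conjI allI impI As)
    show "\<not> zero_sheaf P A" using vA v0(2) p(1) by (auto simp: zero_sheaf_def)
    fix T assume T: "direct_sum_decomposition P A 2 T"
    have sub: "subsheaf P (T j) A" if "j < 2" for j using dsd_sub[OF T that] .
    have z: "zero_sheaf P (T j)" if j: "j < 2" and Tp: "stalk (T j) p \<subseteq> {0}" for j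
    proof -
      have "x = 0" if s: "\<sigma> \<in> P" and x: "x \<in> stalk (T j) \<sigma>" for \<sigma> x
      proof (rule A0[OF s subsheafD(2)[OF sub[OF j] s x]])
        assume "\<sigma> \<le> p"
        then show "res F \<sigma> p x = 0" using subsheafD(4)[OF sub[OF j] s p(1) _ x] Tp by (auto simp: resA)
      qed
      then show ?thesis using subsp_0[OF sheaf_subsp[OF subsheafD(1)[OF sub[OF j]]]] by (auto simp: zero_sheaf_def)
    qed
    show "zero_sheaf P (T 0) \<or> zero_sheaf P (T 1)"
    proof (rule ccontr)
      assume "\<not> ?thesis"
      then obtain x y where xy: "x \<in> stalk (T 0) p" "x \<noteq> 0" "y \<in> stalk (T 1) p" "y \<noteq> 0" using z[of 0] z[of 1] by auto
      define a where "a = x i / v i"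
      define b where "b = y i / v i"
      have x: "x = vscale a v" unfolding a_def by (rule Ap[OF subsheafD(2)[OF sub p(1) xy(1)]]) simp
      have y: "y = vscale b v" unfolding b_def by (rule Ap[OF subsheafD(2)[OF sub p(1) xy(3)]]) simp
      have b0: "b \<noteq> 0" using y xy(4) by auto
      \<comment> \<open>Since x = a v and y = b v lie on one line, b x - a y = 0 is a relation
        between the two summands, which forces b x = 0.\<close>
      let ?u = "\<lambda>j::nat. if j = 0 then vscale b x else vscale (- a) y"
      have "?u 0 = 0"
      proof (rule dsd_zero[OF T As p(1), where w = ?u and i = 0])
        show "?u j \<in> stalk (T j) p" if "j < 2" for j
          using that xy subsp_scale[OF sheaf_subsp[OF subsheafD(1)[OF sub[OF that]] p(1)]]
            subsp_neg[OF sheaf_subsp[OF subsheafD(1)[OF sub[OF that]] p(1)]] by (auto simp: less_2_cases_iff)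
        show "(\<Sum>j<2. ?u j) = 0"
          unfolding sum_lessThan_2 x y by (simp add: mult.commute)
      qed simp
      then show False using b0 xy(2) by simp
    qed
  qed
  moreover have "stalk B p \<noteq> stalk F p"
  proof
    assume "stalk B p = stalk F p"
    then have "v \<in> stalk B p" using v0(1) by simp
    then show False using vA v0(2) by (simp add: A_in B_in)
  qed
  ultimately show ?thesis using d 1 p(1) by blast
qed

text \<open>Induction on the total dimension: the complement \<open>B\<close> from
  \<open>split_point\<close> is smaller, and injective because it is a summand. \<open>A\<close> is
  appended last, so the summands of \<open>B\<close> keep their indices.\<close>

lemma decomposition_exists:
  fixes F :: "('a::order, 'i, 'k::field) sheaf"
  assumes P: "finite P" and F: "ginj P F"
  shows "\<exists>n S. direct_sum_decomposition P F n S \<and> (\<forall>i<n. indecomposable P (S i))"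
  using F
proof (induct "\<Sum>p\<in>P. dm (stalk F p)" arbitrary: F rule: less_induct)
  case less
  note F = less.prems
  note sh = ginj_sheaf[OF F]
  show ?case
  proof (cases "zero_sheaf P F")
    case True
    then have "direct_sum_decomposition P F 0 (\<lambda>_. F)" by (intro dsdI) (auto simp: zero_sheaf_def)
    then show ?thesis by (intro exI[of _ 0]) auto
  next
    case False
    obtain A B where AB: "direct_sum_decomposition P F 2 (\<lambda>i. if i = 0 then A else B)" "indecomposable P A"
      "\<exists>p\<in>P. stalk B p \<noteq> stalk F p"
      using split_point[OF P F False] by blast
    note d = AB(1)
    have Asub: "subsheaf P A F" and Bsub: "subsheaf P B F" using dsd_sub[OF d, of 0] dsd_sub[OF d, of 1] by auto
    have Binj: "ginj P B" using ginj_summand[OF d F _ P, of 1] by simp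
    note Bs = subsheafD(1)[OF Bsub]
    have le: "dm (stalk B p) \<le> dm (stalk F p)" if "p \<in> P" for p
      using dim_mono[OF sheaf_findim[OF sh that], of "stalk B p"] subsheafD(2)[OF Bsub that] by blast
    obtain p where p: "p \<in> P" "stalk B p \<noteq> stalk F p" using AB(3) by blast
    have "stalk B p \<subset> stalk F p" using p subsheafD(2)[OF Bsub p(1)] by blast
    then have "dm (stalk B p) < dm (stalk F p)" by (rule dim_psubset[OF sheaf_findim[OF sh p(1)] sheaf_subsp[OF Bs p(1)]])
    then have "(\<Sum>p\<in>P. dm (stalk B p)) < (\<Sum>p\<in>P. dm (stalk F p))"
      using le p(1) P by (intro sum_strict_mono_ex1) auto
    then obtain n S where S: "direct_sum_decomposition P B n S" "\<forall>i<n. indecomposable P (S i)"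
      using less.hyps Binj by blast
    let ?T = "\<lambda>i. if i < n then S i else A"
    have "direct_sum_decomposition P F (Suc n) ?T"
    proof (rule dsdI)
      fix i assume "i < Suc n"
      have "subsheaf P (S i) F" if "i < n"
        using dsd_sub[OF S(1) that] Bsub unfolding subsheaf_def by (metis subset_iff)
      then show "subsheaf P (?T i) F" using Asub by simp
    next
      fix \<sigma> v assume s: "\<sigma> \<in> P" and v: "v \<in> stalk F \<sigma>"
      obtain w where w: "\<forall>i<2::nat. w i \<in> stalk (if i = 0 then A else B) \<sigma>" "v = (\<Sum>i<2. w i)"
        using dsd_span[OF d s v] by blast
      have w01: "w 0 \<in> stalk A \<sigma>" "w 1 \<in> stalk B \<sigma>" "v = w 0 + w 1"
        using w(1)[rule_format, of 0] w(1)[rule_format, of 1] w(2) by (auto simp: sum_lessThan_2)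
      obtain u where u: "\<forall>i<n. u i \<in> stalk (S i) \<sigma>" "w 1 = (\<Sum>i<n. u i)" using dsd_span[OF S(1) s w01(2)] by blast
      let ?u = "\<lambda>i. if i < n then u i else w 0"
      have "(\<Sum>i<n. ?u i) = (\<Sum>i<n. u i)" by (rule sum.cong) auto
      then have "v = (\<Sum>i<Suc n. ?u i)" using w01(3) u(2) by (simp add: add.commute)
      then show "\<exists>w. (\<forall>i<Suc n. w i \<in> stalk (?T i) \<sigma>) \<and> v = (\<Sum>i<Suc n. w i)"
        using u(1) w01(1) by (intro exI[of _ ?u]) simp
    next
      fix \<sigma> u i assume s: "\<sigma> \<in> P" and u: "\<And>i. i < Suc n \<Longrightarrow> u i \<in> stalk (?T i) \<sigma>" and u0: "(\<Sum>i<Suc n. u i) = 0" and i: "i < Suc n"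
      have uS: "u j \<in> stalk (S j) \<sigma>" if "j < n" for j using u[of j] that by simp
      have uA: "u n \<in> stalk A \<sigma>" using u[of n] by simp
      let ?b = "\<Sum>i<n. u i"
      have bB: "?b \<in> stalk B \<sigma>"
        using subsheafD(2)[OF dsd_sub[OF S(1)] s uS] by (intro subsp_sum[OF sheaf_subsp[OF Bs s]]) auto
      let ?w = "\<lambda>j::nat. if j = 0 then u n else ?b"
      have w: "?w j = 0" if "j < 2" for j
      proof (rule dsd_zero[OF d sh s, where w = ?w and i = j])
        show "?w j \<in> stalk (if j = 0 then A else B) \<sigma>" for j using uA bB by simp
        show "(\<Sum>j<2. ?w j) = 0" using u0 by (simp add: sum_lessThan_2 add.commute)
      qed (rule that)
      have "u n = 0" "?b = 0" using w[of 0] w[of 1] by simp_all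
      then show "u i = 0" using dsd_zero[OF S(1) Bs s uS, of i] i by (cases "i = n") auto
    qed
    moreover have "\<forall>i<Suc n. indecomposable P (?T i)" using S(2) AB(2) by simp
    ultimately show ?thesis by blast
  qed
qed

text \<open>The piece split off by \<open>split_point\<close> is nonzero, so indecomposability makes
  the complement vanish and leaves socle dimension 1.\<close>

lemma indecomposable_soc_dim:
  assumes P: "finite P" and F: "ginj P F" and ind: "indecomposable P F"
  shows "soc_dim P F = 1"
proof -
  have "\<not> zero_sheaf P F" using ind by (simp add: indecomposable_def)
  then obtain A B where AB: "direct_sum_decomposition P F 2 (\<lambda>i. if i = 0 then A else B)" "indecomposable P A" "soc_dim P A = 1"
    using split_point[OF P F] by blast
  have "zero_sheaf P A \<or> zero_sheaf P B"
    using ind AB(1) spec[of "\<lambda>S. direct_sum_decomposition P F 2 S \<longrightarrow> zero_sheaf P (S 0) \<or> zero_sheaf P (S 1)" "\<lambda>i. if i = 0 then A else B"]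
    by (simp add: indecomposable_def)
  moreover have "\<not> zero_sheaf P A" using AB(2) by (simp add: indecomposable_def)
  ultimately have "zero_sheaf P B" by blast
  then have "soc P B p = {0}" if "p \<in> P" for p
    using that subsp_0[OF subsp_soc[OF subsheafD(1)[OF dsd_sub[OF AB(1), of 1]]], of p] soc_in[of _ P B p]
    by (auto simp: zero_sheaf_def)
  then have "soc_dim P B = 0" by simp
  then show ?thesis using soc_dim_decomposition[OF AB(1) ginj_sheaf[OF F]] AB(3) by (simp add: sum_lessThan_2)
qed

text \<open>Krull-Schmidt for injective sheaves: the socle dimension is additive and equals 1 on
  each indecomposable part, so it counts the parts of any decomposition. This is the uniqueness
  behind the definite description.\<close>

lemma num_summands_soc_dim:
  assumes P: "finite P" and F: "ginj P F"
  shows "num_summands P F = soc_dim P F"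
proof -
  have *: "n = soc_dim P F" if "direct_sum_decomposition P F n S" "\<forall>i<n. indecomposable P (S i)" for n S
    using soc_dim_decomposition[OF that(1) ginj_sheaf[OF F]] that(2)
      indecomposable_soc_dim[OF P ginj_summand[OF that(1) F _ P]] by simp
  obtain n S where S: "direct_sum_decomposition P F n S" "\<forall>i<n. indecomposable P (S i)"
    using decomposition_exists[OF P F] by blast
  show ?thesis
    unfolding num_summands_def by (rule the_equality) (use S * in blast)+
qed

lemma reduced_minimal:
  assumes P: "finite P" and J: "bounded_complex P J" and inj: "\<And>n. ginj P (obj J n)" and red: "reduced P J"
  shows "minimal_injective_complex P J"
  unfolding minimal_injective_complex_def
proof (intro conjI allI impI)
  show "injective_complex P J" using J inj by (simp add: injective_complex_def injective_sheaf_iff_ginj[OF P])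
  fix K n assume K: "injective_complex P K \<and> quasi_isomorphic P J K"
  then have K': "bounded_complex P K" "\<And>n. ginj P (obj K n)"
    by (auto simp: injective_complex_def injective_sheaf_iff_ginj[OF P])
  obtain b where b: "quasi_iso P K J b" using zigzag_quasi_iso[OF J inj] K by blast
  show "num_summands P (obj J n) \<le> num_summands P (obj K n)"
    unfolding num_summands_soc_dim[OF P inj] num_summands_soc_dim[OF P K'(2)]
    by (rule sum_mono) (rule reduced_soc_le[OF J inj K' b red])
qed

text \<open>A reduced resolution witnesses the choice. From here on the chosen complex is used only
  through these three properties.\<close>

lemma min_inj_res:
  fixes C :: "('a::order, 'i, 'k::field) cpx"
  assumes P: "finite P" and C: "bounded_complex P C"
  shows "bounded_complex P (min_inj_res P C)" "ginj P (obj (min_inj_res P C) n)" "\<exists>\<phi>. quasi_iso P C (min_inj_res P C) \<phi>"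
proof -
  obtain J :: "('a, nat, 'k) cpx" and \<phi> where J: "bounded_complex P J" "\<forall>n. ginj P (obj J n)" "quasi_iso P C J \<phi>"
    using injective_resolution[OF P C] by blast
  then obtain L :: "('a, nat, 'k) cpx" and e where L: "bounded_complex P L" "\<forall>n. ginj P (obj L n)" "quasi_iso P J L e" "reduced P L"
    using reduce_injective_complex[OF P J(1)] by blast
  have "minimal_injective_complex P L \<and> (\<exists>\<phi>. quasi_iso P C L \<phi>)"
    using reduced_minimal[OF P L(1) _ L(4)] L(2) quasi_iso_comp[OF C J(1) L(1) J(3) L(3)] by blast
  then have *: "minimal_injective_complex P (min_inj_res P C) \<and> (\<exists>\<phi>. quasi_iso P C (min_inj_res P C) \<phi>)"
    unfolding min_inj_res_def by (rule someI)
  then show "\<exists>\<phi>. quasi_iso P C (min_inj_res P C) \<phi>" by blast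
  have "injective_complex P (min_inj_res P C)" using * by (simp add: minimal_injective_complex_def)
  then show "bounded_complex P (min_inj_res P C)" "ginj P (obj (min_inj_res P C) n)"
    by (auto simp: injective_complex_def injective_sheaf_iff_ginj[OF P])
qed


section \<open>Global sections and hypercohomology\<close>

definition sec_map :: "'a set \<Rightarrow> ('a \<Rightarrow> ('i \<Rightarrow> 'k::field) \<Rightarrow> 'j \<Rightarrow> 'k) \<Rightarrow> ('a \<times> 'i \<Rightarrow> 'k) \<Rightarrow> 'a \<times> 'j \<Rightarrow> 'k" where
  "sec_map P \<phi> v = (\<lambda>(\<pi>, i). if \<pi> \<in> P then \<phi> \<pi> (curry v \<pi>) i else 0)"

lemma curry_sec_map: "curry (sec_map P \<phi> v) \<pi> = (if \<pi> \<in> P then \<phi> \<pi> (curry v \<pi>) else 0)"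
  by (auto simp: sec_map_def fun_eq_iff)

lemma limit_in: "v \<in> limit_space P F \<Longrightarrow> \<pi> \<in> P \<Longrightarrow> curry v \<pi> \<in> stalk F \<pi>"
  and limit_out: "v \<in> limit_space P F \<Longrightarrow> \<pi> \<notin> P \<Longrightarrow> curry v \<pi> = 0"
  and limit_res: "v \<in> limit_space P F \<Longrightarrow> \<pi> \<in> P \<Longrightarrow> \<rho> \<in> P \<Longrightarrow> \<pi> \<le> \<rho> \<Longrightarrow> res F \<pi> \<rho> (curry v \<pi>) = curry v \<rho>"
  by (auto simp: limit_space_def)

lemma limitI:
  assumes "\<And>\<pi>. \<pi> \<in> P \<Longrightarrow> curry v \<pi> \<in> stalk F \<pi>" "\<And>\<pi>. \<pi> \<notin> P \<Longrightarrow> curry v \<pi> = 0"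
    and "\<And>\<pi> \<rho>. \<pi> \<in> P \<Longrightarrow> \<rho> \<in> P \<Longrightarrow> \<pi> \<le> \<rho> \<Longrightarrow> res F \<pi> \<rho> (curry v \<pi>) = curry v \<rho>"
  shows "v \<in> limit_space P F"
  using assms by (auto simp: limit_space_def)

lemma subsp_limit:
  assumes F: "is_sheaf P F"
  shows "subsp (limit_space P F)"
proof (rule subspI)
  show "0 \<in> limit_space P F"
    by (rule limitI) (auto simp: subsp_0[OF sheaf_subsp[OF F]] lm_0[OF sheaf_res[OF F] sheaf_subsp[OF F]])
  show "x + y \<in> limit_space P F" if x: "x \<in> limit_space P F" "y \<in> limit_space P F" for x y
    by (rule limitI) (use x in \<open>simp_all add: subsp_add[OF sheaf_subsp[OF F]] limit_in[of _ P F] limit_out[of _ P F]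
      limit_res[of _ P F] lm_add[OF sheaf_res[OF F]]\<close>)
  show "vscale c x \<in> limit_space P F" if x: "x \<in> limit_space P F" for c x
    by (rule limitI) (use x in \<open>simp_all add: subsp_scale[OF sheaf_subsp[OF F]] limit_in[of _ P F] limit_out[of _ P F]
      limit_res[of _ P F] lm_scale[OF sheaf_res[OF F]]\<close>)
qed

lemma findim_limit:
  assumes "finite P" and F: "is_sheaf P F"
  shows "findim_space (limit_space P F)"
  by (rule findim_subset[OF findim_prod[OF assms(1) sheaf_findim[OF F]] subsp_limit[OF F]])
    (auto simp: prod_space_def limit_in limit_out)

lemma sec_map_lm:
  assumes f: "sheaf_hom P F G \<phi>"
  shows "linear_map (limit_space P F) (limit_space P G) (sec_map P \<phi>)"
proof (rule linear_mapI)
  fix x assume x: "x \<in> limit_space P F"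
  show "sec_map P \<phi> x \<in> limit_space P G"
    by (rule limitI) (simp_all add: curry_sec_map hom_in[OF f] limit_in[OF x] limit_res[OF x] flip: hom_nat[OF f])
next
  fix x y assume x: "x \<in> limit_space P F" "y \<in> limit_space P F"
  show "sec_map P \<phi> (x + y) = sec_map P \<phi> x + sec_map P \<phi> y"
    by (rule curry_eqI) (simp add: curry_sec_map hom_add[OF f] limit_in[OF x(1)] limit_in[OF x(2)])
next
  fix c x assume x: "x \<in> limit_space P F"
  show "sec_map P \<phi> (vscale c x) = vscale c (sec_map P \<phi> x)"
    by (rule curry_eqI) (simp add: curry_sec_map lm_scale[OF hom_lm[OF f]] limit_in[OF x])
qed

lemma pp_simps: "stk (pushforward_point P C) n u = limit_space P (obj C n)"
  "diff (pushforward_point P C) n u = sec_map P (diff C n)" "res (obj (pushforward_point P C) n) u u' v = v"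
  by (simp_all add: pushforward_point_def sec_map_def[abs_def])

lemma hom_unitI:
  assumes "linear_map (stalk F ()) (stalk G ()) (\<phi> ())" "\<And>u u' v. res F u u' v = v" "\<And>u u' v. res G u u' v = v"
  shows "sheaf_hom {()} F G \<phi>"
  by (rule sheaf_homI) (use assms in \<open>auto simp: less_eq_unit_def\<close>)

lemma pp_sheaf:
  assumes "finite P" "is_sheaf P (obj C n)"
  shows "is_sheaf {()} (obj (pushforward_point P C) n)"
  by (rule is_sheafI) (auto simp: pp_simps findim_limit[OF assms] intro!: linear_mapI)

lemma pp_complex:
  assumes P: "finite P" and C: "bounded_complex P C"
  shows "bounded_complex {()} (pushforward_point P C)"
  unfolding bounded_complex_def
proof (intro conjI allI ballI)
  show "is_sheaf {()} (obj (pushforward_point P C) n)" for n by (rule pp_sheaf[OF P cpx_sheaf[OF C]])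
  show "sheaf_hom {()} (obj (pushforward_point P C) n) (obj (pushforward_point P C) (n + 1)) (diff (pushforward_point P C) n)" for n
    by (rule hom_unitI) (simp_all add: pp_simps sec_map_lm[OF cpx_diff[OF C]])
  show "diff (pushforward_point P C) (n + 1) \<sigma> (diff (pushforward_point P C) n \<sigma> v) = 0"
    if "v \<in> stk (pushforward_point P C) n \<sigma>" for n \<sigma> v
    by (rule curry_eqI) (use that in \<open>simp add: pp_simps curry_sec_map d_d[OF C] limit_in\<close>)
  obtain M where M: "\<And>n. \<bar>n\<bar> > M \<Longrightarrow> zero_sheaf P (obj C n)" using cpx_bounded[OF C] by blast
  have "zero_sheaf {()} (obj (pushforward_point P C) n)" if n: "\<bar>n\<bar> > M" for n
  proof -
    have "v = 0" if v: "v \<in> limit_space P (obj C n)" for v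
    proof (rule curry_eqI)
      fix p show "curry v p = curry 0 p"
        using limit_in[OF v, of p] limit_out[OF v, of p] M[OF n] by (cases "p \<in> P") (auto simp: zero_sheaf_def)
    qed
    then show ?thesis using subsp_0[OF subsp_limit[OF cpx_sheaf[OF C]]] by (auto simp: zero_sheaf_def pp_simps)
  qed
  then show "\<exists>N. \<forall>n. N < \<bar>n\<bar> \<longrightarrow> zero_sheaf {()} (obj (pushforward_point P C) n)" by blast
qed

lemma pp_chain_map:
  assumes f: "chain_map P C D \<phi>"
  shows "chain_map {()} (pushforward_point P C) (pushforward_point P D) (\<lambda>n _. sec_map P (\<phi> n))"
  unfolding chain_map_def
proof (intro conjI allI ballI)
  show "sheaf_hom {()} (obj (pushforward_point P C) n) (obj (pushforward_point P D) n) (\<lambda>_. sec_map P (\<phi> n))" for n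
    by (rule hom_unitI) (simp_all add: pp_simps sec_map_lm[OF map_hom[OF f]])
  show "sec_map P (\<phi> (n + 1)) (diff (pushforward_point P C) n \<sigma> v) = diff (pushforward_point P D) n \<sigma> (sec_map P (\<phi> n) v)"
    if "v \<in> stk (pushforward_point P C) n \<sigma>" for n \<sigma> v
    by (rule curry_eqI) (use that in \<open>simp add: pp_simps curry_sec_map map_comm[OF f] limit_in\<close>)
qed

lemma pp_hty:
  assumes h: "hty P C D f g h"
  shows "hty {()} (pushforward_point P C) (pushforward_point P D) (\<lambda>n _. sec_map P (f n)) (\<lambda>n _. sec_map P (g n)) (\<lambda>n _. sec_map P (h n))"
  unfolding hty_def
proof (intro conjI allI ballI)
  show "sheaf_hom {()} (obj (pushforward_point P C) n) (obj (pushforward_point P D) (n - 1)) (\<lambda>_. sec_map P (h n))" for n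
    by (rule hom_unitI) (simp_all add: pp_simps sec_map_lm[OF hty_hom[OF h]])
  show "sec_map P (f n) v = sec_map P (g n) v + diff (pushforward_point P D) (n - 1) \<sigma> (sec_map P (h n) v) +
      sec_map P (h (n + 1)) (diff (pushforward_point P C) n \<sigma> v)"
    if "v \<in> stk (pushforward_point P C) n \<sigma>" for n \<sigma> v
    by (rule curry_eqI) (use that in \<open>simp add: pp_simps curry_sec_map hty_eq[OF h] limit_in\<close>)
qed

section \<open>Cohomology dimensions and their homotopy invariance\<close>

lemma cocycles_findim:
  assumes C: "bounded_complex P C" and s: "\<sigma> \<in> P"
  shows "findim_space (cocycles C n \<sigma>)" "findim_space (coboundaries C n \<sigma>)" "coboundaries C n \<sigma> \<subseteq> cocycles C n \<sigma>"
proof -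
  show "findim_space (cocycles C n \<sigma>)"
    unfolding cocycles_def
    by (rule findim_subset[OF sheaf_findim[OF cpx_sheaf[OF C] s] subsp_kernel[OF d_lm[OF C s] c_subsp[OF C s]]]) auto
  show "findim_space (coboundaries C n \<sigma>)"
    unfolding coboundaries_def by (rule findim_image[OF d_lm[OF C s] sheaf_findim[OF cpx_sheaf[OF C] s]])
  show "coboundaries C n \<sigma> \<subseteq> cocycles C n \<sigma>"
    by (auto simp: cocycles_def coboundaries_def d_inm[OF C s] d_dm[OF C s])
qed

text \<open>Quotients are avoided by the map (z, b) to \<phi> z + b from the sum of the cocycles of
  \<open>C\<close> and the coboundaries of \<open>D\<close> to the cocycles of \<open>D\<close>.
  Injectivity on cohomology bounds its kernel by the coboundaries of \<open>C\<close>, surjectivity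
  makes it onto; rank and nullity give the two inequalities.\<close>

lemma cohomology_compare:
  assumes C: "bounded_complex P C" and D: "bounded_complex P D" and f: "chain_map P C D \<phi>" and s: "\<sigma> \<in> P"
  shows "(\<And>z u. z \<in> stk C n \<sigma> \<Longrightarrow> diff C n \<sigma> z = 0 \<Longrightarrow> u \<in> stk D (n - 1) \<sigma> \<Longrightarrow> \<phi> n \<sigma> z = diff D (n - 1) \<sigma> u \<Longrightarrow>
      z \<in> coboundaries C n \<sigma>) \<Longrightarrow> cohomology_dim C n \<sigma> \<le> cohomology_dim D n \<sigma>"
    and "(\<And>w. w \<in> stk D n \<sigma> \<Longrightarrow> diff D n \<sigma> w = 0 \<Longrightarrow> \<exists>z u. z \<in> stk C n \<sigma> \<and> diff C n \<sigma> z = 0 \<and> u \<in> stk D (n - 1) \<sigma> \<and>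
      w = \<phi> n \<sigma> z + diff D (n - 1) \<sigma> u) \<Longrightarrow> cohomology_dim D n \<sigma> \<le> cohomology_dim C n \<sigma>"
proof -
  let ?ZC = "cocycles C n \<sigma>" and ?BC = "coboundaries C n \<sigma>" and ?ZD = "cocycles D n \<sigma>" and ?BD = "coboundaries D n \<sigma>"
  note fC = cocycles_findim[OF C s, of n] and fD = cocycles_findim[OF D s, of n]
  let ?m = "\<lambda>v. \<phi> n \<sigma> (v \<circ> Inl) + (v \<circ> Inr)"
  have ZC: "?ZC \<subseteq> stk C n \<sigma>" and ZD: "?ZD \<subseteq> stk D n \<sigma>" by (auto simp: cocycles_def)
  have fZ: "\<phi> n \<sigma> z \<in> ?ZD" if "z \<in> ?ZC" for z
    using that f_in[OF C f s] f_cocycle[OF C f s] by (auto simp: cocycles_def)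
  have lf: "linear_map ?ZC ?ZD (\<phi> n \<sigma>)" by (rule lm_restrict[OF hom_lm[OF map_hom[OF f] s] ZC fZ])
  have m: "linear_map (dsum ?ZC ?BD) ?ZD ?m"
    by (rule lm_plus[OF lm_compose[OF lm_Inl lf] lm_restrict[OF lm_compose[OF lm_Inr lm_id] subset_refl] findim_subsp[OF fD(1)]])
      (use fD(3) in \<open>auto simp: dsum_def\<close>)
  let ?K = "{v \<in> dsum ?ZC ?BD. ?m v = 0}" and ?I = "?m ` dsum ?ZC ?BD"
  note fS = findim_dsum[OF fC(1) fD(2)]
  have rn: "dm ?ZC + dm ?BD = dm ?K + dm ?I"
    using rank_nullity[OF m fS] dim_dsum[OF fC(1) fD(2)] by simp
  have fK: "findim_space ?K" by (rule findim_subset[OF fS subsp_kernel[OF m findim_subsp[OF fS]]]) auto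
  have BZ: "dm ?BC \<le> dm ?ZC" "dm ?BD \<le> dm ?ZD"
    using dim_mono[OF fC(1,3)] dim_mono[OF fD(1,3)] by auto
  {
    assume inj: "\<And>z u. z \<in> stk C n \<sigma> \<Longrightarrow> diff C n \<sigma> z = 0 \<Longrightarrow> u \<in> stk D (n - 1) \<sigma> \<Longrightarrow> \<phi> n \<sigma> z = diff D (n - 1) \<sigma> u \<Longrightarrow>
      z \<in> ?BC"
    have z: "v \<circ> Inl \<in> ?BC" if v: "v \<in> ?K" for v
    proof -
      obtain a b where ab: "v = case_sum a b" "a \<in> ?ZC" "b \<in> ?BD" using v by (auto elim: dsumE)
      obtain u where u: "u \<in> stk D (n - 1) \<sigma>" "b = diff D (n - 1) \<sigma> u" using ab(3) by (auto simp: coboundaries_def)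
      have "\<phi> n \<sigma> a + diff D (n - 1) \<sigma> u = 0" using v by (simp add: ab(1) u(2))
      then have "\<phi> n \<sigma> a = - diff D (n - 1) \<sigma> u" by (simp add: eq_neg_iff_add_eq_0)
      then have "\<phi> n \<sigma> a = diff D (n - 1) \<sigma> (- u)" using lm_neg[OF d_lm[OF D s] u(1)] by simp
      then show ?thesis
        using inj[of a "- u"] ab subsp_neg[OF c_subsp[OF D s] u(1)] by (simp add: cocycles_def)
    qed
    have "dm ?K \<le> dm ?BC"
    proof (rule dim_le_via_inj)
      show "linear_map ?K ?BC (\<lambda>v. v \<circ> Inl)" by (rule lm_restrict[OF lm_Inl[of ?ZC ?BD]]) (use z in auto)
      show "inj_on (\<lambda>v. v \<circ> Inl) ?K"
      proof (rule inj_onI)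
        fix x y assume xy: "x \<in> ?K" "y \<in> ?K" "x \<circ> Inl = y \<circ> Inl"
        then have "\<phi> n \<sigma> (x \<circ> Inl) + (x \<circ> Inr) = \<phi> n \<sigma> (x \<circ> Inl) + (y \<circ> Inr)" by simp
        then have "x \<circ> Inr = y \<circ> Inr" by (rule add_left_imp_eq)
        then show "x = y" using xy(3) by (intro dsum_eqI)
      qed
    qed (rule fK, rule fC(2))
    moreover have "dm ?I \<le> dm ?ZD" by (rule dim_mono[OF fD(1)]) (use lm_in[OF m] in blast)
    ultimately show "cohomology_dim C n \<sigma> \<le> cohomology_dim D n \<sigma>"
      using rn BZ unfolding cohomology_dim_def by linarith
  next
    assume sur: "\<And>w. w \<in> stk D n \<sigma> \<Longrightarrow> diff D n \<sigma> w = 0 \<Longrightarrow> \<exists>z u. z \<in> stk C n \<sigma> \<and> diff C n \<sigma> z = 0 \<and> u \<in> stk D (n - 1) \<sigma> \<and>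
      w = \<phi> n \<sigma> z + diff D (n - 1) \<sigma> u"
    have "?ZD \<subseteq> ?I"
    proof
      fix w assume "w \<in> ?ZD"
      then obtain z u where zu: "z \<in> stk C n \<sigma>" "diff C n \<sigma> z = 0" "u \<in> stk D (n - 1) \<sigma>" "w = \<phi> n \<sigma> z + diff D (n - 1) \<sigma> u"
        using sur[of w] by (auto simp: cocycles_def)
      have "w = ?m (case_sum z (diff D (n - 1) \<sigma> u))" using zu(4) by simp
      moreover have "case_sum z (diff D (n - 1) \<sigma> u) \<in> dsum ?ZC ?BD"
        using zu by (simp add: cocycles_def coboundaries_def)
      ultimately show "w \<in> ?I" by (rule image_eqI)
    qed
    then have "dm ?ZD \<le> dm ?I" by (rule dim_mono[OF findim_image[OF m fS]])
    moreover have "dm ?BC \<le> dm ?K"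
    proof (rule dim_le_via_inj)
      have i: "- \<phi> n \<sigma> z \<in> ?BD" if z: "z \<in> ?BC" for z
      proof -
        obtain u where u: "u \<in> stk C (n - 1) \<sigma>" "z = diff C (n - 1) \<sigma> u" using z by (auto simp: coboundaries_def)
        have "\<phi> n \<sigma> z \<in> ?BD" unfolding u(2) f_commm[OF C f s u(1)] coboundaries_def using f_in[OF C f s u(1)] by blast
        then show ?thesis by (rule subsp_neg[OF findim_subsp[OF fD(2)]])
      qed
      have BC: "z \<in> stk C n \<sigma>" if "z \<in> ?BC" for z using that fC(3) ZC by blast
      show "linear_map ?BC ?K (\<lambda>z. case_sum z (- \<phi> n \<sigma> z))"
      proof (rule linear_mapI)
        fix z assume z: "z \<in> ?BC"
        have "case_sum z (- \<phi> n \<sigma> z) \<in> dsum ?ZC ?BD" using i[OF z] subsetD[OF fC(3) z] by simp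
        then show "case_sum z (- \<phi> n \<sigma> z) \<in> ?K" by simp
        show "case_sum (vscale c z) (- \<phi> n \<sigma> (vscale c z)) = vscale c (case_sum z (- \<phi> n \<sigma> z))" for c
          unfolding case_sum_linear lm_scale[OF hom_lm[OF map_hom[OF f] s] BC[OF z]] kfun.scale_minus_right ..
      next
        fix y z assume z: "y \<in> ?BC" "z \<in> ?BC"
        show "case_sum (y + z) (- \<phi> n \<sigma> (y + z)) = case_sum y (- \<phi> n \<sigma> y) + case_sum z (- \<phi> n \<sigma> z)"
          unfolding case_sum_linear f_add[OF C f s BC[OF z(1)] BC[OF z(2)]] minus_add_distrib ..
      qed
      show "inj_on (\<lambda>z. case_sum z (- \<phi> n \<sigma> z)) ?BC"
      proof (rule inj_onI)
        fix y z assume "case_sum y (- \<phi> n \<sigma> y) = case_sum z (- \<phi> n \<sigma> z)"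
        from arg_cong[OF this, of "\<lambda>v. v \<circ> Inl"] show "y = z" unfolding case_sum_comp .
      qed
    qed (rule fC(2), rule fK)
    ultimately show "cohomology_dim D n \<sigma> \<le> cohomology_dim C n \<sigma>"
      using rn BZ unfolding cohomology_dim_def by linarith
  }
qed

lemma quasi_iso_cohomology:
  assumes C: "bounded_complex P C" and D: "bounded_complex P D" and q: "quasi_iso P C D \<phi>" and s: "\<sigma> \<in> P"
  shows "cohomology_dim C n \<sigma> = cohomology_dim D n \<sigma>"
proof (rule antisym)
  show "cohomology_dim C n \<sigma> \<le> cohomology_dim D n \<sigma>"
  proof (rule cohomology_compare(1)[OF C D qi_map[OF q] s])
    fix z u assume "z \<in> stk C n \<sigma>" "diff C n \<sigma> z = 0" "u \<in> stk D (n - 1) \<sigma>" "\<phi> n \<sigma> z = diff D (n - 1) \<sigma> u"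
    then show "z \<in> coboundaries C n \<sigma>" using qi_inj[OF q s, OF \<open>z \<in> stk C n \<sigma>\<close>] unfolding coboundaries_def by blast
  qed
  show "cohomology_dim D n \<sigma> \<le> cohomology_dim C n \<sigma>"
    by (rule cohomology_compare(2)[OF C D qi_map[OF q] s]) (rule qi_surj[OF q s])
qed

text \<open>The map \<open>i\<close> stands for the identity. It is a variable because the identity
  of a sheaf induces on sections the map \<open>sec_map P (\<lambda>_ v. v)\<close>, which is the
  identity only on families that vanish outside \<open>P\<close>.\<close>

lemma homotopy_retract_cohomology:
  assumes C: "bounded_complex P C" and D: "bounded_complex P D" and f: "chain_map P C D \<phi>" and g: "chain_map P D C \<psi>"
    and h: "hty P C C (\<lambda>n \<sigma> v. \<psi> n \<sigma> (\<phi> n \<sigma> v)) i h" and s: "\<sigma> \<in> P"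
    and i: "\<And>n v. v \<in> stk C n \<sigma> \<Longrightarrow> i n \<sigma> v = v"
  shows "cohomology_dim C n \<sigma> \<le> cohomology_dim D n \<sigma>"
proof (rule cohomology_compare(1)[OF C D f s])
  fix z u assume z: "z \<in> stk C n \<sigma>" "diff C n \<sigma> z = 0" and u: "u \<in> stk D (n - 1) \<sigma>" and eq: "\<phi> n \<sigma> z = diff D (n - 1) \<sigma> u"
  have gu: "\<psi> (n - 1) \<sigma> u \<in> stk C (n - 1) \<sigma>" and hz: "h n \<sigma> z \<in> stk C (n - 1) \<sigma>"
    using f_in[OF D g s u] h_facts(1)[OF C h s z(1)] by auto
  have "diff C (n - 1) \<sigma> (\<psi> (n - 1) \<sigma> u) = z + diff C (n - 1) \<sigma> (h n \<sigma> z)"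
    using h_facts(6)[OF C h s z] unfolding eq f_commm[OF D g s u] i[OF z(1)] .
  then have "z = diff C (n - 1) \<sigma> (\<psi> (n - 1) \<sigma> u - h n \<sigma> z)"
    unfolding d_diff[OF C s gu hz] by simp
  then show "z \<in> coboundaries C n \<sigma>"
    unfolding coboundaries_def using c_diff[OF C s gu hz] by blast
qed

abbreviation sec_coh :: "'a::order set \<Rightarrow> ('a, 'i, 'k::field) cpx \<Rightarrow> int \<Rightarrow> nat" where
  "sec_coh P C n \<equiv> cohomology_dim (pushforward_point P C) n ()"

lemma sec_coh_retract:
  assumes P: "finite P" and C: "bounded_complex P C" and D: "bounded_complex P D" and f: "chain_map P C D \<phi>" and g: "chain_map P D C \<psi>"
    and h: "hty P C C (\<lambda>n \<sigma> v. \<psi> n \<sigma> (\<phi> n \<sigma> v)) (\<lambda>_ _ v. v) h"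
  shows "sec_coh P C n \<le> sec_coh P D n"
proof -
  have "sec_map P (\<lambda>\<sigma> v. \<psi> n \<sigma> (\<phi> n \<sigma> v)) = (\<lambda>v. sec_map P (\<psi> n) (sec_map P (\<phi> n) v))" for n
    by (rule ext, rule curry_eqI) (simp add: curry_sec_map)
  then have "hty {()} (pushforward_point P C) (pushforward_point P C) (\<lambda>n \<sigma> v. sec_map P (\<psi> n) (sec_map P (\<phi> n) v))
      (\<lambda>n _. sec_map P (\<lambda>_ v. v)) (\<lambda>n _. sec_map P (h n))"
    using pp_hty[OF h] by simp
  then show ?thesis
  proof (rule homotopy_retract_cohomology[OF pp_complex[OF P C] pp_complex[OF P D] pp_chain_map[OF f] pp_chain_map[OF g]])
    fix n v assume "v \<in> stk (pushforward_point P C) n ()"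
    then show "sec_map P (\<lambda>_ v. v) v = v"
      by (intro curry_eqI) (simp add: curry_sec_map pp_simps limit_out)
  qed simp
qed

text \<open>Global sections need not preserve quasi-isomorphisms, but they preserve homotopies.
  Between injective complexes there are homotopy inverses, so each side is a homotopy retract of the
  other.\<close>

lemma sec_coh_quasi_iso:
  assumes P: "finite P" and J: "bounded_complex P J" and injJ: "\<And>n. ginj P (obj J n)"
    and K: "bounded_complex P K" and injK: "\<And>n. ginj P (obj K n)" and b: "quasi_iso P K J b"
  shows "sec_coh P K n = sec_coh P J n"
proof -
  obtain \<alpha> \<beta> h h' where a: "quasi_iso P J K \<alpha>" "chain_map P K J \<beta>"
    and h: "hty P J J (\<lambda>n \<sigma> v. \<beta> n \<sigma> (\<alpha> n \<sigma> v)) (\<lambda>_ _ v. v) h" "hty P K K (\<lambda>n \<sigma> v. \<alpha> n \<sigma> (b n \<sigma> v)) (\<lambda>_ _ v. v) h'"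
    using homotopy_inverses[OF J injJ K injK b] by blast
  show ?thesis
    using sec_coh_retract[OF P J K qi_map[OF a(1)] a(2) h(1)] sec_coh_retract[OF P K J qi_map[OF b] qi_map[OF a(1)] h(2)]
    by (rule antisym[rotated])
qed

text \<open>Over a point the minimal resolution is a quasi-isomorphism at the only stalk, so it
  preserves the cohomology of the complex of sections.\<close>

lemma hypercoh_dim_sec_coh:
  assumes P: "finite P" and I: "bounded_complex P I"
  shows "hypercoh_dim P I d = sec_coh P I d"
proof -
  have pp: "bounded_complex {()} (pushforward_point P I)" by (rule pp_complex[OF P I])
  obtain \<phi> where "quasi_iso {()} (pushforward_point P I) (min_inj_res {()} (pushforward_point P I)) \<phi>"
    using min_inj_res(3)[OF _ pp] by blast
  then show ?thesis
    unfolding hypercoh_dim_def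
    by (intro quasi_iso_cohomology[OF pp, symmetric] min_inj_res(1)[OF _ pp]) simp_all
qed

section \<open>Alternating sums and Morse inequalities\<close>

text \<open>The sum f l - f (l - 1) + f (l - 2) - ..., in which the sign in front of the Morse
  inequalities is absorbed. Integer values allow subtraction.\<close>

definition alt :: "int \<Rightarrow> (int \<Rightarrow> int) \<Rightarrow> int" where
  "alt l f = neg_one_pow l * (\<Sum>j | j \<le> l \<and> f j \<noteq> 0. neg_one_pow j * f j)"

lemma neg_one_pow_sq [simp]: "neg_one_pow l * neg_one_pow l = 1" "neg_one_pow l * (neg_one_pow l * x) = x"
proof -
  show 1: "neg_one_pow l * neg_one_pow l = 1" by (simp add: neg_one_pow_def flip: power_mult_distrib)
  show "neg_one_pow l * (neg_one_pow l * x) = x" by (simp add: 1 flip: mult.assoc)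
qed

lemma neg_one_pow_pred: "neg_one_pow (l - 1) = - neg_one_pow l"
proof (cases "l > 0")
  case True
  then have *: "nat \<bar>l\<bar> = Suc (nat \<bar>l - 1\<bar>)" by simp
  show ?thesis unfolding neg_one_pow_def * by simp
next
  case False
  then have *: "nat \<bar>l - 1\<bar> = Suc (nat \<bar>l\<bar>)" by simp
  show ?thesis unfolding neg_one_pow_def * by simp
qed

lemma alt_rec:
  assumes "finite {j. f j \<noteq> 0}"
  shows "alt l f = f l - alt (l - 1) f"
proof -
  have fin: "finite {j. j \<le> l - 1 \<and> f j \<noteq> 0}" by (rule finite_subset[OF _ assms]) auto
  have "(\<Sum>j | j \<le> l \<and> f j \<noteq> 0. neg_one_pow j * f j) = neg_one_pow l * f l + (\<Sum>j | j \<le> l - 1 \<and> f j \<noteq> 0. neg_one_pow j * f j)"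
  proof (cases "f l = 0")
    case True
    then have "j \<le> l \<and> f j \<noteq> 0 \<longleftrightarrow> j \<le> l - 1 \<and> f j \<noteq> 0" for j by (cases "j = l") auto
    then show ?thesis using True by simp
  next
    case False
    then have "j \<le> l \<and> f j \<noteq> 0 \<longleftrightarrow> j = l \<or> j \<le> l - 1 \<and> f j \<noteq> 0" for j by (cases "j = l") auto
    then have "{j. j \<le> l \<and> f j \<noteq> 0} = insert l {j. j \<le> l - 1 \<and> f j \<noteq> 0}" by blast
    then show ?thesis using fin by simp
  qed
  then show ?thesis by (simp add: alt_def distrib_left neg_one_pow_pred)
qed

lemma alt_low: "(\<And>j. j \<le> l \<Longrightarrow> f j = 0) \<Longrightarrow> alt l f = 0"
proof -
  assume "\<And>j. j \<le> l \<Longrightarrow> f j = 0"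
  then have "{j. j \<le> l \<and> f j \<noteq> 0} = {}" by auto
  then show ?thesis by (simp add: alt_def)
qed

text \<open>A recursion together with vanishing in low degrees determines \<open>alt\<close>;
  identities for \<open>alt\<close> then reduce to checking one recursion step.\<close>

lemma alt_unique:
  assumes "finite {j. f j \<noteq> 0}" and rec: "\<And>l. A l = f l - A (l - 1)" and low: "\<And>l. l < m \<Longrightarrow> A l = 0"
  shows "alt l f = A l"
proof -
  have f0: "f j = 0" if "j < m" for j using rec[of j] low[of j] low[of "j - 1"] that by simp
  have al: "alt l f = A l" if "l < m" for l
    using that alt_low[of l f] f0 low by simp
  show ?thesis
  proof (cases "l < m")
    case False
    then have "m - 1 \<le> l" by simp
    then show ?thesis
    proof (induct l rule: int_ge_induct)
      case base
      then show ?case by (rule al) simp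
    next
      case (step i)
      then show ?case using alt_rec[OF assms(1), of "i + 1"] rec[of "i + 1"] by simp
    qed
  qed (rule al)
qed

definition bdd :: "(int \<Rightarrow> int) \<Rightarrow> bool" where
  "bdd f \<longleftrightarrow> (\<exists>N. \<forall>n. \<bar>n\<bar> > N \<longrightarrow> f n = 0)"

lemma bdd_finite: "bdd f \<Longrightarrow> finite {j. f j \<noteq> 0}"
proof -
  assume "bdd f"
  then obtain N where "\<And>n. \<bar>n\<bar> > N \<Longrightarrow> f n = 0" unfolding bdd_def by blast
  then have "{j. f j \<noteq> 0} \<subseteq> {-N..N}" by force
  then show ?thesis by (rule finite_subset) simp
qed

lemma bdd_low: "bdd f \<Longrightarrow> \<exists>m. \<forall>l<m. f l = 0 \<and> alt l f = 0"
proof -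
  assume "bdd f"
  then obtain N where N: "\<And>n. \<bar>n\<bar> > N \<Longrightarrow> f n = 0" unfolding bdd_def by blast
  then have "f l = 0 \<and> alt l f = 0" if "l < - \<bar>N\<bar>" for l
    using that by (auto intro!: alt_low)
  then show ?thesis by blast
qed

lemma alt_add:
  assumes "bdd f" "bdd g"
  shows "alt l (\<lambda>j. f j + g j) = alt l f + alt l g"
proof -
  obtain m m' where m: "\<forall>l<m. f l = 0 \<and> alt l f = 0" "\<forall>l<m'. g l = 0 \<and> alt l g = 0"
    using bdd_low assms by meson
  have "finite {j. f j + g j \<noteq> 0}"
    by (rule finite_subset[OF _ finite_UnI[OF bdd_finite[OF assms(1)] bdd_finite[OF assms(2)]]]) auto
  then show ?thesis
  proof (rule alt_unique[where m = "min m m'"])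
    show "alt l f + alt l g = f l + g l - (alt (l - 1) f + alt (l - 1) g)" for l
      using alt_rec[OF bdd_finite[OF assms(1)], of l] alt_rec[OF bdd_finite[OF assms(2)], of l] by simp
  qed (use m in auto)
qed

lemma alt_shift:
  assumes "bdd f"
  shows "alt l (\<lambda>j. f (j - 1)) = alt (l - 1) f"
proof -
  obtain m where m: "\<forall>l<m. f l = 0 \<and> alt l f = 0" using bdd_low[OF assms] by blast
  have "{j. f (j - 1) \<noteq> 0} \<subseteq> (\<lambda>j. j + 1) ` {j. f j \<noteq> 0}" by (auto intro!: image_eqI[of _ _ "_ - 1"])
  then have "finite {j. f (j - 1) \<noteq> 0}" using finite_surj[OF bdd_finite[OF assms]] by blast
  then show ?thesis
  proof (rule alt_unique[where m = m])
    show "alt (l - 1) f = f (l - 1) - alt (l - 1 - 1) f" for l by (rule alt_rec[OF bdd_finite[OF assms]])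
    show "alt (l - 1) f = 0" if "l < m" for l using m that by simp
  qed
qed

section \<open>Morse inequalities for complexes of vector spaces\<close>

abbreviation cdim :: "(unit, 'i, 'k::field) cpx \<Rightarrow> int \<Rightarrow> int" where
  "cdim X n \<equiv> int (dm (stk X n ()))"

abbreviation crank :: "(unit, 'i, 'k::field) cpx \<Rightarrow> int \<Rightarrow> int" where
  "crank X n \<equiv> int (dm (diff X n () ` stk X n ()))"

abbreviation coh :: "(unit, 'i, 'k::field) cpx \<Rightarrow> int \<Rightarrow> int" where
  "coh X n \<equiv> int (cohomology_dim X n ())"

context
  fixes X :: "(unit, 'i, 'k::field) cpx"
  assumes X: "bounded_complex {()} X"
begin

lemma v_findim: "findim_space (stk X n ())"
  by (rule sheaf_findim[OF cpx_sheaf[OF X]]) simp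

lemma cocycles_dim: "int (dm (cocycles X n ())) = cdim X n - crank X n"
  using rank_nullity[OF d_lm[OF X, of "()"] v_findim] by (simp add: cocycles_def)

lemma coh_dims: "coh X n = cdim X n - crank X n - crank X (n - 1)"
  using cocycles_dim[of n] dim_mono[OF cocycles_findim(1,3)[OF X, of "()" n]]
  by (simp add: cohomology_dim_def coboundaries_def)

lemma bdd_cdim: "bdd (cdim X)" and bdd_coh: "bdd (coh X)" and bdd_crank: "bdd (crank X)"
proof -
  obtain N where N: "\<And>n. \<bar>n\<bar> > N \<Longrightarrow> zero_sheaf {()} (obj X n)" using cpx_bounded[OF X] by blast
  have z: "stk X n () = {0}" if "\<bar>n\<bar> > N" for n using N[OF that] by (simp add: zero_sheaf_def)
  have "cdim X n = 0" if "\<bar>n\<bar> > N" for n unfolding z[OF that] by simp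
  then show "bdd (cdim X)" unfolding bdd_def by blast
  have r: "crank X n = 0" if "\<bar>n\<bar> > N" for n using z[OF that] d_0[OF X, of "()"] by simp
  then show "bdd (crank X)" unfolding bdd_def by blast
  have "coh X n = 0" if "\<bar>n\<bar> > \<bar>N\<bar> + 1" for n
    using that z[of n] r[of n] r[of "n - 1"] by (simp add: coh_dims)
  then show "bdd (coh X)" unfolding bdd_def by blast
qed

text \<open>The cohomology dimension is the chain dimension minus the ranks of the outgoing and the
  incoming differential. In the alternating sum the ranks telescope, and only the outgoing rank in
  degree l remains.\<close>

lemma alt_coh: "alt l (coh X) = alt l (cdim X) - crank X l"
proof -
  obtain m m' where m: "\<forall>l<m. cdim X l = 0 \<and> alt l (cdim X) = 0" "\<forall>l<m'. crank X l = 0 \<and> alt l (crank X) = 0"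
    using bdd_low[OF bdd_cdim] bdd_low[OF bdd_crank] by blast
  show ?thesis
  proof (rule alt_unique[OF bdd_finite[OF bdd_coh], where m = "min m m'"])
    show "alt l (cdim X) - crank X l = coh X l - (alt (l - 1) (cdim X) - crank X (l - 1))" for l
      using alt_rec[OF bdd_finite[OF bdd_cdim], of l] by (simp add: coh_dims)
  qed (use m in auto)
qed

end

text \<open>Chain dimensions add up, so by \<open>alt_coh\<close> the claim is rank X + rank Z <=
  rank Y in degree l: the image of the differential of \<open>Y\<close> maps onto that of
  \<open>Z\<close>, and the kernel of this map contains a copy of that of \<open>X\<close>.\<close>

lemma morse_exact:
  assumes X: "bounded_complex {()} X" and Y: "bounded_complex {()} Y" and Z: "bounded_complex {()} Z"
    and i: "chain_map {()} X Y i" and q: "chain_map {()} Y Z q"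
    and i_inj: "\<And>n x. x \<in> stk X n () \<Longrightarrow> i n () x = 0 \<Longrightarrow> x = 0"
    and qi0: "\<And>n x. x \<in> stk X n () \<Longrightarrow> q n () (i n () x) = 0"
    and exact: "\<And>n b. b \<in> stk Y n () \<Longrightarrow> q n () b = 0 \<Longrightarrow> \<exists>a\<in>stk X n (). b = i n () a"
    and q_surj: "\<And>n c. c \<in> stk Z n () \<Longrightarrow> \<exists>b\<in>stk Y n (). c = q n () b"
  shows "alt l (coh Y) \<le> alt l (coh X) + alt l (coh Z)"
proof -
  have u: "() \<in> {()}" by simp
  note li = hom_lm[OF map_hom[OF i] u] and lq = hom_lm[OF map_hom[OF q] u]
  have inj: "inj_on (i n ()) (stk X n ())" for n
  proof (rule inj_onI)
    fix x y assume xy: "x \<in> stk X n ()" "y \<in> stk X n ()" "i n () x = i n () y"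
    then have "x - y = 0" using f_diff[OF X i u] by (intro i_inj[OF c_diff[OF X u]]) auto
    then show "x = y" by simp
  qed
  have D: "cdim Y n = cdim X n + cdim Z n" for n
  proof -
    have "{y \<in> stk Y n (). q n () y = 0} = i n () ` stk X n ()" using qi0 exact f_in[OF X i u] by blast
    moreover have "q n () ` stk Y n () = stk Z n ()" using q_surj f_in[OF Y q u] by blast
    ultimately show ?thesis using rank_nullity[OF lq v_findim[OF Y]] dim_inj_image[OF li v_findim[OF X] inj] by simp
  qed
  have R: "crank X l + crank Z l \<le> crank Y l"
  proof -
    let ?B = "diff Y l () ` stk Y l ()"
    have fB: "findim_space ?B" by (rule findim_image[OF d_lm[OF Y u] v_findim[OF Y]])
    have B: "?B \<subseteq> stk Y (l + 1) ()" using d_in[OF Y u] by blast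
    have lqB: "linear_map ?B (stk Z (l + 1) ()) (q (l + 1) ())"
      by (rule lm_restrict[OF lq B]) (use B f_in[OF Y q u] in blast)
    have "q (l + 1) () ` ?B = diff Z l () ` stk Z l ()"
    proof
      show "q (l + 1) () ` ?B \<subseteq> diff Z l () ` stk Z l ()"
        using f_comm[OF Y q u] f_in[OF Y q u] by fastforce
      show "diff Z l () ` stk Z l () \<subseteq> q (l + 1) () ` ?B"
      proof
        fix z assume "z \<in> diff Z l () ` stk Z l ()"
        then obtain c where c: "c \<in> stk Z l ()" "z = diff Z l () c" by blast
        obtain b where b: "b \<in> stk Y l ()" "c = q l () b" using q_surj[OF c(1)] by blast
        have "z = q (l + 1) () (diff Y l () b)" unfolding c(2) b(2) f_comm[OF Y q u b(1)] ..
        then show "z \<in> q (l + 1) () ` ?B" using b(1) by blast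
      qed
    qed
    moreover have "dm (diff X l () ` stk X l ()) \<le> dm {y \<in> ?B. q (l + 1) () y = 0}"
    proof (rule dim_le_via_inj)
      have A: "diff X l () ` stk X l () \<subseteq> stk X (l + 1) ()" using d_in[OF X u] by blast
      show "linear_map (diff X l () ` stk X l ()) {y \<in> ?B. q (l + 1) () y = 0} (i (l + 1) ())"
      proof (rule lm_restrict[OF li A])
        fix x assume "x \<in> diff X l () ` stk X l ()"
        then obtain a where a: "a \<in> stk X l ()" "x = diff X l () a" by blast
        have "i (l + 1) () x = diff Y l () (i l () a)" unfolding a(2) f_comm[OF X i u a(1)] ..
        moreover have "q (l + 1) () (i (l + 1) () x) = 0" by (rule qi0) (simp add: a d_in[OF X u])
        ultimately show "i (l + 1) () x \<in> {y \<in> ?B. q (l + 1) () y = 0}" using f_in[OF X i u a(1)] by blast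
      qed
      show "inj_on (i (l + 1) ()) (diff X l () ` stk X l ())" by (rule inj_on_subset[OF inj A])
      show "findim_space (diff X l () ` stk X l ())" by (rule findim_image[OF d_lm[OF X u] v_findim[OF X]])
      show "findim_space {y \<in> ?B. q (l + 1) () y = 0}"
        by (rule findim_subset[OF fB subsp_kernel[OF lqB findim_subsp[OF fB]]]) auto
    qed
    ultimately show ?thesis using rank_nullity[OF lqB fB] by simp
  qed
  have "cdim Y = (\<lambda>n. cdim X n + cdim Z n)" using D by (rule ext)
  then have "alt l (cdim Y) = alt l (cdim X) + alt l (cdim Z)"
    using alt_add[OF bdd_cdim[OF X] bdd_cdim[OF Z]] by simp
  then show ?thesis using R by (simp add: alt_coh[OF X] alt_coh[OF Y] alt_coh[OF Z])
qed

text \<open>With \<open>alt_coh\<close> and the shift of \<open>Z\<close> the claim becomes rank K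
  <= rank Y + dim of the cocycles of \<open>Z\<close> in degree l, for the cocone \<open>K\<close>.
  The image of the differential of \<open>K\<close> projects into that of \<open>Y\<close>, and an
  element (0, w) of this image is a cocycle, hence so is w.\<close>

lemma morse_cocone:
  assumes Y: "bounded_complex {()} Y" and Z: "bounded_complex {()} Z" and f: "chain_map {()} Y Z \<phi>"
  shows "alt l (coh Y) \<le> alt l (coh (cocone Y Z \<phi>)) + alt l (coh Z)"
proof -
  have u: "() \<in> {()}" by simp
  let ?K = "cocone Y Z \<phi>"
  have K: "bounded_complex {()} ?K" by (rule cocone_complex[OF Y Z f])
  have "cdim ?K = (\<lambda>n. cdim Y n + cdim Z (n - 1))"
    by (rule ext) (simp add: cocone_stk dim_dsum[OF v_findim[OF Y] v_findim[OF Z]])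
  moreover have "bdd (\<lambda>n. cdim Z (n - 1))"
  proof -
    obtain N where N: "\<And>n. \<bar>n\<bar> > N \<Longrightarrow> cdim Z n = 0" using bdd_cdim[OF Z] unfolding bdd_def by blast
    then have "cdim Z (n - 1) = 0" if "\<bar>n\<bar> > \<bar>N\<bar> + 1" for n using that by (intro N) simp
    then show ?thesis unfolding bdd_def by blast
  qed
  ultimately have D: "alt l (cdim ?K) = alt l (cdim Y) + alt (l - 1) (cdim Z)"
    using alt_add[OF bdd_cdim[OF Y]] alt_shift[OF bdd_cdim[OF Z]] by simp
  have R: "crank ?K l \<le> crank Y l + (cdim Z l - crank Z l)"
  proof -
    let ?B = "diff ?K l () ` stk ?K l ()"
    have fB: "findim_space ?B" by (rule findim_image[OF d_lm[OF K u] v_findim[OF K]])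
    have B: "?B \<subseteq> dsum (stk Y (l + 1) ()) (stk Z l ())" using d_in[OF K u] unfolding cocone_stk by force
    have p: "linear_map ?B (stk Y (l + 1) ()) (\<lambda>v. v \<circ> Inl)" by (rule lm_restrict[OF lm_Inl B]) (use B in \<open>auto simp: dsum_def\<close>)
    have "(\<lambda>v. v \<circ> Inl) ` ?B \<subseteq> diff Y l () ` stk Y l ()"
      by (auto simp: cocone_stk cocone_diff elim!: dsumE)
    then have "dm ((\<lambda>v. v \<circ> Inl) ` ?B) \<le> dm (diff Y l () ` stk Y l ())"
      by (rule dim_mono[OF findim_image[OF d_lm[OF Y u] v_findim[OF Y]]])
    moreover have "dm {v \<in> ?B. v \<circ> Inl = 0} \<le> dm (cocycles Z l ())"
    proof (rule dim_le_via_inj)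
      have m: "v \<circ> Inr \<in> cocycles Z l ()" if v: "v \<in> ?B" "v \<circ> Inl = 0" for v
      proof -
        have "v \<in> stk ?K (l + 1) ()" using v(1) d_in[OF K u] by blast
        moreover have "diff ?K (l + 1) () v = 0" using v(1) d_d[OF K u] by auto
        ultimately show ?thesis
          using v(2) by (auto simp: cocone_stk cocone_diff cocycles_def f_0[OF Y f u] elim!: dsumE)
      qed
      show "linear_map {v \<in> ?B. v \<circ> Inl = 0} (cocycles Z l ()) (\<lambda>v. v \<circ> Inr)"
        by (rule lm_restrict[OF lm_Inr[of "stk Y (l + 1) ()" "stk Z l ()"]]) (use B m in auto)
      show "inj_on (\<lambda>v. v \<circ> Inr) {v \<in> ?B. v \<circ> Inl = 0}"
        by (rule inj_onI) (auto intro: dsum_eqI)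
      show "findim_space {v \<in> ?B. v \<circ> Inl = 0}"
        by (rule findim_subset[OF fB subsp_kernel[OF p findim_subsp[OF fB]]]) auto
    qed (rule cocycles_findim(1)[OF Z u])
    ultimately show ?thesis using rank_nullity[OF p fB] cocycles_dim[OF Z, of l] by simp
  qed
  show ?thesis
    using R D alt_rec[OF bdd_finite[OF bdd_cdim[OF Z]], of l] by (simp add: alt_coh[OF K] alt_coh[OF Y] alt_coh[OF Z])
qed

text \<open>Sections of a cocone are the cocone of the sections. The isomorphism only distributes
  the index: a family of pairs becomes a pair of families.\<close>

lemma sec_coh_cocone:
  assumes P: "finite P" and C: "bounded_complex P C" and D: "bounded_complex P D" and f: "chain_map P C D \<phi>"
  shows "alt l (\<lambda>n. int (sec_coh P C n)) \<le> alt l (\<lambda>n. int (sec_coh P (cocone C D \<phi>) n)) + alt l (\<lambda>n. int (sec_coh P D n))"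
proof -
  let ?G = "pushforward_point P" and ?F = "\<lambda>n _. sec_map P (\<phi> n)"
  note m = pp_chain_map[OF f] and GC = pp_complex[OF P C] and GD = pp_complex[OF P D]
  note K = cocone_complex[OF C D f]
  note GK = pp_complex[OF P K] and KG = cocone_complex[OF GC GD m]
  let ?t = "\<lambda>n u v. case_sum (case_prod (\<lambda>\<pi>. curry v \<pi> \<circ> Inl)) (case_prod (\<lambda>\<pi>. curry v \<pi> \<circ> Inr))"
  let ?s = "\<lambda>n u w. case_prod (\<lambda>\<pi>. case_sum (curry (w \<circ> Inl) \<pi>) (curry (w \<circ> Inr) \<pi>))"
  have vr: "res (obj (cocone (?G C) (?G D) ?F) n) u u' v = v" for n u u' v
    by (rule dsum_eqI) (simp_all add: cocone_obj dsum_sheaf_def pp_simps)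
  have tin: "?t n u v \<in> stk (cocone (?G C) (?G D) ?F) n ()" if v: "v \<in> limit_space P (obj (cocone C D \<phi>) n)" for n u v
  proof -
    have vi: "curry v \<pi> \<circ> Inl \<in> stk C n \<pi>" "curry v \<pi> \<circ> Inr \<in> stk D (n - 1) \<pi>" if "\<pi> \<in> P" for \<pi>
      using limit_in[OF v that] unfolding cocone_stk dsum_def by simp_all
    have vo: "curry v \<pi> \<circ> Inl = 0" "curry v \<pi> \<circ> Inr = 0" if "\<pi> \<notin> P" for \<pi>
      using limit_out[OF v that] by simp_all
    have vr: "res (obj C n) \<pi> \<rho> (curry v \<pi> \<circ> Inl) = curry v \<rho> \<circ> Inl"
        "res (obj D (n - 1)) \<pi> \<rho> (curry v \<pi> \<circ> Inr) = curry v \<rho> \<circ> Inr"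
      if "\<pi> \<in> P" "\<rho> \<in> P" "\<pi> \<le> \<rho>" for \<pi> \<rho>
      unfolding limit_res[OF v that, symmetric] cocone_obj dsum_sheaf_def by simp_all
    have "case_prod (\<lambda>\<pi>. curry v \<pi> \<circ> Inl) \<in> limit_space P (obj C n)"
      by (rule limitI) (simp_all add: vi vo vr)
    moreover have "case_prod (\<lambda>\<pi>. curry v \<pi> \<circ> Inr) \<in> limit_space P (obj D (n - 1))"
      by (rule limitI) (simp_all add: vi vo vr)
    ultimately show ?thesis by (simp add: cocone_stk pp_simps)
  qed
  have sin: "?s n u w \<in> limit_space P (obj (cocone C D \<phi>) n)" if w: "w \<in> stk (cocone (?G C) (?G D) ?F) n ()" for n u w
  proof -
    have wi: "w \<circ> Inl \<in> limit_space P (obj C n)" "w \<circ> Inr \<in> limit_space P (obj D (n - 1))"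
      using w by (auto simp: cocone_stk pp_simps dsum_def)
    show ?thesis
      by (rule limitI) (simp_all add: cocone_obj dsum_sheaf_def case_sum_linear
        limit_in[OF wi(1)] limit_in[OF wi(2)] limit_out[OF wi(1)] limit_out[OF wi(2)] limit_res[OF wi(1)] limit_res[OF wi(2)])
  qed
  have tm: "chain_map {()} (?G (cocone C D \<phi>)) (cocone (?G C) (?G D) ?F) ?t"
    unfolding chain_map_def
  proof (intro conjI allI ballI)
    show "sheaf_hom {()} (obj (?G (cocone C D \<phi>)) n) (obj (cocone (?G C) (?G D) ?F) n) (?t n)" for n
    proof (rule hom_unitI)
      show "linear_map (stk (?G (cocone C D \<phi>)) n ()) (stk (cocone (?G C) (?G D) ?F) n ()) (?t n ())"
        by (rule linear_mapI) (use tin in \<open>auto simp: pp_simps intro!: dsum_eqI curry_eqI\<close>)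
    qed (simp_all add: pp_simps vr)
    fix n \<sigma> v assume "v \<in> stk (?G (cocone C D \<phi>)) n \<sigma>"
    then have v: "v \<in> limit_space P (obj (cocone C D \<phi>) n)" by (simp add: pp_simps)
    show "?t (n + 1) \<sigma> (diff (?G (cocone C D \<phi>)) n \<sigma> v) = diff (cocone (?G C) (?G D) ?F) n \<sigma> (?t n \<sigma> v)"
      unfolding cocone_diff
      by (rule dsum_eqI; rule curry_eqI) (auto simp: pp_simps curry_sec_map cocone_def)
  qed
  have sm: "chain_map {()} (cocone (?G C) (?G D) ?F) (?G (cocone C D \<phi>)) ?s"
    unfolding chain_map_def
  proof (intro conjI allI ballI)
    show "sheaf_hom {()} (obj (cocone (?G C) (?G D) ?F) n) (obj (?G (cocone C D \<phi>)) n) (?s n)" for n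
    proof (rule hom_unitI)
      show "linear_map (stk (cocone (?G C) (?G D) ?F) n ()) (stk (?G (cocone C D \<phi>)) n ()) (?s n ())"
        by (rule linear_mapI) (use sin in \<open>auto simp: pp_simps case_sum_linear intro!: curry_eqI\<close>)
    qed (simp_all add: pp_simps vr)
    fix n \<sigma> w assume "w \<in> stk (cocone (?G C) (?G D) ?F) n \<sigma>"
    then obtain a b where w: "w = case_sum a b" "a \<in> limit_space P (obj C n)" "b \<in> limit_space P (obj D (n - 1))"
      unfolding cocone_stk pp_simps by (rule dsumE)
    show "?s (n + 1) \<sigma> (diff (cocone (?G C) (?G D) ?F) n \<sigma> w) = diff (?G (cocone C D \<phi>)) n \<sigma> (?s n \<sigma> w)"
      unfolding w(1) cocone_diff
      by (rule curry_eqI) (auto simp: pp_simps curry_sec_map cocone_diff case_sum_linear)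
  qed
  have "quasi_iso {()} (?G (cocone C D \<phi>)) (cocone (?G C) (?G D) ?F) ?t"
    by (rule iso_quasi_iso[OF GK KG tm sm]) (auto intro!: curry_eqI dsum_eqI)
  then have "sec_coh P (cocone C D \<phi>) n = cohomology_dim (cocone (?G C) (?G D) ?F) n ()" for n
    by (rule quasi_iso_cohomology[OF GK KG]) simp
  then show ?thesis using morse_cocone[OF GC GD m] by simp
qed


section \<open>Sections with support\<close>

lemma shriek_stk: "\<zeta> \<in> Z \<Longrightarrow> v \<in> stk (pullback_shriek P Z C) n \<zeta> \<longleftrightarrow>
     v \<in> stk C n \<zeta> \<and> (\<forall>\<tau>\<in>P. \<zeta> \<le> \<tau> \<longrightarrow> \<tau> \<notin> Z \<longrightarrow> res (obj C n) \<zeta> \<tau> v = 0)"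
  and shriek_res: "\<zeta> \<in> Z \<Longrightarrow> \<xi> \<in> Z \<Longrightarrow> res (obj (pullback_shriek P Z C) n) \<zeta> \<xi> = res (obj C n) \<zeta> \<xi>"
  and shriek_diff: "\<zeta> \<in> Z \<Longrightarrow> diff (pullback_shriek P Z C) n \<zeta> = diff C n \<zeta>"
  by (auto simp: pullback_shriek_def star_def)

lemma shriek_sheaf:
  assumes C: "is_sheaf P (obj C n)" and Z: "Z \<subseteq> P"
  shows "is_sheaf Z (obj (pullback_shriek P Z C) n)"
proof (rule is_sheafI)
  let ?S = "obj (pullback_shriek P Z C) n"
  have zp: "\<zeta> \<in> P" if "\<zeta> \<in> Z" for \<zeta> using Z that by blast
  have in': "v \<in> stk C n \<zeta>" if "\<zeta> \<in> Z" "v \<in> stalk ?S \<zeta>" for \<zeta> v using that shriek_stk by blast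
  {
    fix \<zeta> assume z: "\<zeta> \<in> Z"
    have "subsp (stalk ?S \<zeta>)"
      by (rule subspI) (auto simp: shriek_stk[OF z] subsp_0[OF sheaf_subsp[OF C]] subsp_add[OF sheaf_subsp[OF C]]
          subsp_scale[OF sheaf_subsp[OF C]] zp[OF z] lm_0[OF sheaf_res[OF C] sheaf_subsp[OF C]] lm_add[OF sheaf_res[OF C]] lm_scale[OF sheaf_res[OF C]])
    then show "findim_space (stalk ?S \<zeta>)"
      using in'[OF z] by (intro findim_subset[OF sheaf_findim[OF C zp[OF z]]]) auto
  next
    fix \<zeta> \<xi> assume z: "\<zeta> \<in> Z" "\<xi> \<in> Z" "\<zeta> \<le> \<xi>"
    show "linear_map (stalk ?S \<zeta>) (stalk ?S \<xi>) (res ?S \<zeta> \<xi>)"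
      unfolding shriek_res[OF z(1,2)]
    proof (rule lm_restrict[OF sheaf_res[OF C zp[OF z(1)] zp[OF z(2)] z(3)]])
      show "stalk ?S \<zeta> \<subseteq> stk C n \<zeta>" using in'[OF z(1)] by blast
      fix x assume x: "x \<in> stalk ?S \<zeta>"
      note xC = in'[OF z(1) x]
      show "res (obj C n) \<zeta> \<xi> x \<in> stalk ?S \<xi>"
        unfolding shriek_stk[OF z(2)]
      proof (intro conjI ballI impI)
        show "res (obj C n) \<zeta> \<xi> x \<in> stk C n \<xi>" by (rule sheaf_res_in[OF C zp[OF z(1)] zp[OF z(2)] z(3) xC])
        fix \<tau> assume t: "\<tau> \<in> P" "\<xi> \<le> \<tau>" "\<tau> \<notin> Z"
        show "res (obj C n) \<xi> \<tau> (res (obj C n) \<zeta> \<xi> x) = 0"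
          unfolding sheaf_res_res[OF C zp[OF z(1)] zp[OF z(2)] t(1) z(3) t(2) xC]
          using x t order.trans[OF z(3) t(2)] unfolding shriek_stk[OF z(1)] by blast
      qed
    qed
  next
    fix \<zeta> v assume "\<zeta> \<in> Z" "v \<in> stalk ?S \<zeta>"
    then show "res ?S \<zeta> \<zeta> v = v" using in' sheaf_res_id[OF C zp] by (simp add: shriek_res)
  next
    fix \<rho> \<sigma> \<tau> v assume "\<rho> \<in> Z" "\<sigma> \<in> Z" "\<tau> \<in> Z" "\<rho> \<le> \<sigma>" "\<sigma> \<le> \<tau>" "v \<in> stalk ?S \<rho>"
    then show "res ?S \<sigma> \<tau> (res ?S \<rho> \<sigma> v) = res ?S \<rho> \<tau> v"
      using in' sheaf_res_res[OF C zp zp zp] by (simp add: shriek_res)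
  }
qed

lemma shriek_complex:
  assumes C: "bounded_complex P C" and Z: "Z \<subseteq> P"
  shows "bounded_complex Z (pullback_shriek P Z C)"
proof -
  let ?S = "pullback_shriek P Z C"
  have zp: "\<zeta> \<in> P" if "\<zeta> \<in> Z" for \<zeta> using Z that by blast
  have S: "is_sheaf Z (obj ?S n)" for n by (rule shriek_sheaf[OF cpx_sheaf[OF C] Z])
  have in': "v \<in> stk C n \<zeta>" if "\<zeta> \<in> Z" "v \<in> stk ?S n \<zeta>" for \<zeta> v n using that shriek_stk by blast
  have d: "diff C n \<zeta> v \<in> stk ?S (n + 1) \<zeta>" if z: "\<zeta> \<in> Z" and v: "v \<in> stk ?S n \<zeta>" for n \<zeta> v
    unfolding shriek_stk[OF z]
  proof (intro conjI ballI impI)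
    show "diff C n \<zeta> v \<in> stk C (n + 1) \<zeta>" by (rule d_in[OF C zp[OF z] in'[OF z v]])
    fix \<tau> assume t: "\<tau> \<in> P" "\<zeta> \<le> \<tau>" "\<tau> \<notin> Z"
    have "res (obj C n) \<zeta> \<tau> v = 0" using v t unfolding shriek_stk[OF z] by blast
    then show "res (obj C (n + 1)) \<zeta> \<tau> (diff C n \<zeta> v) = 0"
      using hom_nat[OF cpx_diff[OF C] zp[OF z] t(1,2) in'[OF z v]] d_0[OF C t(1)] by simp
  qed
  show ?thesis
    unfolding bounded_complex_def
  proof (intro conjI allI ballI S)
    fix n
    show "sheaf_hom Z (obj ?S n) (obj ?S (n + 1)) (diff ?S n)"
    proof (rule sheaf_homI)
      fix \<zeta> assume z: "\<zeta> \<in> Z"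
      show "linear_map (stk ?S n \<zeta>) (stk ?S (n + 1) \<zeta>) (diff ?S n \<zeta>)"
        unfolding shriek_diff[OF z] by (rule lm_restrict[OF d_lm[OF C zp[OF z]]]) (use in'[OF z] d[OF z] in auto)
    qed (simp add: shriek_diff shriek_res hom_nat[OF cpx_diff[OF C] zp zp _ in'])
    show "diff ?S (n + 1) \<zeta> (diff ?S n \<zeta> v) = 0" if "\<zeta> \<in> Z" "v \<in> stk ?S n \<zeta>" for \<zeta> v
      using that by (simp add: shriek_diff d_d[OF C zp in'])
  next
    obtain N where N: "\<And>n. \<bar>n\<bar> > N \<Longrightarrow> zero_sheaf P (obj C n)" using cpx_bounded[OF C] by blast
    have "zero_sheaf Z (obj ?S n)" if n: "\<bar>n\<bar> > N" for n
      unfolding zero_sheaf_def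
    proof
      fix \<zeta> assume z: "\<zeta> \<in> Z"
      have "stk C n \<zeta> = {0}" using N[OF n] zp[OF z] by (simp add: zero_sheaf_def)
      then show "stk ?S n \<zeta> = {0}" using in'[OF z, of _ n] subsp_0[OF sheaf_subsp[OF S z]] by blast
    qed
    then show "\<exists>N. \<forall>n. N < \<bar>n\<bar> \<longrightarrow> zero_sheaf Z (obj ?S n)" by blast
  qed
qed

text \<open>A Godement family over \<open>Z\<close> is, extended by zero, one over \<open>P\<close>,
  so the retraction on \<open>P\<close> can be reused. Local closedness ensures that its values are
  supported in \<open>Z\<close>.\<close>

lemma shriek_ginj:
  assumes F: "ginj P (obj C n)" and Z: "locally_closed P Z"
  shows "ginj Z (obj (pullback_shriek P Z C) n)"
proof -
  let ?S = "obj (pullback_shriek P Z C) n" and ?F = "obj C n"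
  obtain r where r: "is_sheaf P ?F" "sheaf_hom P (godement P ?F) ?F r"
      "\<And>\<sigma> v. \<sigma> \<in> P \<Longrightarrow> v \<in> stalk ?F \<sigma> \<Longrightarrow> r \<sigma> (god_unit P ?F \<sigma> v) = v"
    using F unfolding ginj_def god_retraction_def by blast
  have ZP: "Z \<subseteq> P" and lc: "\<And>a b c. a \<in> Z \<Longrightarrow> c \<in> Z \<Longrightarrow> b \<in> P \<Longrightarrow> a \<le> b \<Longrightarrow> b \<le> c \<Longrightarrow> b \<in> Z"
    using Z unfolding locally_closed_def by blast+
  have zp: "\<zeta> \<in> P" if "\<zeta> \<in> Z" for \<zeta> using ZP that by blast
  have S: "is_sheaf Z ?S" by (rule shriek_sheaf[OF r(1) ZP])
  have in': "v \<in> stalk ?F \<zeta>" if "\<zeta> \<in> Z" "v \<in> stalk ?S \<zeta>" for \<zeta> v using that shriek_stk by blast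
  have g: "x \<in> stalk (godement P ?F) \<sigma>" if x: "x \<in> stalk (godement Z ?S) \<sigma>" for \<sigma> x
  proof (rule godement_stalkI)
    fix p assume p: "p \<in> P" "\<sigma> \<le> p"
    show "curry x p \<in> stalk ?F p"
      using godement_inside[OF x _ p(2)] godement_outside[OF x, of p] in' subsp_0[OF sheaf_subsp[OF r(1) p(1)]]
      by (cases "p \<in> Z") auto
  qed (use godement_outside[OF x] ZP in blast)
  have resg: "res (godement P ?F) \<sigma> \<tau> x = res (godement Z ?S) \<sigma> \<tau> x" for \<sigma> \<tau> and x :: "'a \<times> 'b \<Rightarrow> 'c"
    by (simp add: godement_def)
  have rin: "r \<sigma> x \<in> stalk ?S \<sigma>" if s: "\<sigma> \<in> Z" and x: "x \<in> stalk (godement Z ?S) \<sigma>" for \<sigma> x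
    unfolding shriek_stk[OF s]
  proof (intro conjI ballI impI)
    show "r \<sigma> x \<in> stalk ?F \<sigma>" by (rule hom_in[OF r(2) zp[OF s] g[OF x]])
    fix \<tau> assume t: "\<tau> \<in> P" "\<sigma> \<le> \<tau>" "\<tau> \<notin> Z"
    \<comment> \<open>If \<open>p\<close> were in \<open>Z\<close>, then \<sigma> <= \<tau> <= p
      would put \<tau> into \<open>Z\<close>.\<close>
    have "curry x p = 0" if "\<tau> \<le> p" for p
      using godement_outside[OF x, of p] lc[OF s _ t(1,2) that] t(3) by blast
    then have "res (godement P ?F) \<sigma> \<tau> x = 0" by (intro curry_eqI) (simp add: godement_res)
    moreover have "r \<tau> 0 = 0"
      by (rule lm_0[OF hom_lm[OF r(2) t(1)]], unfold godement_def sheaf.simps, rule subsp_prod) (simp add: sheaf_subsp[OF r(1)])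
    ultimately show "res ?F \<sigma> \<tau> (r \<sigma> x) = 0" using hom_nat[OF r(2) zp[OF s] t(1,2) g[OF x]] by simp
  qed
  have "sheaf_hom Z (godement Z ?S) ?S r"
  proof (rule sheaf_homI)
    fix \<sigma> assume s: "\<sigma> \<in> Z"
    show "linear_map (stalk (godement Z ?S) \<sigma>) (stalk ?S \<sigma>) (r \<sigma>)"
      by (rule lm_restrict[OF hom_lm[OF r(2) zp[OF s]]]) (use g rin[OF s] in auto)
  next
    fix \<sigma> \<tau> x assume s: "\<sigma> \<in> Z" "\<tau> \<in> Z" "\<sigma> \<le> \<tau>" and x: "x \<in> stalk (godement Z ?S) \<sigma>"
    show "r \<tau> (res (godement Z ?S) \<sigma> \<tau> x) = res ?S \<sigma> \<tau> (r \<sigma> x)"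
      using hom_nat[OF r(2) zp[OF s(1)] zp[OF s(2)] s(3) g[OF x]] by (simp add: shriek_res[OF s(1,2)] resg)
  qed
  moreover have "r \<sigma> (god_unit Z ?S \<sigma> v) = v" if s: "\<sigma> \<in> Z" and v: "v \<in> stalk ?S \<sigma>" for \<sigma> v
  proof -
    have "god_unit Z ?S \<sigma> v = god_unit P ?F \<sigma> v"
      using v[unfolded shriek_stk[OF s]] zp by (intro curry_eqI) (auto simp: curry_god_map shriek_res[OF s])
    then show ?thesis using r(3)[OF zp[OF s] in'[OF s v]] by simp
  qed
  ultimately have "god_retraction Z ?S r" using S by (simp add: god_retraction_def)
  then show ?thesis unfolding ginj_def by blast
qed

text \<open>Families vanish outside \<open>W\<close>, so compatibility inside \<open>W\<close> and
  vanishing under restrictions that leave \<open>W\<close> merge into one condition over all of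
  \<open>P\<close>. In this form sections over different \<open>W\<close> can be compared.\<close>

lemma shriek_sections:
  assumes "W \<subseteq> P"
  shows "v \<in> limit_space W (obj (pullback_shriek P W C) n) \<longleftrightarrow>
    (\<forall>\<pi>\<in>W. curry v \<pi> \<in> stk C n \<pi>) \<and> (\<forall>\<pi>. \<pi> \<notin> W \<longrightarrow> curry v \<pi> = 0) \<and>
    (\<forall>\<pi>\<in>W. \<forall>\<tau>\<in>P. \<pi> \<le> \<tau> \<longrightarrow> res (obj C n) \<pi> \<tau> (curry v \<pi>) = curry v \<tau>)" (is "?L \<longleftrightarrow> ?A \<and> ?B \<and> ?C")
proof
  assume v: ?L
  have "?A" using limit_in[OF v] shriek_stk by blast
  moreover have "?B" using limit_out[OF v] by blast
  moreover have "?C"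
  proof (intro ballI impI)
    fix \<pi> \<tau> assume p: "\<pi> \<in> W" "\<tau> \<in> P" "\<pi> \<le> \<tau>"
    show "res (obj C n) \<pi> \<tau> (curry v \<pi>) = curry v \<tau>"
    proof (cases "\<tau> \<in> W")
      case True
      then show ?thesis using limit_res[OF v p(1) True p(3)] by (simp add: shriek_res[OF p(1)])
    next
      case False
      then show ?thesis using limit_in[OF v p(1)] limit_out[OF v False] p unfolding shriek_stk[OF p(1)] by simp
    qed
  qed
  ultimately show "?A \<and> ?B \<and> ?C" by blast
next
  assume a: "?A \<and> ?B \<and> ?C"
  show ?L
  proof (rule limitI)
    show "curry v \<pi> \<in> stk (pullback_shriek P W C) n \<pi>" if p: "\<pi> \<in> W" for \<pi>
      unfolding shriek_stk[OF p] using a p by simp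
    show "curry v \<pi> = 0" if "\<pi> \<notin> W" for \<pi> using a that by blast
    show "res (obj (pullback_shriek P W C) n) \<pi> \<rho> (curry v \<pi>) = curry v \<rho>" if p: "\<pi> \<in> W" "\<rho> \<in> W" "\<pi> \<le> \<rho>" for \<pi> \<rho>
      unfolding shriek_res[OF p(1,2)] using a p assms by blast
  qed
qed

lemma shriek_sectionsD:
  assumes "W \<subseteq> P" "v \<in> limit_space W (obj (pullback_shriek P W C) n)"
  shows "\<pi> \<in> W \<Longrightarrow> curry v \<pi> \<in> stk C n \<pi>" "\<pi> \<notin> W \<Longrightarrow> curry v \<pi> = 0"
    "\<pi> \<in> W \<Longrightarrow> \<tau> \<in> P \<Longrightarrow> \<pi> \<le> \<tau> \<Longrightarrow> res (obj C n) \<pi> \<tau> (curry v \<pi>) = curry v \<tau>"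
  using assms(2) unfolding shriek_sections[OF assms(1)] by simp_all

lemma curry_sec_map_shriek:
  "curry (sec_map W (diff (pullback_shriek P W C) n) v) \<pi> = (if \<pi> \<in> W then diff C n \<pi> (curry v \<pi>) else 0)"
  by (simp add: curry_sec_map shriek_diff)

text \<open>Down-closedness of \<open>W\<close> makes zero extension from \<open>W\<close> to
  \<open>V\<close> and the cut-off to V - W respect restrictions. Lifting a section from V - W to
  \<open>V\<close> is where injectivity enters.\<close>

lemma shriek_step:
  assumes P: "finite P" and I: "bounded_complex P I" and inj: "\<And>n. ginj P (obj I n)"
    and V: "V \<subseteq> P" and W: "W \<subseteq> V"
    and dV: "\<And>x y. x \<in> P \<Longrightarrow> y \<in> V \<Longrightarrow> x \<le> y \<Longrightarrow> x \<in> V"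
    and dW: "\<And>x y. x \<in> P \<Longrightarrow> y \<in> W \<Longrightarrow> x \<le> y \<Longrightarrow> x \<in> W"
  shows "alt l (\<lambda>n. int (sec_coh V (pullback_shriek P V I) n)) \<le>
    alt l (\<lambda>n. int (sec_coh W (pullback_shriek P W I) n)) + alt l (\<lambda>n. int (sec_coh (V - W) (pullback_shriek P (V - W) I) n))"
proof -
  let ?G = "\<lambda>A. pushforward_point A (pullback_shriek P A I)" and ?S = "\<lambda>A n. limit_space A (obj (pullback_shriek P A I) n)"
  have sub: "W \<subseteq> P" "V - W \<subseteq> P" using V W by auto
  have fin: "finite A" if "A \<subseteq> P" for A using P that by (rule rev_finite_subset)
  have G: "bounded_complex {()} (?G A)" if "A \<subseteq> P" for A
    by (rule pp_complex[OF fin[OF that] shriek_complex[OF I that]])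
  note SV = shriek_sections[OF V, of _ I] and SW = shriek_sections[OF sub(1), of _ I] and SZ = shriek_sections[OF sub(2), of _ I]
  have d0: "\<pi> \<in> P \<Longrightarrow> diff I n \<pi> 0 = 0" for n \<pi> by (rule d_0[OF I])
  have res0: "\<pi> \<in> P \<Longrightarrow> \<tau> \<in> P \<Longrightarrow> \<pi> \<le> \<tau> \<Longrightarrow> res (obj I n) \<pi> \<tau> 0 = 0" for n \<pi> \<tau>
    by (rule lm_0[OF sheaf_res[OF cpx_sheaf[OF I]] sheaf_subsp[OF cpx_sheaf[OF I]]])
  have WV: "v \<in> ?S V n" if v: "v \<in> ?S W n" for v n
    unfolding SV
  proof (intro conjI ballI allI impI)
    note v' = shriek_sectionsD[OF sub(1) v]
    show "curry v \<pi> \<in> stk I n \<pi>" if "\<pi> \<in> V" for \<pi>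
      using v'(1,2)[of \<pi>] c_0[OF I subsetD[OF V that]] by (cases "\<pi> \<in> W") auto
    show "curry v \<pi> = 0" if "\<pi> \<notin> V" for \<pi> using v'(2) that W by blast
    show "res (obj I n) \<pi> \<tau> (curry v \<pi>) = curry v \<tau>" if p: "\<pi> \<in> V" "\<tau> \<in> P" "\<pi> \<le> \<tau>" for \<pi> \<tau>
    proof (cases "\<pi> \<in> W")
      case False
      then have "\<tau> \<notin> W" using dW[OF subsetD[OF V p(1)] _ p(3)] by blast
      then show ?thesis using v'(2) False res0[OF subsetD[OF V p(1)] p(2,3)] by simp
    qed (rule v'(3)[OF _ p(2,3)])
  qed
  have VW: "v \<in> ?S W n" if v: "v \<in> ?S V n" and z: "\<And>\<pi>. \<pi> \<in> V - W \<Longrightarrow> curry v \<pi> = 0" for v n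
    unfolding SW
  proof (intro conjI ballI allI impI)
    note v' = shriek_sectionsD[OF V v]
    show "curry v \<pi> \<in> stk I n \<pi>" if "\<pi> \<in> W" for \<pi> using that W by (intro v'(1)) blast
    show "curry v \<pi> = 0" if "\<pi> \<notin> W" for \<pi> using that v'(2)[of \<pi>] z[of \<pi>] by blast
    show "res (obj I n) \<pi> \<tau> (curry v \<pi>) = curry v \<tau>" if "\<pi> \<in> W" "\<tau> \<in> P" "\<pi> \<le> \<tau>" for \<pi> \<tau>
      using that W by (intro v'(3)) blast+
  qed
  have VZ: "sec_map (V - W) (\<lambda>_ x. x) v \<in> ?S (V - W) n" if v: "v \<in> ?S V n" for v n
    unfolding SZ
  proof (intro conjI ballI allI impI)
    note v' = shriek_sectionsD[OF V v]
    show "curry (sec_map (V - W) (\<lambda>_ x. x) v) \<pi> \<in> stk I n \<pi>" if "\<pi> \<in> V - W" for \<pi>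
      using v'(1) that by (simp add: curry_sec_map)
    show "curry (sec_map (V - W) (\<lambda>_ x. x) v) \<pi> = 0" if "\<pi> \<notin> V - W" for \<pi>
      by (simp only: curry_sec_map that if_False)
    show "res (obj I n) \<pi> \<tau> (curry (sec_map (V - W) (\<lambda>_ x. x) v) \<pi>) = curry (sec_map (V - W) (\<lambda>_ x. x) v) \<tau>"
      if p: "\<pi> \<in> V - W" "\<tau> \<in> P" "\<pi> \<le> \<tau>" for \<pi> \<tau>
    proof -
      have "\<tau> \<notin> W" using dW[OF _ _ p(3)] p(1) V by blast
      then show ?thesis using v'(2)[of \<tau>] v'(3)[OF _ p(2,3)] p(1) by (simp add: curry_sec_map)
    qed
  qed
  have "alt l (coh (?G V)) \<le> alt l (coh (?G W)) + alt l (coh (?G (V - W)))"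
  proof (rule morse_exact[OF G[OF sub(1)] G[OF V] G[OF sub(2)]])
    show "chain_map {()} (?G W) (?G V) (\<lambda>_ _ v. v)"
      unfolding chain_map_def
    proof (intro conjI allI ballI)
      show "sheaf_hom {()} (obj (?G W) n) (obj (?G V) n) (\<lambda>_ v. v)" for n
        by (rule hom_unitI) (simp_all add: pp_simps WV linear_mapI)
      fix n \<sigma> v assume "v \<in> stk (?G W) n \<sigma>"
      then have "v \<in> ?S W n" by (simp add: pp_simps)
      then have "\<And>\<pi>. \<pi> \<notin> W \<Longrightarrow> curry v \<pi> = 0" by (rule shriek_sectionsD(2)[OF sub(1)])
      then show "diff (?G W) n \<sigma> v = diff (?G V) n \<sigma> v"
        by (intro curry_eqI) (use V W d0 in \<open>auto simp: pp_simps curry_sec_map_shriek subset_iff\<close>)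
    qed
    show "chain_map {()} (?G V) (?G (V - W)) (\<lambda>_ _. sec_map (V - W) (\<lambda>_ x. x))"
      unfolding chain_map_def
    proof (intro conjI allI ballI)
      show "sheaf_hom {()} (obj (?G V) n) (obj (?G (V - W)) n) (\<lambda>_. sec_map (V - W) (\<lambda>_ x. x))" for n
        by (rule hom_unitI) (auto simp: pp_simps VZ curry_sec_map intro!: linear_mapI curry_eqI)
      show "sec_map (V - W) (\<lambda>_ x. x) (diff (?G V) n \<sigma> v) = diff (?G (V - W)) n \<sigma> (sec_map (V - W) (\<lambda>_ x. x) v)" for n \<sigma> v
        by (rule curry_eqI) (simp add: pp_simps curry_sec_map_shriek curry_sec_map[of "V - W" "\<lambda>_ x. x"])
    qed
  next
    fix n x assume "x \<in> stk (?G W) n ()"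
    then have "x \<in> ?S W n" by (simp add: pp_simps)
    then have "\<And>\<pi>. \<pi> \<notin> W \<Longrightarrow> curry x \<pi> = 0" by (rule shriek_sectionsD(2)[OF sub(1)])
    then show "sec_map (V - W) (\<lambda>_ x. x) x = 0" by (intro curry_eqI) (simp add: curry_sec_map)
  next
    fix n b assume b: "b \<in> stk (?G V) n ()" and 0: "sec_map (V - W) (\<lambda>_ x. x) b = 0"
    have "curry b \<pi> = 0" if "\<pi> \<in> V - W" for \<pi>
      using curry_sec_map[of "V - W" "\<lambda>_ x. x" b \<pi>] that unfolding 0 by simp
    then have "b \<in> ?S W n" using b by (intro VW) (simp_all add: pp_simps)
    then show "\<exists>a\<in>stk (?G W) n (). b = a" by (simp add: pp_simps)
  next
    fix n c assume "c \<in> stk (?G (V - W)) n ()"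
    then have "c \<in> ?S (V - W) n" by (simp add: pp_simps)
    note c = shriek_sectionsD[OF sub(2) this]
    obtain r where r: "is_sheaf P (obj I n)" "sheaf_hom P (godement P (obj I n)) (obj I n) r"
        "\<And>\<sigma> v. \<sigma> \<in> P \<Longrightarrow> v \<in> stk I n \<sigma> \<Longrightarrow> r \<sigma> (god_unit P (obj I n) \<sigma> v) = v"
      using inj[of n] unfolding ginj_def god_retraction_def by blast
    \<comment> \<open>At each \<sigma> the coordinates of \<open>c\<close> above \<sigma> form an
      element of the Godement sheaf, compatible under restriction, and the retraction turns them
      into a family in \<open>I\<close>. Off \<open>V\<close> they are 0 because \<open>V\<close> is
      down-closed.\<close>
    define x where "x \<sigma> = case_prod (\<lambda>p. if \<sigma> \<le> p then curry c p else 0)" for \<sigma>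
    have cin: "curry c p \<in> stk I n p" if "p \<in> P" for p
      using c(1,2)[of p] c_0[OF I that] by (cases "p \<in> V - W") auto
    have xin: "x \<sigma> \<in> stalk (godement P (obj I n)) \<sigma>" for \<sigma>
    proof (rule godement_stalkI)
      show "curry (x \<sigma>) p = 0" if "\<not> (p \<in> P \<and> \<sigma> \<le> p)" for p
        using that c(2)[of p] sub(2) by (auto simp: x_def)
    qed (simp add: x_def cin)
    have xres: "res (godement P (obj I n)) \<sigma> \<tau> (x \<sigma>) = x \<tau>" if "\<sigma> \<le> \<tau>" for \<sigma> \<tau>
      by (rule curry_eqI) (use order.trans[OF that] in \<open>auto simp: godement_res x_def\<close>)
    have x0: "x \<tau> = 0" if t: "\<tau> \<in> P" "\<tau> \<notin> V" for \<tau>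
    proof (rule curry_eqI)
      fix p
      show "curry (x \<tau>) p = curry 0 p"
        using c(2)[of p] dV[OF t(1), of p] t(2) by (cases "p \<in> V - W") (auto simp: x_def)
    qed
    have r0: "r \<tau> 0 = 0" if "\<tau> \<in> P" for \<tau>
      by (rule lm_0[OF hom_lm[OF r(2) that]], unfold godement_def sheaf.simps, rule subsp_prod) (simp add: sheaf_subsp[OF r(1)])
    define b where "b = case_prod (\<lambda>\<pi>. if \<pi> \<in> V then r \<pi> (x \<pi>) else 0)"
    have cb: "curry b \<pi> = (if \<pi> \<in> V then r \<pi> (x \<pi>) else 0)" for \<pi> by (simp add: b_def)
    have "b \<in> ?S V n"
      unfolding SV
    proof (intro conjI ballI allI impI)
      show "curry b \<pi> \<in> stk I n \<pi>" if "\<pi> \<in> V" for \<pi>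
        using that hom_in[OF r(2) subsetD[OF V that] xin] by (simp add: cb)
      show "curry b \<pi> = 0" if "\<pi> \<notin> V" for \<pi> using that by (simp add: cb)
      show "res (obj I n) \<pi> \<tau> (curry b \<pi>) = curry b \<tau>" if p: "\<pi> \<in> V" "\<tau> \<in> P" "\<pi> \<le> \<tau>" for \<pi> \<tau>
      proof -
        have "res (obj I n) \<pi> \<tau> (r \<pi> (x \<pi>)) = r \<tau> (x \<tau>)"
          unfolding hom_nat[OF r(2) subsetD[OF V p(1)] p(2,3) xin, symmetric] xres[OF p(3)] ..
        then show ?thesis using p x0[OF p(2)] r0[OF p(2)] by (simp add: cb)
      qed
    qed
    moreover have "c = sec_map (V - W) (\<lambda>_ x. x) b"
    proof (rule curry_eqI)
      fix \<pi>
      show "curry c \<pi> = curry (sec_map (V - W) (\<lambda>_ x. x) b) \<pi>"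
      proof (cases "\<pi> \<in> V - W")
        case True
        then have pP: "\<pi> \<in> P" using V by blast
        \<comment> \<open>Restrictions of \<open>c\<close> to points outside V - W are 0, so the
          unit of its value at \<pi> has exactly the coordinates collected in
          \<open>x \<pi>\<close>, and the retraction gives the value back.\<close>
        have "x \<pi> = god_unit P (obj I n) \<pi> (curry c \<pi>)"
        proof (rule curry_eqI)
          fix p
          show "curry (x \<pi>) p = curry (god_unit P (obj I n) \<pi> (curry c \<pi>)) p"
            using c(3)[OF True, of p] c(2)[of p] sub(2) by (auto simp: x_def curry_god_map)
        qed
        then have "r \<pi> (x \<pi>) = curry c \<pi>" using r(3)[OF pP c(1)[OF True]] by simp
        then show ?thesis using True by (simp add: curry_sec_map cb)
      next
        case False
        then show ?thesis by (simp only: c(2)[OF False] curry_sec_map if_False)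
      qed
    qed
    ultimately show "\<exists>b\<in>stk (?G V) n (). c = sec_map (V - W) (\<lambda>_ x. x) b" by (auto simp: pp_simps)
  qed simp
  then show ?thesis .
qed

section \<open>Filtration along down-sets of the target\<close>

lemma sec_coh_zero:
  assumes "\<And>n. limit_space P (obj C n) = {0}"
  shows "sec_coh P C n = 0"
proof -
  have "cocycles (pushforward_point P C) n () \<subseteq> {0}" using assms by (auto simp: cocycles_def pp_simps)
  then have "dm (cocycles (pushforward_point P C) n ()) \<le> dm {0 :: 'a \<times> 'b \<Rightarrow> 'c}" by (rule dim_mono[OF findim_zero])
  then show ?thesis by (simp add: cohomology_dim_def)
qed

lemma alt_zero [simp]: "alt l (\<lambda>n. 0) = 0"
  by (simp add: alt_def)

text \<open>Removing a maximal element \<open>m\<close> leaves a down-set; monotonicity makes both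
  preimages down-closed in \<open>P\<close>, and they differ by the fibre over
  \<open>m\<close>.\<close>

lemma shriek_filtration:
  fixes f :: "'a::order \<Rightarrow> 'b::order"
  assumes P: "finite P" and Q: "finite Q" and fQ: "f ` P \<subseteq> Q" and mono: "mono_on P f"
    and I: "bounded_complex P I" and inj: "\<And>n. ginj P (obj I n)"
    and S: "S \<subseteq> Q" and down: "\<And>x y. x \<in> Q \<Longrightarrow> y \<in> S \<Longrightarrow> x \<le> y \<Longrightarrow> x \<in> S"
  shows "alt l (\<lambda>n. int (sec_coh {\<sigma>\<in>P. f \<sigma> \<in> S} (pullback_shriek P {\<sigma>\<in>P. f \<sigma> \<in> S} I) n)) \<le>
    (\<Sum>\<pi>\<in>S. alt l (\<lambda>n. int (sec_coh (fibre P f \<pi>) (pullback_shriek P (fibre P f \<pi>) I) n)))"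
  using S down
proof (induct "card S" arbitrary: S)
  case 0
  have S: "S = {}" using 0(1) finite_subset[OF 0(2) Q] by simp
  have "limit_space {} F = {0}" for F :: "('a, 'c, 'd) sheaf"
    by (auto simp: limit_space_def intro!: curry_eqI)
  then show ?case unfolding S by (simp add: sec_coh_zero)
next
  case (Suc k)
  have fS: "finite S" by (rule finite_subset[OF Suc.prems(1) Q])
  have "S \<noteq> {}" using Suc.hyps(2) by auto
  then obtain m where m: "m \<in> S" "\<And>y. y \<in> S \<Longrightarrow> m \<le> y \<Longrightarrow> y = m" using finite_has_maximal[OF fS] by blast
  let ?S = "S - {m}"
  have c: "k = card ?S" using Suc.hyps(2) fS m(1) by simp
  have d: "x \<in> ?S" if "x \<in> Q" "y \<in> ?S" "x \<le> y" for x y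
    using Suc.prems(2)[OF that(1) _ that(3)] m(2)[of y] that by blast
  let ?V = "{\<sigma>\<in>P. f \<sigma> \<in> S}" and ?W = "{\<sigma>\<in>P. f \<sigma> \<in> ?S}"
  have dn: "x \<in> {\<sigma>\<in>P. f \<sigma> \<in> T}" if x: "x \<in> P" "y \<in> {\<sigma>\<in>P. f \<sigma> \<in> T}" "x \<le> y"
    and T: "\<And>x y. x \<in> Q \<Longrightarrow> y \<in> T \<Longrightarrow> x \<le> y \<Longrightarrow> x \<in> T" for x y T
    using T[of "f x" "f y"] fQ x mono_onD[OF mono, of x y] by blast
  have VW: "?V - ?W = fibre P f m" using m(1) by (auto simp: fibre_def)
  have "alt l (\<lambda>n. int (sec_coh ?V (pullback_shriek P ?V I) n)) \<le>
      alt l (\<lambda>n. int (sec_coh ?W (pullback_shriek P ?W I) n)) + alt l (\<lambda>n. int (sec_coh (fibre P f m) (pullback_shriek P (fibre P f m) I) n))"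
    unfolding VW[symmetric]
  proof (rule shriek_step[OF P I inj])
    show "x \<in> ?V" if "x \<in> P" "y \<in> ?V" "x \<le> y" for x y by (rule dn[OF that Suc.prems(2)])
    show "x \<in> ?W" if "x \<in> P" "y \<in> ?W" "x \<le> y" for x y by (rule dn[OF that d])
  qed auto
  moreover have "alt l (\<lambda>n. int (sec_coh ?W (pullback_shriek P ?W I) n)) \<le>
      (\<Sum>\<pi>\<in>?S. alt l (\<lambda>n. int (sec_coh (fibre P f \<pi>) (pullback_shriek P (fibre P f \<pi>) I) n)))"
    by (rule Suc.hyps(1)[OF c]) (use Suc.prems(1) d in blast)+
  ultimately show ?case unfolding sum.remove[OF fS m(1)] by linarith
qed

text \<open>The pullback to \<open>P\<close> itself agrees with \<open>I\<close> only at points of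
  \<open>P\<close>, so the comparison goes through an isomorphism, not an equality of
  records.\<close>

lemma shriek_all:
  assumes P: "finite P" and I: "bounded_complex P I" and inj: "\<And>n. ginj P (obj I n)"
  shows "sec_coh P (pullback_shriek P P I) n = sec_coh P I n"
proof -
  let ?S = "pullback_shriek P P I"
  have S: "bounded_complex P ?S" by (rule shriek_complex[OF I subset_refl])
  have st: "stk ?S n \<sigma> = stk I n \<sigma>" if "\<sigma> \<in> P" for n \<sigma> using that by (auto simp: shriek_stk)
  have "chain_map P ?S I (\<lambda>_ _ v. v)" "chain_map P I ?S (\<lambda>_ _ v. v)"
    unfolding chain_map_def by (auto intro!: sheaf_homI linear_mapI simp: st shriek_res shriek_diff)
  then have q: "quasi_iso P ?S I (\<lambda>_ _ v. v)" by (intro iso_quasi_iso[OF S I]) auto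
  have "locally_closed P P" by (simp add: locally_closed_def)
  then show ?thesis by (rule sec_coh_quasi_iso[OF P I inj S shriek_ginj[OF inj] q])
qed

lemma fibre_locally_closed:
  fixes f :: "'a::order \<Rightarrow> 'b::order"
  assumes "mono_on P f"
  shows "locally_closed P (fibre P f \<pi>)"
proof -
  have "f b = \<pi>" if "a \<in> P" "f a = \<pi>" "c \<in> P" "f c = \<pi>" "b \<in> P" "a \<le> b" "b \<le> c" for a b c
    using mono_onD[OF assms that(1,5,6)] mono_onD[OF assms that(5,3,7)] that(2,4) by simp
  then show ?thesis unfolding locally_closed_def fibre_def by blast
qed

text \<open>The pullback is already injective by \<open>shriek_ginj\<close>, so its minimal
  resolution is a homotopy equivalence and leaves the cohomology of sections alone.\<close>

lemma hypercoh_local_shriek: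
  assumes P: "finite P" and I: "bounded_complex P I" and inj: "\<And>n. ginj P (obj I n)" and Z: "locally_closed P Z"
  shows "hypercoh_dim Z (local_shriek P Z I) d = sec_coh Z (pullback_shriek P Z I) d"
proof -
  have ZP: "Z \<subseteq> P" using Z by (simp add: locally_closed_def)
  have fZ: "finite Z" using P ZP by (rule rev_finite_subset)
  have S: "bounded_complex Z (pullback_shriek P Z I)" by (rule shriek_complex[OF I ZP])
  note m = min_inj_res[OF fZ S]
  obtain \<phi> where "quasi_iso Z (pullback_shriek P Z I) (min_inj_res Z (pullback_shriek P Z I)) \<phi>" using m(3) by blast
  then show ?thesis
    unfolding local_shriek_def hypercoh_dim_sec_coh[OF fZ m(1)]
    by (rule sec_coh_quasi_iso[OF fZ m(1,2) S shriek_ginj[OF inj Z], symmetric])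
qed


section \<open>Extension by zero\<close>

lemma ext_stk: "stk (pushforward_shriek Z C) n \<sigma> = (if \<sigma> \<in> Z then stk C n \<sigma> else {0})"
  and ext_res: "res (obj (pushforward_shriek Z C) n) \<sigma> \<tau> = (if \<sigma> \<in> Z \<and> \<tau> \<in> Z then res (obj C n) \<sigma> \<tau> else (\<lambda>_. 0))"
  and ext_diff: "diff (pushforward_shriek Z C) n \<sigma> = (if \<sigma> \<in> Z then diff C n \<sigma> else (\<lambda>_. 0))"
  by (simp_all add: pushforward_shriek_def)

lemma star_stk: "\<zeta> \<in> Z \<Longrightarrow> stk (pullback_star Z C) n \<zeta> = stk C n \<zeta>"
  and star_res: "\<zeta> \<in> Z \<Longrightarrow> \<xi> \<in> Z \<Longrightarrow> res (obj (pullback_star Z C) n) \<zeta> \<xi> = res (obj C n) \<zeta> \<xi>"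
  and star_diff: "\<zeta> \<in> Z \<Longrightarrow> diff (pullback_star Z C) n \<zeta> = diff C n \<zeta>"
  by (simp_all add: pullback_star_def)

lemma star_complex:
  assumes C: "bounded_complex P C" and Z: "Z \<subseteq> P"
  shows "bounded_complex Z (pullback_star Z C)"
proof -
  have zp: "\<zeta> \<in> P" if "\<zeta> \<in> Z" for \<zeta> using Z that by blast
  note sh = cpx_sheaf[OF C]
  have "is_sheaf Z (obj (pullback_star Z C) n)" for n
    by (rule is_sheafI)
      (auto simp: star_stk star_res zp sheaf_findim[OF sh] sheaf_res[OF sh] sheaf_res_id[OF sh] sheaf_res_res[OF sh])
  moreover have "sheaf_hom Z (obj (pullback_star Z C) n) (obj (pullback_star Z C) (n + 1)) (diff (pullback_star Z C) n)" for n
    by (rule sheaf_homI) (auto simp: star_stk star_res star_diff zp d_lm[OF C] hom_nat[OF cpx_diff[OF C]])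
  moreover have "\<exists>N. \<forall>n. N < \<bar>n\<bar> \<longrightarrow> zero_sheaf Z (obj (pullback_star Z C) n)"
  proof -
    obtain N where "\<forall>n. N < \<bar>n\<bar> \<longrightarrow> zero_sheaf P (obj C n)" using cpx_bounded[OF C] by blast
    then have "\<forall>n. N < \<bar>n\<bar> \<longrightarrow> zero_sheaf Z (obj (pullback_star Z C) n)" by (simp add: zero_sheaf_def star_stk zp)
    then show ?thesis by (rule exI)
  qed
  moreover have "diff (pullback_star Z C) (n + 1) \<sigma> (diff (pullback_star Z C) n \<sigma> v) = 0"
    if "\<sigma> \<in> Z" "v \<in> stk (pullback_star Z C) n \<sigma>" for n \<sigma> v
    using that by (simp add: star_stk star_diff d_d[OF C zp])
  ultimately show ?thesis unfolding bounded_complex_def by blast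
qed

lemma ext_complex:
  assumes C: "bounded_complex Z C" and Z: "locally_closed P Z"
  shows "bounded_complex P (pushforward_shriek Z C)"
proof -
  let ?E = "pushforward_shriek Z C"
  note sh = cpx_sheaf[OF C]
  have lc: "\<And>a b c. a \<in> Z \<Longrightarrow> c \<in> Z \<Longrightarrow> b \<in> P \<Longrightarrow> a \<le> b \<Longrightarrow> b \<le> c \<Longrightarrow> b \<in> Z"
    using Z unfolding locally_closed_def by blast
  have s: "subsp (stk ?E n \<sigma>)" for n \<sigma>
    by (simp add: ext_stk sheaf_subsp[OF sh])
  have E: "is_sheaf P (obj ?E n)" for n
  proof (rule is_sheafI)
    fix \<sigma> show "findim_space (stk ?E n \<sigma>)" by (simp add: ext_stk sheaf_findim[OF sh])
  next
    fix \<sigma> \<tau> :: 'a assume "\<sigma> \<le> \<tau>"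
    then show "linear_map (stk ?E n \<sigma>) (stk ?E n \<tau>) (res (obj ?E n) \<sigma> \<tau>)"
      by (auto simp: ext_res ext_stk intro: lm_zero sheaf_res[OF sh] sheaf_subsp[OF sh])
  next
    fix \<sigma> v assume "v \<in> stk ?E n \<sigma>"
    then show "res (obj ?E n) \<sigma> \<sigma> v = v" using sheaf_res_id[OF sh] by (auto simp: ext_stk ext_res split: if_splits)
  next
    fix \<rho> \<sigma> \<tau> v assume a: "\<rho> \<in> P" "\<sigma> \<in> P" "\<tau> \<in> P" "\<rho> \<le> \<sigma>" "\<sigma> \<le> \<tau>" "v \<in> stk ?E n \<rho>"
    show "res (obj ?E n) \<sigma> \<tau> (res (obj ?E n) \<rho> \<sigma> v) = res (obj ?E n) \<rho> \<tau> v"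
    proof (cases "\<rho> \<in> Z \<and> \<tau> \<in> Z")
      case True
      \<comment> \<open>Functoriality depends on this: passing through a point outside
        \<open>Z\<close> would give 0 although the direct restriction inside \<open>Z\<close> need
        not vanish.\<close>
      then have "\<sigma> \<in> Z" using lc a by blast
      then show ?thesis using True a sheaf_res_res[OF sh] by (simp add: ext_stk ext_res)
    next
      case False
      then show ?thesis using lm_0[OF sheaf_res[OF sh] sheaf_subsp[OF sh]] a by (auto simp: ext_res)
    qed
  qed
  have d: "linear_map (stk ?E n \<sigma>) (stk ?E (n + 1) \<sigma>) (diff ?E n \<sigma>)" for n \<sigma>
    by (auto simp: ext_diff ext_stk intro: lm_zero d_lm[OF C])
  have "sheaf_hom P (obj ?E n) (obj ?E (n + 1)) (diff ?E n)" for n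
  proof (rule sheaf_homI)
    fix \<sigma> \<tau> v assume "\<sigma> \<in> P" "\<tau> \<in> P" "\<sigma> \<le> \<tau>" "v \<in> stk ?E n \<sigma>"
    then show "diff ?E n \<tau> (res (obj ?E n) \<sigma> \<tau> v) = res (obj ?E (n + 1)) \<sigma> \<tau> (diff ?E n \<sigma> v)"
      using hom_nat[OF cpx_diff[OF C]] d_0[OF C] by (auto simp: ext_stk ext_res ext_diff)
  qed (rule d)
  moreover have "diff ?E (n + 1) \<sigma> (diff ?E n \<sigma> v) = 0" if "v \<in> stk ?E n \<sigma>" for n \<sigma> v
    using that d_d[OF C] by (auto simp: ext_stk ext_diff)
  moreover have "\<exists>N. \<forall>n. N < \<bar>n\<bar> \<longrightarrow> zero_sheaf P (obj ?E n)"
  proof -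
    obtain N where "\<forall>n. N < \<bar>n\<bar> \<longrightarrow> zero_sheaf Z (obj C n)" using cpx_bounded[OF C] by blast
    then have "\<forall>n. N < \<bar>n\<bar> \<longrightarrow> zero_sheaf P (obj ?E n)" by (simp add: zero_sheaf_def ext_stk)
    then show ?thesis by (rule exI)
  qed
  ultimately show ?thesis unfolding bounded_complex_def using E by blast
qed

lemma ext_quasi_iso:
  assumes C: "bounded_complex Z C" and D: "bounded_complex Z D" and q: "quasi_iso Z C D \<phi>" and Z: "locally_closed P Z"
  shows "quasi_iso P (pushforward_shriek Z C) (pushforward_shriek Z D) (\<lambda>n \<sigma> v. if \<sigma> \<in> Z then \<phi> n \<sigma> v else 0)"
proof -
  let ?E = "pushforward_shriek Z" and ?p = "\<lambda>n \<sigma> v. if \<sigma> \<in> Z then \<phi> n \<sigma> v else 0"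
  note f = qi_map[OF q]
  have E: "bounded_complex P (?E C)" "bounded_complex P (?E D)" using ext_complex[OF C Z] ext_complex[OF D Z] .
  have m: "chain_map P (?E C) (?E D) ?p"
    unfolding chain_map_def
  proof (intro conjI allI ballI)
    show "sheaf_hom P (obj (?E C) n) (obj (?E D) n) (?p n)" for n
    proof (rule sheaf_homI)
      show "linear_map (stk (?E C) n \<sigma>) (stk (?E D) n \<sigma>) (?p n \<sigma>)" for \<sigma>
        using hom_lm[OF map_hom[OF f], of \<sigma> n] by (simp add: ext_stk lm_zero)
      show "?p n \<tau> (res (obj (?E C) n) \<sigma> \<tau> v) = res (obj (?E D) n) \<sigma> \<tau> (?p n \<sigma> v)"
        if "\<sigma> \<in> P" "\<tau> \<in> P" "\<sigma> \<le> \<tau>" "v \<in> stk (?E C) n \<sigma>" for \<sigma> \<tau> v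
        using that hom_nat[OF map_hom[OF f]] f_0[OF C f] by (auto simp: ext_stk ext_res)
    qed
    show "?p (n + 1) \<sigma> (diff (?E C) n \<sigma> v) = diff (?E D) n \<sigma> (?p n \<sigma> v)" if "v \<in> stk (?E C) n \<sigma>" for n \<sigma> v
      using that map_comm[OF f] by (auto simp: ext_stk ext_diff)
  qed
  show ?thesis
  proof (rule quasi_isoI[OF m])
    fix n \<sigma> z u assume a: "z \<in> stk (?E C) n \<sigma>" "diff (?E C) n \<sigma> z = 0" "u \<in> stk (?E D) (n - 1) \<sigma>" "?p n \<sigma> z = diff (?E D) (n - 1) \<sigma> u"
    show "\<exists>y\<in>stk (?E C) (n - 1) \<sigma>. z = diff (?E C) (n - 1) \<sigma> y"
    proof (cases "\<sigma> \<in> Z")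
      case True
      then have b: "z \<in> stk C n \<sigma>" "diff C n \<sigma> z = 0" "u \<in> stk D (n - 1) \<sigma>" "\<phi> n \<sigma> z = diff D (n - 1) \<sigma> u"
        using a by (simp_all add: ext_stk ext_diff)
      show ?thesis using qi_inj[OF q True, OF b] True by (auto simp: ext_stk ext_diff)
    qed (use a in \<open>simp add: ext_stk ext_diff\<close>)
  next
    fix n \<sigma> w assume a: "w \<in> stk (?E D) n \<sigma>" "diff (?E D) n \<sigma> w = 0"
    show "\<exists>z\<in>stk (?E C) n \<sigma>. diff (?E C) n \<sigma> z = 0 \<and> (\<exists>u\<in>stk (?E D) (n - 1) \<sigma>. w = ?p n \<sigma> z + diff (?E D) (n - 1) \<sigma> u)"
    proof (cases "\<sigma> \<in> Z")
      case True
      then have b: "w \<in> stk D n \<sigma>" "diff D n \<sigma> w = 0" using a by (simp_all add: ext_stk ext_diff)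
      show ?thesis using qi_surj[OF q True b] True by (simp add: ext_stk ext_diff) blast
    qed (use a in \<open>simp add: ext_stk ext_diff\<close>)
  qed
qed

text \<open>The piece underlying \<open>local_star\<close>, without its two minimal resolutions.
  Being exact in \<open>I\<close>, it is what the filtration works with.\<close>

abbreviation part :: "'a::order set \<Rightarrow> ('a, 'i, 'k::field) cpx \<Rightarrow> ('a, 'i, 'k) cpx" where
  "part Z I \<equiv> pushforward_shriek Z (pullback_star Z I)"

lemma part_stk: "stk (part Z I) n \<sigma> = (if \<sigma> \<in> Z then stk I n \<sigma> else {0})"
  and part_res: "res (obj (part Z I) n) \<sigma> \<tau> = (if \<sigma> \<in> Z \<and> \<tau> \<in> Z then res (obj I n) \<sigma> \<tau> else (\<lambda>_. 0))"
  and part_diff: "diff (part Z I) n \<sigma> = (if \<sigma> \<in> Z then diff I n \<sigma> else (\<lambda>_. 0))"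
  by (simp_all add: ext_stk ext_res ext_diff star_stk star_res star_diff)

lemma part_complex:
  assumes I: "bounded_complex P I" and Z: "locally_closed P Z"
  shows "bounded_complex P (part Z I)"
proof -
  have "Z \<subseteq> P" using Z unfolding locally_closed_def by (rule conjunct1)
  then show ?thesis by (rule ext_complex[OF star_complex[OF I] Z])
qed

section \<open>Filtration along up-sets of the target\<close>

lemma locally_closed_self: "locally_closed P P" and locally_closed_empty: "locally_closed P {}"
  unfolding locally_closed_def by blast+

text \<open>The pieces over \<open>W\<close>, \<open>V\<close> and V - W form a short exact
  sequence, but they need not be injective. The map between the last two is extended to the given
  resolutions, and the cocone of the extension is an injective resolution of the first piece whose
  sections obey \<open>sec_coh_cocone\<close>.\<close>

lemma star_step:
  fixes I :: "('a::order, nat, 'k::field) cpx" and J C' :: "('a, nat, 'k) cpx"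
  assumes P: "finite P" and I: "bounded_complex P I"
    and V: "V \<subseteq> P" and W: "W \<subseteq> V"
    and uV: "\<And>x y. y \<in> P \<Longrightarrow> x \<in> V \<Longrightarrow> x \<le> y \<Longrightarrow> y \<in> V"
    and uW: "\<And>x y. y \<in> P \<Longrightarrow> x \<in> W \<Longrightarrow> x \<le> y \<Longrightarrow> y \<in> W"
    and J: "bounded_complex P J" "\<And>n. ginj P (obj J n)" and j: "quasi_iso P (part V I) J j"
    and C': "bounded_complex P C'" "\<And>n. ginj P (obj C' n)" and c: "quasi_iso P (part (V - W) I) C' c"
  shows "\<exists>(M :: ('a, nat, 'k) cpx) \<phi>. bounded_complex P M \<and> (\<forall>n. ginj P (obj M n)) \<and> quasi_iso P (part W I) M \<phi> \<and>
    alt l (\<lambda>n. int (sec_coh P J n)) \<le> alt l (\<lambda>n. int (sec_coh P M n)) + alt l (\<lambda>n. int (sec_coh P C' n))"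
proof -
  have lc: "locally_closed P V" "locally_closed P W" "locally_closed P (V - W)"
    unfolding locally_closed_def
  proof -
    have 1: "b \<in> V" if "a \<in> V" "b \<in> P" "a \<le> b" for a b by (rule uV[OF that(2,1,3)])
    have 2: "b \<in> W" if "a \<in> W" "b \<in> P" "a \<le> b" for a b by (rule uW[OF that(2,1,3)])
    show "V \<subseteq> P \<and> (\<forall>a\<in>V. \<forall>c\<in>V. \<forall>b\<in>P. a \<le> b \<and> b \<le> c \<longrightarrow> b \<in> V)" using V 1 by simp
    show "W \<subseteq> P \<and> (\<forall>a\<in>W. \<forall>c\<in>W. \<forall>b\<in>P. a \<le> b \<and> b \<le> c \<longrightarrow> b \<in> W)" using V W 2 by simp
    have 3: "b \<in> V - W" if "a \<in> V - W" "c \<in> V - W" "b \<in> P" "a \<le> b" "b \<le> c" for a b c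
      using 1[of a b] 2[of b c] that V by auto
    show "V - W \<subseteq> P \<and> (\<forall>a\<in>V - W. \<forall>c\<in>V - W. \<forall>b\<in>P. a \<le> b \<and> b \<le> c \<longrightarrow> b \<in> V - W)"
    proof (intro conjI ballI impI)
      show "V - W \<subseteq> P" using V by blast
      fix a b c assume "a \<in> V - W" "c \<in> V - W" "b \<in> P" "a \<le> b \<and> b \<le> c"
      then show "b \<in> V - W" using 3[of a c b] by simp
    qed
  qed
  note A = part_complex[OF I lc(2)] and B = part_complex[OF I lc(1)] and C = part_complex[OF I lc(3)]
  have vp: "x \<in> P" if "x \<in> V" for x using V that by blast
  have wv: "x \<in> V" if "x \<in> W" for x using W that by blast
  have d0: "\<sigma> \<in> P \<Longrightarrow> diff I n \<sigma> 0 = 0" for n \<sigma> by (rule d_0[OF I])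
  have r0: "\<sigma> \<in> P \<Longrightarrow> \<tau> \<in> P \<Longrightarrow> \<sigma> \<le> \<tau> \<Longrightarrow> res (obj I n) \<sigma> \<tau> 0 = 0" for n \<sigma> \<tau>
    by (rule lm_0[OF sheaf_res[OF cpx_sheaf[OF I]] sheaf_subsp[OF cpx_sheaf[OF I]]])
  have 0: "0 \<in> stk I n \<sigma>" if "\<sigma> \<in> P" for n \<sigma> by (rule c_0[OF I that])
  let ?i = "\<lambda>(n::int) (\<sigma>::'a) v. v :: nat \<Rightarrow> 'k" and ?q = "\<lambda>(n::int) \<sigma> v. if \<sigma> \<in> V - W then v else 0 :: nat \<Rightarrow> 'k"
  have i: "chain_map P (part W I) (part V I) ?i"
    unfolding chain_map_def
  proof (intro conjI allI ballI)
    show "sheaf_hom P (obj (part W I) n) (obj (part V I) n) (?i n)" for n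
    proof (rule sheaf_homI)
      show "linear_map (stk (part W I) n \<sigma>) (stk (part V I) n \<sigma>) (?i n \<sigma>)" for \<sigma>
        by (rule linear_mapI) (use wv 0 vp in \<open>auto simp: part_stk split: if_splits\<close>)
      fix \<sigma> \<tau> v assume a: "\<sigma> \<in> P" "\<tau> \<in> P" "\<sigma> \<le> \<tau>" "v \<in> stk (part W I) n \<sigma>"
      \<comment> \<open>Up-closedness of \<open>W\<close> makes the inclusion natural: a restriction
        that starts in \<open>W\<close> stays in \<open>W\<close>, and outside \<open>W\<close> the
        vector is 0.\<close>
      show "res (obj (part W I) n) \<sigma> \<tau> v = res (obj (part V I) n) \<sigma> \<tau> v"
        using a uW[OF a(2) _ a(3)] r0[OF a(1-3)] by (cases "\<sigma> \<in> W") (auto simp: part_stk part_res wv)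
    qed
    show "diff (part W I) n \<sigma> v = diff (part V I) n \<sigma> v" if "\<sigma> \<in> P" "v \<in> stk (part W I) n \<sigma>" for n \<sigma> v
      using that d0 by (cases "\<sigma> \<in> W") (auto simp: part_stk part_diff wv)
  qed
  have q: "chain_map P (part V I) (part (V - W) I) ?q"
    unfolding chain_map_def
  proof (intro conjI allI ballI)
    show "sheaf_hom P (obj (part V I) n) (obj (part (V - W) I) n) (?q n)" for n
    proof (rule sheaf_homI)
      show "linear_map (stk (part V I) n \<sigma>) (stk (part (V - W) I) n \<sigma>) (?q n \<sigma>)" for \<sigma>
        by (rule linear_mapI) (auto simp: part_stk split: if_splits)
      fix \<sigma> \<tau> v assume a: "\<sigma> \<in> P" "\<tau> \<in> P" "\<sigma> \<le> \<tau>" "v \<in> stk (part V I) n \<sigma>"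
      show "?q n \<tau> (res (obj (part V I) n) \<sigma> \<tau> v) = res (obj (part (V - W) I) n) \<sigma> \<tau> (?q n \<sigma> v)"
        using uW[OF a(2) _ a(3)] by (auto simp: part_res)
    qed
    show "?q (n + 1) \<sigma> (diff (part V I) n \<sigma> v) = diff (part (V - W) I) n \<sigma> (?q n \<sigma> v)" for n \<sigma> v
      by (simp add: part_diff)
  qed
  obtain \<beta> h where b: "chain_map P J C' \<beta>" and h: "hty P (part V I) C' (\<lambda>n \<sigma> v. \<beta> n \<sigma> (j n \<sigma> v)) (\<lambda>n \<sigma> v. c n \<sigma> (?q n \<sigma> v)) h"
    using extend_along_quasi_iso[OF B J(1) j C'(1,2) chain_map_comp[OF q qi_map[OF c]]] by blast
  let ?K = "cocone J C' \<beta>"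
  have K: "bounded_complex P ?K" by (rule cocone_complex[OF J(1) C'(1) b])
  have "quasi_iso P (part W I) ?K (\<lambda>n \<sigma> x. case_sum (j n \<sigma> (?i n \<sigma> x)) (h n \<sigma> (?i n \<sigma> x)))"
  proof (rule cocone_resolves[OF A B C J(1) C'(1) i q _ _ _ _ j c b h])
    show "?q n \<sigma> (?i n \<sigma> x) = 0" if "x \<in> stk (part W I) n \<sigma>" for n \<sigma> x
      using that by (auto simp: part_stk split: if_splits)
    show "\<exists>a\<in>stk (part W I) n \<sigma>. x = ?i n \<sigma> a" if "x \<in> stk (part V I) n \<sigma>" "?q n \<sigma> x = 0" for n \<sigma> x
      using that wv by (auto simp: part_stk split: if_splits)
    show "\<exists>x\<in>stk (part V I) n \<sigma>. y = ?q n \<sigma> x" if "y \<in> stk (part (V - W) I) n \<sigma>" "\<sigma> \<in> P" for n \<sigma> y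
    proof (rule bexI[of _ y])
      show "y = ?q n \<sigma> y" using that(1) by (auto simp: part_stk split: if_splits)
      show "y \<in> stk (part V I) n \<sigma>" using that(1) 0[OF that(2)] by (cases "\<sigma> \<in> V - W") (auto simp: part_stk)
    qed
  qed
  then obtain k where k: "quasi_iso P (part W I) ?K k" by blast
  have injK: "ginj P (obj ?K n)" for n unfolding cocone_obj by (rule ginj_dsum[OF J(2) C'(2) P])
  obtain M :: "('a, nat, 'k) cpx" and t s where M: "bounded_complex P M" "quasi_iso P ?K M t" "chain_map P M ?K s" "chain_map P ?K M t"
      "\<forall>n. \<forall>\<sigma>\<in>P. \<forall>v\<in>stk M n \<sigma>. t n \<sigma> (s n \<sigma> v) = v"
    using cpx_nat_model[OF K] by blast
  have injM: "ginj P (obj M n)" for n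
    by (rule ginj_transfer[OF P K M(1,4,3) _ injK]) (use M(5) in blast)
  have "sec_coh P ?K n = sec_coh P M n" for n by (rule sec_coh_quasi_iso[OF P M(1) injM K injK M(2)])
  then have "alt l (\<lambda>n. int (sec_coh P J n)) \<le> alt l (\<lambda>n. int (sec_coh P M n)) + alt l (\<lambda>n. int (sec_coh P C' n))"
    using sec_coh_cocone[OF P J(1) C'(1) b, of l] by simp
  then show ?thesis using M(1) injM quasi_iso_comp[OF A K M(1) k M(2)] by blast
qed

text \<open>Extension by zero keeps quasi-isomorphisms, being exact on stalks. So resolving before
  and after it still yields a resolution of the unresolved piece.\<close>

lemma local_star:
  assumes P: "finite P" and I: "bounded_complex P I" and Z: "locally_closed P Z"
  shows "bounded_complex P (local_star P Z I)" "ginj P (obj (local_star P Z I) n)" "\<exists>c. quasi_iso P (part Z I) (local_star P Z I) c"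
proof -
  have ZP: "Z \<subseteq> P" using Z by (simp add: locally_closed_def)
  have fZ: "finite Z" using P ZP by (rule rev_finite_subset)
  have S: "bounded_complex Z (pullback_star Z I)" by (rule star_complex[OF I ZP])
  let ?K = "min_inj_res Z (pullback_star Z I)"
  note K = min_inj_res[OF fZ S]
  have E: "bounded_complex P (pushforward_shriek Z ?K)" by (rule ext_complex[OF K(1) Z])
  note L = min_inj_res[OF P E]
  show "bounded_complex P (local_star P Z I)" "ginj P (obj (local_star P Z I) n)" unfolding local_star_def by (rule L(1), rule L(2))
  obtain \<phi> where "quasi_iso Z (pullback_star Z I) ?K \<phi>" using K(3) by blast
  from ext_quasi_iso[OF S K(1) this Z] obtain \<phi>' where p: "quasi_iso P (part Z I) (pushforward_shriek Z ?K) \<phi>'" by blast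
  obtain \<psi> where "quasi_iso P (pushforward_shriek Z ?K) (local_star P Z I) \<psi>" unfolding local_star_def using L(3) by blast
  then show "\<exists>c. quasi_iso P (part Z I) (local_star P Z I) c"
    using quasi_iso_comp[OF part_complex[OF I Z] E _ p] L(1) unfolding local_star_def by blast
qed

text \<open>Removing a minimal element of an up-set leaves an up-set. The resolution
  \<open>J\<close> varies in the induction because \<open>star_step\<close> supplies the next one, a
  cocone instead of a minimal resolution.\<close>

lemma star_filtration:
  fixes f :: "'a::order \<Rightarrow> 'b::order" and I J :: "('a, nat, 'k::field) cpx"
  assumes P: "finite P" and Q: "finite Q" and fQ: "f ` P \<subseteq> Q" and mono: "mono_on P f"
    and I: "bounded_complex P I"
    and S: "S \<subseteq> Q" and up: "\<And>x y. y \<in> Q \<Longrightarrow> x \<in> S \<Longrightarrow> x \<le> y \<Longrightarrow> y \<in> S"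
    and J: "bounded_complex P J" "\<And>n. ginj P (obj J n)" and j: "quasi_iso P (part {\<sigma>\<in>P. f \<sigma> \<in> S} I) J j"
  shows "alt l (\<lambda>n. int (sec_coh P J n)) \<le> (\<Sum>\<pi>\<in>S. alt l (\<lambda>n. int (sec_coh P (local_star P (fibre P f \<pi>) I) n)))"
  using S up J j
proof (induct "card S" arbitrary: S J j)
  case 0
  have S: "S = {}" using 0(1) finite_subset[OF 0(2) Q] by simp
  let ?E = "part {} I"
  have E: "bounded_complex P ?E" by (rule part_complex[OF I locally_closed_empty])
  have "ginj P (obj ?E n)" for n by (rule zero_sheaf_ginj[OF cpx_sheaf[OF E] _ P]) (simp add: part_stk)
  moreover have "quasi_iso P ?E J j" using 0(6) by (simp add: S)
  ultimately have "sec_coh P ?E n = sec_coh P J n" for n by (intro sec_coh_quasi_iso[OF P 0(4,5) E])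
  moreover have "sec_coh P ?E n = 0" for n
  proof (rule sec_coh_zero)
    have z: "stk ?E n \<sigma> = {0}" for n \<sigma> by (simp add: part_stk)
    have "v = 0" if "v \<in> limit_space P (obj ?E n)" for v n
    proof (rule curry_eqI)
      fix p show "curry v p = curry 0 p"
        using limit_in[OF that, of p] limit_out[OF that, of p] by (cases "p \<in> P") (auto simp: z)
    qed
    then show "limit_space P (obj ?E n) = {0}" for n
      using subsp_0[OF subsp_limit[OF cpx_sheaf[OF E]]] by blast
  qed
  ultimately show ?case by (simp add: S)
next
  case (Suc k)
  have fS: "finite S" by (rule finite_subset[OF Suc.prems(1) Q])
  have "S \<noteq> {}" using Suc.hyps(2) by auto
  then obtain m where m: "m \<in> S" "\<And>y. y \<in> S \<Longrightarrow> y \<le> m \<Longrightarrow> y = m" using finite_has_minimal[OF fS] by blast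
  let ?S = "S - {m}"
  have c: "k = card ?S" using Suc.hyps(2) fS m(1) by simp
  have d: "y \<in> ?S" if "y \<in> Q" "x \<in> ?S" "x \<le> y" for x y
    using Suc.prems(2)[OF that(1) _ that(3)] m(2)[of x] that by blast
  let ?V = "{\<sigma>\<in>P. f \<sigma> \<in> S}" and ?W = "{\<sigma>\<in>P. f \<sigma> \<in> ?S}"
  have upn: "y \<in> {\<sigma>\<in>P. f \<sigma> \<in> T}" if x: "y \<in> P" "x \<in> {\<sigma>\<in>P. f \<sigma> \<in> T}" "x \<le> y"
    and T: "\<And>x y. y \<in> Q \<Longrightarrow> x \<in> T \<Longrightarrow> x \<le> y \<Longrightarrow> y \<in> T" for x y T
    using T[of "f y" "f x"] fQ x mono_onD[OF mono, of x y] by blast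
  have VW: "?V - ?W = fibre P f m" using m(1) by (auto simp: fibre_def)
  note L = local_star[OF P I fibre_locally_closed[OF mono, of m]]
  obtain c where cq: "quasi_iso P (part (?V - ?W) I) (local_star P (fibre P f m) I) c" unfolding VW using L(3) by blast
  have uV: "y \<in> ?V" if "y \<in> P" "x \<in> ?V" "x \<le> y" for x y by (rule upn[OF that Suc.prems(2)])
  have uW: "y \<in> ?W" if "y \<in> P" "x \<in> ?W" "x \<le> y" for x y by (rule upn[OF that d])
  have "\<exists>(M :: ('a, nat, 'k) cpx) \<phi>. bounded_complex P M \<and> (\<forall>n. ginj P (obj M n)) \<and> quasi_iso P (part ?W I) M \<phi> \<and>
    alt l (\<lambda>n. int (sec_coh P J n)) \<le> alt l (\<lambda>n. int (sec_coh P M n)) +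
      alt l (\<lambda>n. int (sec_coh P (local_star P (fibre P f m) I) n))"
  proof (rule star_step[OF P I _ _ _ _ Suc.prems(3,4,5) L(1,2) cq])
    show "?V \<subseteq> P" "?W \<subseteq> ?V" by auto
    show "y \<in> ?V" if "y \<in> P" "x \<in> ?V" "x \<le> y" for x y by (rule uV[OF that])
    show "y \<in> ?W" if "y \<in> P" "x \<in> ?W" "x \<le> y" for x y by (rule uW[OF that])
  qed
  then obtain M :: "('a, nat, 'k) cpx" and \<phi> where M: "bounded_complex P M" "\<forall>n. ginj P (obj M n)" "quasi_iso P (part ?W I) M \<phi>"
    "alt l (\<lambda>n. int (sec_coh P J n)) \<le> alt l (\<lambda>n. int (sec_coh P M n)) + alt l (\<lambda>n. int (sec_coh P (local_star P (fibre P f m) I) n))"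
    by blast
  have "alt l (\<lambda>n. int (sec_coh P M n)) \<le> (\<Sum>\<pi>\<in>?S. alt l (\<lambda>n. int (sec_coh P (local_star P (fibre P f \<pi>) I) n)))"
  proof (rule Suc.hyps(1)[OF \<open>k = card ?S\<close>])
    show "?S \<subseteq> Q" using Suc.prems(1) by blast
  qed (use d M in blast)+
  then show ?case unfolding sum.remove[OF fS m(1)] using M(4) by linarith
qed

lemma part_all:
  assumes I: "bounded_complex P I"
  shows "quasi_iso P (part P I) I (\<lambda>_ _ v. v)"
proof (rule iso_quasi_iso[OF _ I])
  show "bounded_complex P (part P I)" by (rule part_complex[OF I locally_closed_self])
  show "chain_map P (part P I) I (\<lambda>_ _ v. v)" "chain_map P I (part P I) (\<lambda>_ _ v. v)"
    unfolding chain_map_def by (auto intro!: sheaf_homI linear_mapI simp: part_stk part_res part_diff)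
qed auto

section \<open>Conclusion\<close>

text \<open>
  The Euler characteristic formula comes from two consecutive inequalities beyond the top degree,
  where the sums agree up to opposite signs.
\<close>

lemma morse_conclusion:
  fixes h :: "int \<Rightarrow> nat" and g :: "'b \<Rightarrow> int \<Rightarrow> nat"
  assumes Q: "finite Q" and h: "finite {j. h j \<noteq> 0}" and g: "\<And>\<pi>. \<pi> \<in> Q \<Longrightarrow> finite {j. g \<pi> j \<noteq> 0}"
    and ineq: "\<And>l. alt l (\<lambda>n. int (h n)) \<le> (\<Sum>\<pi>\<in>Q. alt l (\<lambda>n. int (g \<pi> n)))"
    and C: "C = {\<pi>\<in>Q. \<exists>d. g \<pi> d \<noteq> 0}"
  shows "neg_one_pow l * (\<Sum>j | j \<le> l \<and> h j \<noteq> 0. neg_one_pow j * int (h j)) \<le>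
      neg_one_pow l * (\<Sum>\<pi>\<in>C. \<Sum>j | j \<le> l \<and> g \<pi> j \<noteq> 0. neg_one_pow j * int (g \<pi> j))"
    and "(\<Sum>j | h j \<noteq> 0. neg_one_pow j * int (h j)) = (\<Sum>\<pi>\<in>C. \<Sum>j | g \<pi> j \<noteq> 0. neg_one_pow j * int (g \<pi> j))"
proof -
  have alt: "alt l (\<lambda>n. int (u n)) = neg_one_pow l * (\<Sum>j | j \<le> l \<and> u j \<noteq> 0. neg_one_pow j * int (u j))" for l u
    by (simp add: alt_def)
  have main: "neg_one_pow l * (\<Sum>j | j \<le> l \<and> h j \<noteq> 0. neg_one_pow j * int (h j)) \<le>
      neg_one_pow l * (\<Sum>\<pi>\<in>C. \<Sum>j | j \<le> l \<and> g \<pi> j \<noteq> 0. neg_one_pow j * int (g \<pi> j))" for l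
  proof -
    \<comment> \<open>Outside \<open>C\<close> all values of \<open>g \<pi>\<close> are 0, so the
      sum over \<open>Q\<close> loses nothing.\<close>
    have "(\<Sum>\<pi>\<in>C. alt l (\<lambda>n. int (g \<pi> n))) = (\<Sum>\<pi>\<in>Q. alt l (\<lambda>n. int (g \<pi> n)))"
      by (rule sum.mono_neutral_left[OF Q]) (auto simp: C)
    then have "alt l (\<lambda>n. int (h n)) \<le> (\<Sum>\<pi>\<in>C. alt l (\<lambda>n. int (g \<pi> n)))" using ineq[of l] by linarith
    then show ?thesis unfolding alt sum_distrib_left[symmetric] .
  qed
  then show "neg_one_pow l * (\<Sum>j | j \<le> l \<and> h j \<noteq> 0. neg_one_pow j * int (h j)) \<le>
      neg_one_pow l * (\<Sum>\<pi>\<in>C. \<Sum>j | j \<le> l \<and> g \<pi> j \<noteq> 0. neg_one_pow j * int (g \<pi> j))" .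
  let ?A = "{j. h j \<noteq> 0} \<union> (\<Union>\<pi>\<in>Q. {j. g \<pi> j \<noteq> 0})"
  have "finite ?A" using Q h g by blast
  \<comment> \<open>From \<open>L\<close> on, truncation at l has no effect in any of the finitely
    many sums.\<close>
  then obtain L where L: "\<And>j. j \<in> ?A \<Longrightarrow> j \<le> L" using bdd_above_finite[of ?A] unfolding bdd_above_def by blast
  have Lh: "{j. j \<le> l \<and> h j \<noteq> 0} = {j. h j \<noteq> 0}" if "l \<ge> L" for l using L that by force
  have Lg: "{j. j \<le> l \<and> g \<pi> j \<noteq> 0} = {j. g \<pi> j \<noteq> 0}" if "l \<ge> L" "\<pi> \<in> C" for l \<pi> using L that C by force
  let ?x = "\<Sum>j | h j \<noteq> 0. neg_one_pow j * int (h j)" and ?y = "\<Sum>\<pi>\<in>C. \<Sum>j | g \<pi> j \<noteq> 0. neg_one_pow j * int (g \<pi> j)"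
  have le: "neg_one_pow l * ?x \<le> neg_one_pow l * ?y" if "l \<ge> L" for l
  proof -
    have "(\<Sum>\<pi>\<in>C. \<Sum>j | j \<le> l \<and> g \<pi> j \<noteq> 0. neg_one_pow j * int (g \<pi> j)) = ?y"
      by (rule sum.cong[OF refl]) (simp only: Lg[OF that])
    then show ?thesis using main[of l] unfolding Lh[OF that] by simp
  qed
  have "neg_one_pow L * ?x \<le> neg_one_pow L * ?y" by (rule le) simp
  moreover have "- (neg_one_pow L * ?x) \<le> - (neg_one_pow L * ?y)"
    using le[of "L + 1"] neg_one_pow_pred[of "L + 1"] by simp
  ultimately have "neg_one_pow L * ?x = neg_one_pow L * ?y" by linarith
  then have "neg_one_pow L * (neg_one_pow L * ?x) = neg_one_pow L * (neg_one_pow L * ?y)" by (rule arg_cong)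
  then show "?x = ?y" unfolding neg_one_pow_sq .
qed

lemma hypercoh_finite:
  assumes P: "finite P" and I: "bounded_complex P I"
  shows "finite {j. hypercoh_dim P I j \<noteq> 0}"
  using bdd_finite[OF bdd_coh[OF pp_complex[OF P I]]] by (simp add: hypercoh_dim_sec_coh[OF P I])

theorem theorem6p8:
  fixes P :: "'a::order set" and Q :: "'b::order set" and f :: "'a \<Rightarrow> 'b"
    and I :: "('a, nat, 'k::field) cpx"
  assumes "finite P" and "finite Q"
    and "f ` P \<subseteq> Q" and "mono_on P f"
    and "minimal_injective_complex P I"
  shows "(\<forall>l. neg_one_pow l * alt_sum_upto P I l
            \<le> neg_one_pow l * (\<Sum>\<pi>\<in>critical_shriek P Q f I.
                  alt_sum_upto (fibre P f \<pi>) (local_shriek P (fibre P f \<pi>) I) l))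
       \<and> (\<forall>l. neg_one_pow l * alt_sum_upto P I l
            \<le> neg_one_pow l * (\<Sum>\<pi>\<in>critical_star P Q f I.
                  alt_sum_upto P (local_star P (fibre P f \<pi>) I) l))
       \<and> euler_char P I = (\<Sum>\<pi>\<in>critical_shriek P Q f I.
                  euler_char (fibre P f \<pi>) (local_shriek P (fibre P f \<pi>) I))
       \<and> euler_char P I = (\<Sum>\<pi>\<in>critical_star P Q f I.
                  euler_char P (local_star P (fibre P f \<pi>) I))"
proof -
  note P = assms(1) and mono = assms(4)
  have I: "bounded_complex P I" and inj: "\<And>n. ginj P (obj I n)"
    using assms(5) by (auto simp: minimal_injective_complex_def injective_complex_def injective_sheaf_iff_ginj[OF P])
  note lc = fibre_locally_closed[OF mono]
  have fsub: "fibre P f \<pi> \<subseteq> P" for \<pi> by (auto simp: fibre_def)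
  have ffin: "finite (fibre P f \<pi>)" for \<pi> using P fsub by (rule rev_finite_subset)
  have all: "{\<sigma>\<in>P. f \<sigma> \<in> Q} = P" using assms(3) by blast
  note fin = hypercoh_finite[OF P I] and eq = hypercoh_dim_sec_coh[OF P I]
  let ?gs = "\<lambda>\<pi>. hypercoh_dim (fibre P f \<pi>) (local_shriek P (fibre P f \<pi>) I)"
  have "local_shriek P (fibre P f \<pi>) I = min_inj_res (fibre P f \<pi>) (pullback_shriek P (fibre P f \<pi>) I)" for \<pi>
    by (simp add: local_shriek_def)
  then have fs: "finite {j. ?gs \<pi> j \<noteq> 0}" for \<pi>
    using hypercoh_finite[OF ffin min_inj_res(1)[OF ffin shriek_complex[OF I fsub]]] by simp
  \<comment> \<open>The filtration is applied to all of \<open>Q\<close>, whose preimage is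
    \<open>P\<close>; there the sections with support are those of \<open>I\<close>.\<close>
  have is': "alt l (\<lambda>n. int (hypercoh_dim P I n)) \<le> (\<Sum>\<pi>\<in>Q. alt l (\<lambda>n. int (?gs \<pi> n)))" for l
    using shriek_filtration[OF assms(1-4) I inj subset_refl, of l]
    unfolding all shriek_all[OF P I inj] eq hypercoh_local_shriek[OF P I inj lc] by simp
  \<comment> \<open>Fibres are locally closed, so criticality says exactly that some hypercohomology
    of the local complex is nonzero.\<close>
  have cs: "critical_shriek P Q f I = {\<pi>\<in>Q. \<exists>d. ?gs \<pi> d \<noteq> 0}"
    using lc by (auto simp: critical_shriek_def musupp_shriek_def)
  note shriek = morse_conclusion[OF assms(2) fin fs is' cs]
  let ?gt = "\<lambda>\<pi>. hypercoh_dim P (local_star P (fibre P f \<pi>) I)"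
  note L = local_star(1)[OF P I lc]
  have ft: "finite {j. ?gt \<pi> j \<noteq> 0}" for \<pi> by (rule hypercoh_finite[OF P L])
  have j: "quasi_iso P (part {\<sigma>\<in>P. f \<sigma> \<in> Q} I) I (\<lambda>_ _ v. v)" unfolding all by (rule part_all[OF I])
  \<comment> \<open>Here \<open>I\<close> itself is the injective resolution of the piece over
    \<open>P\<close> with which the filtration starts.\<close>
  have it: "alt l (\<lambda>n. int (hypercoh_dim P I n)) \<le> (\<Sum>\<pi>\<in>Q. alt l (\<lambda>n. int (?gt \<pi> n)))" for l
    using star_filtration[OF assms(1-4) I subset_refl _ I inj j, of l]
    unfolding eq hypercoh_dim_sec_coh[OF P L] by simp
  have ct: "critical_star P Q f I = {\<pi>\<in>Q. \<exists>d. ?gt \<pi> d \<noteq> 0}"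
    using lc by (auto simp: critical_star_def musupp_star_def)
  note star = morse_conclusion[OF assms(2) fin ft it ct]
  show ?thesis
    unfolding alt_sum_upto_def euler_char_def using shriek star by blast
qed

end
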